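(* Let $S$ be the set of primes $p\equiv 1\pmod 9$ such that the equation $px^3+y^3=9$ has no solution in integers $x,y$. Then the density of $S$ (in the set of all primes) is at least $1/9$, that is, $$ \liminf_{x\to\infty}\frac{\#\{p\leq x: p\in S\}}{\pi(x)}\geq \frac19 . $$ Moreover, for every $p\in S$ the cubic field $\mathbb{Q}(\sqrt[3]{p})$ is non-monogenic.
   Context: $\pi(x)$ denotes the number of primes less than $x$. A number field $K$ with ring of integers $\mathcal{O}_K$ is called monogenic if there exists $\alpha\in\mathcal{O}_K$ such that $\mathcal{O}_K=\mathbb{Z}[\alpha]$; otherwise it is non-monogenic. *)

theory Defs
  imports
    "HOL-Algebra.Algebraic_Closure_Type"
    "HOL-Algebra.Generated_Fields"
    "HOL-Number_Theory.Cong"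
    "HOL-Analysis.Analysis"
begin

text \<open>
  Number fields are taken inside the complex numbers, viewed as a ring record so that the
  notions of HOL-Algebra (\<open>subfield\<close>, \<open>generate_field\<close>, \<open>generate_ring\<close>, \<open>dimension\<close>) apply.
\<close>

abbreviation complex_ring :: "complex ring" where
  "complex_ring \<equiv> ring_of_type_algebra"

definition number_field :: "complex set \<Rightarrow> bool" where
  "number_field K \<longleftrightarrow> subfield K complex_ring \<and> ring.finite_dimension complex_ring \<rat> K"

definition cubic_field :: "complex set \<Rightarrow> bool" where
  "cubic_field K \<longleftrightarrow> number_field K \<and> ring.dimension complex_ring 3 \<rat> K"

definition ring_of_integers :: "complex set \<Rightarrow> complex set" where
  "ring_of_integers K = {x \<in> K. algebraic_int x}"

text \<open>
  \<open>generate_ring complex_ring {\<alpha>}\<close> is the subring of the complex numbers generated by \<open>\<alpha>\<close>, that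
  is, \<open>\<int>[\<alpha>]\<close>. The predicate is only meaningful for number fields \<open>K\<close>.
\<close>

definition monogenic :: "complex set \<Rightarrow> bool" where
  "monogenic K \<longleftrightarrow>
     (\<exists>\<alpha>\<in>ring_of_integers K. ring_of_integers K = generate_ring complex_ring {\<alpha>})"

text \<open>The field \<open>\<rat>(p\<^sup>1\<^sup>/\<^sup>3)\<close> for the real cube root of \<open>p\<close>.\<close>

definition pure_cubic_field :: "nat \<Rightarrow> complex set" where
  "pure_cubic_field p = generate_field complex_ring {complex_of_real (root 3 (real p))}"

text \<open>HOL-Algebra also has a constant called \<open>prime\<close>, hence the qualified name.\<close>

definition prime_count :: "real \<Rightarrow> nat" where
  "prime_count x = card {p :: nat. Factorial_Ring.prime p \<and> real p < x}"

definition insoluble_primes :: "nat set" where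
  "insoluble_primes = {p. Factorial_Ring.prime p \<and> [p = 1] (mod 9) \<and>
           \<not> (\<exists>x y :: int. int p * x ^ 3 + y ^ 3 = 9)}"

end

theory Submission
  imports Defs "HOL-Complex_Analysis.Complex_Analysis" "HOL-Number_Theory.Number_Theory" "HOL-Real_Asymp.Real_Asymp"
begin

text \<open>
  The density statement is a prime number theorem for Eisenstein primes in one residue class modulo 9; the
  statement on fields is a computation with the index of an order.

  If \<open>p x\<^sup>3 + y\<^sup>3 = 9\<close>, then 9 is a cube modulo \<open>p\<close>. So it suffices to find sufficiently many primes \<open>p \<equiv> 1\<close>
  modulo 9 for which 9, equivalently 3, is not a cube. Whether 3 is a cube can be read off from a
  factorisation \<open>p = N(\<pi>)\<close> in the ring of Eisenstein integers \<open>\<int>[\<omega>]\<close>: up to conjugation and sign, the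
  generator \<open>\<pi> \<equiv> 1\<close> modulo 3 is the cubic Jacobi sum, and if 3 is a cube modulo \<open>p\<close>, then 9 divides the
  coefficient of \<open>\<omega>\<close> in that sum (\<open>nine_dvd_jacobi_if_chi_3\<close>). Consequently every prime \<open>p = N(\<pi>)\<close> with
  \<open>\<pi> \<equiv> 4 + 6\<omega>\<close> modulo 9 is in the set; such \<open>p\<close> are 1 modulo 9 (\<open>nine_not_cube\<close>). The primary elements,
  those that are 1 modulo 3, fall into nine classes modulo 9, and half of the rational primes have two
  primary prime factors each. As \<open>4 + 6\<omega>\<close> and its conjugate lie in different classes, no \<open>p\<close> arises twice, and
  equidistribution over the classes gives the density \<open>2 \<sqdot> 1/2 \<sqdot> 1/9 = 1/9\<close>.

  Equidistribution follows the classical route. The nine characters of the group of classes are multiplicative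
  on primary elements, and each ideal prime to 3 has one primary generator, so a character \<open>\<chi>\<close> has an L-series
  \<open>\<Sum> \<chi>(x) N(x)\<^sup>-\<^sup>s\<close> over primary \<open>x\<close>. Counting lattice points in discs shows that the summatory function of its
  coefficients is linear up to \<open>O(\<surd>n)\<close> (\<open>cubic_char_mean_value\<close>), which continues the series to \<open>Re s > 1/2\<close>.
  The inequality \<open>3 + 4 cos \<phi> + cos 2\<phi> \<ge> 0\<close> excludes zeros on the line \<open>Re s = 1\<close>, where in the critical case of
  a zero at 1 itself it is essential that \<open>\<chi>\<^sup>2\<close> is nontrivial together with \<open>\<chi>\<close>, as the group has exponent 3
  (\<open>log_derivative_simple_pole\<close>). Newman's Tauberian theorem then yields the mean value of the von Mangoldt
  function on the class (\<open>mean_value_of_simple_pole\<close>). The same theorems, applied to the zeta function, bound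
  the number of all primes from above.

  For the fields let \<open>\<theta>\<close> be the cube root of \<open>p\<close>. The integers of \<open>\<rat>(\<theta>)\<close> have coordinates \<open>A/3\<close>, \<open>B/3\<close>, \<open>C/3\<close> with
  \<open>A \<equiv> B \<equiv> C\<close> modulo 3, and \<open>(1 + \<theta> + \<theta>\<^sup>2)/3\<close> is one of them as \<open>p \<equiv> 1\<close> modulo 9. If an element with
  these coordinates generated the ring, its index \<open>(B\<^sup>3 - p C\<^sup>3)/9\<close> would be \<open>1\<close> or \<open>-1\<close>, a solution of the
  equation (\<open>not_monogenic_pure_cubic\<close>).
\<close>

section \<open>Dirichlet series\<close>

definition dirichlet_series :: "(nat \<Rightarrow> complex) \<Rightarrow> complex \<Rightarrow> complex" where
  "dirichlet_series f s = (\<Sum>n. f n * of_nat n powr (-s))"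

definition linear_growth :: "(nat \<Rightarrow> complex) \<Rightarrow> bool" where
  "linear_growth f \<longleftrightarrow> (\<exists>K. \<forall>N. (\<Sum>n=1..N. norm (f n)) \<le> K * real N)"

definition powr_step :: "nat \<Rightarrow> complex \<Rightarrow> complex" where
  "powr_step n s = of_nat n powr (-s) - of_nat (Suc n) powr (-s)"

lemma norm_nat_powr: "norm ((of_nat n :: complex) powr s) = real n powr Re s"
  using norm_powr_real_powr[of "of_nat n" s] by simp

lemma sum_by_parts_nat:
  fixes f u :: "nat \<Rightarrow> 'a :: comm_ring_1"
  shows "(\<Sum>n=1..N. f n * u n) =
    (\<Sum>k=1..N. f k) * u (Suc N) + (\<Sum>n=1..N. (\<Sum>k=1..n. f k) * (u n - u (Suc n)))"
proof (induction N)
  case (Suc N)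
  define F where "F = (\<Sum>k=1..N. f k)"
  show ?case
    using Suc by (simp add: F_def[symmetric]) (simp add: algebra_simps)
qed auto

lemma powr_nat_deriv:
  assumes "x > 0"
  shows "((\<lambda>t::real. (of_real t :: complex) powr (-s)) has_vector_derivative
            (-s * of_real x powr (-s-1))) (at x within S)"
proof -
  have "((\<lambda>z. z powr (-s)) has_field_derivative (-s * of_real x powr (-s-1))) (at (of_real x))"
    using assms by (intro has_field_derivative_powr) (auto simp: complex_nonpos_Reals_iff)
  from has_vector_derivative_real_field[OF this] show ?thesis .
qed

lemma unit_step_bound:
  fixes f f' :: "real \<Rightarrow> complex"
  assumes "\<And>x. x \<in> {a..a+1} \<Longrightarrow> (f has_vector_derivative f' x) (at x within {a..a+1})"
    and "\<And>x. x \<in> {a..a+1} \<Longrightarrow> norm (f' x) \<le> B"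
  shows "norm (f (a+1) - f a) \<le> B"
proof -
  have "norm (f (a+1) - f a) \<le> B * norm ((a+1) - a)"
  proof (rule differentiable_bound[where S="{a..a+1}" and f' = "\<lambda>x h. h *\<^sub>R f' x"])
    show "convex {a..a+1}" by simp
    fix x assume x: "x \<in> {a..a+1}"
    show "(f has_derivative (\<lambda>h. h *\<^sub>R f' x)) (at x within {a..a+1})"
      using assms(1)[OF x] by (simp add: has_vector_derivative_def)
    show "onorm (\<lambda>h. h *\<^sub>R f' x) \<le> B"
      using assms(2)[OF x] by (intro onorm_le) (simp add: mult.commute[of _ "norm (f' x)"] mult_right_mono)
  qed auto
  thus ?thesis by simp
qed

lemma norm_powr_le_left_end:
  assumes "n > 0" "x \<in> {real n..real n + 1}" "Re s \<ge> 0"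
  shows "norm ((of_real x :: complex) powr (-s)) \<le> real n powr (- Re s)"
proof -
  have "norm ((of_real x :: complex) powr (-s)) = x powr (- Re s)"
    using assms by (subst norm_powr_real_powr) auto
  also have "\<dots> \<le> real n powr (- Re s)"
    using assms by (intro powr_mono2') auto
  finally show ?thesis .
qed

lemma norm_powr_step:
  assumes "n > 0" "Re s > 0"
  shows "norm (powr_step n s) \<le> norm s * real n powr (- Re s - 1)"
proof -
  have "norm ((of_real (real n + 1) :: complex) powr (-s) - of_real (real n) powr (-s))
      \<le> norm s * real n powr (- Re s - 1)"
  proof (rule unit_step_bound[where f' = "\<lambda>x. -s * of_real x powr (-s-1)"])
    fix x assume x: "x \<in> {real n..real n+1}"
    show "((\<lambda>t. (of_real t :: complex) powr (-s)) has_vector_derivative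
            (-s * of_real x powr (-s-1))) (at x within {real n..real n+1})"
      using x assms by (intro powr_nat_deriv) auto
    have "norm ((of_real x :: complex) powr (-(s+1))) \<le> real n powr (- Re (s+1))"
      using x assms by (intro norm_powr_le_left_end) auto
    thus "norm (-s * of_real x powr (-s-1)) \<le> norm s * real n powr (- Re s - 1)"
      by (simp add: norm_mult mult_left_mono)
  qed
  thus ?thesis by (simp add: powr_step_def norm_minus_commute add.commute)
qed

lemma powr_step_real:
  assumes "n > 0" "\<sigma> > 0"
  shows "\<bar>real n powr (-\<sigma>) - real (Suc n) powr (-\<sigma>)\<bar> \<le> \<sigma> * real n powr (-\<sigma>-1)"
proof -
  have 1: "(of_nat m :: complex) powr (- of_real \<sigma>) = of_real (real m powr (-\<sigma>))" for m
    by (subst powr_of_real[symmetric]) auto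
  have "norm (powr_step n (of_real \<sigma>)) \<le> \<sigma> * real n powr (-\<sigma>-1)"
    using norm_powr_step[of n "of_real \<sigma>"] assms by simp
  thus ?thesis
    unfolding powr_step_def 1 of_real_diff[symmetric] norm_of_real .
qed

lemma summable_nat_powr: "p > 1 \<Longrightarrow> summable (\<lambda>n. real n powr (-p))"
  using summable_real_powr_iff[of "-p"] by simp

lemma linear_growth_summable:
  assumes "linear_growth f" "\<sigma> > 1"
  shows "summable (\<lambda>n. norm (f n) * real n powr (-\<sigma>))"
proof -
  obtain K where K: "\<And>N. (\<Sum>n=1..N. norm (f n)) \<le> K * real N"
    using assms by (auto simp: linear_growth_def)
  have K0: "K \<ge> 0" using order_trans[OF norm_ge_zero, of "f 1" K] K[of 1] by simp
  define F where "F N = (\<Sum>n=1..N. norm (f n))" for N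
  have F0: "F N \<ge> 0" for N unfolding F_def by (intro sum_nonneg) auto
  let ?Z = "\<Sum>n. real n powr (-\<sigma>)"
  have "(\<Sum>n\<in>{1..N}. norm (f n) * real n powr (-\<sigma>)) \<le> K + K * \<sigma> * ?Z" for N
  proof -
    have "(\<Sum>n=1..N. norm (f n) * real n powr (-\<sigma>)) = F N * real (Suc N) powr (-\<sigma>) +
       (\<Sum>n=1..N. F n * (real n powr (-\<sigma>) - real (Suc n) powr (-\<sigma>)))"
      unfolding F_def by (rule sum_by_parts_nat)
    also have "F N * real (Suc N) powr (-\<sigma>) \<le> (K * real (Suc N)) * real (Suc N) powr (-1)"
      using K[of N] assms K0 by (intro mult_mono powr_mono) (auto simp: F_def field_simps)
    also have "\<dots> = K" by (simp add: powr_minus)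
    also have "(\<Sum>n=1..N. F n * (real n powr (-\<sigma>) - real (Suc n) powr (-\<sigma>))) \<le>
       (\<Sum>n=1..N. K * \<sigma> * real n powr (-\<sigma>))"
    proof (intro sum_mono)
      fix n assume n: "n \<in> {1..N}"
      have "F n * (real n powr (-\<sigma>) - real (Suc n) powr (-\<sigma>)) \<le> (K * real n) * (\<sigma> * real n powr (-\<sigma>-1))"
        using powr_step_real[of n \<sigma>] n assms K[of n] K0 F0[of n]
        by (intro mult_mono) (auto simp: F_def intro!: powr_mono2')
      also have "\<dots> = K * \<sigma> * (real n * real n powr (-\<sigma>-1))" by simp
      also have "real n * real n powr (-\<sigma>-1) = real n powr (-\<sigma>)"
        using n by (simp add: powr_diff powr_minus field_simps)
      finally show "F n * (real n powr (-\<sigma>) - real (Suc n) powr (-\<sigma>)) \<le> K * \<sigma> * real n powr (-\<sigma>)" .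
    qed
    also have "\<dots> = K * \<sigma> * (\<Sum>n=1..N. real n powr (-\<sigma>))" by (simp add: sum_distrib_left)
    also have "\<dots> \<le> K * \<sigma> * ?Z"
      using assms K0 by (intro mult_left_mono sum_le_suminf summable_nat_powr) auto
    finally show ?thesis by simp
  qed
  moreover have "(\<Sum>n<N. norm (f n) * real n powr (-\<sigma>)) \<le> (\<Sum>n\<in>{1..N}. norm (f n) * real n powr (-\<sigma>))" for N
  proof -
    have "(\<Sum>n<N. norm (f n) * real n powr (-\<sigma>)) = (\<Sum>n\<in>{1..<N}. norm (f n) * real n powr (-\<sigma>))"
    proof (rule sum.mono_neutral_right)
      show "\<forall>i\<in>{..<N} - {1..<N}. norm (f i) * real i powr (- \<sigma>) = 0"
        by (auto simp: Suc_le_eq)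
    qed auto
    also have "\<dots> \<le> (\<Sum>n\<in>{1..N}. norm (f n) * real n powr (-\<sigma>))"
      by (intro sum_mono2) auto
    finally show ?thesis .
  qed
  ultimately have "\<And>N. (\<Sum>n<N. norm (f n) * real n powr (-\<sigma>)) \<le> K + K * \<sigma> * ?Z"
    using order_trans by blast
  thus ?thesis
    by (intro summableI_nonneg_bounded) auto
qed

lemma linear_growth_summable_complex:
  assumes "linear_growth f" "Re s > 1"
  shows "summable (\<lambda>n. norm (f n * of_nat n powr (-s)))"
  using linear_growth_summable[OF assms] by (simp add: norm_mult norm_nat_powr)

lemma dirichlet_series_sums:
  assumes "linear_growth f" "Re s > 1"
  shows "(\<lambda>n. f n * of_nat n powr (-s)) sums dirichlet_series f s"
  unfolding dirichlet_series_def
  using summable_norm_cancel[OF linear_growth_summable_complex[OF assms]] by (rule summable_sums)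

lemma open_halfplane: "open {s. Re s > a}" and connected_halfplane: "connected {s. Re s > a}"
  using open_halfspace_Re_gt[of a] convex_halfspace_Re_gt[of a] convex_connected by auto

lemma nat_powr_has_field_derivative:
  "((\<lambda>s. (of_nat n :: complex) powr (-s)) has_field_derivative
     (- of_real (ln (real n)) * of_nat n powr (-s))) (at s within S)"
proof (cases "n = 0")
  case False
  have "(\<lambda>s. (of_nat n :: complex) powr (-s)) = (\<lambda>s. exp (-s * of_real (ln (real n))))"
    using False by (auto simp: powr_def Ln_of_nat)
  thus ?thesis
    using False by (auto intro!: derivative_eq_intros simp: powr_def Ln_of_nat)
qed auto

lemma nat_powr_holomorphic: "(\<lambda>s. (of_nat n :: complex) powr (-s)) holomorphic_on S"
  unfolding holomorphic_on_def field_differentiable_def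
  using nat_powr_has_field_derivative by blast

lemma powr_step_holomorphic: "powr_step n holomorphic_on S"
  unfolding powr_step_def by (intro holomorphic_on_diff nat_powr_holomorphic)

text \<open>Weierstrass test for series whose \<open>n\<close>-th term decays like \<open>n\<close> to the power \<open>a - 1 - Re s\<close>.\<close>
lemma holomorphic_powr_series:
  assumes hol: "\<And>n. g n holomorphic_on {s. Re s > a}"
    and bound: "\<And>n s. Re s > a \<Longrightarrow>
       norm (g n s) \<le> C * (1 + norm s)^2 * real n powr (-(Re s + 1 - a))"
  shows "(\<lambda>s. \<Sum>n. g n s) holomorphic_on {s. Re s > a}"
    and "\<And>s. Re s > a \<Longrightarrow> summable (\<lambda>n. g n s)"
proof -
  let ?S = "{s. Re s > a}"
  have C0: "C \<ge> 0"
    using order_trans[OF norm_ge_zero bound[where n=1 and s="of_real (a + 1)"]]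
    by (auto simp: zero_le_mult_iff)
  have *: "\<exists>d h. 0 < d \<and> summable h \<and> range h \<subseteq> \<real>\<^sub>\<ge>\<^sub>0 \<and>
     (\<forall>\<^sub>F n in sequentially. \<forall>y\<in>ball x d \<inter> ?S. cmod (g n y) \<le> cmod (h n))" if "x \<in> ?S" for x
  proof -
    define d where "d = (Re x - a) / 2"
    have d: "d > 0" using that by (simp add: d_def)
    define h where "h n = C * (1 + norm x + d)^2 * real n powr (-(1 + d))" for n
    have h0: "h n \<ge> 0" for n using C0 by (simp add: h_def)
    have "summable h" unfolding h_def using d by (intro summable_mult summable_nat_powr) auto
    moreover have "cmod (g n y) \<le> h n" if y: "y \<in> ball x d \<inter> ?S" for n y
    proof (cases "n = 0")
      case False
      have "Re x - Re y \<le> norm (x - y)" by (metis complex_Re_le_cmod minus_complex.simps(1))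
      hence Re: "Re y > a + d" using y by (auto simp: d_def dist_norm field_simps)
      have "norm y \<le> norm x + norm (x - y)" using norm_triangle_ineq4[of x "x - y"] by simp
      hence ny: "norm y \<le> norm x + d" using y by (auto simp: dist_norm)
      have "cmod (g n y) \<le> C * (1 + norm y)^2 * real n powr (-(Re y + 1 - a))" using bound y by auto
      also have "\<dots> \<le> C * (1 + norm x + d)^2 * real n powr (-(1+d))"
        using C0 ny Re d False by (intro mult_mono powr_mono power_mono) (auto simp: ac_simps)
      finally show ?thesis by (simp add: h_def)
    qed (use bound[of y 0] y in \<open>auto simp: h_def\<close>)
    ultimately show ?thesis using d h0
      by (intro exI[of _ d] exI[of _ "\<lambda>n. of_real (h n)"])
         (auto simp: summable_of_real_iff intro!: always_eventually)
  qed
  have hfd: "g n field_differentiable (at x)" if "x \<in> ?S" for n x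
    using hol[of n] open_halfplane[of a] that by (simp add: holomorphic_on_imp_differentiable_at)
  obtain G where G: "\<forall>x\<in>?S. ((\<lambda>n. g n x) sums G x) \<and> G field_differentiable (at x)"
    using series_differentiable_comparison_complex[OF open_halfplane[of a] hfd *] by blast
  show "summable (\<lambda>n. g n s)" if "Re s > a" for s using G that sums_summable by auto
  have "G holomorphic_on ?S"
    using G by (auto simp: holomorphic_on_def intro: field_differentiable_at_within)
  thus "(\<lambda>s. \<Sum>n. g n s) holomorphic_on ?S"
    by (rule holomorphic_transform) (use G in \<open>auto simp: sums_iff\<close>)
qed

lemma dirichlet_series_has_field_derivative:
  assumes "linear_growth f" "Re s > 1"
  shows "(dirichlet_series f has_field_derivative
            - dirichlet_series (\<lambda>n. f n * of_real (ln (real n))) s) (at s)"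
    and "(\<lambda>n. f n * of_real (ln (real n)) * of_nat n powr (-s)) sums
           dirichlet_series (\<lambda>n. f n * of_real (ln (real n))) s"
proof -
  let ?S = "{s. Re s > 1}"
  have "\<exists>g g'. \<forall>x\<in>?S. ((\<lambda>n. f n * of_nat n powr (-x)) sums g x) \<and>
      ((\<lambda>n. f n * (- of_real (ln (real n)) * of_nat n powr (-x))) sums g' x) \<and>
      (g has_field_derivative g' x) (at x)"
  proof (rule series_and_derivative_comparison_complex[OF open_halfplane])
    show "((\<lambda>x. f n * of_nat n powr (-x)) has_field_derivative
        f n * (- of_real (ln (real n)) * of_nat n powr (-x))) (at x)" for n x
      by (intro DERIV_cmult nat_powr_has_field_derivative)
    fix x assume x: "x \<in> ?S"
    define d where "d = (Re x - 1) / 2"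
    have d: "d > 0" using x by (simp add: d_def)
    define h where "h n = norm (f n) * real n powr (-(1 + d))" for n
    have h0: "h n \<ge> 0" for n by (simp add: h_def)
    have "summable h" unfolding h_def using d assms by (intro linear_growth_summable) auto
    moreover have "cmod (f n * of_nat n powr (-y)) \<le> h n" if y: "y \<in> ball x d \<inter> ?S" for n y
    proof (cases "n = 0")
      case False
      have "Re x - Re y \<le> norm (x - y)" by (metis complex_Re_le_cmod minus_complex.simps(1))
      hence Re: "Re y > 1 + d" using y by (auto simp: d_def dist_norm field_simps)
      thus ?thesis unfolding h_def using False
        by (auto simp: norm_mult norm_nat_powr intro!: mult_left_mono powr_mono)
    qed (auto simp: h_def)
    ultimately show "\<exists>d h. 0 < d \<and> summable h \<and> range h \<subseteq> \<real>\<^sub>\<ge>\<^sub>0 \<and>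
     (\<forall>\<^sub>F n in sequentially. \<forall>y\<in>ball x d \<inter> ?S. cmod (f n * of_nat n powr (-y)) \<le> cmod (h n))"
      using d h0 by (intro exI[of _ d] exI[of _ "\<lambda>n. of_real (h n)"])
         (auto simp: summable_of_real_iff intro!: always_eventually)
  qed
  then obtain g g' where g: "\<And>x. x \<in> ?S \<Longrightarrow> (\<lambda>n. f n * of_nat n powr (-x)) sums g x"
    "\<And>x. x \<in> ?S \<Longrightarrow> (\<lambda>n. f n * (- of_real (ln (real n)) * of_nat n powr (-x))) sums g' x"
    "\<And>x. x \<in> ?S \<Longrightarrow> (g has_field_derivative g' x) (at x)" by blast
  have "(\<lambda>n. - (f n * (- of_real (ln (real n)) * of_nat n powr (-s)))) sums (- g' s)"
    using g(2)[of s] assms by (intro sums_minus) auto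
  hence 1: "(\<lambda>n. f n * of_real (ln (real n)) * of_nat n powr (-s)) sums (- g' s)"
    by (simp add: algebra_simps)
  hence 2: "dirichlet_series (\<lambda>n. f n * of_real (ln (real n))) s = - g' s"
    by (simp add: dirichlet_series_def sums_iff)
  show "(\<lambda>n. f n * of_real (ln (real n)) * of_nat n powr (-s)) sums
           dirichlet_series (\<lambda>n. f n * of_real (ln (real n))) s" using 1 2 by simp
  have "(dirichlet_series f has_field_derivative g' s) (at s)"
  proof (rule DERIV_cong_ev[OF refl _ refl, THEN iffD1])
    show "(g has_field_derivative g' s) (at s)" using g(3) assms by auto
    show "\<forall>\<^sub>F x in nhds s. g x = dirichlet_series f x"
      using eventually_nhds_in_open[OF open_halfplane, of s 1] assms
      by (auto elim!: eventually_mono simp: dirichlet_series_def intro!: sums_unique g(1))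
  qed
  thus "(dirichlet_series f has_field_derivative
            - dirichlet_series (\<lambda>n. f n * of_real (ln (real n))) s) (at s)" by (simp add: 2)
qed

text \<open>A good approximation of the summatory function, inserted here, continues the series to the left: each
  step gains a factor \<open>1/n\<close>.\<close>
lemma abel_summation:
  assumes gr: "linear_growth f" and s: "Re s > 1"
  shows "(\<lambda>n. (\<Sum>k=1..n. f k) * powr_step n s) sums dirichlet_series f s"
proof -
  define F where "F n = (\<Sum>k=1..n. f k)" for n
  obtain K where K: "\<And>N. (\<Sum>n=1..N. norm (f n)) \<le> K * real N"
    using gr by (auto simp: linear_growth_def)
  have K0: "K \<ge> 0" using order_trans[OF norm_ge_zero, of "f 1" K] K[of 1] by simp
  have FK: "norm (F N) \<le> K * real N" for N
    unfolding F_def using order_trans[OF norm_sum K] .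
  have upto: "(\<Sum>n<Suc N. g n) = (\<Sum>n=1..N. g n)" if "g 0 = 0" for g :: "nat \<Rightarrow> complex" and N
  proof -
    have "(\<Sum>n<Suc N. g n) = (\<Sum>n\<in>insert 0 {1..N}. g n)"
      by (intro sum.cong) auto
    thus ?thesis using that by simp
  qed
  have lim: "(\<lambda>N. F N * of_nat (Suc N) powr (-s)) \<longlonglongrightarrow> 0"
  proof (rule tendsto_0_le[where K=1])
    show "(\<lambda>N. K * real (Suc N) powr (1 - Re s)) \<longlonglongrightarrow> 0"
      using s by real_asymp
    show "\<forall>\<^sub>F N in sequentially. norm (F N * of_nat (Suc N) powr (-s)) \<le> norm (K * real (Suc N) powr (1 - Re s)) * 1"
    proof (intro always_eventually allI)
      fix N
      have "norm (F N * of_nat (Suc N) powr (-s)) = norm (F N) * real (Suc N) powr (- Re s)"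
        by (simp only: norm_mult norm_nat_powr) simp
      also have "\<dots> \<le> (K * real (Suc N)) * real (Suc N) powr (- Re s)"
      proof (intro mult_right_mono)
        have "K * real N \<le> K * real (Suc N)" using K0 by (intro mult_left_mono) auto
        thus "norm (F N) \<le> K * real (Suc N)" using FK[of N] by linarith
      qed auto
      also have "\<dots> = K * real (Suc N) powr (1 - Re s)"
        by (simp add: powr_diff powr_minus field_simps)
      finally show "norm (F N * of_nat (Suc N) powr (-s)) \<le> norm (K * real (Suc N) powr (1 - Re s)) * 1"
        using K0 by simp
    qed
  qed
  have "(\<lambda>N. \<Sum>n<Suc N. f n * of_nat n powr (-s)) \<longlonglongrightarrow> dirichlet_series f s"
    using dirichlet_series_sums[OF assms] LIMSEQ_Suc unfolding sums_def by blast
  hence "(\<lambda>N. (\<Sum>n=1..N. f n * of_nat n powr (-s)) - F N * of_nat (Suc N) powr (-s))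
      \<longlonglongrightarrow> dirichlet_series f s - 0"
    by (intro tendsto_diff lim) (simp only: upto powr_0 mult_zero_right of_nat_0 simp_thms)
  also have "(\<lambda>N. (\<Sum>n=1..N. f n * of_nat n powr (-s)) - F N * of_nat (Suc N) powr (-s)) =
     (\<lambda>N. \<Sum>n<Suc N. F n * powr_step n s)"
  proof
    fix N
    show "(\<Sum>n=1..N. f n * of_nat n powr (-s)) - F N * of_nat (Suc N) powr (-s) =
       (\<Sum>n<Suc N. F n * powr_step n s)"
      using sum_by_parts_nat[of f "\<lambda>n. of_nat n powr (-s)" N]
      by (subst upto) (simp_all add: F_def powr_step_def del: of_nat_Suc)
  qed
  finally show ?thesis
    unfolding sums_def F_def[symmetric]
    by (subst filterlim_sequentially_Suc[symmetric]) (simp only: diff_0_right)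
qed

text \<open>The function \<open>zeta_step n s\<close> is \<open>s (s-1)\<close> times the integral of \<open>(n - t) t^(-s-1)\<close> over the
  unit interval to the right of \<open>n\<close>.\<close>
definition zeta_step :: "nat \<Rightarrow> complex \<Rightarrow> complex" where
  "zeta_step n s = (if n = 0 then 0 else (s - 1) * of_nat n * powr_step n s
      - s * (of_nat n powr (1 - s) - of_nat (Suc n) powr (1 - s)))"

lemma norm_zeta_step:
  assumes "Re s > 0"
  shows "norm (zeta_step n s) \<le> norm s * norm (s - 1) * real n powr (- Re s - 1)"
proof (cases "n = 0")
  case False
  define h where "h t = (s - 1) * of_nat n * (- (of_real t powr (-s))) + s * of_real t powr (- (s - 1))" for t
  have "norm (h (real n + 1) - h (real n)) \<le> norm s * norm (s - 1) * real n powr (- Re s - 1)"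
  proof (rule unit_step_bound)
    fix x assume x: "x \<in> {real n..real n+1}"
    hence x0: "x > 0" using False by simp
    show "(h has_vector_derivative ((s-1) * of_nat n * (- (-s * of_real x powr (-s-1))) +
          s * (-(s-1) * of_real x powr (-(s-1) - 1)))) (at x within {real n..real n+1})"
      unfolding h_def
      by (intro has_vector_derivative_add has_vector_derivative_mult_right
            has_vector_derivative_minus powr_nat_deriv x0)
    define P where "P = (of_real x :: complex) powr (-s-1)"
    have "(of_real x :: complex) powr (-(s-1) - 1) = of_real x powr (1 + (-s-1))"
      by (rule arg_cong[where f = "\<lambda>u. of_real x powr u"]) simp
    hence *: "of_real x powr (-(s-1) - 1) = of_real x * P"
      using x0 unfolding powr_add P_def by simp
    have **: "of_real x powr (-(s+1)) = P"
      unfolding P_def by (rule arg_cong[where f = "\<lambda>u. of_real x powr u"]) simp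
    have "(s-1) * of_nat n * (- (-s * of_real x powr (-s-1))) + s * (-(s-1) * of_real x powr (-(s-1) - 1))
      = s * (s - 1) * (of_real x powr (-(s + 1))) * (of_real (real n - x))"
      unfolding * ** P_def[symmetric] by (simp add: algebra_simps)
    also have "norm \<dots> = norm s * norm (s - 1) * norm (of_real x powr (-(s + 1)) :: complex) * \<bar>real n - x\<bar>"
      unfolding norm_mult norm_of_real by simp
    also have "\<dots> \<le> norm s * norm (s - 1) * real n powr (- Re (s + 1)) * 1"
      using x assms False by (intro mult_mono norm_powr_le_left_end) auto
    finally show "norm ((s-1) * of_nat n * (- (-s * of_real x powr (-s-1))) +
          s * (-(s-1) * of_real x powr (-(s-1) - 1))) \<le> norm s * norm (s - 1) * real n powr (- Re s - 1)"
      by simp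
  qed
  also have "h (real n + 1) - h (real n) = zeta_step n s"
    using False by (simp add: h_def zeta_step_def powr_step_def algebra_simps)
  finally show ?thesis .
qed (auto simp: zeta_step_def)

lemma linear_growth_one: "linear_growth (\<lambda>_. 1)"
  by (auto simp: linear_growth_def intro!: exI[of _ 1])

lemma norm_le_1_plus: "norm s \<le> 1 + norm (s :: complex)" "norm (s - 1) \<le> 1 + norm (s :: complex)"
  using norm_triangle_ineq4[of s 1] by simp_all

lemma zeta_simple_pole:
  obtains H where "H holomorphic_on {s. Re s > 0}"
    "\<And>s. Re s > 1 \<Longrightarrow> dirichlet_series (\<lambda>_. 1) s = 1 / (s - 1) + H s"
proof -
  let ?S = "{s. Re s > 0}"
  define T where "T s = (\<Sum>n. zeta_step n s)" for s
  define G where "G s = s + T s" for s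
  have bound: "norm (zeta_step n s) \<le> 1 * (1 + norm s)\<^sup>2 * real n powr (-(Re s + 1 - 0))"
    if "Re s > 0" for n s
  proof -
    have "norm s * norm (s - 1) \<le> (1 + norm s) * (1 + norm s)"
      by (intro mult_mono norm_le_1_plus) auto
    hence "norm s * norm (s - 1) * real n powr (- Re s - 1) \<le> (1 + norm s)\<^sup>2 * real n powr (- Re s - 1)"
      unfolding power2_eq_square by (intro mult_right_mono) auto
    moreover have "-(Re s + 1 - 0) = - Re s - 1" by simp
    ultimately show ?thesis using norm_zeta_step[OF that, of n] by (simp only: mult_1_left)
  qed
  have "zeta_step n holomorphic_on ?S" for n
  proof -
    have "(\<lambda>s. of_nat m powr (1 - s)) holomorphic_on ?S" for m
      using holomorphic_on_compose[of "\<lambda>s. s - 1" ?S "\<lambda>s. of_nat m powr (-s)"] nat_powr_holomorphic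
      by (auto simp: o_def intro!: holomorphic_intros)
    thus ?thesis unfolding zeta_step_def
      by (cases "n = 0") (auto intro!: holomorphic_intros powr_step_holomorphic)
  qed
  note TT = holomorphic_powr_series[of zeta_step 0 1, OF this bound]
  have holG: "G holomorphic_on ?S"
    unfolding G_def T_def using TT(1) by (intro holomorphic_intros)
  have "zeta_step n 1 = 0" for n by (simp add: zeta_step_def del: of_nat_Suc)
  hence G1: "G 1 = 1" by (simp add: G_def T_def)
  have G: "(s - 1) * dirichlet_series (\<lambda>_. 1) s = G s" if s: "Re s > 1" for s
  proof -
    have "(\<lambda>n. (s-1) * (of_nat n * powr_step n s)) sums ((s-1) * dirichlet_series (\<lambda>_. 1) s)"
      using abel_summation[OF linear_growth_one s] by (intro sums_mult) simp
    moreover have "(\<lambda>n. if n = 0 then 0 else s * (of_nat n powr (1 - s) - of_nat (Suc n) powr (1 - s))) sums s"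
    proof -
      have "(\<lambda>n. of_nat (Suc n) powr (1 - s) :: complex) \<longlonglongrightarrow> 0"
      proof (rule Lim_null_comparison)
        show "(\<lambda>n. real (Suc n) powr (1 - Re s)) \<longlonglongrightarrow> 0" using s by real_asymp
        show "\<forall>\<^sub>F n in sequentially. cmod (of_nat (Suc n) powr (1 - s)) \<le> real (Suc n) powr (1 - Re s)"
          by (intro always_eventually allI) (simp only: norm_nat_powr, simp)
      qed
      from telescope_sums'[OF this]
      have "(\<lambda>n. of_nat (Suc n) powr (1 - s) - of_nat (Suc (Suc n)) powr (1 - s)) sums (1 :: complex)"
        by simp
      from sums_mult[OF this, of s]
      have "(\<lambda>n. s * (of_nat (Suc n) powr (1 - s) - of_nat (Suc (Suc n)) powr (1 - s))) sums s"
        by (simp only: mult_1_right)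
      from sums_Suc[where f = "\<lambda>n. if n = 0 then 0 else s * (of_nat n powr (1 - s) - of_nat (Suc n) powr (1 - s))"
          and l = s] this show ?thesis by (simp del: of_nat_Suc)
    qed
    ultimately have "(\<lambda>n. (s-1) * (of_nat n * powr_step n s) -
        (if n = 0 then 0 else s * (of_nat n powr (1 - s) - of_nat (Suc n) powr (1 - s)))) sums
          ((s-1) * dirichlet_series (\<lambda>_. 1) s - s)" by (rule sums_diff)
    also have "(\<lambda>n. (s-1) * (of_nat n * powr_step n s) -
        (if n = 0 then 0 else s * (of_nat n powr (1 - s) - of_nat (Suc n) powr (1 - s)))) = (\<lambda>n. zeta_step n s)"
      by (auto simp: zeta_step_def mult.assoc)
    finally show ?thesis by (simp add: G_def T_def sums_iff)
  qed
  define H where "H = (\<lambda>z. if z = 1 then deriv G 1 else (G z - G 1)/(z-1))"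
  show ?thesis
  proof (rule that)
    show "H holomorphic_on ?S"
      unfolding H_def using holG open_halfplane by (rule pole_lemma_open)
    fix s assume s: "Re s > 1"
    hence "s \<noteq> 1" by auto
    thus "dirichlet_series (\<lambda>_. 1) s = 1 / (s - 1) + H s"
      using G[OF s] by (simp add: H_def G1 field_simps)
  qed
qed

text \<open>If the coefficients have mean value \<open>C\<close> with a square root error term, partial summation
  continues the series to \<open>Re s > 1/2\<close>, up to the pole inherited from the zeta function.\<close>
lemma dirichlet_series_continuation:
  assumes gr: "linear_growth r"
    and mean: "\<And>n. norm ((\<Sum>k=1..n. r k) - C * of_nat n) \<le> K * sqrt (real n)"
  obtains H where "H holomorphic_on {s. Re s > 1/2}"
    "\<And>s. Re s > 1 \<Longrightarrow> dirichlet_series r s = C / (s - 1) + H s"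
proof -
  let ?S = "{s. Re s > 1/2}"
  define E where "E n = (\<Sum>k=1..n. r k) - C * of_nat n" for n
  have bound: "norm (E n * powr_step n s) \<le> \<bar>K\<bar> * (1 + norm s)\<^sup>2 * real n powr (-(Re s + 1 - 1/2))"
    if s: "Re s > 1/2" for n s
  proof (cases "n = 0")
    case True
    thus ?thesis by (simp add: E_def)
  next
    case False
    have "norm (E n * powr_step n s) \<le> (\<bar>K\<bar> * sqrt (real n)) * (norm s * real n powr (- Re s - 1))"
      unfolding norm_mult
    proof (intro mult_mono norm_powr_step)
      show "norm (E n) \<le> \<bar>K\<bar> * sqrt (real n)"
        using mean[of n] by (simp add: E_def abs_if mult_right_mono order_trans)
    qed (use False s in auto)
    also have "\<dots> = \<bar>K\<bar> * norm s * (real n powr (1/2) * real n powr (- Re s - 1))"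
      by (simp add: powr_half_sqrt)
    also have "real n powr (1/2) * real n powr (- Re s - 1) = real n powr (-(Re s + 1 - 1/2))"
      by (simp add: powr_add[symmetric])
    also have "\<bar>K\<bar> * norm s * \<dots> \<le> \<bar>K\<bar> * (1 + norm s)\<^sup>2 * \<dots>"
    proof (intro mult_right_mono mult_left_mono)
      have "norm s \<le> (1 + norm s) * 1" by simp
      also have "\<dots> \<le> (1 + norm s) * (1 + norm s)" by (intro mult_left_mono) auto
      finally show "norm s \<le> (1 + norm s)\<^sup>2" by (simp add: power2_eq_square)
    qed auto
    finally show ?thesis .
  qed
  have "(\<lambda>s. E n * powr_step n s) holomorphic_on ?S" for n
    using powr_step_holomorphic by (intro holomorphic_intros)
  note TT = holomorphic_powr_series[of "\<lambda>n s. E n * powr_step n s" "1/2" "\<bar>K\<bar>", OF this bound]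
  obtain Z where Z: "Z holomorphic_on {s. Re s > 0}"
    "\<And>s. Re s > 1 \<Longrightarrow> dirichlet_series (\<lambda>_. 1) s = 1 / (s - 1) + Z s"
    using zeta_simple_pole by blast
  show ?thesis
  proof (rule that)
    show "(\<lambda>s. C * Z s + (\<Sum>n. E n * powr_step n s)) holomorphic_on ?S"
      by (intro holomorphic_on_add holomorphic_on_mult TT(1) holomorphic_on_const
            holomorphic_on_subset[OF Z(1)]) auto
    fix s assume s: "Re s > 1"
    have "(\<lambda>n. C * (of_nat n * powr_step n s) + E n * powr_step n s) sums
        (C * dirichlet_series (\<lambda>_. 1) s + (\<Sum>n. E n * powr_step n s))"
    proof (intro sums_add sums_mult)
      show "(\<lambda>n. of_nat n * powr_step n s) sums dirichlet_series (\<lambda>_. 1) s"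
        using abel_summation[OF linear_growth_one s] by simp
      show "(\<lambda>n. E n * powr_step n s) sums (\<Sum>n. E n * powr_step n s)"
        using TT(2)[of s] s by (intro summable_sums) auto
    qed
    moreover have "(\<lambda>n. C * (of_nat n * powr_step n s) + E n * powr_step n s) =
      (\<lambda>n. (\<Sum>k=1..n. r k) * powr_step n s)"
      by (auto simp: E_def algebra_simps)
    ultimately have "dirichlet_series r s = C * dirichlet_series (\<lambda>_. 1) s + (\<Sum>n. E n * powr_step n s)"
      using abel_summation[OF gr s] sums_unique2 by metis
    thus "dirichlet_series r s = C / (s - 1) + (C * Z s + (\<Sum>n. E n * powr_step n s))"
      using Z(2)[OF s] by (simp add: algebra_simps)
  qed
qed

lemma dirichlet_series_mult:
  assumes f: "linear_growth f" and g: "linear_growth g" and s: "Re s > 1"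
    and conv: "\<And>n. n > 0 \<Longrightarrow> (\<Sum>d | d dvd n. f d * g (n div d)) = h n"
  shows "dirichlet_series f s * dirichlet_series g s = dirichlet_series h s"
proof -
  define a where "a n = f n * of_nat n powr (-s)" for n
  define b where "b n = g n * of_nat n powr (-s)" for n
  have [simp]: "a 0 = 0" "b 0 = 0" by (simp_all add: a_def b_def)
  have a: "summable (\<lambda>n. norm (a n))" "a sums dirichlet_series f s"
    and b: "summable (\<lambda>n. norm (b n))" "b sums dirichlet_series g s"
    unfolding a_def b_def
    by (intro linear_growth_summable_complex dirichlet_series_sums f g s)+
  have "((\<lambda>(m,n). a m * b n) has_sum (dirichlet_series f s * dirichlet_series g s)) (UNIV \<times> UNIV)"
  proof (rule has_sum_SigmaI)
    show "((\<lambda>y. case (x, y) of (m, n) \<Rightarrow> a m * b n) has_sum (a x * dirichlet_series g s)) UNIV" for x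
      using norm_summable_imp_has_sum[OF b] by (auto intro: has_sum_cmult_right)
    show "((\<lambda>x. a x * dirichlet_series g s) has_sum dirichlet_series f s * dirichlet_series g s) UNIV"
      by (intro has_sum_cmult_left norm_summable_imp_has_sum a)
    have na: "((\<lambda>n. norm (a n)) has_sum (\<Sum>n. norm (a n))) UNIV"
      and nb: "((\<lambda>n. norm (b n)) has_sum (\<Sum>n. norm (b n))) UNIV"
      using a(1) b(1) by (auto intro!: norm_summable_imp_has_sum summable_sums)
    have "(\<lambda>(m,n). norm (a m) * norm (b n)) summable_on (UNIV \<times> UNIV)"
    proof (rule summable_on_SigmaI)
      show "((\<lambda>y. case (x, y) of (m, n) \<Rightarrow> norm (a m) * norm (b n)) has_sum (norm (a x) * (\<Sum>n. norm (b n)))) UNIV" for x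
        using nb by (auto intro: has_sum_cmult_right)
      show "(\<lambda>x. norm (a x) * (\<Sum>n. norm (b n))) summable_on UNIV"
        using has_sum_cmult_left[OF na] by (auto simp: summable_on_def)
    qed auto
    hence "(\<lambda>x. norm (case x of (m,n) \<Rightarrow> a m * b n)) summable_on (UNIV \<times> UNIV)"
      by (simp add: case_prod_unfold norm_mult)
    thus "(\<lambda>x. case x of (m,n) \<Rightarrow> a m * b n) summable_on (UNIV \<times> UNIV)"
      by (rule abs_summable_summable)
  qed
  also have "?this \<longleftrightarrow> ((\<lambda>(m,n). a m * b n) has_sum (dirichlet_series f s * dirichlet_series g s)) ({1..} \<times> {1..})"
    by (rule has_sum_cong_neutral) (auto simp: not_le Suc_le_eq intro!: gr0I)
  also have "\<dots> \<longleftrightarrow> ((\<lambda>(n,d). a d * b (n div d)) has_sum (dirichlet_series f s * dirichlet_series g s))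
       (SIGMA n:{1..}. {d. d dvd n})"
    by (rule has_sum_reindex_bij_witness[where i = "\<lambda>(n,d). (d, n div d)" and j = "\<lambda>(m,n). (m * n, m)"])
       (auto simp: Suc_le_eq intro!: Nat.gr0I elim!: dvdE)
  finally have "((\<lambda>n. \<Sum>d | d dvd n. a d * b (n div d)) has_sum (dirichlet_series f s * dirichlet_series g s)) {1..}"
    by (rule has_sum_SigmaD) (auto intro!: has_sum_finiteI simp: Suc_le_eq)
  also have "?this \<longleftrightarrow> ((\<lambda>n. h n * of_nat n powr (-s)) has_sum (dirichlet_series f s * dirichlet_series g s)) UNIV"
  proof (rule has_sum_cong_neutral)
    fix n :: nat assume "n \<in> {1..} \<inter> UNIV"
    hence n: "n > 0" by simp
    have "(\<Sum>d | d dvd n. a d * b (n div d)) = (\<Sum>d | d dvd n. f d * g (n div d) * of_nat n powr (-s))"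
    proof (intro sum.cong refl)
      fix d assume "d \<in> {d. d dvd n}"
      then obtain e where e: "n = d * e" by (auto elim: dvdE)
      with n have "d > 0" by (auto intro: Nat.gr0I)
      moreover have "of_nat n powr (-s) = (of_nat d powr (-s) * of_nat e powr (-s) :: complex)"
        unfolding e of_nat_mult by (rule powr_times_real) auto
      ultimately show "a d * b (n div d) = f d * g (n div d) * of_nat n powr (-s)"
        by (simp add: a_def b_def e algebra_simps)
    qed
    also have "\<dots> = h n * of_nat n powr (-s)"
      using conv[OF n] by (simp add: sum_distrib_right[symmetric])
    finally show "(\<Sum>d | d dvd n. a d * b (n div d)) = h n * of_nat n powr (-s)" .
  qed auto
  finally show ?thesis
    by (simp add: dirichlet_series_def has_sum_imp_sums sums_unique)
qed

section \<open>Non-vanishing on the line \<open>Re s = 1\<close>\<close>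

text \<open>Approaching a zero \<open>s0\<close> horizontally, \<open>x F'/F\<close> tends to its multiplicity. In this form the orders of
  zeros and poles of several functions can be added up inside one inequality between Dirichlet series.\<close>
lemma log_derivative_order:
  assumes hol: "F holomorphic_on S" and S: "open S" "connected S" and s0: "s0 \<in> S"
    and nz: "\<exists>s\<in>S. F s \<noteq> 0"
  obtains m :: nat where "m > 0 \<longleftrightarrow> F s0 = 0"
    "eventually (\<lambda>x. F (s0 + of_real x) \<noteq> 0) (at_right 0)"
    "((\<lambda>x. of_real x * (deriv F (s0 + of_real x) / F (s0 + of_real x))) \<longlongrightarrow> of_nat m) (at_right (0::real))"
proof -
  have lim0: "((\<lambda>x. s0 + of_real x) \<longlongrightarrow> s0) (at_right (0::real))"
    by (auto intro!: tendsto_eq_intros)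
  have comp: "((\<lambda>x. g (s0 + of_real x)) \<longlongrightarrow> g s0) (at_right (0::real))"
    if "g holomorphic_on T" "open T" "s0 \<in> T" for g T
  proof -
    have "isCont g s0"
      using that by (metis holomorphic_on_imp_continuous_on continuous_on_eq_continuous_at)
    thus ?thesis using lim0 by (rule isCont_tendsto_compose)
  qed
  have x0: "((\<lambda>x. of_real x :: complex) \<longlongrightarrow> 0) (at_right (0::real))"
    by (auto intro!: tendsto_eq_intros)
  show ?thesis
  proof (cases "F s0 = 0")
    case False
    have "eventually (\<lambda>x. F (s0 + of_real x) \<noteq> 0) (at_right (0::real))"
      using comp[OF hol S(1) s0] False by (rule tendsto_imp_eventually_ne)
    moreover have "((\<lambda>x. of_real x * (deriv F (s0 + of_real x) / F (s0 + of_real x))) \<longlongrightarrow>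
        0 * (deriv F s0 / F s0)) (at_right (0::real))"
      using False hol S s0
      by (intro tendsto_mult tendsto_divide x0 comp[of _ S] holomorphic_deriv) auto
    ultimately show ?thesis using False by (intro that[of 0]) auto
  next
    case True
    have "\<not> F constant_on S"
      using nz True s0 unfolding constant_on_def by metis
    from holomorphic_factor_zero_nonconstant[OF hol S s0 True this]
    obtain g r n where n: "0 < n" "0 < r" "ball s0 r \<subseteq> S" "g holomorphic_on ball s0 r"
      "\<And>w. w \<in> ball s0 r \<Longrightarrow> F w = (w - s0) ^ n * g w" "\<And>w. w \<in> ball s0 r \<Longrightarrow> g w \<noteq> 0" by metis
    have small: "eventually (\<lambda>x. x > 0 \<and> s0 + of_real x \<in> ball s0 r) (at_right (0::real))"
      using n(2) eventually_at_right_real[of 0 r] by (auto elim!: eventually_mono simp: dist_norm)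
    have ev: "eventually (\<lambda>x. of_nat n + of_real x * (deriv g (s0 + of_real x) / g (s0 + of_real x)) =
        of_real x * (deriv F (s0 + of_real x) / F (s0 + of_real x))) (at_right (0::real))"
      using small
    proof eventually_elim
      case (elim x)
      define w where "w = s0 + of_real x"
      have w: "w \<in> ball s0 r" using elim by (simp add: w_def)
      have "(g has_field_derivative deriv g w) (at w)"
        using n(4) w by (auto intro: holomorphic_derivI)
      hence "((\<lambda>w. (w - s0) ^ n * g w) has_field_derivative
          (of_nat n * (w - s0) ^ (n - 1) * g w + (w - s0) ^ n * deriv g w)) (at w)"
        by (auto intro!: derivative_eq_intros)
      hence "(F has_field_derivative
          (of_nat n * (w - s0) ^ (n - 1) * g w + (w - s0) ^ n * deriv g w)) (at w)"
        by (rule has_field_derivative_transform_within_open[of _ _ _ "ball s0 r"]) (use n w in auto)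
      hence d: "deriv F w = of_nat n * (w - s0) ^ (n - 1) * g w + (w - s0) ^ n * deriv g w"
        by (rule DERIV_imp_deriv)
      have x: "w - s0 = of_real x" "(of_real x :: complex) \<noteq> 0" using elim by (auto simp: w_def)
      define y where "y = (of_real x :: complex)"
      define Y where "Y = y ^ (n - 1)"
      have "y ^ n = y ^ Suc (n - 1)" using n(1) by simp
      hence Y: "y ^ n = y * Y" "Y \<noteq> 0" "y \<noteq> 0"
        using x(2) by (simp_all add: Y_def y_def)
      have quot: "p + y * (b / a) = y * ((p * Y * a + y * Y * b) / (y * Y * a))" if "a \<noteq> 0" for p a b
      proof -
        have "y * ((p * Y * a + y * Y * b) / (y * Y * a)) = (y * (Y * (p * a + y * b))) / (y * (Y * a))"
          by (simp add: algebra_simps)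
        also have "\<dots> = (Y * (p * a + y * b)) / (Y * a)" using Y by simp
        also have "\<dots> = p + y * (b / a)"
          using Y that by (simp add: add_divide_distrib)
        finally show ?thesis by simp
      qed
      show ?case unfolding w_def[symmetric] d n(5)[OF w] x(1) unfolding y_def[symmetric] Y(1) Y_def[symmetric]
        by (rule quot[OF n(6)[OF w]])
    qed
    have "((\<lambda>x. of_nat n + of_real x * (deriv g (s0 + of_real x) / g (s0 + of_real x))) \<longlongrightarrow>
        of_nat n + 0 * (deriv g s0 / g s0)) (at_right (0::real))"
      using n by (intro tendsto_add tendsto_const tendsto_mult tendsto_divide x0 comp[of _ "ball s0 r"] holomorphic_deriv) auto
    hence "((\<lambda>x. of_real x * (deriv F (s0 + of_real x) / F (s0 + of_real x))) \<longlongrightarrow> of_nat n) (at_right (0::real))"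
      using Lim_transform_eventually[OF _ ev] by simp
    moreover have "eventually (\<lambda>x. F (s0 + of_real x) \<noteq> 0) (at_right (0::real))"
      using small by eventually_elim (use n in auto)
    ultimately show ?thesis using n True by (intro that[of n]) auto
  qed
qed

text \<open>As \<open>s\<close> tends to infinity along the reals, only the term of index 1 survives.\<close>
lemma dirichlet_series_not_identically_zero:
  assumes gr: "linear_growth r" and r1: "r 1 \<noteq> 0"
  shows "\<exists>s. Re s > 1 \<and> dirichlet_series r s \<noteq> 0"
proof (rule ccontr)
  assume "\<not> ?thesis"
  hence zero: "dirichlet_series r s = 0" if "Re s > 1" for s using that by auto
  define B where "B = (\<Sum>n. norm (r n) * real n powr (-2))"
  have Bs: "summable (\<lambda>n. norm (r n) * real n powr (-2))"
    using linear_growth_summable[OF gr, of 2] by simp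
  have "norm (r 1) \<le> 2 powr (2 - \<sigma>) * B" if \<sigma>: "\<sigma> \<ge> 2" for \<sigma>
  proof -
    let ?f = "\<lambda>n. r n * of_nat n powr (- of_real \<sigma>)"
    have sm: "summable (\<lambda>n. norm (?f n))"
      using linear_growth_summable_complex[OF gr, of "of_real \<sigma>"] \<sigma> by simp
    have "0 = (\<Sum>n. ?f n)" using zero[of "of_real \<sigma>"] \<sigma> by (simp add: dirichlet_series_def)
    also have "\<dots> = (\<Sum>n. ?f (n + 2)) + (\<Sum>n<2. ?f n)"
      by (rule suminf_split_initial_segment[OF summable_norm_cancel[OF sm]])
    also have "(\<Sum>n<2. ?f n) = r 1" by (simp add: eval_nat_numeral)
    finally have "r 1 = - (\<Sum>n. ?f (n + 2))"
      by (simp only: eq_neg_iff_add_eq_0 add.commute)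
    hence "norm (r 1) = norm (\<Sum>n. ?f (n + 2))" by simp
    also have "\<dots> \<le> (\<Sum>n. norm (?f (n + 2)))"
      using summable_ignore_initial_segment[OF sm, of 2] by (rule summable_norm)
    also have "\<dots> \<le> (\<Sum>n. 2 powr (2 - \<sigma>) * (norm (r (n+2)) * real (n + 2) powr (-2)))"
    proof (rule suminf_le)
      show "summable (\<lambda>n. norm (?f (n + 2)))"
        using summable_ignore_initial_segment[OF sm, of 2] .
      show "summable (\<lambda>n. 2 powr (2 - \<sigma>) * (norm (r (n+2)) * real (n + 2) powr (-2)))"
        using summable_ignore_initial_segment[OF Bs, of 2] by (rule summable_mult)
      fix n
      have "real (n+2) powr (-\<sigma>) = real (n+2) powr (2 - \<sigma>) * real (n + 2) powr (-2)"
        by (simp add: powr_add[symmetric])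
      also have "\<dots> \<le> 2 powr (2 - \<sigma>) * real (n + 2) powr (-2)"
        using \<sigma> by (intro mult_right_mono powr_mono2') auto
      finally have "norm (r (n+2)) * real (n+2) powr (-\<sigma>) \<le> norm (r (n+2)) * (2 powr (2 - \<sigma>) * real (n + 2) powr (-2))"
        by (rule mult_left_mono) auto
      thus "norm (?f (n + 2)) \<le> 2 powr (2 - \<sigma>) * (norm (r (n+2)) * real (n + 2) powr (-2))"
        unfolding norm_mult norm_nat_powr by (simp add: mult_ac)
    qed
    also have "\<dots> = 2 powr (2 - \<sigma>) * (\<Sum>n. norm (r (n+2)) * real (n + 2) powr (-2))"
      using summable_ignore_initial_segment[OF Bs, of 2] by (rule suminf_mult)
    also have "(\<Sum>n. norm (r (n+2)) * real (n + 2) powr (-2)) \<le> B"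
      unfolding B_def suminf_split_initial_segment[OF Bs, of 2] by (simp add: sum_nonneg)
    finally show ?thesis by simp
  qed
  hence "eventually (\<lambda>\<sigma>. norm (r 1) \<le> 2 powr (2 - \<sigma>) * B) at_top"
    by (auto intro: eventually_at_top_linorderI[of 2])
  moreover have "((\<lambda>\<sigma>. 2 powr (2 - \<sigma>) * B) \<longlongrightarrow> 0) at_top" by real_asymp
  ultimately have "norm (r 1) \<le> 0"
    by (intro tendsto_lowerbound) auto
  thus False using r1 by simp
qed

text \<open>The coefficients \<open>r\<close> of an L-function with residue \<open>C\<close> at 1, and the coefficients \<open>lam\<close> of its
  negative logarithmic derivative.\<close>
definition log_derivative_pair :: "(nat \<Rightarrow> complex) \<Rightarrow> (nat \<Rightarrow> complex) \<Rightarrow> complex \<Rightarrow> bool" where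
  "log_derivative_pair r lam C \<longleftrightarrow> linear_growth r \<and> linear_growth lam \<and> r 1 = 1 \<and>
     (\<exists>K. \<forall>n. norm ((\<Sum>k=1..n. r k) - C * of_nat n) \<le> K * sqrt (real n)) \<and>
     (\<forall>n>0. (\<Sum>d | d dvd n. lam d * r (n div d)) = r n * of_real (ln (real n)))"

text \<open>\<open>F\<close> is the L-function itself or, if it has a pole at 1, its product with \<open>s - 1\<close>. The convolution identity
  says \<open>\<Lambda> * L = - L'\<close> for the series; as \<open>F' = F (e / (s - 1) - \<Lambda>)\<close>, a zero of \<open>F\<close> with \<open>Re s > 1\<close> would have
  infinite order.\<close>
lemma log_derivative_pair_continuation:
  assumes "log_derivative_pair r lam C"
  obtains F e where "F holomorphic_on {s. Re s > 1/2}" "\<exists>s\<in>{s. Re s > 1/2}. F s \<noteq> 0"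
    "e = (if C = 0 then 0 else 1)" "C \<noteq> 0 \<Longrightarrow> F 1 \<noteq> 0"
    "\<And>s. Re s > 1 \<Longrightarrow> F s \<noteq> 0"
    "\<And>s. Re s > 1 \<Longrightarrow> dirichlet_series lam s = e / (s - 1) - deriv F s / F s"
proof -
  let ?L = "dirichlet_series r" and ?S = "{s. Re s > 1/2}"
  define e where "e = (if C = 0 then 0 else 1 :: complex)"
  obtain K where gr: "linear_growth r" "linear_growth lam" "r 1 = 1"
    and K: "\<And>n. norm ((\<Sum>k=1..n. r k) - C * of_nat n) \<le> K * sqrt (real n)"
    and conv: "\<And>n. n > 0 \<Longrightarrow> (\<Sum>d | d dvd n. lam d * r (n div d)) = r n * of_real (ln (real n))"
    using assms unfolding log_derivative_pair_def by blast
  obtain H where H: "H holomorphic_on ?S" "\<And>s. Re s > 1 \<Longrightarrow> ?L s = C / (s - 1) + H s"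
    using dirichlet_series_continuation[OF gr(1) K] by blast
  \<comment> \<open>Multiplying by \<open>s - 1\<close> removes the pole and gives \<open>F 1 = C\<close>.\<close>
  define F where "F = (\<lambda>s. if C = 0 then H s else C + (s - 1) * H s)"
  have holF: "F holomorphic_on ?S" unfolding F_def using H(1)
    by (cases "C = 0") (auto intro!: holomorphic_intros)
  have FL: "F s = (if C = 0 then 1 else s - 1) * ?L s" if "Re s > 1" for s
  proof -
    have "s - 1 \<noteq> 0" using that by auto
    thus ?thesis using H(2)[OF that] by (simp add: F_def distrib_left)
  qed
  have LL: "dirichlet_series lam s * ?L s = - deriv ?L s" if s: "Re s > 1" for s
    using dirichlet_series_mult[OF gr(2,1) s conv]
      DERIV_imp_deriv[OF dirichlet_series_has_field_derivative(1)[OF gr(1) s]] by simp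
  have key: "deriv F s = F s * (e / (s - 1) - dirichlet_series lam s)" if s: "Re s > 1" for s
  proof -
    have d: "(?L has_field_derivative (- dirichlet_series lam s * ?L s)) (at s)"
      using dirichlet_series_has_field_derivative(1)[OF gr(1) s] LL[OF s]
      by (metis DERIV_imp_deriv minus_minus mult_minus_left)
    have "((\<lambda>s. (if C = 0 then 1 else s - 1) * ?L s) has_field_derivative
       (e * ?L s + (if C = 0 then 1 else s - 1) * (- dirichlet_series lam s * ?L s))) (at s)"
      using d by (cases "C = 0") (auto intro!: derivative_eq_intros simp: e_def)
    hence "(F has_field_derivative
       (e * ?L s + (if C = 0 then 1 else s - 1) * (- dirichlet_series lam s * ?L s))) (at s)"
      by (rule has_field_derivative_transform_within_open[OF _ open_halfplane, of _ _ _ 1]) (use FL s in auto)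
    hence "deriv F s = (e * ?L s + (if C = 0 then 1 else s - 1) * (- dirichlet_series lam s * ?L s))"
      by (rule DERIV_imp_deriv)
    also have "\<dots> = F s * (e / (s - 1) - dirichlet_series lam s)"
    proof -
      have "s - 1 \<noteq> 0" using s by auto
      thus ?thesis unfolding FL[OF s] e_def by (simp add: field_simps)
    qed
    finally show ?thesis .
  qed
  have nz: "\<exists>s\<in>?S. F s \<noteq> 0"
  proof -
    obtain s where "Re s > 1" "?L s \<noteq> 0"
      using dirichlet_series_not_identically_zero[OF gr(1)] gr(3) by auto
    thus ?thesis using FL[of s] by (intro bexI[of _ s]) auto
  qed
  have F0: "F s \<noteq> 0" if s: "Re s > 1" for s
  proof
    assume "F s = 0"
    have sS: "s \<in> ?S" using s by simp
    obtain m :: nat where m: "m > 0 \<longleftrightarrow> F s = 0"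
      "eventually (\<lambda>x. F (s + of_real x) \<noteq> 0) (at_right 0)"
      "((\<lambda>x. of_real x * (deriv F (s + of_real x) / F (s + of_real x))) \<longlongrightarrow> of_nat m) (at_right (0::real))"
      using log_derivative_order[OF holF open_halfplane connected_halfplane sS nz] by metis
    have ev: "eventually (\<lambda>x. of_real x * (deriv F (s + of_real x) / F (s + of_real x)) =
       of_real x * (e / (s + of_real x - 1) - dirichlet_series lam (s + of_real x))) (at_right (0::real))"
      using m(2) eventually_at_right_less[of 0]
    proof eventually_elim
      case (elim x)
      thus ?case using key[of "s + of_real x"] s by simp
    qed
    have "isCont (dirichlet_series lam) s"
      using dirichlet_series_has_field_derivative(1)[OF gr(2) s] by (rule DERIV_isCont)
    hence "((\<lambda>x. of_real x * (e / (s + of_real x - 1) - dirichlet_series lam (s + of_real x))) \<longlongrightarrow>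
       of_real 0 * (e / (s + of_real 0 - 1) - dirichlet_series lam (s + of_real 0))) (at_right (0::real))"
      using s by (intro tendsto_intros isCont_tendsto_compose[of _ "dirichlet_series lam"]) auto
    hence "((\<lambda>x. of_real x * (deriv F (s + of_real x) / F (s + of_real x))) \<longlongrightarrow> 0) (at_right (0::real))"
      using tendsto_cong[OF ev] by simp
    hence "of_nat m = (0 :: complex)"
      using m(3) tendsto_unique trivial_limit_at_right_real by blast
    thus False using m(1) \<open>F s = 0\<close> by simp
  qed
  show ?thesis
  proof (rule that[OF holF nz e_def])
    show "F 1 \<noteq> 0" if "C \<noteq> 0" using that by (simp add: F_def)
    show "F s \<noteq> 0" if "Re s > 1" for s using F0 that .
    show "dirichlet_series lam s = e / (s - 1) - deriv F s / F s" if "Re s > 1" for s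
      using key[OF that] F0[OF that] by simp
  qed
qed

text \<open>The argument of Mertens with \<open>3 + 4 cos \<phi> + cos 2\<phi> \<ge> 0\<close>: let \<open>x\<close> tend to 0 from the right in
  \<open>x Re (3 \<Lambda>0(1 + x) + 4 \<Lambda>1(1 + x + it) + \<Lambda>2(1 + x + 2it)) \<ge> 0\<close>. The limit is \<open>3 - 4 m1 - m2\<close>, where the
  \<open>m\<close> are orders of zeros, so a zero of \<open>F1\<close> is impossible. At a point where \<open>F1\<close> or \<open>F2\<close> stands for a
  series with a pole the limit would be different, hence the assumptions on \<open>t\<close>.\<close>
lemma nonvanishing_341:
  assumes gr: "linear_growth l0" "linear_growth l1" "linear_growth l2"
    and F0: "F0 holomorphic_on {s. Re s > 1/2}" "\<exists>s\<in>{s. Re s > 1/2}. F0 s \<noteq> 0" "F0 1 \<noteq> 0"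
      "\<And>s. Re s > 1 \<Longrightarrow> dirichlet_series l0 s = 1 / (s - 1) - deriv F0 s / F0 s"
    and F1: "F1 holomorphic_on {s. Re s > 1/2}" "\<exists>s\<in>{s. Re s > 1/2}. F1 s \<noteq> 0"
      "\<And>s. Re s > 1 \<Longrightarrow> dirichlet_series l1 s = e1 / (s - 1) - deriv F1 s / F1 s"
    and F2: "F2 holomorphic_on {s. Re s > 1/2}" "\<exists>s\<in>{s. Re s > 1/2}. F2 s \<noteq> 0"
      "\<And>s. Re s > 1 \<Longrightarrow> dirichlet_series l2 s = e2 / (s - 1) - deriv F2 s / F2 s"
    and t: "e1 = 0 \<or> t \<noteq> 0" "e2 = 0 \<or> t \<noteq> 0"
    and pos: "\<And>n z. norm z = 1 \<Longrightarrow> Re (3 * l0 n + 4 * l1 n * z + l2 n * z\<^sup>2) \<ge> 0"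
  shows "F1 (Complex 1 t) \<noteq> 0"
proof
  assume zero: "F1 (Complex 1 t) = 0"
  have D: "\<exists>m::nat. (m > 0 \<longleftrightarrow> F (Complex 1 u) = 0) \<and>
     ((\<lambda>x. of_real x * dirichlet_series l (Complex 1 u + of_real x)) \<longlongrightarrow>
         (if u = 0 then e else 0) - of_nat m) (at_right 0)"
    if F: "F holomorphic_on {s. Re s > 1/2}" "\<exists>s\<in>{s. Re s > 1/2}. F s \<noteq> 0"
      "\<And>s. Re s > 1 \<Longrightarrow> dirichlet_series l s = e / (s - 1) - deriv F s / F s"
    for F l e u
  proof -
    let ?s = "Complex 1 u"
    obtain m :: nat where m: "m > 0 \<longleftrightarrow> F ?s = 0"
      "((\<lambda>x. of_real x * (deriv F (?s + of_real x) / F (?s + of_real x))) \<longlongrightarrow> of_nat m) (at_right (0::real))"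
      using log_derivative_order[OF F(1) open_halfplane connected_halfplane _ F(2), of ?s] by auto
    have "((\<lambda>x. of_real x * (e / (?s + of_real x - 1))) \<longlongrightarrow> (if u = 0 then e else 0)) (at_right 0)"
    proof (cases "u = 0")
      case True
      have "eventually (\<lambda>x. e = of_real x * (e / (?s + of_real x - 1))) (at_right (0::real))"
        using eventually_at_right_less[of 0]
      proof eventually_elim
        case (elim x)
        have "?s + of_real x - 1 = of_real x" using True by (simp add: complex_eq_iff)
        thus ?case using elim by simp
      qed
      thus ?thesis using True tendsto_const[of e "at_right 0"]
        by (auto intro: Lim_transform_eventually)
    next
      case False
      have "((\<lambda>x. of_real x * (e / (?s + of_real x - 1))) \<longlongrightarrow> of_real 0 * (e / (?s + of_real 0 - 1))) (at_right 0)"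
        using False by (intro tendsto_intros) (auto simp: complex_eq_iff)
      thus ?thesis using False by simp
    qed
    from tendsto_diff[OF this m(2)]
    have "((\<lambda>x. of_real x * (e / (?s + of_real x - 1)) -
         of_real x * (deriv F (?s + of_real x) / F (?s + of_real x))) \<longlongrightarrow>
         (if u = 0 then e else 0) - of_nat m) (at_right 0)" .
    moreover have "eventually (\<lambda>x. of_real x * (e / (?s + of_real x - 1)) -
         of_real x * (deriv F (?s + of_real x) / F (?s + of_real x)) =
         of_real x * dirichlet_series l (?s + of_real x)) (at_right 0)"
      using eventually_at_right_less[of 0]
    proof eventually_elim
      case (elim x)
      thus ?case using F(3)[of "?s + of_real x"] by (simp add: right_diff_distrib)
    qed
    ultimately have "((\<lambda>x. of_real x * dirichlet_series l (?s + of_real x)) \<longlongrightarrow>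
         (if u = 0 then e else 0) - of_nat m) (at_right 0)"
      by (rule Lim_transform_eventually)
    with m(1) show ?thesis by (intro exI[of _ m] conjI)
  qed
  obtain m0 :: nat where m0: "m0 > 0 \<longleftrightarrow> F0 (Complex 1 0) = 0"
    "((\<lambda>x. of_real x * dirichlet_series l0 (Complex 1 0 + of_real x)) \<longlongrightarrow> (1 - of_nat m0)) (at_right 0)"
    using D[OF F0(1,2,4), of 0] by auto
  obtain m1 :: nat where m1: "m1 > 0 \<longleftrightarrow> F1 (Complex 1 t) = 0"
    "((\<lambda>x. of_real x * dirichlet_series l1 (Complex 1 t + of_real x)) \<longlongrightarrow> (0 - of_nat m1)) (at_right 0)"
    using D[OF F1, of t] t(1) by (auto split: if_splits)
  obtain m2 :: nat where m2: "m2 > 0 \<longleftrightarrow> F2 (Complex 1 (2*t)) = 0"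
    "((\<lambda>x. of_real x * dirichlet_series l2 (Complex 1 (2*t) + of_real x)) \<longlongrightarrow> (0 - of_nat m2)) (at_right 0)"
    using D[OF F2, of "2*t"] t(2) by (auto split: if_splits)
  have one: "Complex 1 0 = 1" by (simp add: complex_eq_iff)
  have m0': "m0 = 0" using m0(1) F0(3) by (simp add: one)
  define P where "P x = 3 * dirichlet_series l0 (Complex 1 0 + of_real x)
       + 4 * dirichlet_series l1 (Complex 1 t + of_real x) + dirichlet_series l2 (Complex 1 (2*t) + of_real x)" for x :: real
  have "((\<lambda>x. 3 * (of_real x * dirichlet_series l0 (Complex 1 0 + of_real x))
       + 4 * (of_real x * dirichlet_series l1 (Complex 1 t + of_real x))
       + of_real x * dirichlet_series l2 (Complex 1 (2*t) + of_real x)) \<longlongrightarrow>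
       3 * (1 - of_nat m0) + 4 * (0 - of_nat m1) + (0 - of_nat m2)) (at_right (0::real))"
    by (intro tendsto_intros m0 m1 m2)
  also have "(\<lambda>x::real. 3 * (of_real x * dirichlet_series l0 (Complex 1 0 + of_real x))
       + 4 * (of_real x * dirichlet_series l1 (Complex 1 t + of_real x))
       + of_real x * dirichlet_series l2 (Complex 1 (2*t) + of_real x)) = (\<lambda>x. of_real x * P x)"
    by (auto simp: P_def algebra_simps)
  finally have "((\<lambda>x. Re (of_real x * P x)) \<longlongrightarrow> Re (3 * (1 - of_nat m0) + 4 * (0 - of_nat m1) + (0 - of_nat m2))) (at_right 0)"
    by (rule tendsto_Re)
  moreover have "eventually (\<lambda>x. Re (of_real x * P x) \<ge> 0) (at_right (0::real))"
    using eventually_at_right_less[of 0]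
  proof eventually_elim
    case (elim x)
    let ?T = "\<lambda>n. 3 * (l0 n * of_nat n powr (-(Complex 1 0 + of_real x))) +
        4 * (l1 n * of_nat n powr (-(Complex 1 t + of_real x))) + l2 n * of_nat n powr (-(Complex 1 (2*t) + of_real x))"
    have "?T sums P x"
      unfolding P_def by (intro sums_add sums_mult dirichlet_series_sums gr) (use elim in auto)
    hence Re: "(\<lambda>n. Re (?T n)) sums Re (P x)" by (rule sums_Re)
    have "Re (?T n) \<ge> 0" for n
    proof (cases "n = 0")
      case False
      define z where "z = (of_nat n :: complex) powr (- (\<i> * of_real t))"
      have z: "norm z = 1" unfolding z_def norm_nat_powr using False by simp
      have a: "(of_nat n :: complex) powr (-(Complex 1 u + of_real x)) =
          of_real (real n powr (-1-x)) * of_nat n powr (- (\<i> * of_real u))" for u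
      proof -
        have *: "-(Complex 1 u + of_real x) = of_real (-1-x) + (- (\<i> * of_real u))"
          by (simp add: complex_eq_iff)
        have "(of_nat n :: complex) powr (of_real (-1-x)) = of_real (real n powr (-1-x))"
          using powr_of_real[of "real n" "-1-x"] by simp
        thus ?thesis unfolding * powr_add by simp
      qed
      have z2: "(of_nat n :: complex) powr (- (\<i> * of_real (2 * t))) = z\<^sup>2"
      proof -
        have *: "- (\<i> * of_real (2 * t)) = (- (\<i> * of_real t)) + (- (\<i> * of_real t))" by simp
        show ?thesis unfolding * powr_add z_def power2_eq_square ..
      qed
      have z0: "(of_nat n :: complex) powr (- (\<i> * of_real 0)) = 1" using False by simp
      have "?T n = of_real (real n powr (-1-x)) * (3 * l0 n + 4 * l1 n * z + l2 n * z\<^sup>2)"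
        unfolding a z2 z0 z_def[symmetric] by (simp add: algebra_simps)
      thus ?thesis using pos[OF z, of n] by simp
    qed auto
    hence "Re (P x) \<ge> 0" by (intro sums_le[OF _ sums_zero Re])
    thus ?case using elim by simp
  qed
  ultimately have "Re (3 * (1 - of_nat m0) + 4 * (0 - of_nat m1) + (0 - of_nat m2)) \<ge> 0"
    by (intro tendsto_lowerbound) auto
  hence "3 \<ge> 4 * real m1 + real m2" using m0' by simp
  thus False using m1(1) zero by simp
qed

text \<open>A pole of residue \<open>c\<close> at 1 is the only singularity on the closed half plane \<open>Re s \<ge> 1\<close>; the case
  \<open>c = 0\<close> means that there is none.\<close>
definition simple_pole_at_1 :: "(nat \<Rightarrow> complex) \<Rightarrow> complex \<Rightarrow> bool" where
  "simple_pole_at_1 f c \<longleftrightarrow> linear_growth f \<and> (\<exists>h. h analytic_on {s. Re s \<ge> 1} \<and>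
      (\<forall>s. Re s > 1 \<longrightarrow> dirichlet_series f s = c / (s - 1) + h s))"

text \<open>In the application \<open>r0\<close>, \<open>r1\<close>, \<open>r2\<close> belong to the trivial character, a character \<open>\<chi>\<close> and \<open>\<chi>\<^sup>2\<close>; either neither
  \<open>\<chi>\<close> nor \<open>\<chi>\<^sup>2\<close> is trivial, or \<open>\<chi>\<close> is.\<close>
theorem log_derivative_simple_pole:
  assumes p: "log_derivative_pair r0 l0 C0" "log_derivative_pair r1 l1 C1" "log_derivative_pair r2 l2 C2"
    and C0: "C0 \<noteq> 0"
    and C12: "C1 = 0 \<and> C2 = 0 \<or> r1 = r0 \<and> C1 = C0"
    and pos: "\<And>n z. norm z = 1 \<Longrightarrow> Re (3 * l0 n + 4 * l1 n * z + l2 n * z\<^sup>2) \<ge> 0"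
  shows "simple_pole_at_1 l1 (if C1 = 0 then 0 else 1)"
proof -
  obtain F0 e0 where F0: "F0 holomorphic_on {s. Re s > 1/2}" "\<exists>s\<in>{s. Re s > 1/2}. F0 s \<noteq> 0"
    "e0 = (if C0 = 0 then 0 else 1)" "C0 \<noteq> 0 \<Longrightarrow> F0 1 \<noteq> 0"
    "\<And>s. Re s > 1 \<Longrightarrow> F0 s \<noteq> 0" "\<And>s. Re s > 1 \<Longrightarrow> dirichlet_series l0 s = e0 / (s - 1) - deriv F0 s / F0 s"
    using log_derivative_pair_continuation[OF p(1)] by metis
  obtain F1 e1 where F1: "F1 holomorphic_on {s. Re s > 1/2}" "\<exists>s\<in>{s. Re s > 1/2}. F1 s \<noteq> 0"
    "e1 = (if C1 = 0 then 0 else 1)" "C1 \<noteq> 0 \<Longrightarrow> F1 1 \<noteq> 0"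
    "\<And>s. Re s > 1 \<Longrightarrow> F1 s \<noteq> 0" "\<And>s. Re s > 1 \<Longrightarrow> dirichlet_series l1 s = e1 / (s - 1) - deriv F1 s / F1 s"
    using log_derivative_pair_continuation[OF p(2)] by metis
  obtain F2 e2 where F2: "F2 holomorphic_on {s. Re s > 1/2}" "\<exists>s\<in>{s. Re s > 1/2}. F2 s \<noteq> 0"
    "e2 = (if C2 = 0 then 0 else 1)" "C2 \<noteq> 0 \<Longrightarrow> F2 1 \<noteq> 0"
    "\<And>s. Re s > 1 \<Longrightarrow> F2 s \<noteq> 0" "\<And>s. Re s > 1 \<Longrightarrow> dirichlet_series l2 s = e2 / (s - 1) - deriv F2 s / F2 s"
    using log_derivative_pair_continuation[OF p(3)] by metis
  have gr: "linear_growth l0" "linear_growth l1" "linear_growth l2"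
    using p by (auto simp: log_derivative_pair_def)
  have line: "F1 (Complex 1 t) \<noteq> 0" for t
  proof (cases "C1 \<noteq> 0 \<and> t = 0")
    case True
    moreover have "Complex 1 0 = 1" by (simp add: complex_eq_iff)
    ultimately show ?thesis using F1(4) by simp
  next
    case False
    have e0: "e0 = 1" using F0(3) C0 by simp
    show ?thesis
    proof (rule nonvanishing_341[OF gr F0(1,2) F0(4)[OF C0] _ F1(1,2,6) F2(1,2,6) _ _ pos])
      show "dirichlet_series l0 s = 1 / (s - 1) - deriv F0 s / F0 s" if "Re s > 1" for s
        using F0(6)[OF that] e0 by simp
      show "e1 = 0 \<or> t \<noteq> 0" "e2 = 0 \<or> t \<noteq> 0"
        using False C12 C0 F1(3) F2(3) by auto
    qed
  qed
  have nz: "F1 s \<noteq> 0" if "Re s \<ge> 1" for s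
  proof (cases "Re s = 1")
    case True
    hence "s = Complex 1 (Im s)" by (simp add: complex_eq_iff)
    thus ?thesis using line[of "Im s"] by simp
  qed (use that F1(5)[of s] in auto)
  have an: "F1 analytic_on {s. Re s \<ge> 1}" "deriv F1 analytic_on {s. Re s \<ge> 1}"
  proof -
    have sub: "{s. Re s \<ge> 1} \<subseteq> {s. Re s > 1/2}" by auto
    have "F1 analytic_on {s. Re s > 1/2}" "deriv F1 analytic_on {s. Re s > 1/2}"
      unfolding analytic_on_open[OF open_halfplane] by (intro F1(1) holomorphic_deriv open_halfplane)+
    thus "F1 analytic_on {s. Re s \<ge> 1}" "deriv F1 analytic_on {s. Re s \<ge> 1}"
      using analytic_on_subset[OF _ sub] by blast+
  qed
  have "(\<lambda>s. - (deriv F1 s / F1 s)) analytic_on {s. Re s \<ge> 1}"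
    using an nz by (intro analytic_intros) auto
  moreover have "dirichlet_series l1 s = (if C1 = 0 then 0 else 1) / (s - 1) + - (deriv F1 s / F1 s)"
    if "Re s > 1" for s
    using F1(6)[OF that] F1(3) by simp
  ultimately show ?thesis
    unfolding simple_pole_at_1_def using gr(2) by blast
qed

section \<open>Newman's Tauberian theorem\<close>

lemma powr_mvt:
  fixes a u :: real
  assumes "a > 0"
  obtains x where "a < x" "x < a + 1" "(a + 1) powr u - a powr u = u * x powr (u - 1)"
proof -
  have "\<exists>z>a. z < a + 1 \<and> (a + 1) powr u - a powr u = ((a + 1) - a) * (u * z powr (u - 1))"
    using assms by (intro MVT2[of a "a + 1" "\<lambda>x. x powr u" "\<lambda>x. u * x powr (u - 1)"])
      (auto intro!: derivative_eq_intros)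
  thus ?thesis using that by auto
qed

lemma sum_powr_tail:
  assumes "N > 0" "x > 0"
  shows "(\<Sum>n\<in>{N<..N+k}. real n powr (-1-x)) \<le> real N powr (-x) / x"
proof -
  have "(\<Sum>n\<in>{N<..N+k}. real n powr (-1-x)) \<le> (real N powr (-x) - real (N+k) powr (-x)) / x"
  proof (induction k)
    case (Suc k)
    have "{N<..N + Suc k} = insert (N + Suc k) {N<..N+k}" by auto
    hence sum: "(\<Sum>n\<in>{N<..N + Suc k}. real n powr (-1-x)) =
        real (N + Suc k) powr (-1-x) + (\<Sum>n\<in>{N<..N+k}. real n powr (-1-x))" by simp
    obtain y where y: "real (N+k) < y" "y < real (N+k) + 1"
      "(real (N+k) + 1) powr (-x) - real (N+k) powr (-x) = (-x) * y powr (-x - 1)"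
      using powr_mvt[of "real (N+k)" "-x"] assms by auto
    have e: "-1 - x = -x - 1" by simp
    have "real (N + Suc k) powr (-1-x) \<le> y powr (-x-1)"
      unfolding e using y(1,2) assms by (intro powr_mono2') auto
    moreover have "y powr (-x-1) = (real (N+k) powr (-x) - real (N + Suc k) powr (-x)) / x"
      using y(3) assms by (simp add: field_simps)
    ultimately have "real (N + Suc k) powr (-1-x) \<le> (real (N+k) powr (-x) - real (N + Suc k) powr (-x)) / x"
      by linarith
    with sum show ?case using Suc assms by (simp add: diff_divide_distrib)
  qed simp
  also have "\<dots> \<le> real N powr (-x) / x"
    using assms by (intro divide_right_mono) auto
  finally show ?thesis .
qed

lemma sum_powr_initial:
  assumes "N > 0" "y > 0"
  shows "(\<Sum>n=1..N. real n powr (y - 1)) \<le> real N powr y / y + real N powr (y - 1)"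
proof (cases "y \<le> 1")
  case True
  have "(\<Sum>n=1..N. real n powr (y - 1)) \<le> real N powr y / y"
  proof (induction N)
    case (Suc N)
    have "real (Suc N) powr (y - 1) \<le> (real (Suc N) powr y - real N powr y) / y"
    proof (cases "N = 0")
      case True
      thus ?thesis using \<open>y \<le> 1\<close> assms by simp
    next
      case False
      then obtain z where z: "real N < z" "z < real N + 1" "(real N + 1) powr y - real N powr y = y * z powr (y - 1)"
        using powr_mvt[of "real N" y] by auto
      have "real (Suc N) powr (y - 1) \<le> z powr (y - 1)"
        using z(1,2) \<open>y \<le> 1\<close> False by (intro powr_mono2') auto
      also have "\<dots> = (real (Suc N) powr y - real N powr y) / y"
        using z(3) assms by (simp add: field_simps)
      finally show ?thesis .
    qed
    thus ?case using Suc by (simp add: diff_divide_distrib)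
  qed (use assms in auto)
  thus ?thesis using powr_ge_zero[of "real N" "y - 1"] by linarith
next
  case False
  have "(\<Sum>n=1..N. real n powr (y - 1)) \<le> real N powr y / y + real N powr (y - 1)"
    using \<open>N > 0\<close>
  proof (induction N rule: nat_induct_non_zero)
    case (Suc N)
    obtain z where z: "real N < z" "z < real N + 1" "(real N + 1) powr y - real N powr y = y * z powr (y - 1)"
      using powr_mvt[of "real N" y] Suc by auto
    have "real N powr (y - 1) \<le> z powr (y - 1)"
      using z(1,2) False Suc by (intro powr_mono2) auto
    also have "\<dots> = (real (Suc N) powr y - real N powr y) / y"
      using z(3) assms by (simp add: field_simps)
    finally have "real N powr (y - 1) \<le> (real (Suc N) powr y - real N powr y) / y" .
    thus ?case using Suc by (simp add: diff_divide_distrib)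
  qed (use False in auto)
  thus ?thesis .
qed

text \<open>Both closed contours of the proof consist of the right half of the circle and of a path through
  the left half plane on which the integral of \<open>1/z\<close> is that over the left half circle. Comparing the
  function with its value at 0 replaces a computation of winding numbers.\<close>
lemma cauchy_right_semicircle:
  assumes W: "convex W" "open W" and hol: "h holomorphic_on W" and R: "R > 0"
    and p: "valid_path p" "pathstart p = \<i> * of_real R" "pathfinish p = - \<i> * of_real R" "path_image p \<subseteq> W" "0 \<notin> path_image p"
    and right: "path_image (part_circlepath 0 R (-(pi/2)) (pi/2)) \<subseteq> W"
    and inv: "((\<lambda>z. 1 / z) has_contour_integral (\<i> * of_real pi)) p"
    and i1: "((\<lambda>z. h z / z) has_contour_integral I1) (part_circlepath 0 R (-(pi/2)) (pi/2))"
    and i2: "((\<lambda>z. h z / z) has_contour_integral I2) p"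
  shows "I1 + I2 = 2 * of_real pi * \<i> * h 0"
proof -
  let ?c = "part_circlepath 0 R (-(pi/2)) (pi/2)"
  define q where "q = (\<lambda>z. if z = 0 then deriv h 0 else (h z - h 0) / (z - 0))"
  have q: "q holomorphic_on W" unfolding q_def using hol W(2) by (rule pole_lemma_open)
  have ends: "pathstart ?c = - \<i> * of_real R" "pathfinish ?c = \<i> * of_real R"
    unfolding pathstart_part_circlepath pathfinish_part_circlepath cis_conv_exp[symmetric]
    by (simp_all add: complex_eq_iff)
  have "(q has_contour_integral 0) (?c +++ p)"
    using q W p right ends by (intro Cauchy_theorem_convex_simple) (auto simp: path_image_join intro: valid_path_join)
  have "((\<lambda>z. 1 / z) has_contour_integral (\<i> * of_real pi)) ?c"
  proof -
    have "((\<lambda>t. \<i>) has_integral (\<i> * of_real pi)) {-(pi/2)..pi/2}"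
      using has_integral_const_real[of \<i> "-(pi/2)" "pi/2"] by (simp add: scaleR_conv_of_real mult.commute)
    moreover have "(\<lambda>t. 1 / (0 + of_real R * cis t) * of_real R * \<i> * cis t) = (\<lambda>t. \<i>)"
      using R by (simp add: fun_eq_iff field_simps)
    ultimately show ?thesis
      by (subst has_contour_integral_part_circlepath_iff) (simp, simp only:)
  qed
  hence c1: "((\<lambda>z. h z / z - h 0 * (1 / z)) has_contour_integral (I1 - h 0 * (\<i> * of_real pi))) ?c"
    by (intro has_contour_integral_diff i1 has_contour_integral_lmul)
  have c2: "((\<lambda>z. h z / z - h 0 * (1 / z)) has_contour_integral (I2 - h 0 * (\<i> * of_real pi))) p"
    by (intro has_contour_integral_diff i2 has_contour_integral_lmul inv)
  have n0: "0 \<notin> path_image ?c"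
    using path_image_part_circlepath_subset[of "-(pi/2)" "pi/2" R 0] R by auto
  have qe: "h z / z - h 0 * (1 / z) = q z" if "z \<noteq> 0" for z
    using that by (simp add: q_def diff_divide_distrib)
  have q1: "(q has_contour_integral (I1 - h 0 * (\<i> * of_real pi))) ?c"
    using c1 by (rule has_contour_integral_eq) (use qe n0 in metis)
  have q2: "(q has_contour_integral (I2 - h 0 * (\<i> * of_real pi))) p"
    using c2 by (rule has_contour_integral_eq) (use qe p in metis)
  have "(q has_contour_integral ((I1 - h 0 * (\<i> * of_real pi)) + (I2 - h 0 * (\<i> * of_real pi)))) (?c +++ p)"
    using p ends by (intro has_contour_integral_join q1 q2) auto
  with \<open>(q has_contour_integral 0) (?c +++ p)\<close>
  have "(I1 - h 0 * (\<i> * of_real pi)) + (I2 - h 0 * (\<i> * of_real pi)) = 0"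
    using has_contour_integral_unique by blast
  thus ?thesis by (simp add: algebra_simps)
qed

lemma contour_integral_inverse_left:
  assumes R: "R > 0" and p: "valid_path p" "pathstart p = \<i> * of_real R" "pathfinish p = - \<i> * of_real R"
    and neg: "\<And>z. z \<in> path_image p \<Longrightarrow> -z \<notin> \<real>\<^sub>\<le>\<^sub>0"
  shows "((\<lambda>z. 1 / z) has_contour_integral (\<i> * of_real pi)) p"
proof -
  have "((\<lambda>z. 1 / z) has_contour_integral (Ln (- pathfinish p) - Ln (- pathstart p))) p"
  proof (rule contour_integral_primitive[of "path_image p"])
    fix z assume z: "z \<in> path_image p"
    hence "z \<noteq> 0" using neg[of z] by auto
    thus "((\<lambda>z. Ln (- z)) has_field_derivative 1 / z) (at z within path_image p)"
      using neg[OF z] by (auto intro!: derivative_eq_intros simp: field_simps)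
  qed (use p in auto)
  moreover have "Ln (\<i> * of_real R) = Ln (of_real R) + \<i> * of_real pi / 2"
    using R Ln_times_of_real[of R \<i>] by (simp add: Ln_of_real mult.commute)
  moreover have "Ln (- (\<i> * of_real R)) = Ln (of_real R) - \<i> * of_real pi / 2"
    using R Ln_times_of_real[of R "-\<i>"] by (simp add: Ln_of_real mult.commute)
  ultimately show ?thesis using p by (simp add: mult.commute)
qed

text \<open>On the circle of radius \<open>R\<close> Newman's kernel is real and proportional to the distance from the
  imaginary axis, which cancels the factor \<open>1 / Re z\<close> in the bounds for the tail and for the partial sums.\<close>
lemma newman_weight:
  assumes "norm z = R" "R > 0"
  shows "(1 + z\<^sup>2 / of_real (R\<^sup>2)) / z = of_real (2 * Re z / R\<^sup>2)"
proof -
  have z0: "z \<noteq> 0" using assms by auto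
  have zz: "z * cnj z = of_real (R\<^sup>2)" using assms complex_norm_square[of z] by simp
  have "(1 + z\<^sup>2 / of_real (R\<^sup>2)) / z = (z * cnj z + z\<^sup>2) / (of_real (R\<^sup>2) * z)"
    using z0 assms(2) unfolding zz by (simp add: field_simps)
  also have "z * cnj z + z\<^sup>2 = z * (z + cnj z)" by (simp add: power2_eq_square algebra_simps)
  also have "\<dots> / (of_real (R\<^sup>2) * z) = (z + cnj z) / of_real (R\<^sup>2)" using z0 by simp
  also have "z + cnj z = of_real (2 * Re z)" by (rule complex_add_cnj)
  finally show ?thesis by simp
qed

text \<open>On a segment leaving the imaginary axis to the left \<open>N\<close> to the power \<open>Re z\<close> decays exponentially in
  the distance from the axis, at rate \<open>ln N\<close>; so the integral is \<open>O(1 / ln N)\<close>, with a constant that may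
  depend on the segment.\<close>
lemma segment_decay:
  assumes a: "Re a = 0" and b: "b = - of_real d" and d: "d > 0" and N: "N > 1"
    and cont: "continuous_on (closed_segment a b) f"
    and M: "M \<ge> 0" "\<And>z. z \<in> closed_segment a b \<Longrightarrow> norm (f z) \<le> M * real N powr Re z"
  shows "norm (contour_integral (linepath a b) f) \<le> M * norm (b - a) / (d * ln (real N))"
proof -
  define L where "L = d * ln (real N)"
  have L: "L > 0" using d N by (simp add: L_def)
  have "f contour_integrable_on linepath a b"
    using cont by (rule contour_integrable_continuous_linepath)
  hence int: "(\<lambda>t. f (linepath a b t) * (b - a)) integrable_on {0..1}"
    by (simp add: contour_integrable_on_def has_contour_integral_linepath integrable_on_def)
  have prim: "((\<lambda>t. M * norm (b - a) * exp (- L * t)) has_integral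
      (- M * norm (b - a) * exp (- L * 1) / L - (- M * norm (b - a) * exp (- L * 0) / L))) {0..1}"
    using L by (intro fundamental_theorem_of_calculus)
      (auto intro!: derivative_eq_intros simp: has_real_derivative_iff_has_vector_derivative[symmetric])
  have "norm (contour_integral (linepath a b) f) = norm (integral {0..1} (\<lambda>t. f (linepath a b t) * (b - a)))"
    by (simp add: contour_integral_integral)
  also have "\<dots> \<le> integral {0..1} (\<lambda>t. M * norm (b - a) * exp (- L * t))"
  proof (rule integral_norm_bound_integral[OF int])
    show "(\<lambda>t. M * norm (b - a) * exp (- L * t)) integrable_on {0..1}"
      using prim by (auto simp: integrable_on_def)
    fix t :: real assume t: "t \<in> {0..1}"
    have "linepath a b t \<in> closed_segment a b" using t by (auto simp: closed_segment_def linepath_def)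
    hence "norm (f (linepath a b t)) \<le> M * real N powr Re (linepath a b t)" by (rule M)
    also have "Re (linepath a b t) = - d * t" using a b by (simp add: linepath_def)
    also have "real N powr (- d * t) = exp (- L * t)" using N by (simp add: powr_def L_def)
    finally show "norm (f (linepath a b t) * (b - a)) \<le> M * norm (b - a) * exp (- L * t)"
      unfolding norm_mult by (metis mult.assoc mult.commute mult_right_mono norm_ge_zero)
  qed
  also have "\<dots> = M * norm (b - a) * (1 - exp (- L)) / L"
    using integral_unique[OF prim] by (simp add: diff_divide_distrib algebra_simps)
  also have "\<dots> \<le> M * norm (b - a) * 1 / L"
    using L M by (intro divide_right_mono mult_left_mono) auto
  finally show ?thesis by (simp add: L_def)
qed

lemma compact_halfdisc_neighbourhood:
  assumes "open T" "{z. Re z \<ge> 0} \<subseteq> T" "r > 0"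
  obtains d where "d > 0" "ball 0 r \<inter> {z. Re z > -d} \<subseteq> T"
proof -
  let ?K = "cball 0 r \<inter> {z. Re z \<ge> (0::real)}"
  have "0 \<in> ?K" using assms(3) by simp
  hence K: "?K \<noteq> {}" "compact ?K"
    by (blast, intro compact_Int_closed closed_halfspace_Re_ge compact_cball)
  obtain e where e: "e > 0" "{x. infdist x ?K \<le> e} \<subseteq> T"
    using compact_in_open_separated[OF K assms(1)] assms(2) by auto
  show ?thesis
  proof (rule that[OF e(1)])
    show "ball 0 r \<inter> {z. Re z > -e} \<subseteq> T"
    proof
      fix z assume z: "z \<in> ball 0 r \<inter> {z. Re z > -e}"
      show "z \<in> T"
      proof (cases "Re z \<ge> 0")
        case False
        define w where "w = Complex 0 (Im z)"
        have "norm w \<le> norm z" unfolding w_def by (simp add: norm_complex_def)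
        hence w: "w \<in> ?K" using z by (auto simp: w_def)
        have "dist z w \<le> e" using z False by (simp add: w_def dist_norm norm_complex_def)
        hence "infdist z ?K \<le> e" using infdist_le[OF w, of z] by linarith
        thus ?thesis using e by auto
      qed (use assms in auto)
    qed
  qed
qed

text \<open>Newman's contour argument. With \<open>g z = f (1 + z)\<close> and the partial sums \<open>S N z\<close>, the difference
  \<open>g 0 - S N 0\<close> is a Cauchy integral with kernel \<open>N\<^sup>z (1 + z\<^sup>2/R\<^sup>2) / z\<close>. The right half of the circle contributes
  \<open>g - S N\<close>, a tail of the series; on the left the entire function \<open>S N\<close> is integrated over the half
  circle, and \<open>g\<close> over two segments inside its domain, where the integral vanishes in the limit. Each
  half circle costs \<open>O(B / R)\<close>, and \<open>R\<close> is arbitrary.\<close>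
theorem newman_tauberian:
  fixes b :: "nat \<Rightarrow> complex"
  assumes bound: "\<And>n. norm (b n) \<le> B"
    and f: "f analytic_on {s. Re s \<ge> 1}" "\<And>s. Re s > 1 \<Longrightarrow> dirichlet_series b s = f s"
  shows "(\<lambda>N. \<Sum>n=1..N. b n / of_nat n) \<longlonglongrightarrow> f 1"
proof -
  have B0: "B \<ge> 0" using order_trans[OF norm_ge_zero bound[of 0]] .
  have gr: "linear_growth b"
    unfolding linear_growth_def
  proof (intro exI[of _ B] allI)
    fix N
    have "(\<Sum>n=1..N. norm (b n)) \<le> (\<Sum>n=1..N. B)" by (intro sum_mono bound)
    thus "(\<Sum>n=1..N. norm (b n)) \<le> B * real N" by (simp add: mult.commute)
  qed
  define S where "S N z = (\<Sum>n=1..N. b n * of_nat n powr (-(1+z)))" for N z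
  define g where "g z = f (1 + z)" for z
  have S0: "S N 0 = (\<Sum>n=1..N. b n / of_nat n)" for N
    unfolding S_def by (intro sum.cong) (auto simp: powr_minus field_simps)
  obtain T0 where T0: "open T0" "{s. Re s \<ge> 1} \<subseteq> T0" "f holomorphic_on T0"
    using f(1) by (auto simp: analytic_on_holomorphic)
  define T where "T = (\<lambda>z. 1 + z) -` T0"
  have "open T" unfolding T_def by (intro open_vimage T0 continuous_intros)
  have T: "{z. Re z \<ge> 0} \<subseteq> T" using T0(2) by (force simp: T_def)
  have holg: "g holomorphic_on T"
  proof -
    have "(f \<circ> (\<lambda>z. 1 + z)) holomorphic_on T"
      by (rule holomorphic_on_compose_gen[OF _ T0(3)]) (auto simp: T_def intro!: holomorphic_intros)
    thus ?thesis by (simp add: o_def g_def[abs_def])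
  qed
  have holS: "S N holomorphic_on A" for N A
  proof -
    have "(\<lambda>z. (of_nat n :: complex) powr (-(1+z))) holomorphic_on A" for n
    proof -
      have "((\<lambda>s. (of_nat n :: complex) powr (-s)) \<circ> (\<lambda>z. 1 + z)) holomorphic_on A"
        by (intro holomorphic_on_compose nat_powr_holomorphic holomorphic_intros)
      thus ?thesis by (simp only: o_def)
    qed
    thus ?thesis unfolding S_def by (intro holomorphic_intros)
  qed
  have tail: "norm (g z - S N z) \<le> B * real N powr (- Re z) / Re z" if z: "Re z > 0" and N: "N > 0" for z N
  proof -
    have "(\<lambda>m. \<Sum>n<m. b n * of_nat n powr (-(1+z))) \<longlonglongrightarrow> dirichlet_series b (1 + z)"
      using dirichlet_series_sums[OF gr, of "1 + z"] z by (simp add: sums_def)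
    moreover have "(\<Sum>n<Suc m. b n * of_nat n powr (-(1+z))) = S m z" for m
    proof -
      have "(\<Sum>n<Suc m. b n * of_nat n powr (-(1+z))) = (\<Sum>n\<in>insert 0 {1..m}. b n * of_nat n powr (-(1+z)))"
        by (intro sum.cong) auto
      thus ?thesis by (simp add: S_def)
    qed
    ultimately have "(\<lambda>m. S m z) \<longlonglongrightarrow> g z"
      using f(2)[of "1 + z"] z LIMSEQ_Suc by (fastforce simp: g_def)
    hence "(\<lambda>k. S (k + N) z - S N z) \<longlonglongrightarrow> g z - S N z"
      using tendsto_diff[OF LIMSEQ_ignore_initial_segment[of "\<lambda>m. S m z" _ N] tendsto_const] by blast
    moreover have "norm (S (k + N) z - S N z) \<le> B * real N powr (- Re z) / Re z" for k
    proof -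
      have "{1..k+N} = {1..N} \<union> {N<..N+k}" using N by auto
      hence "S (k + N) z = S N z + (\<Sum>n\<in>{N<..N+k}. b n * of_nat n powr (-(1+z)))"
        unfolding S_def by (simp add: sum.union_disjoint[symmetric] ivl_disj_int)
      hence "norm (S (k + N) z - S N z) \<le> (\<Sum>n\<in>{N<..N+k}. norm (b n * of_nat n powr (-(1+z))))"
        by (simp add: norm_sum)
      also have "\<dots> \<le> (\<Sum>n\<in>{N<..N+k}. B * real n powr (-1 - Re z))"
        unfolding norm_mult norm_nat_powr by (intro sum_mono mult_mono bound B0) auto
      also have "\<dots> = B * (\<Sum>n\<in>{N<..N+k}. real n powr (-1 - Re z))" by (simp add: sum_distrib_left)
      also have "\<dots> \<le> B * (real N powr (- Re z) / Re z)"
        using sum_powr_tail[OF N z] by (intro mult_left_mono B0)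
      finally show ?thesis by simp
    qed
    ultimately show ?thesis by (intro Lim_bounded[OF tendsto_norm, of _ _ 0]) auto
  qed
  have initial: "norm (S N z) \<le> B * real N powr (- Re z) * (1 / (- Re z) + 1 / real N)"
    if z: "Re z < 0" and N: "N > 0" for z N
  proof -
    have "norm (S N z) \<le> (\<Sum>n=1..N. norm (b n * of_nat n powr (-(1+z))))"
      unfolding S_def by (rule norm_sum)
    also have "\<dots> \<le> (\<Sum>n=1..N. B * real n powr (- Re z - 1))"
      unfolding norm_mult norm_nat_powr
    proof (intro sum_mono mult_mono bound B0)
      have e: "Re (- (1 + z)) = - Re z - 1" by simp
      show "real n powr Re (- (1 + z)) \<le> real n powr (- Re z - 1)" for n unfolding e ..
    qed auto
    also have "\<dots> = B * (\<Sum>n=1..N. real n powr (- Re z - 1))" by (simp add: sum_distrib_left)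
    also have "\<dots> \<le> B * (real N powr (- Re z) / (- Re z) + real N powr (- Re z - 1))"
      using sum_powr_initial[of N "- Re z"] N z by (intro mult_left_mono B0) auto
    also have "real N powr (- Re z - 1) = real N powr (- Re z) / real N"
      using N by (simp add: powr_diff)
    finally show ?thesis by (simp add: algebra_simps)
  qed
  have main: "\<exists>C. \<forall>N>1. norm (g 0 - S N 0) \<le> 2 * B / R + B / real N + C / ln (real N)" if R: "R > 0" for R
  proof -
    obtain d0 where d0: "d0 > 0" "ball 0 (2 * R) \<inter> {z. Re z > -d0} \<subseteq> T"
      using compact_halfdisc_neighbourhood[OF \<open>open T\<close> T, of "2 * R"] R by auto
    define W where "W = ball 0 (2 * R) \<inter> {z. Re z > -d0}"
    define d where "d = min R d0 / 2"
    have d: "d > 0" "d < d0" "d < R" using R d0(1) by (auto simp: d_def)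
    define rc where "rc = part_circlepath 0 R (-(pi/2)) (pi/2)"
    define lc where "lc = part_circlepath 0 R (pi/2) (3 * pi/2)"
    define p1 where "p1 = linepath (\<i> * of_real R) (- of_real d)"
    define p2 where "p2 = linepath (- of_real d) (- \<i> * of_real R)"
    define K where "K = path_image (p1 +++ p2)"
    \<comment> \<open>Newman's multiplier: it is 1 at 0, so inserting it leaves the Cauchy integrals unchanged.\<close>
    define M where "M N z = of_nat N powr z * (1 + z\<^sup>2 / of_real (R\<^sup>2))" for N and z :: complex
    have W: "convex W" "open W" unfolding W_def
      by (auto intro!: convex_Int convex_halfspace_Re_gt open_Int open_halfspace_Re_gt)
    have ends: "pathstart lc = \<i> * of_real R" "pathfinish lc = - \<i> * of_real R"
        unfolding lc_def pathstart_part_circlepath pathfinish_part_circlepath cis_conv_exp[symmetric]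
      using cos_3over2_pi sin_3over2_pi by (simp_all add: complex_eq_iff)
    have rcI: "norm z = R" "Re z \<ge> 0" "z \<notin> {\<i> * of_real R, - \<i> * of_real R} \<Longrightarrow> Re z > 0"
      if "z \<in> path_image rc" for z
    proof -
      from that obtain x where x: "z = of_real R * cis x" "-(pi/2) \<le> x" "x \<le> pi/2"
        by (auto simp: rc_def path_image_part_circlepath cis_conv_exp)
      show 1: "norm z = R" using x R by (simp add: norm_mult)
      show 2: "Re z \<ge> 0" using x R cos_ge_zero[of x] by simp
      assume "z \<notin> {\<i> * of_real R, - \<i> * of_real R}"
      moreover have "Re z = 0 \<Longrightarrow> Im z = R \<or> Im z = - R"
        using 1 R by (auto simp: norm_complex_def real_sqrt_unique abs_if split: if_splits)
      ultimately show "Re z > 0" using 2 by (cases "Re z = 0") (auto simp: complex_eq_iff)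
    qed
    have lcI: "norm z = R" "Re z \<le> 0" "z \<notin> {\<i> * of_real R, - \<i> * of_real R} \<Longrightarrow> Re z < 0"
      if "z \<in> path_image lc" for z
    proof -
      from that obtain x where x: "z = of_real R * cis x" "pi/2 \<le> x" "x \<le> 3*pi/2"
        by (auto simp: lc_def path_image_part_circlepath cis_conv_exp)
      show 1: "norm z = R" using x R by (simp add: norm_mult)
      have "cos (x - pi) \<ge> 0" using x by (intro cos_ge_zero) auto
      hence "cos x \<le> 0" by (simp add: cos_diff)
      thus 2: "Re z \<le> 0" using x R by (simp add: mult_nonneg_nonpos)
      assume "z \<notin> {\<i> * of_real R, - \<i> * of_real R}"
      moreover have "Re z = 0 \<Longrightarrow> Im z = R \<or> Im z = - R"
        using 1 R by (auto simp: norm_complex_def real_sqrt_unique abs_if split: if_splits)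
      ultimately show "Re z < 0" using 2 by (cases "Re z = 0") (auto simp: complex_eq_iff)
    qed
    have Kseg: "K = closed_segment (\<i> * of_real R) (- of_real d) \<union> closed_segment (- of_real d) (- \<i> * of_real R)"
      unfolding K_def p1_def p2_def by (simp add: path_image_join)
    have KW: "K \<subseteq> W"
      unfolding Kseg using W(1) R d d0 by (intro Un_least closed_segment_subset) (auto simp: W_def norm_mult)
    have Kpos: "-z \<notin> \<real>\<^sub>\<le>\<^sub>0" if z: "z \<in> K" for z
    proof
      assume "- z \<in> \<real>\<^sub>\<le>\<^sub>0"
      hence z': "Im z = 0" "Re z \<ge> 0" by (auto simp: complex_nonpos_Reals_iff)
      from z consider u where "0 \<le> u" "u \<le> 1" "z = (1 - u) *\<^sub>R (\<i> * of_real R) + u *\<^sub>R (- of_real d)"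
        | u where "0 \<le> u" "u \<le> 1" "z = (1 - u) *\<^sub>R (- of_real d) + u *\<^sub>R (- \<i> * of_real R)"
        unfolding Kseg closed_segment_def by auto
      thus False
      proof cases
        case 1
        thus False using z' R d by (auto simp: mult_le_0_iff)
      next
        case 2
        thus False using z' R d by (auto simp: mult_le_0_iff)
      qed
    qed
    have K0: "0 \<notin> K" using Kpos[of 0] by auto
    have validp: "valid_path (p1 +++ p2)" by (simp add: p1_def p2_def)
    have rcW: "path_image rc \<subseteq> W" using rcI R d0 by (force simp: W_def)
    have holM: "M N holomorphic_on A" if "N > 0" for N A
      unfolding M_def using that by (intro holomorphic_intros) auto
    have cK: "compact K" unfolding K_def by (intro compact_path_image valid_path_imp_path validp)
    have "continuous_on K (\<lambda>z. g z * (1 + z\<^sup>2 / of_real (R\<^sup>2)) / z)"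
      using KW d0(2) K0 R unfolding W_def[symmetric]
      by (intro continuous_intros holomorphic_on_imp_continuous_on[OF holomorphic_on_subset[OF holg]]) auto
    then obtain M0 where M0: "\<And>z. z \<in> K \<Longrightarrow> norm (g z * (1 + z\<^sup>2 / of_real (R\<^sup>2)) / z) \<le> M0"
      using compact_imp_bounded[OF compact_continuous_image[OF _ cK]] by (force simp: bounded_iff)
    define M1 where "M1 = max M0 0"
    define len where "len = norm (- of_real d - \<i> * of_real R) + norm (- of_real d - (- \<i> * of_real R))"
    define C where "C = M1 * len / d"
    have "norm (g 0 - S N 0) \<le> 2 * B / R + B / real N + C / ln (real N)" if N: "N > 1" for N
    proof -
      have N0: "N > 0" using N by simp
      let ?h = "\<lambda>z. g z * M N z" and ?s = "\<lambda>z. S N z * M N z"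
      have holh: "?h holomorphic_on W" using d0(2) N0 unfolding W_def[symmetric]
        by (intro holomorphic_intros holM holomorphic_on_subset[OF holg])
      have hols: "?s holomorphic_on A" for A using N0 by (intro holomorphic_intros holM holS)
      have rc0: "0 \<notin> path_image rc" and lc0: "0 \<notin> path_image lc" using rcI lcI R by fastforce+
      have hc: "continuous_on A (\<lambda>z. ?h z / z)" if "A \<subseteq> W" "0 \<notin> A" for A
        using that by (intro continuous_intros holomorphic_on_imp_continuous_on[OF holomorphic_on_subset[OF holh]]) auto
      have sc: "continuous_on A (\<lambda>z. ?s z / z)" if "0 \<notin> A" for A
        using that by (intro continuous_intros holomorphic_on_imp_continuous_on[OF hols]) auto
      define I1 where "I1 = contour_integral rc (\<lambda>z. ?h z / z)"
      define I2 where "I2 = contour_integral p1 (\<lambda>z. ?h z / z)"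
      define I3 where "I3 = contour_integral p2 (\<lambda>z. ?h z / z)"
      define J1 where "J1 = contour_integral rc (\<lambda>z. ?s z / z)"
      define J2 where "J2 = contour_integral lc (\<lambda>z. ?s z / z)"
      have i1: "((\<lambda>z. ?h z / z) has_contour_integral I1) rc"
        unfolding I1_def rc_def using rcW rc0 unfolding rc_def
        by (intro has_contour_integral_integral contour_integrable_continuous_part_circlepath hc)
      have i2: "((\<lambda>z. ?h z / z) has_contour_integral I2) p1"
        unfolding I2_def p1_def using KW K0 unfolding Kseg
        by (intro has_contour_integral_integral contour_integrable_continuous_linepath hc) auto
      have i3: "((\<lambda>z. ?h z / z) has_contour_integral I3) p2"
        unfolding I3_def p2_def using KW K0 unfolding Kseg
        by (intro has_contour_integral_integral contour_integrable_continuous_linepath hc) auto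
      have j1: "((\<lambda>z. ?s z / z) has_contour_integral J1) rc"
        unfolding J1_def rc_def using rc0 unfolding rc_def
        by (intro has_contour_integral_integral contour_integrable_continuous_part_circlepath sc)
      have j2: "((\<lambda>z. ?s z / z) has_contour_integral J2) lc"
        unfolding J2_def lc_def using lc0 unfolding lc_def
        by (intro has_contour_integral_integral contour_integrable_continuous_part_circlepath sc)
      have i23: "((\<lambda>z. ?h z / z) has_contour_integral (I2 + I3)) (p1 +++ p2)"
        by (intro has_contour_integral_join i2 i3) (auto simp: p1_def p2_def)
      have E1: "I1 + (I2 + I3) = 2 * of_real pi * \<i> * g 0"
      proof -
        have "I1 + (I2 + I3) = 2 * of_real pi * \<i> * ?h 0"
        proof (rule cauchy_right_semicircle[OF W holh R validp])
          show "((\<lambda>z. 1 / z) has_contour_integral (\<i> * of_real pi)) (p1 +++ p2)"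
            using Kpos R validp by (intro contour_integral_inverse_left[OF R]) (auto simp: K_def p1_def p2_def)
        qed (use i1 i23 KW K0 rcW in \<open>auto simp: K_def rc_def p1_def p2_def\<close>)
        thus ?thesis using N0 by (simp add: M_def)
      qed
      have E2: "J1 + J2 = 2 * of_real pi * \<i> * S N 0"
      proof -
        have "J1 + J2 = 2 * of_real pi * \<i> * ?s 0"
        proof (rule cauchy_right_semicircle[OF convex_UNIV open_UNIV hols R, of lc])
          show "((\<lambda>z. 1 / z) has_contour_integral (\<i> * of_real pi)) lc"
          proof (rule contour_integral_inverse_left[OF R])
            fix z assume z: "z \<in> path_image lc"
            show "- z \<notin> \<real>\<^sub>\<le>\<^sub>0"
            proof
              assume "- z \<in> \<real>\<^sub>\<le>\<^sub>0"
              hence "Im z = 0" "Re z \<ge> 0" by (auto simp: complex_nonpos_Reals_iff)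
              with lcI[OF z] R show False by (auto simp: norm_complex_def)
            qed
          qed (use ends in \<open>auto simp: lc_def\<close>)
        qed (use j1 j2 lc0 ends in \<open>auto simp: rc_def lc_def\<close>)
        thus ?thesis using N0 by (simp add: M_def)
      qed
      have MR: "M N z / z = of_nat N powr z * of_real (2 * Re z / R\<^sup>2)" if "norm z = R" for z
        unfolding newman_weight[OF that R, symmetric] by (simp add: M_def)
      have b1: "norm (I1 - J1) \<le> 2 * B / R\<^sup>2 * R * (pi/2 - (-(pi/2)))"
      proof (rule has_contour_integral_bound_part_circlepath_strong)
        show "((\<lambda>z. ?h z / z - ?s z / z) has_contour_integral (I1 - J1)) (part_circlepath 0 R (-(pi/2)) (pi/2))"
          using i1 j1 unfolding rc_def by (rule has_contour_integral_diff)
        show "finite {\<i> * of_real R, - \<i> * of_real R}" by simp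
        fix z assume z: "z \<in> path_image (part_circlepath 0 R (-(pi/2)) (pi/2)) - {\<i> * of_real R, - \<i> * of_real R}"
        have zR: "norm z = R" "Re z > 0" using rcI[of z] z by (auto simp: rc_def)
        have "?h z / z - ?s z / z = (g z - S N z) * (M N z / z)" by (simp add: diff_divide_distrib[symmetric] algebra_simps)
        also have "norm \<dots> = norm (g z - S N z) * (real N powr Re z * (2 * Re z / R\<^sup>2))"
          unfolding MR[OF zR(1)] norm_mult norm_nat_powr norm_of_real using zR by simp
        also have "\<dots> \<le> (B * real N powr (- Re z) / Re z) * (real N powr Re z * (2 * Re z / R\<^sup>2))"
          using zR by (intro mult_right_mono tail N0) auto
        also have "\<dots> = (real N powr (- Re z) * real N powr Re z) * (2 * B / R\<^sup>2)"
          using zR by simp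
        also have "real N powr (- Re z) * real N powr Re z = 1"
          using N0 by (simp add: powr_add[symmetric])
        finally show "norm (?h z / z - ?s z / z) \<le> 2 * B / R\<^sup>2" by simp
      qed (use B0 R in auto)
      have b2: "norm J2 \<le> (2 * B / R\<^sup>2 * (1 + R / real N)) * R * (3*pi/2 - pi/2)"
      proof (rule has_contour_integral_bound_part_circlepath_strong)
        show "((\<lambda>z. ?s z / z) has_contour_integral J2) (part_circlepath 0 R (pi/2) (3*pi/2))"
          using j2 unfolding lc_def .
        show "finite {\<i> * of_real R, - \<i> * of_real R}" by simp
        fix z assume z: "z \<in> path_image (part_circlepath 0 R (pi/2) (3*pi/2)) - {\<i> * of_real R, - \<i> * of_real R}"
        have zR: "norm z = R" "Re z < 0" using lcI[of z] z by (auto simp: lc_def)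
        have "?s z / z = S N z * (M N z / z)" by simp
        also have "norm \<dots> = norm (S N z) * (real N powr Re z * (2 * (- Re z) / R\<^sup>2))"
          unfolding MR[OF zR(1)] norm_mult norm_nat_powr norm_of_real using zR by simp
        also have "\<dots> \<le> (B * real N powr (- Re z) * (1 / (- Re z) + 1 / real N)) * (real N powr Re z * (2 * (- Re z) / R\<^sup>2))"
          using zR by (intro mult_right_mono initial N0) (auto intro!: divide_nonpos_nonneg mult_nonneg_nonpos)
        also have "\<dots> = (real N powr (- Re z) * real N powr Re z) * (2 * B / R\<^sup>2 * ((1 / (- Re z) + 1 / real N) * (- Re z)))"
          by simp
        also have "real N powr (- Re z) * real N powr Re z = 1"
          using N0 by (simp add: powr_add[symmetric])
        also have "(1 / (- Re z) + 1 / real N) * (- Re z) = 1 + (- Re z) / real N"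
          using zR by (simp add: algebra_simps)
        also have "1 * (2 * B / R\<^sup>2 * (1 + (- Re z) / real N)) \<le> 2 * B / R\<^sup>2 * (1 + R / real N)"
          using zR abs_Re_le_cmod[of z] B0 R by (simp only: mult_1_left) (intro mult_left_mono add_mono divide_right_mono, auto)
        finally show "norm (?s z / z) \<le> 2 * B / R\<^sup>2 * (1 + R / real N)" .
      qed (use B0 R in auto)
      have hb: "norm (?h z / z) \<le> M1 * real N powr Re z" if "z \<in> K" for z
      proof -
        have "?h z / z = of_nat N powr z * (g z * (1 + z\<^sup>2 / of_real (R\<^sup>2)) / z)" by (simp add: M_def)
        also have "norm \<dots> = real N powr Re z * norm (g z * (1 + z\<^sup>2 / of_real (R\<^sup>2)) / z)"
          unfolding norm_mult[of "of_nat N powr z"] norm_nat_powr ..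
        also have "\<dots> \<le> real N powr Re z * M1"
          using M0[OF that] by (intro mult_left_mono) (auto simp: M1_def)
        finally show ?thesis by (simp add: mult.commute)
      qed
      have b3: "norm I2 \<le> M1 * norm (- of_real d - \<i> * of_real R) / (d * ln (real N))"
        unfolding I2_def p1_def using KW K0 d N unfolding Kseg
        by (intro segment_decay hc hb) (auto simp: M1_def Kseg)
      have "norm (contour_integral (linepath (- \<i> * of_real R) (- of_real d)) (\<lambda>z. ?h z / z))
           \<le> M1 * norm (- of_real d - (- \<i> * of_real R)) / (d * ln (real N))"
        using KW K0 d N unfolding Kseg closed_segment_commute[of "- of_real d"]
        by (intro segment_decay hc hb) (auto simp: M1_def Kseg closed_segment_commute)
      moreover have "I3 = - contour_integral (linepath (- \<i> * of_real R) (- of_real d)) (\<lambda>z. ?h z / z)"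
        unfolding I3_def p2_def using contour_integral_reversepath[of "linepath (- \<i> * of_real R) (- of_real d)"]
        by simp
      ultimately have b4: "norm I3 \<le> M1 * norm (- of_real d - (- \<i> * of_real R)) / (d * ln (real N))" by simp
      have "2 * of_real pi * \<i> * (g 0 - S N 0) = (I1 - J1) - J2 + I2 + I3"
        using E1 E2 by (simp add: algebra_simps)
      hence "norm (2 * of_real pi * \<i> * (g 0 - S N 0)) \<le> norm (I1 - J1) + norm J2 + norm I2 + norm I3"
        by (metis (no_types, lifting) norm_triangle_ineq norm_triangle_ineq4 add_mono_thms_linordered_semiring(3) order_trans)
      also have "norm (2 * of_real pi * \<i> * (g 0 - S N 0)) = 2 * pi * norm (g 0 - S N 0)"
        by (simp add: norm_mult)
      also have "norm I2 + norm I3 \<le> C / ln (real N)" (is "?l \<le> ?r")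
        using add_mono[OF b3 b4] N d by (simp add: C_def len_def field_simps)
      hence "norm (I1 - J1) + norm J2 + norm I2 + norm I3 \<le>
          (2 * B / R\<^sup>2 * R * pi) + (2 * B / R\<^sup>2 * (1 + R / real N)) * R * pi + C / ln (real N)"
        using b1 b2 by simp
      also have "\<dots> = 2 * pi * (2 * B / R + B / real N) + C / ln (real N)"
        using R N by (simp add: field_simps power2_eq_square)
      also have "C / ln (real N) \<le> 2 * pi * (C / ln (real N))"
      proof -
        have "C / ln (real N) \<ge> 0" using N d by (simp add: C_def len_def M1_def)
        thus ?thesis using pi_gt3 mult_right_mono[of 1 "2 * pi" "C / ln (real N)"] by simp
      qed
      finally have "2 * pi * norm (g 0 - S N 0) \<le> 2 * pi * (2 * B / R + B / real N + C / ln (real N))"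
        by (simp add: algebra_simps)
      thus ?thesis using pi_gt_zero by simp
    qed
    thus ?thesis by blast
  qed
  have "(\<lambda>N. S N 0) \<longlonglongrightarrow> g 0"
    unfolding LIMSEQ_iff
  proof (intro allI impI)
    fix e :: real assume e: "e > 0"
    \<comment> \<open>With this radius the two half circles contribute less than \<open>e / 2\<close>.\<close>
    define R where "R = 4 * B / e + 1"
    have R: "R > 0" using B0 e by (simp add: R_def add_nonneg_pos)
    obtain C where C: "\<And>N. N > 1 \<Longrightarrow> norm (g 0 - S N 0) \<le> 2 * B / R + B / real N + C / ln (real N)"
      using main[OF R] by blast
    have "2 * B / R < e / 2 + 0"
      using R B0 e by (simp add: R_def field_simps add_nonneg_pos)
    hence RB: "2 * B / R < e / 2" by simp
    have "(\<lambda>N. 2 * B / R + B / real N + C / ln (real N)) \<longlonglongrightarrow> 2 * B / R" by real_asymp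
    hence "eventually (\<lambda>N. 2 * B / R + B / real N + C / ln (real N) < e) sequentially"
      by (rule order_tendstoD) (use RB e in linarith)
    hence "eventually (\<lambda>N. norm (S N 0 - g 0) < e) sequentially"
      using eventually_gt_at_top[of 1]
    proof eventually_elim
      case (elim N)
      thus ?case using C[of N] norm_minus_commute[of "S N 0" "g 0"] by simp
    qed
    thus "\<exists>no. \<forall>n\<ge>no. norm (S n 0 - g 0) < e" by (simp add: eventually_at_top_linorder)
  qed
  thus ?thesis by (simp add: S0 g_def)
qed

text \<open>If \<open>A N\<close> exceeded \<open>(c + r) N\<close>, then by monotonicity \<open>A k - c k\<close> would stay large for all \<open>k\<close> from \<open>N\<close> to
  \<open>(1 + \<eta>) N\<close>, and these terms alone would contradict Cauchy's criterion; if \<open>A N\<close> is too small, the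
  interval from \<open>(1 - \<eta>) N\<close> to \<open>N\<close> serves.\<close>
lemma mean_value_of_convergent_sum:
  fixes A :: "nat \<Rightarrow> real" and c :: real
  assumes mono: "\<And>m n. m \<le> n \<Longrightarrow> A m \<le> A n"
    and conv: "convergent (\<lambda>N. \<Sum>n=1..N. (A n - c * real n) / real n ^ 2)"
  shows "(\<lambda>N. A N / real N) \<longlonglongrightarrow> c"
proof (rule LIMSEQ_I)
  fix r :: real assume r: "r > 0"
  define P where "P N = (\<Sum>n=1..N. (A n - c * real n) / real n ^ 2)" for N
  \<comment> \<open>Small enough that \<open>c k\<close> changes by at most \<open>r N / 2\<close> over an interval of length \<open>\<eta> N\<close>.\<close>
  define \<eta> where "\<eta> = min (1/2) (r / (2 * (\<bar>c\<bar> + 1)))"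
  have eta: "\<eta> > 0" "\<eta> \<le> 1/2" "\<bar>c\<bar> * \<eta> \<le> r / 2"
  proof -
    show "\<eta> \<le> 1/2" unfolding \<eta>_def by (rule min.cobounded1)
    show "\<eta> > 0" using r by (simp add: \<eta>_def add_nonneg_pos)
    have "\<bar>c\<bar> * \<eta> \<le> (\<bar>c\<bar> + 1) * (r / (2 * (\<bar>c\<bar> + 1)))"
      using r by (intro mult_mono) (auto simp: \<eta>_def)
    also have "\<dots> = r / 2" by (simp add: field_simps)
    finally show "\<bar>c\<bar> * \<eta> \<le> r / 2" .
  qed
  have "Cauchy P" using conv unfolding P_def by (rule convergent_Cauchy)
  moreover have "r * \<eta> / 16 > 0" using r eta by simp
  ultimately obtain N0 where N0: "\<And>m n. m \<ge> N0 \<Longrightarrow> n \<ge> N0 \<Longrightarrow> norm (P m - P n) < r * \<eta> / 16"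
    unfolding Cauchy_iff by meson
  have Pdiff: "P n - P m = (\<Sum>k\<in>{m<..n}. (A k - c * real k) / real k ^ 2)" if "m \<le> n" for m n
  proof -
    have "{1..n} = {1..m} \<union> {m<..n}" using that by auto
    moreover have "(\<Sum>k\<in>{1..m} \<union> {m<..n}. (A k - c * real k) / real k ^ 2) = P m + (\<Sum>k\<in>{m<..n}. (A k - c * real k) / real k ^ 2)"
      unfolding P_def by (intro sum.union_disjoint) auto
    ultimately show ?thesis by (simp add: P_def)
  qed
  define N1 where "N1 = 2 * N0 + nat \<lceil>2 / \<eta>\<rceil> + 1"
  have big: "N \<ge> 2 * N0" "N > 0" "real N \<ge> 2 / \<eta>" if "N \<ge> N1" for N
  proof -
    show "N \<ge> 2 * N0" "N > 0" using that by (auto simp: N1_def)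
    have "2 / \<eta> \<le> real (nat \<lceil>2 / \<eta>\<rceil>)" by linarith
    also have "\<dots> \<le> real N" using that[unfolded N1_def] by (intro of_nat_mono) linarith
    finally show "real N \<ge> 2 / \<eta>" .
  qed
  have upper: "A N < (c + r) * real N" if N: "N \<ge> N1" for N
  proof (rule ccontr)
    assume "\<not> ?thesis"
    hence AN: "A N \<ge> (c + r) * real N" by simp
    define M where "M = nat \<lfloor>(1 + \<eta>) * real N\<rfloor>"
    have "(1 + \<eta>) * real N \<ge> 0" using eta by simp
    hence M: "real M \<le> (1 + \<eta>) * real N" "real M > (1 + \<eta>) * real N - 1"
      unfolding M_def by linarith+
    have eN: "\<eta> * real N \<ge> 2" using big(3)[OF N] eta by (simp add: field_simps)
    have MN: "M \<ge> N" using M eN by (simp add: algebra_simps)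
    have "r / (8 * real N) \<le> (A k - c * real k) / real k ^ 2" if k: "k \<in> {N<..M}" for k
    proof -
      have "real k \<le> real M" using k by simp
      hence k1: "real k - real N \<le> \<eta> * real N" "real k \<ge> real N" using M k by (simp_all add: algebra_simps)
      have "c * (real k - real N) \<le> \<bar>c\<bar> * (\<eta> * real N)"
        using k1 by (intro mult_mono) auto
      also have "\<dots> = (\<bar>c\<bar> * \<eta>) * real N" by simp
      also have "\<dots> \<le> r / 2 * real N" using eta by (intro mult_right_mono) auto
      finally have "c * real k \<le> c * real N + r / 2 * real N" by (simp add: algebra_simps)
      moreover have "A k \<ge> (c + r) * real N" using AN mono[of N k] k by simp
      ultimately have num: "A k - c * real k \<ge> r / 2 * real N" by (simp add: algebra_simps)
      have "\<eta> * real N \<le> 1/2 * real N" using eta by (intro mult_right_mono) auto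
      hence "real k \<le> 2 * real N" using k1 by simp
      hence "real k ^ 2 \<le> (2 * real N) ^ 2" by (intro power_mono) auto
      hence "(r / 2 * real N) / (2 * real N) ^ 2 \<le> (A k - c * real k) / real k ^ 2"
        using num k r order_trans[OF _ num, of 0] by (intro frac_le) auto
      moreover have "(r / 2 * real N) / (2 * real N) ^ 2 = r / (8 * real N)"
        using big(2)[OF N] by (simp add: power2_eq_square field_simps)
      ultimately show ?thesis by simp
    qed
    hence "(\<Sum>k\<in>{N<..M}. r / (8 * real N)) \<le> P M - P N"
      unfolding Pdiff[OF MN] by (intro sum_mono)
    moreover have "(\<Sum>k\<in>{N<..M}. r / (8 * real N)) = (real M - real N) * (r / (8 * real N))"
      using MN by (simp add: of_nat_diff)
    moreover have "(\<eta> * real N / 2) * (r / (8 * real N)) \<le> (real M - real N) * (r / (8 * real N))"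
      using M eN r by (intro mult_right_mono) (auto simp: algebra_simps)
    moreover have "(\<eta> * real N / 2) * (r / (8 * real N)) = r * \<eta> / 16" using big(2)[OF N] by simp
    moreover have "norm (P M - P N) < r * \<eta> / 16" using MN big(1)[OF N] by (intro N0) auto
    ultimately show False unfolding real_norm_def by linarith
  qed
  have lower: "A N > (c - r) * real N" if N: "N \<ge> N1" for N
  proof (rule ccontr)
    assume "\<not> ?thesis"
    hence AN: "A N \<le> (c - r) * real N" by simp
    define M where "M = nat \<lceil>(1 - \<eta>) * real N\<rceil>"
    have pos: "(1 - \<eta>) * real N \<ge> 1/2 * real N" using eta by (intro mult_right_mono) auto
    hence M: "real M \<ge> (1 - \<eta>) * real N" "real M < (1 - \<eta>) * real N + 1"
      unfolding M_def by linarith+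
    have eN: "\<eta> * real N \<ge> 2" using big(3)[OF N] eta by (simp add: field_simps)
    have MN: "M \<le> N" using M eN by (simp add: algebra_simps)
    have "real M \<ge> real N0" using M pos big(1)[OF N] by linarith
    hence M0: "M \<ge> N0" by simp
    have "(A k - c * real k) / real k ^ 2 \<le> - (r / (8 * real N))" if k: "k \<in> {M<..N}" for k
    proof -
      have k0: "k > 0" using k by simp
      have "real k \<ge> real M" using k by simp
      hence k1: "real N - real k \<le> \<eta> * real N" "real k \<le> real N" using M k by (simp_all add: algebra_simps)
      have "c * (real N - real k) \<le> \<bar>c\<bar> * (\<eta> * real N)"
        using k1 by (intro mult_mono) auto
      also have "\<dots> = (\<bar>c\<bar> * \<eta>) * real N" by simp
      also have "\<dots> \<le> r / 2 * real N" using eta by (intro mult_right_mono) auto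
      finally have "c * real k \<ge> c * real N - r / 2 * real N" by (simp add: algebra_simps)
      moreover have "A k \<le> (c - r) * real N" using AN mono[of k N] k by simp
      ultimately have num: "- (A k - c * real k) \<ge> r / 2 * real N" by (simp add: algebra_simps)
      have "real k ^ 2 \<le> (2 * real N) ^ 2" using k1 by (intro power_mono) auto
      hence "(r / 2 * real N) / (2 * real N) ^ 2 \<le> (- (A k - c * real k)) / real k ^ 2"
        using num k0 r order_trans[OF _ num, of 0] by (intro frac_le) auto
      moreover have "(r / 2 * real N) / (2 * real N) ^ 2 = r / (8 * real N)"
        using big(2)[OF N] by (simp add: power2_eq_square field_simps)
      ultimately show ?thesis by (simp add: diff_divide_distrib)
    qed
    hence "P N - P M \<le> (\<Sum>k\<in>{M<..N}. - (r / (8 * real N)))"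
      unfolding Pdiff[OF MN] by (intro sum_mono)
    moreover have "(\<Sum>k\<in>{M<..N}. - (r / (8 * real N))) = - ((real N - real M) * (r / (8 * real N)))"
      using MN by (simp add: of_nat_diff)
    moreover have "(\<eta> * real N / 2) * (r / (8 * real N)) \<le> (real N - real M) * (r / (8 * real N))"
      using M eN r by (intro mult_right_mono) (auto simp: algebra_simps)
    moreover have "(\<eta> * real N / 2) * (r / (8 * real N)) = r * \<eta> / 16" using big(2)[OF N] by simp
    moreover have "norm (P N - P M) < r * \<eta> / 16" using M0 big(1)[OF N] by (intro N0) auto
    ultimately show False unfolding real_norm_def by linarith
  qed
  show "\<exists>no. \<forall>n\<ge>no. norm (A n / real n - c) < r"
  proof (intro exI[of _ N1] allI impI)
    fix n assume n: "n \<ge> N1"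
    have n0: "real n > 0" using big(2)[OF n] by simp
    have "A n / real n < c + r" using upper[OF n] n0 by (simp add: pos_divide_less_eq)
    moreover have "A n / real n > c - r" using lower[OF n] n0 by (simp add: pos_less_divide_eq)
    ultimately show "norm (A n / real n - c) < r" unfolding real_norm_def by linarith
  qed
qed

text \<open>The remainder of the first order expansion of a step gains one more power of \<open>n\<close>, so that weights
  of size \<open>O(n)\<close> leave a series which converges for \<open>Re s > 0\<close>.\<close>
lemma norm_powr_step_linear:
  assumes "Re s > 0" "n > 0"
  shows "norm (powr_step n s - s * of_nat n powr (-s-1)) \<le> norm s * norm (s + 1) * real n powr (- Re s - 2)"
proof -
  define N where "N = real n"
  have N: "N > 0" using assms by (simp add: N_def)
  define P where "P = (of_real N :: complex) powr (-s-1)"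
  have close: "norm (P - (of_real x :: complex) powr (-s-1)) \<le> norm (s + 1) * N powr (- Re s - 2)"
    if x: "x \<in> {N..N+1}" for x
  proof -
    define k where "k = x - N"
    define u where "u t = (of_real (N + k * (t - N)) :: complex) powr (-(s+1))" for t
    have k: "0 \<le> k" "k \<le> 1" using x by (auto simp: k_def)
    have "norm (u (N+1) - u N) \<le> norm (s + 1) * N powr (- Re s - 2)"
    proof (rule unit_step_bound)
      fix t assume t: "t \<in> {N..N+1}"
      have m: "0 \<le> k * (t - N)" "k * (t - N) \<le> 1 * 1"
        using k t by (simp, intro mult_mono) auto
      hence y: "N + k * (t - N) \<in> {N..N+1}" by simp
      have "((\<lambda>w. w powr (-(s+1))) has_field_derivative (-(s+1) * of_real (N + k * (t - N)) powr (-(s+1)-1))) (at (of_real (N + k * (t - N))))"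
        using y N by (intro has_field_derivative_powr) (auto simp: complex_nonpos_Reals_iff)
      moreover have "((\<lambda>t. of_real (N + k * (t - N)) :: complex) has_vector_derivative of_real k) (at t within {N..N+1})"
        by (auto intro!: derivative_eq_intros simp: has_vector_derivative_def scaleR_conv_of_real)
      ultimately show "(u has_vector_derivative (of_real k * (-(s+1) * of_real (N + k * (t - N)) powr (-(s+1)-1)))) (at t within {N..N+1})"
        using field_vector_diff_chain_within[OF _ has_field_derivative_at_within]
        unfolding u_def[abs_def] o_def by blast
      have e: "-(s+1)-1 = -(s+2)" by simp
      have "norm (of_real k * (-(s+1) * of_real (N + k * (t - N)) powr (-(s+1)-1)) :: complex)
         = k * (norm (s + 1) * norm ((of_real (N + k * (t - N)) :: complex) powr (-(s+2))))"
        unfolding e norm_mult norm_minus_cancel norm_of_real using k by simp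
      also have "\<dots> \<le> 1 * (norm (s + 1) * N powr (- Re (s + 2)))"
        unfolding N_def using y assms k unfolding N_def
        by (intro mult_mono norm_powr_le_left_end mult_nonneg_nonneg) auto
      also have "- Re (s + 2) = - Re s - 2" by simp
      finally show "norm (of_real k * (-(s+1) * of_real (N + k * (t - N)) powr (-(s+1)-1)) :: complex)
         \<le> norm (s + 1) * N powr (- Re s - 2)" by simp
    qed
    moreover have "u (N+1) = of_real x powr (-s-1)" "u N = P"
      unfolding u_def P_def by (simp_all add: k_def)
    ultimately show ?thesis by (simp add: norm_minus_commute)
  qed
  define h where "h t = - ((of_real t :: complex) powr (-s)) - of_real t * (s * P)" for t
  have "norm (h (N + 1) - h N) \<le> norm s * norm (s + 1) * N powr (- Re s - 2)"
  proof (rule unit_step_bound)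
    fix t assume t: "t \<in> {N..N+1}"
    have "((\<lambda>t. of_real t * (s * P)) has_vector_derivative (s * P)) (at t within {N..N+1})"
      by (auto simp: has_vector_derivative_def scaleR_conv_of_real intro!: derivative_eq_intros)
    thus "(h has_vector_derivative (- (-s * of_real t powr (-s-1)) - s * P)) (at t within {N..N+1})"
      unfolding h_def using t N
      by (intro has_vector_derivative_diff has_vector_derivative_minus powr_nat_deriv) auto
    have "- (-s * of_real t powr (-s-1)) - s * P = s * (of_real t powr (-s-1) - P)"
      by (simp add: algebra_simps)
    also have "norm \<dots> = norm s * norm (P - of_real t powr (-s-1))"
      by (simp only: norm_mult norm_minus_commute)
    also have "\<dots> \<le> norm s * (norm (s + 1) * N powr (- Re s - 2))"
      by (intro mult_left_mono close t) auto
    finally show "norm (- (-s * of_real t powr (-s-1)) - s * P) \<le> norm s * norm (s + 1) * N powr (- Re s - 2)"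
      by (simp add: mult.assoc)
  qed
  also have "h (N + 1) - h N = powr_step n s - s * of_nat n powr (-s-1)"
    by (simp add: h_def N_def P_def powr_step_def algebra_simps)
  finally show ?thesis by (simp add: N_def)
qed

text \<open>Newman's theorem applies to the bounded sequence \<open>b n = A n / n - c\<close>, where \<open>A\<close> is the summatory
  function of \<open>a\<close>: by partial summation its Dirichlet series is that of \<open>a\<close> divided by \<open>s\<close>, minus \<open>c \<zeta>(s)\<close>,
  up to functions holomorphic near \<open>Re s \<ge> 1\<close>, and the two poles cancel.\<close>
theorem mean_value_of_simple_pole:
  fixes a :: "nat \<Rightarrow> real" and c :: real
  assumes nonneg: "\<And>n. a n \<ge> 0" and pole: "simple_pole_at_1 (\<lambda>n. of_real (a n)) (of_real c)"
  shows "(\<lambda>N. (\<Sum>n=1..N. a n) / real N) \<longlonglongrightarrow> c"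
proof -
  define A where "A N = (\<Sum>n=1..N. a n)" for N
  define \<Phi> where "\<Phi> = dirichlet_series (\<lambda>n. of_real (a n))"
  obtain h where gr: "linear_growth (\<lambda>n. of_real (a n))" and h: "h analytic_on {s. Re s \<ge> 1}"
    "\<And>s. Re s > 1 \<Longrightarrow> \<Phi> s = of_real c / (s - 1) + h s"
    using pole unfolding simple_pole_at_1_def \<Phi>_def by blast
  obtain K where K0: "\<And>N. (\<Sum>n=1..N. norm (of_real (a n) :: complex)) \<le> K * real N"
    using gr by (auto simp: linear_growth_def)
  have A0: "A N \<ge> 0" for N unfolding A_def by (intro sum_nonneg nonneg)
  have K: "A N \<le> K * real N" for N using K0[of N] nonneg by (simp add: A_def)
  have Kpos: "K \<ge> 0" using order_trans[OF A0 K, of 1] by simp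
  \<comment> \<open>For \<open>n = 0\<close> the value is \<open>-c\<close>, as division by 0 gives 0; it does not enter the series.\<close>
  define b where "b n = (of_real (A n / real n - c) :: complex)" for n
  have bb: "norm (b n) \<le> K + \<bar>c\<bar>" for n
  proof -
    have "\<bar>A n / real n\<bar> \<le> K" using K[of n] A0[of n] Kpos by (cases "n = 0") (auto simp: field_simps)
    thus ?thesis unfolding b_def norm_of_real by linarith
  qed
  \<comment> \<open>The error made by replacing the step by its derivative sums to a holomorphic function \<open>Ds\<close>.\<close>
  define d where "d n s = of_real (A n) * (powr_step n s - s * of_nat n powr (-s-1))" for n s
  have dbound: "norm (d n s) \<le> K * (1 + norm s)\<^sup>2 * real n powr (-(Re s + 1 - 0))" if s: "Re s > 0" for n s
  proof (cases "n = 0")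
    case False
    hence n: "n > 0" by simp
    have "norm (d n s) = A n * norm (powr_step n s - s * of_nat n powr (-s-1))"
      using A0[of n] by (simp add: d_def norm_mult)
    also have "\<dots> \<le> (K * real n) * (norm s * norm (s + 1) * real n powr (- Re s - 2))"
      using K[of n] A0[of n] Kpos by (intro mult_mono norm_powr_step_linear s n) auto
    also have "\<dots> = K * (norm s * norm (s + 1)) * (real n powr 1 * real n powr (- Re s - 2))" by simp
    also have "real n powr 1 * real n powr (- Re s - 2) = real n powr (-(Re s + 1 - 0))"
      unfolding powr_add[symmetric] by (rule arg_cong[where f = "(powr) (real n)"]) simp
    also have "K * (norm s * norm (s + 1)) * \<dots> \<le> K * (1 + norm s)\<^sup>2 * \<dots>"
      unfolding power2_eq_square using norm_triangle_ineq[of s 1] Kpos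
      by (intro mult_right_mono mult_left_mono mult_mono) auto
    finally show ?thesis .
  qed (simp add: d_def A_def)
  have "d n holomorphic_on {s. Re s > 0}" for n
  proof -
    have "((\<lambda>s. (of_nat n :: complex) powr (-s)) \<circ> (\<lambda>s. s + 1)) holomorphic_on {s. Re s > 0}"
      by (intro holomorphic_on_compose nat_powr_holomorphic holomorphic_intros)
    hence "(\<lambda>s. (of_nat n :: complex) powr (-s-1)) holomorphic_on {s. Re s > 0}"
      by (simp add: o_def algebra_simps)
    thus ?thesis unfolding d_def using powr_step_holomorphic by (intro holomorphic_intros)
  qed
  note D = holomorphic_powr_series[of d 0 K, OF this dbound]
  define Ds where "Ds s = (\<Sum>n. d n s)" for s
  obtain Z where Z: "Z holomorphic_on {s. Re s > 0}"
    "\<And>s. Re s > 1 \<Longrightarrow> dirichlet_series (\<lambda>_. 1) s = 1 / (s - 1) + Z s"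
    using zeta_simple_pole by blast
  define f where "f s = (h s - Ds s) / s - of_real c / s - of_real c * Z s" for s
  have an: "f analytic_on {s. Re s \<ge> 1}"
  proof -
    have sub: "{s. Re s \<ge> 1} \<subseteq> {s. Re s > 0}" by auto
    have "Ds analytic_on {s. Re s > 0}" "Z analytic_on {s. Re s > 0}"
      unfolding analytic_on_open[OF open_halfplane] Ds_def[abs_def] using D(1) Z(1) by auto
    hence "Ds analytic_on {s. Re s \<ge> 1}" "Z analytic_on {s. Re s \<ge> 1}"
      using analytic_on_subset[OF _ sub] by blast+
    thus ?thesis unfolding f_def using h(1) by (intro analytic_intros) auto
  qed
  have bf: "dirichlet_series b s = f s" if s: "Re s > 1" for s
  proof -
    have s0: "s \<noteq> 0" "s - 1 \<noteq> 0" using s by auto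
    have "(\<lambda>n. of_real (A n) * powr_step n s) sums \<Phi> s"
      using abel_summation[OF gr s] by (simp add: A_def \<Phi>_def)
    moreover have "d n s = of_real (A n) * powr_step n s - s * (of_real (A n) * of_nat n powr (-s-1))" for n
      by (simp add: d_def algebra_simps)
    moreover have "(\<lambda>n. d n s) sums Ds s"
      unfolding Ds_def using D(2)[of s] s by (intro summable_sums) auto
    ultimately have "(\<lambda>n. of_real (A n) * powr_step n s - (of_real (A n) * powr_step n s - s * (of_real (A n) * of_nat n powr (-s-1)))) sums (\<Phi> s - Ds s)"
      by (intro sums_diff) simp_all
    hence "(\<lambda>n. s * (of_real (A n) * of_nat n powr (-s-1))) sums (\<Phi> s - Ds s)" by simp
    from sums_divide[OF this, of s]
    have 1: "(\<lambda>n. of_real (A n) * of_nat n powr (-s-1)) sums ((\<Phi> s - Ds s) / s)" using s0 by simp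
    have 2: "(\<lambda>n. of_real c * (1 * of_nat n powr (-s))) sums (of_real c * dirichlet_series (\<lambda>_. 1) s)"
      by (intro sums_mult dirichlet_series_sums linear_growth_one s)
    have "(\<lambda>n. of_real (A n) * of_nat n powr (-s-1) - of_real c * (1 * of_nat n powr (-s))) sums
       ((\<Phi> s - Ds s) / s - of_real c * dirichlet_series (\<lambda>_. 1) s)"
      by (intro sums_diff 1 2)
    also have "(\<lambda>n. of_real (A n) * of_nat n powr (-s-1) - of_real c * (1 * of_nat n powr (-s))) = (\<lambda>n. b n * of_nat n powr (-s))"
    proof
      fix n
      show "of_real (A n) * of_nat n powr (-s-1) - of_real c * (1 * of_nat n powr (-s)) = b n * of_nat n powr (-s)"
        by (cases "n = 0") (simp_all add: b_def powr_diff field_simps)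
    qed
    finally have "dirichlet_series b s = (\<Phi> s - Ds s) / s - of_real c * dirichlet_series (\<lambda>_. 1) s"
      by (simp add: dirichlet_series_def sums_iff)
    also have "\<dots> = f s"
    proof -
      define q where "q = of_real c / (s - 1)"
      have q: "q * (s - 1) = of_real c" using s0 by (simp add: q_def)
      have "q / s = (q * s - q * (s - 1)) / s" by (simp add: algebra_simps)
      also have "\<dots> = q - of_real c / s" unfolding q using s0 by (simp add: diff_divide_distrib)
      finally have e: "of_real c / (s - 1) / s = of_real c * (1 / (s - 1)) - of_real c / s"
        by (simp add: q_def)
      show ?thesis unfolding f_def h(2)[OF s] Z(2)[OF s] diff_divide_distrib add_divide_distrib e
        by (simp add: algebra_simps)
    qed
    finally show ?thesis .
  qed
  have "(\<lambda>N. \<Sum>n=1..N. b n / of_nat n) \<longlonglongrightarrow> f 1"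
    by (rule newman_tauberian[OF bb an bf])
  hence "(\<lambda>N. Re (\<Sum>n=1..N. b n / of_nat n)) \<longlonglongrightarrow> Re (f 1)" by (rule tendsto_Re)
  also have "(\<lambda>N. Re (\<Sum>n=1..N. b n / of_nat n)) = (\<lambda>N. \<Sum>n=1..N. (A n - c * real n) / real n ^ 2)"
  proof
    fix N
    have "Re (\<Sum>n=1..N. b n / of_nat n) = (\<Sum>n=1..N. Re (b n / of_nat n))" by simp
    also have "\<dots> = (\<Sum>n=1..N. (A n - c * real n) / real n ^ 2)"
    proof (intro sum.cong refl)
      fix n assume n: "n \<in> {1..N}"
      have "b n / of_nat n = of_real ((A n / real n - c) / real n)" by (simp add: b_def)
      also have "Re \<dots> = (A n / real n - c) / real n" by (rule Re_complex_of_real)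
      also have "\<dots> = (A n - c * real n) / real n ^ 2"
        using n by (simp add: field_simps power2_eq_square)
      finally show "Re (b n / of_nat n) = (A n - c * real n) / real n ^ 2" .
    qed
    finally show "Re (\<Sum>n=1..N. b n / of_nat n) = (\<Sum>n=1..N. (A n - c * real n) / real n ^ 2)" .
  qed
  finally have "convergent (\<lambda>N. \<Sum>n=1..N. (A n - c * real n) / real n ^ 2)"
    by (auto simp: convergent_def)
  moreover have "A m \<le> A n" if "m \<le> n" for m n
    unfolding A_def using that nonneg by (intro sum_mono2) auto
  ultimately show ?thesis
    unfolding A_def[symmetric] by (intro mean_value_of_convergent_sum)
qed

section \<open>The Eisenstein integers\<close>

datatype eis = Eis (ea: int) (eb: int)

text \<open>\<open>Eis a b\<close> stands for \<open>a + b \<omega>\<close>, where \<open>\<omega>\<close> is a primitive cube root of unity.\<close>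
instantiation eis :: comm_ring_1
begin
definition "0 = Eis 0 0"
definition "1 = Eis 1 0"
definition "x + y = Eis (ea x + ea y) (eb x + eb y)"
definition "x - y = Eis (ea x - ea y) (eb x - eb y)"
definition "- x = Eis (- ea x) (- eb x)"
definition "x * y = Eis (ea x * ea y - eb x * eb y) (ea x * eb y + eb x * ea y - eb x * eb y)"
instance
  by standard (auto simp: zero_eis_def one_eis_def plus_eis_def minus_eis_def uminus_eis_def
      times_eis_def algebra_simps)
end

lemmas eis_defs = zero_eis_def one_eis_def plus_eis_def minus_eis_def uminus_eis_def times_eis_def

lemma eis_sel [simp]:
  "ea 0 = 0" "eb 0 = 0" "ea 1 = 1" "eb 1 = 0"
  "ea (x + y) = ea x + ea y" "eb (x + y) = eb x + eb y"
  "ea (x - y) = ea x - ea y" "eb (x - y) = eb x - eb y"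
  "ea (- x) = - ea x" "eb (- x) = - eb x"
  "ea (x * y) = ea x * ea y - eb x * eb y"
  "eb (x * y) = ea x * eb y + eb x * ea y - eb x * eb y"
  by (simp_all add: eis_defs)

lemma eis_eq_iff: "x = y \<longleftrightarrow> ea x = ea y \<and> eb x = eb y"
  by (cases x; cases y) auto

lemma eis_of_int [simp]: "ea (of_int n) = n" "eb (of_int n) = 0"
proof -
  have nat: "ea (of_nat k) = int k \<and> eb (of_nat k) = 0" for k
    by (induction k) auto
  show "ea (of_int n) = n" "eb (of_int n) = 0"
    using nat by (cases n rule: int_cases2; simp)+
qed

lemma eis_of_nat [simp]: "ea (of_nat n) = int n" "eb (of_nat n) = 0"
  using eis_of_int[of "int n"] by simp_all

lemma eis_numeral [simp]: "ea (numeral n) = numeral n" "eb (numeral n) = 0"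
  using eis_of_int[of "numeral n"] by simp_all

definition eis_norm :: "eis \<Rightarrow> int" where
  "eis_norm x = ea x ^ 2 - ea x * eb x + eb x ^ 2"

definition eis_cnj :: "eis \<Rightarrow> eis" where
  "eis_cnj x = Eis (ea x - eb x) (- eb x)"

lemma eis_cnj_sel [simp]: "ea (eis_cnj x) = ea x - eb x" "eb (eis_cnj x) = - eb x"
  by (simp_all add: eis_cnj_def)

lemma eis_norm_mult: "eis_norm (x * y) = eis_norm x * eis_norm y"
  by (simp add: eis_norm_def power2_eq_square algebra_simps)

lemma eis_mult_cnj: "x * eis_cnj x = of_int (eis_norm x)"
  by (simp add: eis_eq_iff eis_norm_def power2_eq_square algebra_simps)

lemma eis_cnj_mult: "eis_cnj (x * y) = eis_cnj x * eis_cnj y"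
  by (simp add: eis_eq_iff algebra_simps)

lemma eis_cnj_cnj [simp]: "eis_cnj (eis_cnj x) = x"
  by (simp add: eis_eq_iff)

lemma eis_norm_cnj [simp]: "eis_norm (eis_cnj x) = eis_norm x"
  by (simp add: eis_norm_def power2_eq_square algebra_simps)

lemma four_eis_norm:
  "4 * eis_norm x = (2 * ea x - eb x)\<^sup>2 + 3 * (eb x)\<^sup>2"
  "4 * eis_norm x = (2 * eb x - ea x)\<^sup>2 + 3 * (ea x)\<^sup>2"
  by (simp_all add: eis_norm_def power2_eq_square algebra_simps)

lemma eis_norm_nonneg: "eis_norm x \<ge> 0"
  using four_eis_norm(1)[of x] zero_le_power2[of "2 * ea x - eb x"] zero_le_power2[of "eb x"] by linarith

lemma eis_norm_eq_0_iff [simp]: "eis_norm x = 0 \<longleftrightarrow> x = 0"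
proof
  assume "eis_norm x = 0"
  hence "(2 * ea x - eb x)\<^sup>2 + 3 * (eb x)\<^sup>2 = 0" using four_eis_norm(1)[of x] by simp
  moreover have "(2 * ea x - eb x)\<^sup>2 \<ge> 0" "(eb x)\<^sup>2 \<ge> 0" by simp_all
  ultimately have "(2 * ea x - eb x)\<^sup>2 = 0 \<and> (eb x)\<^sup>2 = 0" by linarith
  thus "x = 0" by (simp add: eis_eq_iff)
qed (simp add: eis_norm_def)

lemma eis_norm_pos: "x \<noteq> 0 \<Longrightarrow> eis_norm x > 0"
  using eis_norm_nonneg[of x] eis_norm_eq_0_iff[of x] by linarith

instance eis :: idom
proof
  fix x y :: eis assume "x \<noteq> 0" "y \<noteq> 0"
  hence "eis_norm (x * y) \<noteq> 0" by (simp add: eis_norm_mult)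
  thus "x * y \<noteq> 0" by (metis eis_norm_eq_0_iff)
qed

lemma eis_norm_1 [simp]: "eis_norm 1 = 1"
  and eis_norm_of_int [simp]: "eis_norm (of_int n) = n\<^sup>2"
  by (simp_all add: eis_norm_def)

lemma eis_norm_power: "eis_norm (x ^ n) = eis_norm x ^ n"
  by (induction n) (simp_all add: eis_norm_mult)

lemma eis_dvd_1_iff: "x dvd 1 \<longleftrightarrow> eis_norm x = 1"
proof
  assume "x dvd 1"
  then obtain y where "1 = x * y" by (auto elim: dvdE)
  hence "eis_norm x * eis_norm y = 1" using eis_norm_mult[of x y] by simp
  thus "eis_norm x = 1" using eis_norm_nonneg[of x] by (auto simp: zmult_eq_1_iff)
next
  assume "eis_norm x = 1"
  hence "1 = x * eis_cnj x" by (simp add: eis_mult_cnj)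
  thus "x dvd 1" by (rule dvdI)
qed

text \<open>Euclidean division: the nearest lattice point is at distance less than 1.\<close>
lemma eis_division:
  assumes "y \<noteq> 0"
  shows "\<exists>q. eis_norm (x - q * y) < eis_norm y"
proof -
  define n where "n = eis_norm y"
  have n: "n > 0" using assms eis_norm_pos by (simp add: n_def)
  define z where "z = x * eis_cnj y"
  define r where "r a = a - n * ((2 * a + n) div (2 * n))" for a
  have r: "2 * \<bar>r a\<bar> \<le> n" for a
  proof -
    define t where "t = (2 * a + n) div (2 * n)"
    define m where "m = (2 * a + n) mod (2 * n)"
    have "2 * a + n = 2 * n * t + m" by (simp add: t_def m_def)
    moreover have "0 \<le> m" "m < 2 * n" using n by (simp_all add: m_def)
    moreover define z where "z = a - n * t"
    ultimately have "2 * z = m - n" by (simp add: algebra_simps)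
    with \<open>0 \<le> m\<close> \<open>m < 2 * n\<close> have "2 * \<bar>z\<bar> \<le> n" by linarith
    thus ?thesis by (simp add: r_def z_def t_def)
  qed
  define q where "q = Eis ((2 * ea z + n) div (2 * n)) ((2 * eb z + n) div (2 * n))"
  define w where "w = x - q * y"
  have "w * eis_cnj y = z - q * of_int n"
    by (simp add: w_def z_def n_def eis_mult_cnj[symmetric] algebra_simps)
  hence w: "w * eis_cnj y = Eis (r (ea z)) (r (eb z))"
    by (simp add: eis_eq_iff q_def r_def mult.commute)
  have "4 * (eis_norm w * n) = 4 * eis_norm (Eis (r (ea z)) (r (eb z)))"
    unfolding w[symmetric] eis_norm_mult n_def by simp
  also have "\<dots> = 4 * (r (ea z))\<^sup>2 - 4 * (r (ea z) * r (eb z)) + 4 * (r (eb z))\<^sup>2"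
    by (simp add: eis_norm_def)
  also have "\<dots> \<le> 3 * n\<^sup>2"
  proof -
    have sq: "4 * (r a)\<^sup>2 \<le> n\<^sup>2" for a
      using power_mono[OF r[of a], of 2] by (simp add: power_mult_distrib)
    have "\<bar>2 * r (ea z)\<bar> * \<bar>2 * r (eb z)\<bar> \<le> n * n"
      using r[of "ea z"] r[of "eb z"] n by (intro mult_mono) auto
    hence "- (4 * (r (ea z) * r (eb z))) \<le> n\<^sup>2"
      by (simp add: abs_mult[symmetric] power2_eq_square)
    thus ?thesis using sq[of "ea z"] sq[of "eb z"] by linarith
  qed
  also have "\<dots> < 4 * (n * n)" using n by (simp add: power2_eq_square)
  finally have "eis_norm w < n" using n by simp
  thus ?thesis by (auto simp: w_def n_def)
qed

text \<open>Bezout: a nonzero element of least norm in the ideal of \<open>x\<close> and \<open>y\<close> generates it.\<close>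
lemma eis_bezout:
  fixes x y :: eis
  assumes "x \<noteq> 0"
  obtains g u v where "g = u * x + v * y" "g dvd x" "g dvd y"
proof -
  define P where "P n \<longleftrightarrow> (\<exists>u v. u * x + v * y \<noteq> 0 \<and> nat (eis_norm (u * x + v * y)) = n)" for n
  have "P (nat (eis_norm (1 * x + 0 * y)))" 
    unfolding P_def using assms by (intro exI[of _ 1] exI[of _ 0]) simp
  hence "P (LEAST n. P n)" by (rule LeastI)
  then obtain u v where uv: "u * x + v * y \<noteq> 0" "nat (eis_norm (u * x + v * y)) = (LEAST n. P n)"
    unfolding P_def by blast
  define g where "g = u * x + v * y"
  have div: "g dvd s * x + t * y" for s t
  proof -
    obtain q where q: "eis_norm (s * x + t * y - q * g) < eis_norm g"
      using eis_division[of g] uv by (auto simp: g_def)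
    have e: "s * x + t * y - q * g = (s - q * u) * x + (t - q * v) * y" by (simp add: g_def algebra_simps)
    have "s * x + t * y - q * g = 0"
    proof (rule ccontr)
      assume "\<not> ?thesis"
      hence "P (nat (eis_norm (s * x + t * y - q * g)))" unfolding P_def e by blast
      hence "nat (eis_norm g) \<le> nat (eis_norm (s * x + t * y - q * g))"
        using uv(2) by (simp add: Least_le g_def)
      thus False using q eis_norm_nonneg[of "s * x + t * y - q * g"] by linarith
    qed
    thus ?thesis by (metis dvd_triv_right eq_iff_diff_eq_0)
  qed
  show ?thesis using that[of g u v] div[of 1 0] div[of 0 1] by (simp add: g_def)
qed

lemma eis_irreducible_imp_prime:
  assumes "irreducible (p :: eis)"
  shows "prime_elem p"
proof (rule prime_elemI)
  show "p \<noteq> 0" "\<not> p dvd 1" using assms by (auto simp: irreducible_def)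
  fix a b assume ab: "p dvd a * b"
  show "p dvd a \<or> p dvd b"
  proof (rule disjCI)
    assume nb: "\<not> p dvd b"
    obtain g u v where g: "g = u * p + v * b" "g dvd p" "g dvd b"
      using eis_bezout[OF \<open>p \<noteq> 0\<close>] by blast
    from g(2) obtain k where k: "p = g * k" by (auto elim: dvdE)
    have "g dvd 1"
    proof (rule ccontr)
      assume "\<not> g dvd 1"
      hence "k dvd 1" using assms k unfolding irreducible_def by blast
      then obtain l where "1 = k * l" by (auto elim: dvdE)
      hence "g = p * l" unfolding k by (simp add: mult.assoc)
      hence "p dvd g" by simp
      thus False using g(3) nb dvd_trans by blast
    qed
    then obtain l where l: "1 = g * l" by (auto elim: dvdE)
    have "a = a * (g * l)" using l by simp
    also have "\<dots> = p * (a * u * l) + (a * b) * (v * l)" by (simp add: g(1) algebra_simps)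
    finally have e: "a = p * (a * u * l) + (a * b) * (v * l)" .
    have "p dvd p * (a * u * l) + (a * b) * (v * l)"
      by (intro dvd_add dvd_triv_left dvd_mult2[OF ab])
    thus "p dvd a" by (simp only: e[symmetric])
  qed
qed

section \<open>Primary elements and their von Mangoldt function\<close>

definition primary :: "eis set" where
  "primary = {x. [ea x = 1] (mod 3) \<and> [eb x = 0] (mod 3)}"

lemma primaryE:
  assumes "x \<in> primary"
  obtains u v where "x = Eis (1 + 3 * u) (3 * v)"
proof -
  from assms have "3 dvd ea x - 1" "3 dvd eb x"
    by (auto simp: primary_def cong_iff_dvd_diff)
  then obtain u v where "ea x - 1 = 3 * u" "eb x = 3 * v" by (auto elim!: dvdE)
  thus ?thesis using that[of u v] by (simp add: eis_eq_iff)
qed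

lemma primaryI: "Eis (1 + 3 * u) (3 * v) \<in> primary"
  by (simp add: primary_def cong_iff_dvd_diff)

lemma primary_1: "1 \<in> primary"
  by (simp add: primary_def)

lemma primary_mult_params:
  "Eis (1 + 3 * u) (3 * v) * Eis (1 + 3 * u') (3 * v') =
     Eis (1 + 3 * (u + u' + 3 * (u * u' - v * v'))) (3 * (v + v' + 3 * (u * v' + v * u' - v * v')))"
  by (simp add: eis_eq_iff algebra_simps)

lemma primary_mult:
  assumes "x \<in> primary" "y \<in> primary"
  shows "x * y \<in> primary"
proof -
  from assms obtain u v u' v' where "x = Eis (1 + 3 * u) (3 * v)" "y = Eis (1 + 3 * u') (3 * v')"
    by (metis primaryE)
  thus ?thesis by (simp only: primary_mult_params primaryI)
qed

lemma primary_power: "x \<in> primary \<Longrightarrow> x ^ n \<in> primary"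
  by (induction n) (auto intro: primary_mult primary_1)

text \<open>The classes prime to 3 form a group modulo 3, in which the primary elements are the unit class.\<close>
lemma primary_cofactor:
  assumes "x \<in> primary" "x * y \<in> primary"
  shows "y \<in> primary"
proof -
  obtain u v where x: "x = Eis (1 + 3 * u) (3 * v)" using assms by (auto elim: primaryE)
  obtain s t where xy: "x * y = Eis (1 + 3 * s) (3 * t)" using assms by (auto elim: primaryE)
  from xy have "ea y = 1 + 3 * (s - u * ea y + v * eb y)" "eb y = 3 * (t - u * eb y - v * ea y + v * eb y)"
    unfolding x eis_eq_iff by (simp_all add: algebra_simps)
  hence "ea y - 1 = 3 * (s - u * ea y + v * eb y)" "eb y - 0 = 3 * (t - u * eb y - v * ea y + v * eb y)"
    by linarith+
  thus ?thesis unfolding primary_def cong_iff_dvd_diff by (blast intro: dvdI)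
qed

lemma primary_cnj: "x \<in> primary \<Longrightarrow> eis_cnj x \<in> primary"
  using primaryI[of "u - v" "-v" for u v] by (auto elim!: primaryE simp: eis_cnj_def algebra_simps)

lemma primary_not_0: "x \<in> primary \<Longrightarrow> x \<noteq> 0"
  by (auto simp: primary_def cong_iff_dvd_diff)

text \<open>The six units are represented by their coordinates; every element prime to 3 has exactly one
  primary associate.\<close>
lemma eis_unit_cases:
  assumes "x dvd 1"
  shows "x \<in> {Eis 1 0, Eis (-1) 0, Eis 0 1, Eis 0 (-1), Eis 1 1, Eis (-1) (-1)}"
proof -
  obtain a b where x: "x = Eis a b" by (cases x)
  have n: "eis_norm x = 1" using assms by (simp add: eis_dvd_1_iff)
  have "0 \<le> (2 * a - b)\<^sup>2" "0 \<le> (2 * b - a)\<^sup>2" by simp_all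
  hence "3 * b\<^sup>2 \<le> 4" "3 * a\<^sup>2 \<le> 4"
    using four_eis_norm[of x] n unfolding x eis.sel by linarith+
  hence "a\<^sup>2 < 2\<^sup>2" "b\<^sup>2 < 2\<^sup>2" by simp_all
  hence "\<bar>a\<bar> < 2" "\<bar>b\<bar> < 2"
    using power2_less_imp_less[of "\<bar>a\<bar>" 2] power2_less_imp_less[of "\<bar>b\<bar>" 2] by simp_all
  hence "a \<in> {-1,0,1}" "b \<in> {-1,0,1}" by auto
  thus ?thesis using n unfolding x eis_norm_def by auto
qed

lemma primary_unit:
  assumes "x \<in> primary" "x dvd 1"
  shows "x = 1"
  using eis_unit_cases[OF assms(2)] assms(1)
  by (auto simp: primary_def cong_iff_dvd_diff eis_defs)

lemma primary_associate:
  assumes "x \<in> primary" "x dvd y" "y \<in> primary" "y dvd x"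
  shows "x = y"
proof -
  obtain k where k: "y = x * k" using assms(2) by (auto elim: dvdE)
  obtain l where l: "x = y * l" using assms(4) by (auto elim: dvdE)
  have "x * 1 = x * (k * l)" using k l by (simp add: mult.assoc[symmetric])
  hence "1 = k * l" using primary_not_0[OF assms(1)] by simp
  hence "k dvd 1" by (rule dvdI)
  moreover have "k \<in> primary" using assms(1,3) k by (auto intro: primary_cofactor)
  ultimately show ?thesis using primary_unit k by simp
qed

lemma exists_primary_associate:
  assumes "\<not> 3 dvd eis_norm x"
  obtains u where "u dvd 1" "u * x \<in> primary"
proof -
  obtain a b where x: "x = Eis a b" by (cases x)
  define r where "r = a mod 3"
  define s where "s = b mod 3"
  have ab: "a = 3 * (a div 3) + r" "b = 3 * (b div 3) + s" "r \<in> {0,1,2}" "s \<in> {0,1,2}"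
    unfolding r_def s_def by auto
  then obtain k l where kl: "a = 3 * k + r" "b = 3 * l + s" by metis
  have "\<not> 3 dvd (a\<^sup>2 - a * b + b\<^sup>2)" using assms by (simp add: x eis_norm_def)
  moreover have "a\<^sup>2 - a * b + b\<^sup>2 = 3 * (3 * k * k + 2 * k * r - 3 * k * l - k * s - r * l + 3 * l * l + 2 * l * s) + (r\<^sup>2 - r * s + s\<^sup>2)"
    unfolding kl by (simp add: power2_eq_square algebra_simps)
  ultimately have "\<not> 3 dvd (r\<^sup>2 - r * s + s\<^sup>2)" by (metis dvd_add dvd_triv_left)
  hence "(r,s) \<in> {(1,0),(2,0),(0,1),(0,2),(1,1),(2,2)}" using ab(3,4) by auto
  moreover have "\<exists>u \<in> {Eis 1 0, Eis (-1) 0, Eis 0 1, Eis 0 (-1), Eis 1 1, Eis (-1) (-1)}. u * x \<in> primary"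
    if "(r,s) \<in> {(1,0),(2,0),(0,1),(0,2),(1,1),(2,2)}"
    using that unfolding x kl primary_def cong_iff_dvd_diff
    by (auto simp: times_eis_def)
  moreover have "u dvd 1" if "u \<in> {Eis 1 0, Eis (-1) 0, Eis 0 1, Eis 0 (-1), Eis 1 1, Eis (-1) (-1)}" for u
    using that by (auto simp: eis_dvd_1_iff eis_norm_def)
  ultimately show ?thesis using that by blast
qed

lemma primary_norm_mod_3:
  assumes "x \<in> primary"
  shows "\<not> 3 dvd eis_norm x"
proof -
  obtain u v where x: "x = Eis (1 + 3 * u) (3 * v)" using assms by (auto elim: primaryE)
  have "eis_norm x = 1 + 3 * (2 * u + 3 * u * u - v - 3 * u * v + 3 * v * v)"
    unfolding x eis_norm_def by (simp add: power2_eq_square algebra_simps)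
  thus ?thesis by presburger
qed

definition primary_primes :: "eis set" where
  "primary_primes = {p \<in> primary. prime_elem p}"

lemma eis_norm_dvd: "x dvd y \<Longrightarrow> eis_norm x dvd eis_norm y"
  by (auto elim!: dvdE simp: eis_norm_mult)

lemma exists_primary_prime_divisor:
  assumes "x \<in> primary" "x \<noteq> 1"
  obtains p where "p \<in> primary_primes" "p dvd x"
proof -
  define P where "P n \<longleftrightarrow> (\<exists>y. y dvd x \<and> \<not> y dvd 1 \<and> nat (eis_norm y) = n)" for n
  have x0: "x \<noteq> 0" using assms primary_not_0 by blast
  have "P (nat (eis_norm x))"
    unfolding P_def using assms primary_unit[OF assms(1)] by (intro exI[of _ x]) auto
  hence "P (LEAST n. P n)" by (rule LeastI)
  then obtain y where y: "y dvd x" "\<not> y dvd 1" "nat (eis_norm y) = (LEAST n. P n)"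
    unfolding P_def by blast
  have y0: "y \<noteq> 0" using y(1) x0 by auto
  have "irreducible y"
    unfolding irreducible_def
  proof (intro conjI allI impI y0 y(2))
    fix a b assume ab: "y = a * b"
    show "a dvd 1 \<or> b dvd 1"
    proof (rule disjCI)
      assume b: "\<not> b dvd 1"
      have "b dvd x" using y(1) ab by (metis dvd_mult_right)
      hence "P (nat (eis_norm b))" unfolding P_def using b by (intro exI[of _ b]) auto
      hence le: "nat (eis_norm y) \<le> nat (eis_norm b)" using y(3) by (simp add: Least_le)
      have "a \<noteq> 0" "b \<noteq> 0" using ab y0 by auto
      hence pos: "eis_norm a > 0" "eis_norm b > 0" by (simp_all add: eis_norm_pos)
      have "eis_norm a * eis_norm b \<le> 1 * eis_norm b"
        using le pos unfolding ab eis_norm_mult by (simp add: nat_le_eq_zle)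
      hence "eis_norm a \<le> 1"
        using mult_le_cancel_right[of "eis_norm a" "eis_norm b" 1] pos by simp
      thus "a dvd 1" using pos by (simp add: eis_dvd_1_iff)
    qed
  qed
  hence prime: "prime_elem y" by (rule eis_irreducible_imp_prime)
  have "\<not> 3 dvd eis_norm y"
    using primary_norm_mod_3[OF assms(1)] dvd_trans[OF _ eis_norm_dvd[OF y(1)]] by auto
  then obtain u where u: "u dvd 1" "u * y \<in> primary" using exists_primary_associate by blast
  have uy: "u * y dvd y" using mult_dvd_mono[OF u(1) dvd_refl[of y]] by simp
  have dvd_iff: "u * y dvd z \<longleftrightarrow> y dvd z" for z
    using dvd_trans[OF uy] dvd_trans[OF dvd_triv_right[of y u]] by auto
  have "u \<noteq> 0" using u(1) by auto
  hence "prime_elem (u * y)"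
    using prime unfolding prime_elem_def dvd_iff by auto
  moreover have "u * y dvd x" using dvd_trans[OF uy y(1)] .
  ultimately show ?thesis using that[of "u * y"] u(2) by (simp add: primary_primes_def)
qed

text \<open>An associate of a primary prime is primary only if it is the prime itself.\<close>
lemma primary_prime_unique:
  assumes "p \<in> primary_primes" "q \<in> primary_primes" "p dvd q ^ k"
  shows "p = q"
proof -
  have "p dvd q" using assms prime_elem_dvd_power[of p q k] by (simp add: primary_primes_def)
  then obtain r where r: "q = p * r" by (auto elim: dvdE)
  have "q dvd p \<or> q dvd r"
    using assms(2) r by (intro prime_elem_dvd_multD) (auto simp: primary_primes_def)
  moreover have "\<not> q dvd r"
  proof
    assume "q dvd r"
    then obtain s where "r = q * s" by (auto elim: dvdE)
    hence "q * 1 = q * (p * s)" using r by (simp add: algebra_simps)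
    moreover have "q \<noteq> 0" using assms(2) by (auto simp: primary_primes_def)
    ultimately have "1 = p * s" by simp
    hence "p dvd 1" by (rule dvdI)
    thus False using assms(1) by (auto simp: primary_primes_def prime_elem_def)
  qed
  ultimately show ?thesis
    using assms \<open>p dvd q\<close> primary_associate by (auto simp: primary_primes_def)
qed

text \<open>The choice is harmless: a power of a primary prime determines the prime, by \<open>primary_prime_unique\<close>.
  Each nonzero prime ideal prime to 3 has exactly one primary generator, so this is the von Mangoldt
  function of ideals prime to 3.\<close>
definition eis_mangoldt :: "eis \<Rightarrow> real" where
  "eis_mangoldt x = (if \<exists>p\<in>primary_primes. \<exists>k>0. x = p ^ k
     then ln (of_int (eis_norm (SOME p. p \<in> primary_primes \<and> (\<exists>k>0. x = p ^ k)))) else 0)"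

lemma eis_mangoldt_power:
  assumes "p \<in> primary_primes" "k > 0"
  shows "eis_mangoldt (p ^ k) = ln (of_int (eis_norm p))"
proof -
  define q where "q = (SOME q. q \<in> primary_primes \<and> (\<exists>l>0. p ^ k = q ^ l))"
  have "q \<in> primary_primes \<and> (\<exists>l>0. p ^ k = q ^ l)"
    unfolding q_def by (rule someI[of _ p]) (use assms in blast)
  then obtain l where q: "q \<in> primary_primes" "p ^ k = q ^ l" by blast
  have "p dvd q ^ l" using assms(2) unfolding q(2)[symmetric] by (simp add: dvd_power)
  hence "p = q" using assms(1) q(1) by (rule primary_prime_unique[rotated 2])
  moreover have "\<exists>p'\<in>primary_primes. \<exists>k'>0. p ^ k = p' ^ k'" using assms by blast
  ultimately show ?thesis unfolding eis_mangoldt_def q_def[symmetric] by simp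
qed

lemma eis_norm_primary_prime_gt_1:
  assumes "p \<in> primary_primes"
  shows "eis_norm p > 1"
proof -
  have "p \<noteq> 0" "\<not> p dvd 1" using assms by (auto simp: primary_primes_def prime_elem_def)
  thus ?thesis using eis_norm_pos[of p] eis_dvd_1_iff[of p] by linarith
qed

lemma eis_mangoldt_nonneg: "eis_mangoldt x \<ge> 0"
proof (cases "\<exists>p\<in>primary_primes. \<exists>k>0. x = p ^ k")
  case True
  then obtain p k where "p \<in> primary_primes" "k > 0" "x = p ^ k" by blast
  thus ?thesis using eis_mangoldt_power[of p k] eis_norm_primary_prime_gt_1[of p] by simp
next
  case False
  thus ?thesis unfolding eis_mangoldt_def if_not_P[OF False] by simp
qed

lemma finite_eis_norm_le: "finite {x. eis_norm x \<le> n}"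
proof -
  have "{x. eis_norm x \<le> n} \<subseteq> (\<lambda>(a,b). Eis a b) ` ({-(4*\<bar>n\<bar>)..4*\<bar>n\<bar>} \<times> {-(4*\<bar>n\<bar>)..4*\<bar>n\<bar>})"
  proof
    fix x assume "x \<in> {x. eis_norm x \<le> n}"
    hence n: "eis_norm x \<le> n" by simp
    obtain a b where x: "x = Eis a b" by (cases x)
    have "0 \<le> (2 * a - b)\<^sup>2" "0 \<le> (2 * b - a)\<^sup>2" by simp_all
    hence "3 * b\<^sup>2 \<le> 4 * n" "3 * a\<^sup>2 \<le> 4 * n"
      using four_eis_norm[of x] n unfolding x eis.sel by linarith+
    have "\<bar>c\<bar> \<le> c\<^sup>2" for c :: int
      using self_le_power[of "\<bar>c\<bar>" 2] by (cases "c = 0") auto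
    note sq = this
    have "\<bar>a\<bar> \<le> 4 * \<bar>n\<bar>" "\<bar>b\<bar> \<le> 4 * \<bar>n\<bar>"
      using \<open>3 * b\<^sup>2 \<le> 4 * n\<close> \<open>3 * a\<^sup>2 \<le> 4 * n\<close> sq[of a] sq[of b] by linarith+
    hence "(a, b) \<in> {-(4*\<bar>n\<bar>)..4*\<bar>n\<bar>} \<times> {-(4*\<bar>n\<bar>)..4*\<bar>n\<bar>}" by auto
    thus "x \<in> (\<lambda>(a,b). Eis a b) ` ({-(4*\<bar>n\<bar>)..4*\<bar>n\<bar>} \<times> {-(4*\<bar>n\<bar>)..4*\<bar>n\<bar>})"
      unfolding x by (intro image_eqI[of _ _ "(a, b)"]) auto
  qed
  thus ?thesis by (rule finite_subset) auto
qed

lemma finite_eis_divisors: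
  fixes x :: eis
  assumes "x \<noteq> 0"
  shows "finite {y. y dvd x}"
proof -
  have "eis_norm y \<le> eis_norm x" if "y dvd x" for y
    using eis_norm_dvd[OF that] eis_norm_pos[OF assms] by (rule zdvd_imp_le)
  hence "{y. y dvd x} \<subseteq> {y. eis_norm y \<le> eis_norm x}" by auto
  thus ?thesis using finite_eis_norm_le by (rule finite_subset)
qed

lemma prime_power_dvd_cofactor:
  fixes q :: "'a :: idom"
  assumes "prime_elem q" "\<not> q dvd p"
  shows "q ^ k dvd p * x \<Longrightarrow> q ^ k dvd x"
proof (induction k arbitrary: x)
  case (Suc k)
  have q0: "q \<noteq> 0" using assms by auto
  have "q dvd q ^ Suc k" by simp
  hence "q dvd p * x" using Suc.prems by (rule dvd_trans)
  hence "q dvd x" using assms by (simp add: prime_elem_dvd_mult_iff)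
  then obtain z where z: "x = q * z" by (auto elim: dvdE)
  obtain w where w: "p * x = q ^ Suc k * w" using Suc.prems by (rule dvdE)
  have "q * (p * z) = q * (q ^ k * w)" using w unfolding z by (simp add: algebra_simps)
  hence "p * z = q ^ k * w" using q0 by simp
  hence "q ^ k dvd p * z" by simp
  hence "q ^ k dvd z" by (rule Suc.IH)
  thus ?case unfolding z by simp
qed simp

text \<open>Unique factorisation of primary elements, in the form of its logarithm.\<close>
lemma sum_eis_mangoldt:
  assumes "x \<in> primary"
  shows "(\<Sum>y | y \<in> primary \<and> y dvd x. eis_mangoldt y) = ln (of_int (eis_norm x))"
  using assms
proof (induction "nat (eis_norm x)" arbitrary: x rule: less_induct)
  case less
  define D where "D x = {y. \<exists>p\<in>primary_primes. \<exists>k>0. y = p ^ k \<and> y dvd x}" for x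
  have sumD: "(\<Sum>y | y \<in> primary \<and> y dvd x. eis_mangoldt y) = (\<Sum>y\<in>D x. eis_mangoldt y)"
    if "x \<in> primary" for x
  proof (rule sum.mono_neutral_right)
    show "finite {y \<in> primary. y dvd x}"
      using finite_eis_divisors[OF primary_not_0[OF that]] by (rule rev_finite_subset) auto
    show "D x \<subseteq> {y \<in> primary. y dvd x}"
      by (auto simp: D_def primary_primes_def intro: primary_power)
    show "\<forall>y\<in>{y \<in> primary. y dvd x} - D x. eis_mangoldt y = 0"
      by (auto simp: D_def eis_mangoldt_def)
  qed
  show ?case
  proof (cases "x = 1")
    case True
    have "D 1 = {}"
    proof -
      have "\<not> p ^ k dvd 1" if "p \<in> primary_primes" "k > 0" for p k
      proof
        assume "p ^ k dvd 1"
        moreover have "p dvd p ^ k" using that(2) by (simp add: dvd_power)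
        ultimately have "p dvd 1" by (rule dvd_trans[rotated])
        thus False using that(1) by (auto simp: primary_primes_def prime_elem_def)
      qed
      thus ?thesis by (auto simp: D_def)
    qed
    thus ?thesis using sumD[OF primary_1] True by simp
  next
    case False
    obtain p where p: "p \<in> primary_primes" "p dvd x"
      using exists_primary_prime_divisor[OF less.prems False] by blast
    then obtain z where z: "x = p * z" by (auto elim: dvdE)
    have pp: "p \<in> primary" "prime_elem p" "p \<noteq> 0" using p(1) by (auto simp: primary_primes_def)
    have zp: "z \<in> primary" using primary_cofactor[OF pp(1)] less.prems z by simp
    have z0: "z \<noteq> 0" using zp by (rule primary_not_0)
    have Np: "eis_norm p > 1" using eis_norm_primary_prime_gt_1 p(1) by blast
    have Nz: "eis_norm z > 0" using z0 by (rule eis_norm_pos)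
    have Nx: "eis_norm x = eis_norm p * eis_norm z" by (simp add: z eis_norm_mult)
    have "1 * eis_norm z < eis_norm p * eis_norm z" using Np Nz by (intro mult_strict_right_mono)
    hence "nat (eis_norm z) < nat (eis_norm x)" using Nz by (simp add: Nx)
    hence IH: "(\<Sum>y\<in>D z. eis_mangoldt y) = ln (of_int (eis_norm z))"
      using less.hyps[OF _ zp] sumD[OF zp] by simp
    have "\<exists>m. p ^ m dvd z \<and> \<not> p ^ Suc m dvd z"
    proof (rule ccontr)
      assume "\<nexists>m. p ^ m dvd z \<and> \<not> p ^ Suc m dvd z"
      hence step: "p ^ m dvd z \<Longrightarrow> p ^ Suc m dvd z" for m by blast
      have all: "p ^ m dvd z" for m by (induction m) (simp, rule step)
      have "(2::int) ^ m \<le> eis_norm z" for m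
      proof -
        have "(2::int) ^ m \<le> eis_norm p ^ m" using Np by (intro power_mono) auto
        also have "\<dots> \<le> eis_norm z"
          using eis_norm_dvd[OF all[of m]] Nz by (intro zdvd_imp_le) (simp_all add: eis_norm_power)
        finally show ?thesis .
      qed
      from this[of "nat (eis_norm z)"] have "(2::int) ^ nat (eis_norm z) \<le> eis_norm z" .
      moreover have "int (nat (eis_norm z)) < 2 ^ nat (eis_norm z)"
        using less_exp[of "nat (eis_norm z)"] by (metis of_nat_less_iff of_nat_numeral of_nat_power)
      ultimately show False using Nz by simp
    qed
    then obtain m where m: "p ^ m dvd z" "\<not> p ^ Suc m dvd z" by blast
    have pw: "p ^ k dvd z \<longleftrightarrow> k \<le> m" for k
    proof
      assume "p ^ k dvd z"
      show "k \<le> m"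
      proof (rule ccontr)
        assume "\<not> k \<le> m"
        hence "p ^ Suc m dvd p ^ k" by (intro le_imp_power_dvd) auto
        thus False using m(2) dvd_trans[OF _ \<open>p ^ k dvd z\<close>] by auto
      qed
    next
      assume "k \<le> m"
      thus "p ^ k dvd z" using dvd_trans[OF le_imp_power_dvd m(1)] by simp
    qed
    have Dx: "D x = insert (p ^ Suc m) (D z)"
    proof (intro equalityI subsetI)
      fix y assume "y \<in> D x"
      then obtain q k where q: "q \<in> primary_primes" "k > 0" "y = q ^ k" "q ^ k dvd p * z"
        by (auto simp: D_def z)
      show "y \<in> insert (p ^ Suc m) (D z)"
      proof (cases "q = p")
        case True
        obtain l where l: "k = Suc l" using q(2) by (cases k) auto
        have "p ^ l dvd z" using q(4) pp(3) unfolding True l by simp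
        hence "l \<le> m" by (simp only: pw)
        show ?thesis
        proof (cases "l = m")
          case True
          thus ?thesis using q(3) \<open>q = p\<close> l by simp
        next
          case False
          hence "p ^ k dvd z" using \<open>l \<le> m\<close> by (simp only: pw l)
          thus ?thesis using q(1,2,3) \<open>q = p\<close> unfolding D_def by blast
        qed
      next
        case False
        have nd: "\<not> q dvd p" using primary_prime_unique[OF q(1) p(1), of 1] False by auto
        have pe: "prime_elem q" using q(1) by (simp add: primary_primes_def)
        have "q ^ k dvd z" by (rule prime_power_dvd_cofactor[OF pe nd q(4)])
        thus ?thesis using q by (auto simp: D_def)
      qed
    next
      fix y assume y: "y \<in> insert (p ^ Suc m) (D z)"
      have pd: "p ^ Suc m dvd x" unfolding z using m(1) by simp
      show "y \<in> D x"
      proof (cases "y = p ^ Suc m")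
        case True
        thus ?thesis using p(1) pd unfolding D_def by blast
      next
        case False
        then obtain q k where q: "q \<in> primary_primes" "k > 0" "y = q ^ k" "y dvd z"
          using y unfolding D_def by blast
        have "y dvd x" unfolding z using q(4) by (rule dvd_mult)
        thus ?thesis using q(1-3) unfolding D_def by blast
      qed
    qed
    have notin: "p ^ Suc m \<notin> D z" using m(2) by (auto simp: D_def)
    have fin: "finite (D z)"
      using finite_eis_divisors[OF z0] by (rule rev_finite_subset) (auto simp: D_def)
    have "(\<Sum>y\<in>D x. eis_mangoldt y) = ln (of_int (eis_norm p)) + ln (of_int (eis_norm z))"
      unfolding Dx using fin notin p(1) IH eis_mangoldt_power[of p "Suc m"] by simp
    also have "\<dots> = ln (of_int (eis_norm x))" using Np Nz pp(3) z0 by (simp add: Nx ln_mult)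
    finally show ?thesis using sumD[OF less.prems] by simp
  qed
qed

definition primary_of_norm :: "nat \<Rightarrow> eis set" where
  "primary_of_norm n = {x \<in> primary. eis_norm x = int n}"

lemma finite_primary_of_norm [simp]: "finite (primary_of_norm n)"
  using finite_eis_norm_le[of "int n"] by (rule rev_finite_subset) (auto simp: primary_of_norm_def)

definition norm_sum :: "(eis \<Rightarrow> complex) \<Rightarrow> nat \<Rightarrow> complex" where
  "norm_sum f n = (\<Sum>x\<in>primary_of_norm n. f x)"

text \<open>Grouped by norm, the identity \<open>\<Sum>\<^sub>y\<^sub>|\<^sub>x \<Lambda>(y) = ln N(x)\<close> becomes a convolution over rational divisors: a pair
  of norms \<open>d\<close> and \<open>n / d\<close> collects the factorisations \<open>x = y z\<close>, weighted by \<open>\<psi>(y) \<psi>(z) = \<psi>(x)\<close>.\<close>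
lemma norm_sum_convolution:
  assumes mult: "\<And>x y. x \<in> primary \<Longrightarrow> y \<in> primary \<Longrightarrow> \<psi> (x * y) = \<psi> x * \<psi> y" and n: "n > 0"
  shows "(\<Sum>d | d dvd n. norm_sum (\<lambda>x. \<psi> x * of_real (eis_mangoldt x)) d * norm_sum \<psi> (n div d)) =
     norm_sum \<psi> n * of_real (ln (real n))"
proof -
  let ?L = "\<lambda>x. of_real (eis_mangoldt x) :: complex"
  have "(\<Sum>d | d dvd n. norm_sum (\<lambda>x. \<psi> x * ?L x) d * norm_sum \<psi> (n div d)) =
     (\<Sum>d | d dvd n. \<Sum>(y,z)\<in>primary_of_norm d \<times> primary_of_norm (n div d). \<psi> (y * z) * ?L y)"
  proof (intro sum.cong refl)
    fix d
    show "norm_sum (\<lambda>x. \<psi> x * ?L x) d * norm_sum \<psi> (n div d) =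
      (\<Sum>(y,z)\<in>primary_of_norm d \<times> primary_of_norm (n div d). \<psi> (y * z) * ?L y)"
      unfolding norm_sum_def sum_product sum.cartesian_product
      by (intro sum.cong) (auto simp: primary_of_norm_def mult)
  qed
  also have "\<dots> = (\<Sum>(d,y,z)\<in>(SIGMA d:{d. d dvd n}. primary_of_norm d \<times> primary_of_norm (n div d)). \<psi> (y * z) * ?L y)"
    using n by (subst sum.Sigma) auto
  also have "\<dots> = (\<Sum>(x,y)\<in>(SIGMA x:primary_of_norm n. {y \<in> primary. y dvd x}). \<psi> x * ?L y)"
  proof -
    have bij: "bij_betw (\<lambda>(d,y,z). (y * z, y)) (SIGMA d:{d. d dvd n}. primary_of_norm d \<times> primary_of_norm (n div d))
       (SIGMA x:primary_of_norm n. {y \<in> primary. y dvd x})"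
      unfolding bij_betw_def
    proof (intro conjI equalityI subsetI)
      show "inj_on (\<lambda>(d,y,z). (y * z, y)) (SIGMA d:{d. d dvd n}. primary_of_norm d \<times> primary_of_norm (n div d))"
        by (rule inj_onI) (auto simp: primary_of_norm_def dest: primary_not_0)
    next
      fix t assume "t \<in> (\<lambda>(d,y,z). (y * z, y)) ` (SIGMA d:{d. d dvd n}. primary_of_norm d \<times> primary_of_norm (n div d))"
      then obtain d y z where t: "t = (y * z, y)" "d dvd n" "y \<in> primary_of_norm d" "z \<in> primary_of_norm (n div d)"
        by auto
      have "int d * int (n div d) = int n" using t(2) by (metis dvd_mult_div_cancel of_nat_mult)
      thus "t \<in> (SIGMA x:primary_of_norm n. {y \<in> primary. y dvd x})"
        using t by (auto simp: primary_of_norm_def eis_norm_mult primary_mult)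
    next
      fix t assume "t \<in> (SIGMA x:primary_of_norm n. {y \<in> primary. y dvd x})"
      then obtain x y where t: "t = (x, y)" "x \<in> primary_of_norm n" "y \<in> primary" "y dvd x" by auto
      then obtain z where z: "x = y * z" by (auto elim: dvdE)
      have zp: "z \<in> primary" using primary_cofactor[OF t(3)] t(2) z by (simp add: primary_of_norm_def)
      define d where "d = nat (eis_norm y)"
      have Ny: "eis_norm y = int d" "d > 0" using eis_norm_pos[OF primary_not_0[OF t(3)]] by (auto simp: d_def)
      have "int n = int d * eis_norm z" using t(2) Ny by (simp add: primary_of_norm_def z eis_norm_mult)
      moreover define e where "e = nat (eis_norm z)"
      have Nz: "eis_norm z = int e" using eis_norm_nonneg by (simp add: e_def)
      ultimately have n': "n = d * e" by (metis Nz of_nat_eq_iff of_nat_mult)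
      have "(d, y, z) \<in> (SIGMA d:{d. d dvd n}. primary_of_norm d \<times> primary_of_norm (n div d))"
        using t(3) zp Ny Nz by (auto simp: primary_of_norm_def n')
      thus "t \<in> (\<lambda>(d,y,z). (y * z, y)) ` (SIGMA d:{d. d dvd n}. primary_of_norm d \<times> primary_of_norm (n div d))"
        unfolding t(1) z by (intro image_eqI[where x = "(d, y, z)"]) auto
    qed
    have "(\<Sum>(d,y,z)\<in>(SIGMA d:{d. d dvd n}. primary_of_norm d \<times> primary_of_norm (n div d)). \<psi> (y * z) * ?L y) =
       (\<Sum>t\<in>(SIGMA d:{d. d dvd n}. primary_of_norm d \<times> primary_of_norm (n div d)).
          (\<lambda>(x,y). \<psi> x * ?L y) ((\<lambda>(d,y,z). (y * z, y)) t))"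
      by (intro sum.cong refl) auto
    also have "\<dots> = (\<Sum>(x,y)\<in>(SIGMA x:primary_of_norm n. {y \<in> primary. y dvd x}). \<psi> x * ?L y)"
      by (rule sum.reindex_bij_betw[OF bij])
    finally show ?thesis .
  qed
  also have "\<dots> = (\<Sum>x\<in>primary_of_norm n. \<Sum>y | y \<in> primary \<and> y dvd x. \<psi> x * ?L y)"
  proof (rule sum.Sigma[symmetric])
    show "\<forall>x\<in>primary_of_norm n. finite {y \<in> primary. y dvd x}"
      using finite_eis_divisors primary_not_0 by (auto simp: primary_of_norm_def intro: rev_finite_subset)
  qed simp
  also have "\<dots> = (\<Sum>x\<in>primary_of_norm n. \<psi> x * of_real (ln (real n)))"
  proof (intro sum.cong refl)
    fix x assume x: "x \<in> primary_of_norm n"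
    have "(\<Sum>y | y \<in> primary \<and> y dvd x. \<psi> x * ?L y) = \<psi> x * of_real (\<Sum>y | y \<in> primary \<and> y dvd x. eis_mangoldt y)"
      by (simp add: sum_distrib_left)
    also have "(\<Sum>y | y \<in> primary \<and> y dvd x. eis_mangoldt y) = ln (real n)"
      using x sum_eis_mangoldt[of x] by (simp add: primary_of_norm_def)
    finally show "(\<Sum>y | y \<in> primary \<and> y dvd x. \<psi> x * ?L y) = \<psi> x * of_real (ln (real n))" .
  qed
  also have "\<dots> = norm_sum \<psi> n * of_real (ln (real n))"
    by (simp add: norm_sum_def sum_distrib_right)
  finally show ?thesis .
qed

section \<open>Counting Eisenstein integers in residue classes\<close>

definition eis_complex :: "eis \<Rightarrow> complex" where
  "eis_complex x = Complex (of_int (ea x) - of_int (eb x) / 2) (sqrt 3 / 2 * of_int (eb x))"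

lemma norm_eis_complex: "norm (eis_complex x) = sqrt (of_int (eis_norm x))"
  unfolding eis_complex_def complex_norm eis_norm_def
  by (rule arg_cong[where f = sqrt]) (simp add: power2_eq_square field_simps)

text \<open>The coordinates of a complex number with respect to the basis \<open>1, \<omega>\<close>.\<close>
definition lattice_im :: "complex \<Rightarrow> real" where "lattice_im z = 2 * Im z / sqrt 3"
definition lattice_re :: "complex \<Rightarrow> real" where "lattice_re z = Re z + lattice_im z / 2"

lemma lattice_coordinates:
  "lattice_re (eis_complex x) = of_int (ea x)" "lattice_im (eis_complex x) = of_int (eb x)"
  "lattice_re (z - w) = lattice_re z - lattice_re w" "lattice_im (z - w) = lattice_im z - lattice_im w"
proof -
  show im: "lattice_im (eis_complex x) = of_int (eb x)"
    by (simp add: lattice_im_def eis_complex_def)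
  show "lattice_re (eis_complex x) = of_int (ea x)"
    unfolding lattice_re_def im by (simp add: eis_complex_def)
  show im': "lattice_im (z - w) = lattice_im z - lattice_im w"
    by (simp add: lattice_im_def right_diff_distrib diff_divide_distrib)
  show "lattice_re (z - w) = lattice_re z - lattice_re w"
    unfolding lattice_re_def im' by (simp add: diff_divide_distrib)
qed

definition lattice_cell :: "complex set" where
  "lattice_cell = lattice_re -` {0..<9} \<inter> lattice_im -` {0..<9}"

lemma lattice_cell_bounded:
  assumes "z \<in> lattice_cell"
  shows "norm z \<le> 18"
proof -
  have b: "0 \<le> lattice_re z" "lattice_re z < 9" "0 \<le> lattice_im z" "lattice_im z < 9"
    using assms by (auto simp: lattice_cell_def)
  have "Im z = lattice_im z * (sqrt 3 / 2)" by (simp add: lattice_im_def)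
  moreover have "sqrt 3 / 2 \<le> (1::real)" using real_sqrt_le_mono[of 3 4] by simp
  moreover from this have "lattice_im z * (sqrt 3 / 2) \<le> 9 * 1" using b by (intro mult_mono) auto
  moreover have "lattice_im z * (sqrt 3 / 2) \<ge> 0" using b by simp
  ultimately have "\<bar>Im z\<bar> \<le> 9" by simp
  moreover have "\<bar>Re z\<bar> \<le> 9" using b by (simp add: lattice_re_def)
  ultimately show ?thesis using cmod_le[of z] by simp
qed

lemma lattice_cell_measurable: "lattice_cell \<in> lmeasurable"
proof (rule bounded_set_imp_lmeasurable)
  show "bounded lattice_cell" using lattice_cell_bounded by (auto simp: bounded_iff)
  have m: "lattice_re \<in> borel_measurable borel" "lattice_im \<in> borel_measurable borel"
    unfolding lattice_re_def[abs_def] lattice_im_def[abs_def]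
    by (intro borel_measurable_continuous_onI continuous_intros; simp)+
  have "lattice_cell \<in> sets borel"
    unfolding lattice_cell_def by (intro sets.Int measurable_sets_borel[OF m(1)] measurable_sets_borel[OF m(2)]) auto
  thus "lattice_cell \<in> sets lebesgue" by simp
qed

definition residue_class_9 :: "eis \<Rightarrow> eis set" where
  "residue_class_9 c = {x. 9 dvd (ea x - ea c) \<and> 9 dvd (eb x - eb c)}"

lemma cell_iff: "z \<in> (+) (eis_complex x) ` lattice_cell \<longleftrightarrow>
    of_int (ea x) \<le> lattice_re z \<and> lattice_re z < of_int (ea x) + 9 \<and>
    of_int (eb x) \<le> lattice_im z \<and> lattice_im z < of_int (eb x) + 9"
proof -
  have "z \<in> (+) (eis_complex x) ` lattice_cell \<longleftrightarrow> z - eis_complex x \<in> lattice_cell"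
    by (auto simp: image_iff intro!: bexI[of _ "z - eis_complex x"])
  thus ?thesis by (auto simp: lattice_cell_def lattice_coordinates)
qed

lemma cells_disjoint: "disjoint_family_on (\<lambda>x. (+) (eis_complex x) ` lattice_cell) (residue_class_9 c)"
  unfolding disjoint_family_on_def
proof (intro ballI impI equals0I)
  fix x y z assume xy: "x \<in> residue_class_9 c" "y \<in> residue_class_9 c" "x \<noteq> y"
    and "z \<in> (+) (eis_complex x) ` lattice_cell \<inter> (+) (eis_complex y) ` lattice_cell"
  hence z: "z \<in> (+) (eis_complex x) ` lattice_cell" "z \<in> (+) (eis_complex y) ` lattice_cell" by auto
  have "\<bar>real_of_int (ea x - ea y)\<bar> < 9" "\<bar>real_of_int (eb x - eb y)\<bar> < 9"
    using z unfolding cell_iff by auto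
  hence "\<bar>ea x - ea y\<bar> < 9" "\<bar>eb x - eb y\<bar> < 9" by linarith+
  moreover have "9 dvd (ea x - ea y)" "9 dvd (eb x - eb y)"
    using xy dvd_diff[of 9 "ea x - ea c" "ea y - ea c"] dvd_diff[of 9 "eb x - eb c" "eb y - eb c"]
    by (simp_all add: residue_class_9_def)
  moreover have "d = 0" if "9 dvd d" "\<bar>d\<bar> < 9" for d :: int
    using that by presburger
  ultimately have "ea x - ea y = 0" "eb x - eb y = 0" by blast+
  thus False using xy(3) by (simp add: eis_eq_iff)
qed

lemma cells_cover: "\<exists>x\<in>residue_class_9 c. z \<in> (+) (eis_complex x) ` lattice_cell"
proof -
  define k where "k = \<lfloor>(lattice_re z - of_int (ea c)) / 9\<rfloor>"
  define l where "l = \<lfloor>(lattice_im z - of_int (eb c)) / 9\<rfloor>"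
  have "of_int k \<le> (lattice_re z - of_int (ea c)) / 9" "(lattice_re z - of_int (ea c)) / 9 < of_int k + 1"
    "of_int l \<le> (lattice_im z - of_int (eb c)) / 9" "(lattice_im z - of_int (eb c)) / 9 < of_int l + 1"
    unfolding k_def l_def by linarith+
  hence "z \<in> (+) (eis_complex (Eis (ea c + 9 * k) (eb c + 9 * l))) ` lattice_cell"
    unfolding cell_iff by (simp add: field_simps)
  thus ?thesis by (intro bexI[of _ "Eis (ea c + 9 * k) (eb c + 9 * l)"]) (auto simp: residue_class_9_def)
qed

text \<open>Translates of a cell by the elements of a residue class modulo 9 tile the plane, so the number of
  such elements in a disc is the area of the disc divided by that of a cell, up to a multiple of the
  circumference. In particular the main term does not depend on the class.\<close>
lemma count_residue_class_9:
  obtains C K :: real where "C > 0" "\<And>c n. n > 0 \<Longrightarrow>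
    \<bar>real (card {x \<in> residue_class_9 c. eis_norm x \<le> int n}) - C * real n\<bar> \<le> K * sqrt (real n)"
proof -
  define V where "V = unit_ball_vol (real DIM(complex))"
  define A where "A = measure lebesgue lattice_cell"
  have V: "V > 0" by (simp add: V_def)
  have A0: "A \<ge> 0" by (simp add: A_def)
  have disc: "measure lebesgue (cball (0::complex) r) = V * r\<^sup>2" if "r \<ge> 0" for r
    using content_cball[OF that, of "0::complex"] by (simp add: V_def)
  \<comment> \<open>A cell has diameter at most 18, so the cells of the points in the disc cover a smaller disc and lie in a larger one.\<close>
  have bounds: "real (card {x \<in> residue_class_9 c. eis_norm x \<le> int n}) * A \<le> V * (sqrt n + 18)\<^sup>2"
    "sqrt n \<ge> 18 \<Longrightarrow> V * (sqrt n - 18)\<^sup>2 \<le> real (card {x \<in> residue_class_9 c. eis_norm x \<le> int n}) * A" for c n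
  proof -
    define S where "S = {x \<in> residue_class_9 c. eis_norm x \<le> int n}"
    define U where "U = (\<Union>x\<in>S. (+) (eis_complex x) ` lattice_cell)"
    have fin: "finite S" unfolding S_def using finite_eis_norm_le by (rule rev_finite_subset) auto
    have lm: "(+) (eis_complex x) ` lattice_cell \<in> lmeasurable" for x
      using lattice_cell_measurable by (rule measurable_translation)
    have U: "U \<in> lmeasurable" unfolding U_def using fin lm by (intro fmeasurable.finite_UN) auto
    have "measure lebesgue U = (\<Sum>x\<in>S. measure lebesgue ((+) (eis_complex x) ` lattice_cell))"
      unfolding U_def
    proof (rule measure_finite_Union[OF fin])
      show "(\<lambda>x. (+) (eis_complex x) ` lattice_cell) ` S \<subseteq> sets lebesgue"
        using lm by auto
      show "disjoint_family_on (\<lambda>x. (+) (eis_complex x) ` lattice_cell) S"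
        using cells_disjoint[of c] by (rule disjoint_family_on_mono[rotated]) (auto simp: S_def)
      show "emeasure lebesgue ((+) (eis_complex x) ` lattice_cell) \<noteq> \<infinity>" for x
        using lm[of x] by (auto simp: fmeasurable_def)
    qed
    also have "\<dots> = real (card S) * A"
      by (simp add: measure_translation A_def)
    finally have mU: "measure lebesgue U = real (card S) * A" .
    have near: "norm (z - eis_complex x) \<le> 18" if "z \<in> (+) (eis_complex x) ` lattice_cell" for z x
      using that lattice_cell_bounded by auto
    have "U \<subseteq> cball 0 (sqrt n + 18)"
    proof
      fix z assume "z \<in> U"
      then obtain x where x: "x \<in> S" "z \<in> (+) (eis_complex x) ` lattice_cell" by (auto simp: U_def)
      have "norm z \<le> norm (eis_complex x) + norm (z - eis_complex x)"
        using norm_triangle_ineq[of "eis_complex x" "z - eis_complex x"] by simp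
      also have "norm (eis_complex x) \<le> sqrt n"
      proof -
        have "eis_norm x \<le> int n" using x(1) by (simp add: S_def)
        hence "real_of_int (eis_norm x) \<le> real n" by linarith
        thus ?thesis unfolding norm_eis_complex by (rule real_sqrt_le_mono)
      qed
      finally show "z \<in> cball 0 (sqrt n + 18)" using near[OF x(2)] by simp
    qed
    hence "measure lebesgue U \<le> measure lebesgue (cball (0::complex) (sqrt n + 18))"
      using U by (intro measure_mono_fmeasurable) (auto simp: fmeasurableD)
    thus "real (card {x \<in> residue_class_9 c. eis_norm x \<le> int n}) * A \<le> V * (sqrt n + 18)\<^sup>2"
      using disc[of "sqrt n + 18", OF add_nonneg_nonneg] mU unfolding S_def by (simp only: real_sqrt_ge_zero of_nat_0_le_iff zero_le_numeral)
    show "V * (sqrt n - 18)\<^sup>2 \<le> real (card {x \<in> residue_class_9 c. eis_norm x \<le> int n}) * A"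
      if large: "sqrt n \<ge> 18"
    proof -
      have "cball 0 (sqrt n - 18) \<subseteq> U"
      proof
        fix z :: complex assume z: "z \<in> cball 0 (sqrt n - 18)"
        obtain x where x: "x \<in> residue_class_9 c" "z \<in> (+) (eis_complex x) ` lattice_cell"
          using cells_cover by blast
        have "norm (eis_complex x) \<le> norm z + norm (z - eis_complex x)"
          using norm_triangle_ineq4[of z "z - eis_complex x"] by simp
        also have "\<dots> \<le> sqrt n" using z near[OF x(2)] by simp
        finally have "of_int (eis_norm x) \<le> real n" unfolding norm_eis_complex by simp
        hence "eis_norm x \<le> int n" by linarith
        thus "z \<in> U" using x by (auto simp: U_def S_def)
      qed
      hence "measure lebesgue (cball (0::complex) (sqrt n - 18)) \<le> measure lebesgue U"
        using U by (intro measure_mono_fmeasurable) (auto simp: fmeasurableD)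
      thus ?thesis using disc[of "sqrt n - 18"] large mU unfolding S_def by (simp only: diff_ge_0_iff_ge)
    qed
  qed
  have A: "A > 0"
  proof (rule ccontr)
    assume "\<not> A > 0"
    hence "A = 0" using A0 by simp
    moreover have "sqrt (real (19^2)) = 19" by (simp only: of_nat_power real_sqrt_abs)
    ultimately have "V * 1 \<le> 0" using bounds(2)[of "19^2" 0] by simp
    thus False using V by simp
  qed
  show ?thesis
  proof (rule that[of "V / A" "V * 360 / A"])
    show "V / A > 0" using V A by simp
    fix c :: eis and n :: nat assume n: "n > 0"
    define R where "R = real (card {x \<in> residue_class_9 c. eis_norm x \<le> int n}) * A"
    define q where "q = sqrt (real n)"
    have q: "q \<ge> 1" "q * q = real n" using n by (auto simp: q_def)
    have q2: "1 * q \<le> q * q" using q(1) by (intro mult_right_mono) auto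
    have up: "R \<le> V * real n + V * 360 * q"
    proof -
      have "R \<le> V * (q + 18)\<^sup>2" unfolding R_def q_def by (rule bounds(1))
      also have "(q + 18)\<^sup>2 \<le> real n + 360 * q"
        using q by (simp add: power2_eq_square algebra_simps)
      finally show ?thesis using V by (simp add: algebra_simps)
    qed
    have low: "V * real n - V * 360 * q \<le> R"
    proof (cases "q \<ge> 18")
      case True
      have "real n - 360 * q \<le> (q - 18)\<^sup>2"
        using q by (simp add: power2_eq_square algebra_simps)
      hence "V * (real n - 360 * q) \<le> V * (q - 18)\<^sup>2" using V by (intro mult_left_mono) auto
      also have "\<dots> \<le> R" unfolding R_def q_def using True by (intro bounds(2)) (simp add: q_def)
      finally show ?thesis by (simp add: algebra_simps)
    next
      case False
      have "q * q \<le> 360 * q" using False q by (intro mult_right_mono) auto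
      hence "V * (real n - 360 * q) \<le> 0" using V q by (simp add: mult_le_0_iff)
      also have "0 \<le> R" using A by (simp add: R_def)
      finally show ?thesis by (simp add: algebra_simps)
    qed
    have "\<bar>R - V * real n\<bar> \<le> V * 360 * q" using up low by linarith
    hence "\<bar>R - V * real n\<bar> / A \<le> V * 360 * q / A" using A by (intro divide_right_mono) auto
    moreover have "\<bar>R - V * real n\<bar> / A = \<bar>R / A - V / A * real n\<bar>"
    proof -
      have "R / A - V / A * real n = (R - V * real n) / A" by (simp add: diff_divide_distrib)
      thus ?thesis using A by (simp only: abs_divide abs_of_pos)
    qed
    moreover have "R / A = real (card {x \<in> residue_class_9 c. eis_norm x \<le> int n})"
      using A by (simp add: R_def)
    ultimately show "\<bar>real (card {x \<in> residue_class_9 c. eis_norm x \<le> int n}) - V / A * real n\<bar> \<le> V * 360 / A * sqrt (real n)"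
      by (simp add: q_def)
  qed
qed

section \<open>The cubic characters modulo 9\<close>

definition zeta3 :: complex where "zeta3 = cis (2 * pi / 3)"

lemma norm_zeta3: "norm zeta3 = 1" and zeta3_nz: "zeta3 \<noteq> 0"
  by (simp_all add: zeta3_def)

lemma zeta3_power3: "zeta3 ^ 3 = 1"
proof -
  have "zeta3 ^ 3 = cis (real 3 * (2 * pi / 3))" unfolding zeta3_def by (rule Complex.DeMoivre)
  also have "real 3 * (2 * pi / 3) = 2 * pi" by simp
  finally show ?thesis by simp
qed

lemma zeta3_neq_1: "zeta3 \<noteq> 1"
proof
  assume "zeta3 = 1"
  hence "cos (2 * pi / 3) = 1" by (simp add: zeta3_def complex_eq_iff)
  thus False using cos_120 by (simp add: mult.commute)
qed

lemma zeta3_sum: "1 + zeta3 + zeta3\<^sup>2 = 0"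
proof -
  have "(zeta3 - 1) * (1 + zeta3 + zeta3\<^sup>2) = zeta3 ^ 3 - 1"
    by (simp add: power2_eq_square power3_eq_cube algebra_simps)
  thus ?thesis using zeta3_neq_1 zeta3_power3 by simp
qed

lemma zeta3_powi_cong:
  assumes "3 dvd (m - n)"
  shows "zeta3 powi m = zeta3 powi n"
proof -
  obtain k where "m = n + 3 * k" using assms by (auto elim!: dvdE simp: algebra_simps)
  moreover have "zeta3 powi (3 * k) = 1"
    unfolding power_int_mult using zeta3_power3 by simp
  ultimately show ?thesis using zeta3_nz by (simp add: power_int_add)
qed

lemma norm_zeta3_powi: "norm (zeta3 powi n) = 1"
  by (simp add: norm_power_int norm_zeta3)

text \<open>Orthogonality on the cyclic group of order 3.\<close>
lemma zeta3_powi_sum: "(\<Sum>u\<in>{0,1,2}. zeta3 powi (j * u)) = (if 3 dvd j then 3 else 0)"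
proof -
  have e: "(\<Sum>u\<in>{0,1,2::int}. zeta3 powi (j * u)) = zeta3 powi 0 + zeta3 powi j + zeta3 powi (j * 2)"
    by (simp add: add.assoc)
  have "3 dvd j \<or> 3 dvd (j - 1) \<or> 3 dvd (j - 2)" by presburger
  then consider "3 dvd j" | "3 dvd (j - 1)" | "3 dvd (j - 2)" by blast
  thus ?thesis
  proof cases
    case 1
    hence "zeta3 powi j = zeta3 powi 0" "zeta3 powi (j * 2) = zeta3 powi 0"
      using zeta3_powi_cong[of j 0] zeta3_powi_cong[of "j * 2" 0] by simp_all
    thus ?thesis unfolding e using 1 by simp
  next
    case 2
    hence d: "3 dvd (j * 2 - 2)" "\<not> 3 dvd j" by presburger+
    show ?thesis unfolding e zeta3_powi_cong[OF 2] zeta3_powi_cong[OF d(1)]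
      using zeta3_sum d(2) by (simp add: power_int_numeral)
  next
    case 3
    hence d: "3 dvd (j * 2 - 1)" "\<not> 3 dvd j" by presburger+
    show ?thesis unfolding e zeta3_powi_cong[OF 3] zeta3_powi_cong[OF d(1)]
      using zeta3_sum d(2) by (simp add: power_int_numeral add_ac)
  qed
qed

text \<open>On \<open>1 + 3u + 3v\<omega>\<close> the value is \<open>\<zeta>^(ju + kv)\<close>: modulo 9 multiplication of primary elements is
  addition of \<open>(u, v)\<close> modulo 3.\<close>
definition cubic_char :: "int \<Rightarrow> int \<Rightarrow> eis \<Rightarrow> complex" where
  "cubic_char j k x = zeta3 powi (j * ((ea x - 1) div 3) + k * (eb x div 3))"

lemma cubic_char_params: "cubic_char j k (Eis (1 + 3 * u) (3 * v)) = zeta3 powi (j * u + k * v)"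
  by (simp add: cubic_char_def)

lemma cubic_char_mult:
  assumes "x \<in> primary" "y \<in> primary"
  shows "cubic_char j k (x * y) = cubic_char j k x * cubic_char j k y"
proof -
  obtain u v u' v' where xy: "x = Eis (1 + 3 * u) (3 * v)" "y = Eis (1 + 3 * u') (3 * v')"
    using assms by (metis primaryE)
  have "3 dvd ((j * (u + u' + 3 * (u * u' - v * v')) + k * (v + v' + 3 * (u * v' + v * u' - v * v'))) - ((j * u + k * v) + (j * u' + k * v')))"
    by (rule dvdI[where k = "j * (u * u' - v * v') + k * (u * v' + v * u' - v * v')"]) (simp add: algebra_simps)
  hence "cubic_char j k (x * y) = zeta3 powi ((j * u + k * v) + (j * u' + k * v'))"
    unfolding xy primary_mult_params cubic_char_params by (rule zeta3_powi_cong)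
  thus ?thesis unfolding xy cubic_char_params using zeta3_nz by (simp add: power_int_add)
qed

lemma norm_cubic_char: "norm (cubic_char j k x) = 1"
  unfolding cubic_char_def by (rule norm_zeta3_powi)

lemma cubic_char_square: "cubic_char (2 * j) (2 * k) x = (cubic_char j k x)\<^sup>2"
proof -
  have "2 * j * a + 2 * k * b = (j * a + k * b) * 2" for a b by (simp add: algebra_simps)
  thus ?thesis unfolding cubic_char_def by (simp only: power_int_mult) (simp add: power_int_numeral)
qed

lemma cubic_char_0: "cubic_char 0 0 x = 1"
  by (simp add: cubic_char_def)

lemma cubic_char_residue_class:
  assumes "x \<in> residue_class_9 (Eis (1 + 3 * u) (3 * v))"
  shows "x \<in> primary" "cubic_char j k x = zeta3 powi (j * u + k * v)"
proof -
  from assms obtain s t where "ea x - (1 + 3 * u) = 9 * s" "eb x - 3 * v = 9 * t"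
    by (auto simp: residue_class_9_def elim!: dvdE)
  hence x: "x = Eis (1 + 3 * (u + 3 * s)) (3 * (v + 3 * t))" by (simp add: eis_eq_iff)
  show "x \<in> primary" unfolding x by (rule primaryI)
  show "cubic_char j k x = zeta3 powi (j * u + k * v)"
    unfolding x cubic_char_params
    by (rule zeta3_powi_cong, rule dvdI[where k = "j * s + k * t"]) (simp add: algebra_simps)
qed

lemma primary_decomposition:
  "{x \<in> primary. P x} = (\<Union>(u,v)\<in>{0,1,2}\<times>{0,1,2}. {x \<in> residue_class_9 (Eis (1 + 3 * u) (3 * v)). P x})"
proof (intro equalityI subsetI)
  fix x assume x: "x \<in> {x \<in> primary. P x}"
  then obtain u v where uv: "x = Eis (1 + 3 * u) (3 * v)" by (auto elim: primaryE)
  have "9 dvd (3 * u - 3 * (u mod 3))" "9 dvd (3 * v - 3 * (v mod 3))" by presburger+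
  hence "x \<in> residue_class_9 (Eis (1 + 3 * (u mod 3)) (3 * (v mod 3)))"
    by (simp add: residue_class_9_def uv)
  hence "x \<in> (case (u mod 3, v mod 3) of (u, v) \<Rightarrow> {x \<in> residue_class_9 (Eis (1 + 3 * u) (3 * v)). P x})"
    using x by simp
  moreover have "(u mod 3, v mod 3) \<in> {0,1,2} \<times> {0,1,2}"
    by simp presburger
  ultimately show "x \<in> (\<Union>(u,v)\<in>{0,1,2}\<times>{0,1,2}. {x \<in> residue_class_9 (Eis (1 + 3 * u) (3 * v)). P x})"
    by (rule UN_I[rotated])
next
  fix x assume "x \<in> (\<Union>(u,v)\<in>{0,1,2}\<times>{0,1,2}. {x \<in> residue_class_9 (Eis (1 + 3 * u) (3 * v)). P x})"
  then obtain p where p: "x \<in> (case p of (u,v) \<Rightarrow> {x \<in> residue_class_9 (Eis (1 + 3 * u) (3 * v)). P x})"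
    by (rule UN_E)
  obtain u v where "p = (u, v)" by (cases p)
  with p show "x \<in> {x \<in> primary. P x}" using cubic_char_residue_class(1)[of x u v] by simp
qed

lemma residue_classes_disjoint:
  assumes "u \<in> {0,1,2}" "v \<in> {0,1,2}" "u' \<in> {0,1,2}" "v' \<in> {0,1,2::int}"
    "x \<in> residue_class_9 (Eis (1 + 3 * u) (3 * v))" "x \<in> residue_class_9 (Eis (1 + 3 * u') (3 * v'))"
  shows "u = u' \<and> v = v'"
  using assms unfolding residue_class_9_def by simp presburger

lemma sum_norm_sum:
  "(\<Sum>m=1..n. norm_sum f m) = (\<Sum>x | x \<in> primary \<and> eis_norm x \<le> int n. f x)"
proof -
  have "(\<Sum>m=1..n. norm_sum f m) = (\<Sum>x\<in>(\<Union>m\<in>{1..n}. primary_of_norm m). f x)"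
    unfolding norm_sum_def by (intro sum.UNION_disjoint[symmetric]) (simp, simp, auto simp: primary_of_norm_def)
  also have "(\<Union>m\<in>{1..n}. primary_of_norm m) = {x. x \<in> primary \<and> eis_norm x \<le> int n}"
  proof (intro equalityI subsetI)
    fix x assume x: "x \<in> {x. x \<in> primary \<and> eis_norm x \<le> int n}"
    have "eis_norm x > 0" using x by (auto intro: eis_norm_pos dest: primary_not_0)
    thus "x \<in> (\<Union>m\<in>{1..n}. primary_of_norm m)"
      using x by (intro UN_I[of "nat (eis_norm x)"]) (auto simp: primary_of_norm_def)
  qed (auto simp: primary_of_norm_def)
  finally show ?thesis .
qed

lemma sum_cubic_char:
  "(\<Sum>m=1..n. norm_sum (cubic_char j k) m) = (\<Sum>(u,v)\<in>{0,1,2}\<times>{0,1,2}. zeta3 powi (j * u + k * v) *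
     of_nat (card {x \<in> residue_class_9 (Eis (1 + 3 * u) (3 * v)). eis_norm x \<le> int n}))"
proof -
  have "(\<Sum>m=1..n. norm_sum (cubic_char j k) m) =
     (\<Sum>p\<in>{0,1,2}\<times>{0,1,2}. \<Sum>x\<in>(case p of (u,v) \<Rightarrow> {x \<in> residue_class_9 (Eis (1 + 3 * u) (3 * v)). eis_norm x \<le> int n}). cubic_char j k x)"
    unfolding sum_norm_sum primary_decomposition[of "\<lambda>x. eis_norm x \<le> int n", simplified mem_Collect_eq]
  proof (rule sum.UNION_disjoint)
    show "\<forall>p\<in>{0,1,2}\<times>{0,1,2}. finite (case p of (u,v) \<Rightarrow> {x \<in> residue_class_9 (Eis (1 + 3 * u) (3 * v)). eis_norm x \<le> int n})"
      using rev_finite_subset[OF finite_eis_norm_le[of "int n"]] by (simp add: Collect_mono_iff split: prod.split)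
    show "\<forall>p\<in>{0,1,2}\<times>{0,1,2}. \<forall>q\<in>{0,1,2}\<times>{0,1,2}. p \<noteq> q \<longrightarrow>
       (case p of (u,v) \<Rightarrow> {x \<in> residue_class_9 (Eis (1 + 3 * u) (3 * v)). eis_norm x \<le> int n}) \<inter>
       (case q of (u,v) \<Rightarrow> {x \<in> residue_class_9 (Eis (1 + 3 * u) (3 * v)). eis_norm x \<le> int n}) = {}"
    proof (intro ballI impI equals0I)
      fix p q :: "int \<times> int" and x
      assume pq: "p \<in> {0,1,2}\<times>{0,1,2}" "q \<in> {0,1,2}\<times>{0,1,2}" "p \<noteq> q" and
        x: "x \<in> (case p of (u,v) \<Rightarrow> {x \<in> residue_class_9 (Eis (1 + 3 * u) (3 * v)). eis_norm x \<le> int n}) \<inter>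
         (case q of (u,v) \<Rightarrow> {x \<in> residue_class_9 (Eis (1 + 3 * u) (3 * v)). eis_norm x \<le> int n})"
      obtain u v u' v' where e: "p = (u, v)" "q = (u', v')" by (cases p; cases q)
      have uv: "u \<in> {0,1,2}" "v \<in> {0,1,2}" "u' \<in> {0,1,2}" "v' \<in> {0,1,2}"
        using pq(1,2) unfolding e mem_Sigma_iff prod.case by blast+
      have x12: "x \<in> residue_class_9 (Eis (1 + 3 * u) (3 * v))" "x \<in> residue_class_9 (Eis (1 + 3 * u') (3 * v'))"
        using x unfolding e by (simp_all only: prod.case Int_iff mem_Collect_eq)
      show False using residue_classes_disjoint[OF uv x12] pq(3) unfolding e by simp
    qed
  qed simp
  also have "\<dots> = (\<Sum>(u,v)\<in>{0,1,2}\<times>{0,1,2}. zeta3 powi (j * u + k * v) *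
     of_nat (card {x \<in> residue_class_9 (Eis (1 + 3 * u) (3 * v)). eis_norm x \<le> int n}))"
  proof (intro sum.cong refl)
    fix p :: "int \<times> int"
    obtain u v where p: "p = (u, v)" by (cases p)
    let ?S = "{x \<in> residue_class_9 (Eis (1 + 3 * u) (3 * v)). eis_norm x \<le> int n}"
    have "(\<Sum>x\<in>?S. cubic_char j k x) = (\<Sum>x\<in>?S. zeta3 powi (j * u + k * v))"
      by (intro sum.cong refl) (simp add: cubic_char_residue_class(2))
    also have "\<dots> = zeta3 powi (j * u + k * v) * of_nat (card ?S)" by simp
    finally show "(\<Sum>x\<in>(case p of (u,v) \<Rightarrow> {x \<in> residue_class_9 (Eis (1 + 3 * u) (3 * v)). eis_norm x \<le> int n}). cubic_char j k x) =
      (case p of (u,v) \<Rightarrow> zeta3 powi (j * u + k * v) *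
     of_nat (card {x \<in> residue_class_9 (Eis (1 + 3 * u) (3 * v)). eis_norm x \<le> int n}))"
      unfolding p by (simp only: prod.case)
  qed
  finally show ?thesis .
qed

text \<open>All residue classes contain the same number of elements up to \<open>O(\<surd>n)\<close>, so the sum of a character over
  the nine primary classes keeps a main term only if the character is trivial.\<close>
lemma cubic_char_mean_value:
  obtains C K :: real where "C > 0"
    "\<And>j k n. norm ((\<Sum>m=1..n. norm_sum (cubic_char j k) m) - (if 3 dvd j \<and> 3 dvd k then of_real C else 0) * of_nat n) \<le> K * sqrt (real n)"
proof -
  obtain C K where C: "C > 0" and K: "\<And>c n. n > 0 \<Longrightarrow>
    \<bar>real (card {x \<in> residue_class_9 c. eis_norm x \<le> int n}) - C * real n\<bar> \<le> K * sqrt (real n)"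
    using count_residue_class_9 by blast
  have "norm ((\<Sum>m=1..n. norm_sum (cubic_char j k) m) - (if 3 dvd j \<and> 3 dvd k then of_real (9 * C) else 0) * of_nat n) \<le> (9 * K) * sqrt (real n)" for j k n
  proof (cases "n = 0")
    case False
    define R where "R p = (case p of (u,v) \<Rightarrow> real (card {x \<in> residue_class_9 (Eis (1 + 3 * u) (3 * v)). eis_norm x \<le> int n}))" for p
    define W where "W p = (case p of (u,v) \<Rightarrow> zeta3 powi (j * u + k * v))" for p :: "int \<times> int"
    let ?P = "{0,1,2::int} \<times> {0,1,2::int}"
    have Wsum: "(\<Sum>p\<in>?P. W p) = (if 3 dvd j \<and> 3 dvd k then 9 else 0)"
    proof -
      have "(\<Sum>p\<in>?P. W p) = (\<Sum>u\<in>{0,1,2}. \<Sum>v\<in>{0,1,2}. zeta3 powi (j * u) * zeta3 powi (k * v))"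
        unfolding sum.cartesian_product W_def using zeta3_nz by (intro sum.cong) (auto simp: power_int_add)
      also have "\<dots> = (\<Sum>u\<in>{0,1,2}. zeta3 powi (j * u)) * (\<Sum>v\<in>{0,1,2}. zeta3 powi (k * v))"
        by (rule sum_product[symmetric])
      finally show ?thesis unfolding zeta3_powi_sum by simp
    qed
    have "(\<Sum>m=1..n. norm_sum (cubic_char j k) m) = (\<Sum>p\<in>?P. W p * of_real (R p))"
      unfolding sum_cubic_char by (intro sum.cong) (auto simp: W_def R_def)
    moreover have "(if 3 dvd j \<and> 3 dvd k then of_real (9 * C) else 0) * of_nat n = (\<Sum>p\<in>?P. W p * of_real (C * real n))"
      unfolding sum_distrib_right[symmetric] Wsum by simp
    ultimately have "(\<Sum>m=1..n. norm_sum (cubic_char j k) m) - (if 3 dvd j \<and> 3 dvd k then of_real (9 * C) else 0) * of_nat n =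
       (\<Sum>p\<in>?P. W p * of_real (R p - C * real n))"
      by (simp only: of_real_diff right_diff_distrib sum_subtractf)
    also have "norm \<dots> \<le> (\<Sum>p\<in>?P. K * sqrt (real n))"
    proof (intro sum_norm_le)
      fix p assume "p \<in> ?P"
      have "norm (W p * of_real (R p - C * real n)) = \<bar>R p - C * real n\<bar>"
        unfolding norm_mult norm_of_real by (simp add: W_def norm_zeta3_powi split: prod.split)
      also have "\<dots> \<le> K * sqrt (real n)" using K False by (auto simp: R_def split: prod.split)
      finally show "norm (W p * of_real (R p - C * real n)) \<le> K * sqrt (real n)" .
    qed
    also have "\<dots> = (9 * K) * sqrt (real n)" by (simp add: card_cartesian_product)
    finally show ?thesis .
  qed simp
  thus ?thesis using that[of "9 * C" "9 * K"] C by simp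
qed

section \<open>The cubic character of 3\<close>

definition eis_omega :: eis where "eis_omega = Eis 0 1"

lemma eis_omega_power3: "eis_omega ^ 3 = 1"
  by (simp add: eis_omega_def power3_eq_cube eis_eq_iff)

lemma eis_omega_power_mod: "eis_omega ^ k = eis_omega ^ (k mod 3)"
proof -
  have "eis_omega ^ k = eis_omega ^ (3 * (k div 3) + k mod 3)" by simp
  also have "\<dots> = eis_omega ^ (k mod 3)"
    unfolding power_add power_mult eis_omega_power3 by simp
  finally show ?thesis .
qed

lemma eis_omega_power_cases: "eis_omega ^ k \<in> {Eis 1 0, Eis 0 1, Eis (-1) (-1)}"
proof -
  have "k mod 3 \<in> {0,1,2}" by auto
  thus ?thesis unfolding eis_omega_power_mod[of k]
    by (auto simp: eis_omega_def power2_eq_square eis_eq_iff)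
qed

lemma eis_omega_neq: "eis_omega \<noteq> 0" "eis_omega \<noteq> 1" "eis_omega\<^sup>2 \<noteq> 1"
  by (simp_all add: eis_omega_def power2_eq_square eis_eq_iff)

text \<open>On the cube roots of unity the second coordinate modulo 3 is a discrete logarithm.\<close>
lemma eb_cube_root_mult:
  assumes "x \<in> {Eis 1 0, Eis 0 1, Eis (-1) (-1)}" "y \<in> {Eis 1 0, Eis 0 1, Eis (-1) (-1)}"
  shows "[eb (x * y) = eb x + eb y] (mod 3)" "x * y \<in> {Eis 1 0, Eis 0 1, Eis (-1) (-1)}"
  using assms by (auto simp: times_eis_def cong_iff_dvd_diff)

lemma eb_cube_root_prod:
  assumes "\<And>i. i \<in> A \<Longrightarrow> f i \<in> {Eis 1 0, Eis 0 1, Eis (-1) (-1)}"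
  shows "[eb (\<Prod>i\<in>A. f i) = (\<Sum>i\<in>A. eb (f i))] (mod 3) \<and> (\<Prod>i\<in>A. f i) \<in> {Eis 1 0, Eis 0 1, Eis (-1) (-1)}"
  using assms
proof (induction A rule: infinite_finite_induct)
  case (insert a A)
  have IH: "[eb (\<Prod>i\<in>A. f i) = (\<Sum>i\<in>A. eb (f i))] (mod 3)" "(\<Prod>i\<in>A. f i) \<in> {Eis 1 0, Eis 0 1, Eis (-1) (-1)}"
    using insert by blast+
  note m = eb_cube_root_mult[OF insert.prems[OF insertI1] IH(2)]
  have "[eb (f a * (\<Prod>i\<in>A. f i)) = eb (f a) + (\<Sum>i\<in>A. eb (f i))] (mod 3)"
    using cong_trans[OF m(1) cong_add[OF cong_refl IH(1)]] .
  thus ?case using insert.hyps m(2) by simp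
qed (auto simp: one_eis_def)

lemma eb_sum: "eb (\<Sum>i\<in>A. f i) = (\<Sum>i\<in>A. eb (f i))" and ea_sum: "ea (\<Sum>i\<in>A. f i) = (\<Sum>i\<in>A. ea (f i))"
  by (induction A rule: infinite_finite_induct) auto

text \<open>Lagrange: a polynomial with more roots modulo \<open>p\<close> than its degree vanishes identically modulo \<open>p\<close>.\<close>
lemma poly_roots_mod_prime:
  fixes f :: "int poly"
  assumes "prime p" "finite A" "degree f < card A"
    and "\<And>a. a \<in> A \<Longrightarrow> p dvd poly f a"
    and "\<And>a b. a \<in> A \<Longrightarrow> b \<in> A \<Longrightarrow> a \<noteq> b \<Longrightarrow> \<not> p dvd (a - b)"
  shows "p dvd poly f x"
  using assms(2-)
proof (induction A arbitrary: f x rule: finite_induct)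
  case (insert a B)
  define q where "q = synthetic_div f a"
  have f: "poly f y = (y - a) * poly q y + poly f a" for y
  proof -
    have "poly f y = poly ([:-a, 1:] * q + [:poly f a:]) y"
      unfolding q_def synthetic_div_correct' ..
    thus ?thesis by (simp add: algebra_simps)
  qed
  have pa: "p dvd poly f a" using insert.prems(2) by blast
  have "p dvd poly q x"
  proof (cases "degree f = 0")
    case True
    hence "q = 0" by (simp add: q_def synthetic_div_eq_0_iff)
    thus ?thesis by simp
  next
    case False
    show ?thesis
    proof (rule insert.IH)
      show "degree q < card B"
        using insert.prems(1) insert.hyps False by (simp add: q_def degree_synthetic_div)
      fix b assume b: "b \<in> B"
      have "p dvd poly f b" using insert.prems(2) b by blast
      hence "p dvd (b - a) * poly q b" using pa f[of b] by (metis dvd_add_left_iff)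
      moreover have "\<not> p dvd (b - a)" using insert.prems(3)[of b a] insert.hyps b by auto
      ultimately show "p dvd poly q b" using assms(1) by (simp add: prime_dvd_mult_iff)
    next
      fix b c assume "b \<in> B" "c \<in> B" "b \<noteq> c"
      thus "\<not> p dvd (b - c)" using insert.prems(3) by blast
    qed
  qed
  thus ?case using pa f[of x] by simp
qed simp

text \<open>If \<open>A\<close> is the full set of \<open>n\<close>-th roots of unity modulo \<open>p\<close>, then \<open>X\<^sup>n - 1\<close> is the product of \<open>X - a\<close>; divide
  by \<open>X - 1\<close> and put \<open>X = 1\<close>.\<close>
lemma prod_one_minus_nth_roots:
  fixes p :: int
  assumes p: "prime p" and A: "finite A" "card A = n" "1 \<in> A"
    and roots: "\<And>a. a \<in> A \<Longrightarrow> [a ^ n = 1] (mod p)"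
    and distinct: "\<And>a b. a \<in> A \<Longrightarrow> b \<in> A \<Longrightarrow> a \<noteq> b \<Longrightarrow> \<not> p dvd (a - b)"
  shows "[(\<Prod>a\<in>A - {1}. 1 - a) = int n] (mod p)"
proof (cases "n = 1")
  case True
  hence "A = {1}" using A by (metis card_1_singletonE singletonD)
  thus ?thesis using True by simp
next
  case False
  define B where "B = A - {1}"
  have B: "finite B" "card B = n - 1" using A by (auto simp: B_def)
  have n: "n \<ge> 2" using A False card_gt_0_iff[of A] by auto
  define P where "P = (\<Prod>a\<in>B. [:-a, 1:])"
  define Q where "Q = (\<Sum>i<n. monom (1::int) i)"
  have degP: "degree P = n - 1" unfolding P_def using B by (subst degree_prod_sum_eq) auto
  have leadP: "coeff P (n - 1) = 1"
  proof -
    have "lead_coeff P = 1" unfolding P_def lead_coeff_prod by simp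
    thus ?thesis by (simp add: degP)
  qed
  have coeffQ: "coeff Q k = (if k < n then 1 else 0)" for k
    by (simp add: Q_def coeff_sum)
  have "degree (P - Q) < card B"
    unfolding B(2)
  proof (rule degree_lessI)
    show "P - Q \<noteq> 0 \<or> n - 1 > 0" using n by simp
    show "\<forall>k\<ge>n - 1. coeff (P - Q) k = 0"
    proof (intro allI impI)
      fix k assume k: "k \<ge> n - 1"
      show "coeff (P - Q) k = 0"
      proof (cases "k = n - 1")
        case True
        thus ?thesis using leadP n by (simp add: coeffQ)
      next
        case False
        hence "degree P < k" "\<not> k < n" using k degP by auto
        thus ?thesis by (simp add: coeffQ coeff_eq_0)
      qed
    qed
  qed
  hence "p dvd poly (P - Q) 1"
  proof (rule poly_roots_mod_prime[OF p B(1)])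
    fix a assume a: "a \<in> B"
    have "poly P a = 0" using a B by (auto simp: P_def poly_prod)
    moreover have "p dvd poly Q a"
    proof -
      have "(a - 1) * poly Q a = a ^ n - 1"
        by (simp add: Q_def poly_sum poly_monom power_diff_1_eq)
      moreover have "p dvd a ^ n - 1" using roots[of a] a by (simp add: B_def cong_iff_dvd_diff)
      moreover have "\<not> p dvd (a - 1)" using distinct[of a 1] a A by (auto simp: B_def)
      ultimately show ?thesis using p by (metis prime_dvd_mult_iff)
    qed
    ultimately show "p dvd poly (P - Q) a" by simp
  next
    fix a b assume "a \<in> B" "b \<in> B" "a \<noteq> b"
    thus "\<not> p dvd (a - b)" using distinct by (auto simp: B_def)
  qed
  moreover have "poly P 1 = (\<Prod>a\<in>A - {1}. 1 - a)" by (simp add: P_def B_def poly_prod)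
  moreover have "poly Q 1 = int n" by (simp add: Q_def poly_sum poly_monom)
  ultimately show ?thesis by (simp add: cong_iff_dvd_diff)
qed

text \<open>The cubic character that sends the primitive root \<open>g\<close> to \<open>\<omega>\<close>, with values in the Eisenstein integers;
  the condition on \<open>p\<close> makes \<open>\<omega>\<close> to the power of a discrete logarithm well defined.\<close>
locale cubic_character =
  fixes p :: nat and g :: nat
  assumes prime_p: "Factorial_Ring.prime p" and p_mod_3: "p mod 3 = 1" and primroot: "residue_primroot p g"
begin

definition chi :: "int \<Rightarrow> eis" where
  "chi x = (if int p dvd x then 0 else eis_omega ^ (SOME k. [x = int g ^ k] (mod int p)))"

definition fsum :: "(int \<Rightarrow> eis) \<Rightarrow> eis" where "fsum f = (\<Sum>x\<in>{0..<int p}. f x)"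

definition periodic :: "(int \<Rightarrow> eis) \<Rightarrow> bool" where
  "periodic f \<longleftrightarrow> (\<forall>x y. [x = y] (mod int p) \<longrightarrow> f x = f y)"

lemma p_gt_1: "p > 1" using prime_p by (rule prime_gt_1_nat)

lemma int_prime: "Factorial_Ring.prime (int p)" using prime_p by simp

lemma coprime_g: "coprime p g" and ord_g: "residue_primroot p g \<Longrightarrow> [g ^ k = g ^ l] (mod p) \<longleftrightarrow> [k = l] (mod (p - 1))"
  using primroot order_divides_expdiff[of p g k l] totient_prime[OF prime_p]
  by (auto simp: residue_primroot_def)

lemma g_power_cong: "[int g ^ k = int g ^ l] (mod int p) \<longleftrightarrow> [k = l] (mod (p - 1))"
  using ord_g[OF primroot, of k l] cong_int_iff[of "g ^ k" "g ^ l" p] by simp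

lemma not_dvd_g: "\<not> int p dvd int g ^ k"
proof
  assume "int p dvd int g ^ k"
  hence "int p dvd int g" using int_prime prime_dvd_power by blast
  hence "p dvd g" by simp
  thus False using coprime_g p_gt_1 by (metis coprime_absorb_left nat_neq_iff not_is_unit_0 prime_p not_prime_unit)
qed

lemma exists_log:
  assumes "\<not> int p dvd x"
  shows "\<exists>k. [x = int g ^ k] (mod int p)"
proof -
  define y where "y = nat (x mod int p)"
  have y: "int y = x mod int p" using p_gt_1 by (simp add: y_def)
  have "y < p" using y p_gt_1 by (metis of_nat_0_less_iff of_nat_less_iff pos_mod_bound prime_gt_0_nat prime_p)
  moreover have "y \<noteq> 0" using y assms by (auto simp: dvd_eq_mod_eq_0)
  ultimately have "y \<in> totatives p" using prime_p by (simp add: totatives_prime)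
  also have "totatives p = (\<lambda>i. g ^ i mod p) ` {..<totient p}"
    using residue_primroot_is_generator[OF p_gt_1 primroot] by (simp add: bij_betw_def)
  finally obtain k where "y = g ^ k mod p" by auto
  hence "int y = int g ^ k mod int p" by (simp add: zmod_int)
  thus ?thesis using y unfolding Cong.cong_def by (intro exI[of _ k]) simp
qed

lemma three_dvd: "3 dvd p - 1"
  using p_mod_3 by presburger

lemma chi_g_power:
  assumes "[x = int g ^ k] (mod int p)"
  shows "chi x = eis_omega ^ k"
proof -
  define l where "l = (SOME l. [x = int g ^ l] (mod int p))"
  have l: "[x = int g ^ l] (mod int p)" unfolding l_def
    by (rule someI[of "\<lambda>l. [x = int g ^ l] (mod int p)", OF assms])
  hence "[int g ^ k = int g ^ l] (mod int p)" using assms cong_sym cong_trans by blast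
  hence "[k = l] (mod (p - 1))" by (simp only: g_power_cong)
  hence "[k = l] (mod 3)" using three_dvd by (rule cong_dvd_modulus_nat)
  hence "eis_omega ^ k = eis_omega ^ l" by (metis Cong.cong_def eis_omega_power_mod)
  moreover have "\<not> int p dvd x" using not_dvd_g cong_dvd_iff[OF assms] by simp
  ultimately show ?thesis by (simp add: chi_def l_def)
qed

lemma chi_0_iff: "chi x = 0 \<longleftrightarrow> int p dvd x"
  using eis_omega_neq(1) by (auto simp: chi_def)

lemma chi_cong: "[x = y] (mod int p) \<Longrightarrow> chi x = chi y"
proof (cases "int p dvd x")
  case True
  assume "[x = y] (mod int p)"
  hence "int p dvd y" using True cong_dvd_iff by blast
  thus ?thesis using True chi_0_iff by metis
next
  case False
  assume c: "[x = y] (mod int p)"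
  obtain k where k: "[x = int g ^ k] (mod int p)" using exists_log[OF False] by blast
  hence "[y = int g ^ k] (mod int p)" using c cong_sym cong_trans by blast
  thus ?thesis using k chi_g_power by metis
qed

lemma chi_mult: "chi (x * y) = chi x * chi y"
proof (cases "int p dvd x \<or> int p dvd y")
  case True
  hence "int p dvd x * y" by auto
  thus ?thesis using True chi_0_iff by (metis mult_eq_0_iff)
next
  case False
  obtain k l where kl: "[x = int g ^ k] (mod int p)" "[y = int g ^ l] (mod int p)"
    using exists_log False by blast
  have "[x * y = int g ^ (k + l)] (mod int p)" using cong_mult[OF kl] by (simp add: power_add)
  thus ?thesis using kl chi_g_power by (metis power_add)
qed

lemma chi_cases: "\<not> int p dvd x \<Longrightarrow> chi x \<in> {Eis 1 0, Eis 0 1, Eis (-1) (-1)}"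
  unfolding chi_def using eis_omega_power_cases by simp

lemma chi_cube: "\<not> int p dvd x \<Longrightarrow> chi x ^ 3 = 1"
  unfolding chi_def by (simp add: power_mult[symmetric] mult.commute) (simp add: power_mult eis_omega_power3)

lemma chi_1: "chi 1 = 1"
  using chi_g_power[of 1 0] by simp

lemma chi_minus_1: "chi (-1) = 1"
proof -
  have "\<not> int p dvd -1" using p_gt_1 by simp
  hence "chi (-1) ^ 3 = 1" by (rule chi_cube)
  moreover have "chi (-1) * chi (-1) = 1" using chi_mult[of "-1" "-1"] chi_1 by simp
  ultimately show ?thesis by (simp add: power3_eq_cube)
qed

lemma periodic_chi: "periodic chi"
  unfolding periodic_def using chi_cong by blast

lemma fsum_affine:
  assumes f: "periodic f" and a: "\<not> int p dvd a"
  shows "fsum (\<lambda>x. f (a * x + b)) = fsum f"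
proof -
  define h where "h x = (a * x + b) mod int p" for x
  have p0: "int p > 0" using p_gt_1 by simp
  have inj: "inj_on h {0..<int p}"
  proof (rule inj_onI)
    fix x y assume xy: "x \<in> {0..<int p}" "y \<in> {0..<int p}" "h x = h y"
    hence "int p dvd (a * x + b) - (a * y + b)" by (simp add: h_def mod_eq_dvd_iff)
    hence "int p dvd a * (x - y)" by (simp add: algebra_simps)
    hence "int p dvd (x - y)" using a int_prime by (simp add: prime_dvd_mult_iff)
    hence "x mod int p = y mod int p" by (simp add: mod_eq_dvd_iff)
    thus "x = y" using xy by simp
  qed
  have img: "h ` {0..<int p} = {0..<int p}"
    using p0 by (intro endo_inj_surj inj) (auto simp: h_def)
  have "fsum (\<lambda>x. f (a * x + b)) = (\<Sum>x\<in>{0..<int p}. f (h x))"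
    unfolding fsum_def
  proof (intro sum.cong refl)
    fix x
    have "[a * x + b = h x] (mod int p)" by (simp add: h_def Cong.cong_def)
    thus "f (a * x + b) = f (h x)" using f unfolding periodic_def by simp
  qed
  also have "\<dots> = (\<Sum>x\<in>h ` {0..<int p}. f x)" using inj by (simp add: sum.reindex)
  finally show ?thesis by (simp add: img fsum_def)
qed

lemma residues_split: "{0..<int p} = insert 0 {1..<int p}"
  using p_gt_1 by auto

lemma fsum_split: "fsum f = f 0 + (\<Sum>x\<in>{1..<int p}. f x)"
  unfolding fsum_def residues_split by simp

lemma fsum_nonzero: "(\<Sum>x\<in>{1..<int p}. f x) = fsum f - f 0"
  by (simp add: fsum_split)

lemma not_dvd_residue: "x \<in> {1..<int p} \<Longrightarrow> \<not> int p dvd x"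
  using zdvd_not_zless by auto

lemma fsum_chi_power:
  assumes "\<not> 3 dvd k"
  shows "fsum (\<lambda>x. chi x ^ k) = 0"
proof -
  have per: "periodic (\<lambda>x. chi x ^ k)" unfolding periodic_def using chi_cong by metis
  have "fsum (\<lambda>x. chi x ^ k) = fsum (\<lambda>x. chi (int g * x + 0) ^ k)"
    using fsum_affine[OF per, of "int g" 0] not_dvd_g[of 1] by simp
  also have "\<dots> = chi (int g) ^ k * fsum (\<lambda>x. chi x ^ k)"
    by (simp add: fsum_def chi_mult power_mult_distrib sum_distrib_left)
  also have "chi (int g) = eis_omega" using chi_g_power[of "int g" 1] by simp
  finally have "(1 - eis_omega ^ k) * fsum (\<lambda>x. chi x ^ k) = 0" by (simp add: algebra_simps)
  moreover have "eis_omega ^ k \<noteq> 1"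
  proof -
    have "k mod 3 = 1 \<or> k mod 3 = 2" using assms by presburger
    thus ?thesis unfolding eis_omega_power_mod[of k] using eis_omega_neq by auto
  qed
  ultimately show ?thesis by simp
qed

text \<open>Fermat's formula for the inverse modulo \<open>p\<close>.\<close>
definition minv :: "int \<Rightarrow> int" where "minv x = x ^ (p - 2) mod int p"

lemma minv: "\<not> int p dvd x \<Longrightarrow> [x * minv x = 1] (mod int p)"
proof -
  assume x: "\<not> int p dvd x"
  obtain k where k: "[x = int g ^ k] (mod int p)" using exists_log[OF x] by blast
  have "p - 1 = Suc (p - 2)" using p_gt_1 by simp
  hence "x * x ^ (p - 2) = x ^ (p - 1)" by simp
  moreover have "[x ^ (p - 1) = int g ^ (k * (p - 1))] (mod int p)"
    using cong_pow[OF k, of "p - 1"] by (simp add: power_mult)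
  moreover have "[int g ^ (k * (p - 1)) = int g ^ 0] (mod int p)"
    unfolding g_power_cong by (simp add: cong_0_iff)
  ultimately have "[x * x ^ (p - 2) = 1] (mod int p)" using cong_trans by simp
  thus ?thesis by (simp add: minv_def Cong.cong_def mod_mult_right_eq)
qed

lemma minv_residue: "x \<in> {1..<int p} \<Longrightarrow> minv x \<in> {1..<int p}"
proof -
  assume x: "x \<in> {1..<int p}"
  have "\<not> int p dvd minv x"
  proof
    assume "int p dvd minv x"
    hence "[0 = x * minv x] (mod int p)" by (simp add: cong_iff_dvd_diff)
    hence "[0 = 1] (mod int p)" using minv[OF not_dvd_residue[OF x]] cong_trans by blast
    thus False using p_gt_1 by (simp add: cong_iff_dvd_diff)
  qed
  hence "minv x \<noteq> 0" by auto
  moreover have "0 \<le> minv x" "minv x < int p" using p_gt_1 by (auto simp: minv_def)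
  ultimately show ?thesis by simp
qed

lemma sum_minv: "(\<Sum>x\<in>{1..<int p}. f (minv x)) = (\<Sum>x\<in>{1..<int p}. f x :: eis)"
proof -
  have inj: "inj_on minv {1..<int p}"
  proof (rule inj_onI)
    fix x y assume xy: "x \<in> {1..<int p}" "y \<in> {1..<int p}" "minv x = minv y"
    note m = minv[OF not_dvd_residue[OF xy(1)]] minv[OF not_dvd_residue[OF xy(2)]]
    have c: "[x * (y * minv y) = x * 1] (mod int p)" "[y * (x * minv x) = y * 1] (mod int p)"
      by (rule cong_mult[OF cong_refl m(2)], rule cong_mult[OF cong_refl m(1)])
    have "x * (y * minv y) = y * (x * minv x)" using xy(3) by simp
    hence "[x * 1 = y * (x * minv x)] (mod int p)" using cong_sym[OF c(1)] by (simp only:)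
    hence "[x * 1 = y * 1] (mod int p)" using c(2) by (rule cong_trans)
    hence "[x = y] (mod int p)" by simp
    thus "x = y" using xy(1,2) by (simp add: Cong.cong_def)
  qed
  have img: "minv ` {1..<int p} = {1..<int p}"
    using minv_residue by (intro endo_inj_surj inj) auto
  have "(\<Sum>x\<in>{1..<int p}. f (minv x)) = (\<Sum>x\<in>minv ` {1..<int p}. f x)" using inj by (simp add: sum.reindex)
  thus ?thesis by (simp only: img)
qed

lemma chi_minv: "\<not> int p dvd x \<Longrightarrow> chi (minv x) = chi x ^ 2"
proof -
  assume x: "\<not> int p dvd x"
  have "chi x * chi (minv x) = 1"
    using chi_cong[OF minv[OF x]] by (simp add: chi_mult chi_1)
  moreover have "chi x * chi x ^ 2 = 1" using chi_cube[OF x] by (simp add: power3_eq_cube power2_eq_square mult.assoc)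
  ultimately have "chi x * chi (minv x) = chi x * chi x ^ 2" by simp
  moreover have "chi x \<noteq> 0" using x chi_0_iff by simp
  ultimately show ?thesis by simp
qed

lemma cnj_chi: "eis_cnj (chi x) = chi x ^ 2"
proof (cases "int p dvd x")
  case True
  hence "chi x = 0" by (simp add: chi_0_iff)
  moreover have "eis_cnj 0 = 0\<^sup>2" by (simp add: eis_eq_iff)
  ultimately show ?thesis by simp
next
  case False
  from chi_cases[OF this] show ?thesis
    by (auto simp: eis_eq_iff power2_eq_square)
qed

definition jacobi :: eis where "jacobi = fsum (\<lambda>x. chi x * chi (1 - x))"

lemma eis_cnj_sum: "eis_cnj (\<Sum>i\<in>A. f i) = (\<Sum>i\<in>A. eis_cnj (f i))"
  by (induction A rule: infinite_finite_induct) (auto simp: eis_eq_iff)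

text \<open>The inner sum of the product of the Jacobi sum and its conjugate. For \<open>t\<close> other than 1 the quotient
  \<open>(1 - ty) / (1 - y)\<close> takes each value except \<open>t\<close> once, so the sum of all character values lacks only \<open>\<chi>(t)\<close>.\<close>
lemma jacobi_inner_sum:
  "fsum (\<lambda>y. chi (1 - t * y) * chi (1 - y) ^ 2) = (if int p dvd (1 - t) then of_nat p else 0) - chi t"
proof -
  have per: "periodic (\<lambda>y. chi (1 - t * y) * chi (1 - y) ^ 2)"
    unfolding periodic_def
  proof (intro allI impI)
    fix y z assume c: "[y = z] (mod int p)"
    have "chi (1 - t * y) = chi (1 - t * z)" by (rule chi_cong[OF cong_diff[OF cong_refl cong_mult[OF cong_refl c]]])
    moreover have "chi (1 - y) = chi (1 - z)" by (rule chi_cong[OF cong_diff[OF cong_refl c]])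
    ultimately show "chi (1 - t * y) * chi (1 - y) ^ 2 = chi (1 - t * z) * chi (1 - z) ^ 2" by simp
  qed
  have "fsum (\<lambda>y. chi (1 - t * y) * chi (1 - y) ^ 2) = fsum (\<lambda>y. chi (1 - t * (-1 * y + 1)) * chi (1 - (-1 * y + 1)) ^ 2)"
    using fsum_affine[OF per, of "-1" 1] p_gt_1 by simp
  also have "\<dots> = fsum (\<lambda>y. chi (1 - t + t * y) * chi y ^ 2)"
    by (simp add: algebra_simps)
  also have "\<dots> = (\<Sum>y\<in>{1..<int p}. chi (1 - t + t * y) * chi y ^ 2)"
    by (simp add: fsum_split chi_0_iff)
  also have "\<dots> = (\<Sum>y\<in>{1..<int p}. chi ((1 - t) * minv y + t))"
  proof (intro sum.cong refl)
    fix y assume "y \<in> {1..<int p}"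
    hence y: "\<not> int p dvd y" by (rule not_dvd_residue)
    have "[(1 - t) * minv y + t * (y * minv y) = (1 - t) * minv y + t * 1] (mod int p)"
      by (rule cong_add[OF cong_refl cong_mult[OF cong_refl minv[OF y]]])
    from chi_cong[OF this] have "chi ((1 - t) * minv y + t) = chi ((1 - t) * minv y + t * (y * minv y))"
      by simp
    also have "(1 - t) * minv y + t * (y * minv y) = (1 - t + t * y) * minv y"
      by (simp add: algebra_simps)
    finally have "chi ((1 - t) * minv y + t) = chi ((1 - t + t * y) * minv y)" .
    thus "chi (1 - t + t * y) * chi y ^ 2 = chi ((1 - t) * minv y + t)"
      by (simp only: chi_mult chi_minv[OF y])
  qed
  also have "\<dots> = (\<Sum>u\<in>{1..<int p}. chi ((1 - t) * u + t))" by (rule sum_minv)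
  also have "\<dots> = fsum (\<lambda>u. chi ((1 - t) * u + t)) - chi t" by (simp add: fsum_nonzero)
  also have "fsum (\<lambda>u. chi ((1 - t) * u + t)) = (if int p dvd (1 - t) then of_nat p else 0)"
  proof (cases "int p dvd (1 - t)")
    case True
    have "chi ((1 - t) * u + t) = 1" for u
    proof -
      have "int p dvd (1 - t) * (u - 1)" using True by (rule dvd_mult2)
      hence "[(1 - t) * u + t = 1] (mod int p)" by (simp add: cong_iff_dvd_diff algebra_simps)
      thus ?thesis using chi_cong chi_1 by metis
    qed
    thus ?thesis using True by (simp add: fsum_def)
  next
    case False
    thus ?thesis using fsum_affine[OF periodic_chi False, of t] fsum_chi_power[of 1] by simp
  qed
  finally show ?thesis .
qed

text \<open>The substitution \<open>x = t y\<close> reduces the product with the conjugate to \<open>jacobi_inner_sum\<close>; of the remaining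
  character sums only the term \<open>t = 1\<close> is left.\<close>
lemma eis_norm_jacobi: "eis_norm jacobi = int p"
proof -
  have "jacobi * eis_cnj jacobi = fsum (\<lambda>y. fsum (\<lambda>x. chi x * chi (1 - x) * (chi y ^ 2 * chi (1 - y) ^ 2)))"
    unfolding jacobi_def fsum_def eis_cnj_sum eis_cnj_mult cnj_chi sum_product
    by (rule sum.swap)
  also have "\<dots> = (\<Sum>y\<in>{1..<int p}. fsum (\<lambda>t. chi t * (chi (1 - t * y) * chi (1 - y) ^ 2)))"
  proof -
    have eq: "fsum (\<lambda>x. chi x * chi (1 - x) * (chi y ^ 2 * chi (1 - y) ^ 2)) =
        fsum (\<lambda>t. chi t * (chi (1 - t * y) * chi (1 - y) ^ 2))" if "y \<in> {1..<int p}" for y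
    proof -
      have y: "\<not> int p dvd y" using that by (rule not_dvd_residue)
      have per: "periodic (\<lambda>x. chi x * chi (1 - x) * (chi y ^ 2 * chi (1 - y) ^ 2))"
        unfolding periodic_def by (metis chi_cong cong_diff cong_refl)
      have "fsum (\<lambda>x. chi x * chi (1 - x) * (chi y ^ 2 * chi (1 - y) ^ 2)) =
        fsum (\<lambda>t. chi (y * t + 0) * chi (1 - (y * t + 0)) * (chi y ^ 2 * chi (1 - y) ^ 2))"
        using fsum_affine[OF per y, of 0] by simp
      also have "\<dots> = fsum (\<lambda>t. chi t * (chi (1 - t * y) * chi (1 - y) ^ 2))"
        unfolding fsum_def
      proof (intro sum.cong refl)
        fix t
        have "chi (y * t + 0) * chi (1 - (y * t + 0)) * (chi y ^ 2 * chi (1 - y) ^ 2) =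
          chi y ^ 3 * (chi t * (chi (1 - t * y) * chi (1 - y) ^ 2))"
          by (simp add: chi_mult power3_eq_cube power2_eq_square mult_ac)
        thus "chi (y * t + 0) * chi (1 - (y * t + 0)) * (chi y ^ 2 * chi (1 - y) ^ 2) =
          chi t * (chi (1 - t * y) * chi (1 - y) ^ 2)" by (simp add: chi_cube[OF y])
      qed
      finally show ?thesis .
    qed
    have z: "fsum (\<lambda>x. chi x * chi (1 - x) * (chi 0 ^ 2 * chi (1 - 0) ^ 2)) = 0"
      using chi_0_iff[of 0] by (simp add: fsum_def)
    show ?thesis
      by (subst fsum_split) (simp only: z add_0, intro sum.cong refl eq)
  qed
  also have "\<dots> = fsum (\<lambda>t. chi t * (\<Sum>y\<in>{1..<int p}. chi (1 - t * y) * chi (1 - y) ^ 2))"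
    unfolding fsum_def by (subst sum.swap) (simp add: sum_distrib_left)
  also have "\<dots> = fsum (\<lambda>t. chi t * ((if int p dvd (1 - t) then of_nat p else 0) - chi t - 1))"
    by (simp add: fsum_nonzero jacobi_inner_sum chi_1)
  also have "\<dots> = fsum (\<lambda>t. chi t * (if int p dvd (1 - t) then of_nat p else 0)) - fsum (\<lambda>t. chi t ^ 2) - fsum (\<lambda>t. chi t ^ 1)"
    by (simp add: fsum_def algebra_simps sum.distrib sum_subtractf power2_eq_square)
  also have "fsum (\<lambda>t. chi t * (if int p dvd (1 - t) then of_nat p else 0)) = of_nat p"
  proof -
    have "int p dvd (1 - t) \<longleftrightarrow> t = 1" if "t \<in> {0..<int p}" for t
    proof
      assume "int p dvd (1 - t)"
      hence "1 mod int p = t mod int p" by (simp add: mod_eq_dvd_iff)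
      thus "t = 1" using that p_gt_1 by simp
    qed simp
    hence "fsum (\<lambda>t. chi t * (if int p dvd (1 - t) then of_nat p else 0)) = (\<Sum>t\<in>{0..<int p}. if t = 1 then of_nat p else 0)"
      unfolding fsum_def by (intro sum.cong refl) (auto simp: chi_1)
    thus ?thesis using p_gt_1 by simp
  qed
  finally have "jacobi * eis_cnj jacobi = of_nat p"
    using fsum_chi_power[of 1] fsum_chi_power[of 2] by simp
  thus ?thesis unfolding eis_mult_cnj by (metis eis_of_int(1) eis_of_nat(1))
qed

definition cubes :: "int set" where "cubes = {c \<in> {1..<int p}. chi c = 1}"

lemma finite_cubes: "finite cubes"
  by (rule finite_subset[of _ "{1..<int p}"]) (auto simp: cubes_def)

lemma three_cubes_indicator:
  assumes "\<not> int p dvd c"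
  shows "1 + chi c + chi c ^ 2 = (if chi c = 1 then 3 else 0)"
  using chi_cases[OF assms] by (auto simp: eis_eq_iff power2_eq_square)

lemma card_cubes: "3 * card cubes = p - 1"
proof -
  have "(\<Sum>c\<in>{1..<int p}. 1 + chi c + chi c ^ 2) = (\<Sum>c\<in>{1..<int p}. if chi c = 1 then 3 else 0)"
    using not_dvd_residue three_cubes_indicator by (intro sum.cong refl) blast
  also have "\<dots> = 3 * of_nat (card cubes)"
    by (simp add: sum.If_cases cubes_def Int_def mult.commute)
  also have "(\<Sum>c\<in>{1..<int p}. 1 + chi c + chi c ^ 2) = of_nat (p - 1) + fsum (\<lambda>c. chi c ^ 1) + fsum (\<lambda>c. chi c ^ 2)"
  proof -
    have "chi 0 = 0" "nat (int p - 1) = p - 1" by (simp_all add: chi_0_iff)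
    thus ?thesis by (simp add: sum.distrib fsum_split)
  qed
  finally have "of_nat (p - 1) = (of_nat (3 * card cubes) :: eis)"
    using fsum_chi_power[of 1] fsum_chi_power[of 2] by simp
  thus ?thesis by (metis eis_of_nat(1) of_nat_eq_iff)
qed

text \<open>Average the character over the three cube roots: three times the sum of \<open>\<chi>(1 - c)\<close> over the cubes \<open>c\<close>
  is the sum of \<open>\<chi>(1 - x) (1 + \<chi>(x) + \<chi>(x)\<^sup>2)\<close>, whose parts are \<open>-1\<close>, the Jacobi sum, and \<open>-\<chi>(-1)\<close>.\<close>
lemma jacobi_cubes: "3 * (\<Sum>c\<in>cubes - {1}. chi (1 - c)) = jacobi - 2"
proof -
  have "3 * (\<Sum>c\<in>cubes - {1}. chi (1 - c)) = 3 * (\<Sum>c\<in>cubes. chi (1 - c))"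
  proof -
    have "(\<Sum>c\<in>cubes - {1}. chi (1 - c)) = (\<Sum>c\<in>cubes. chi (1 - c))"
      using finite_cubes by (intro sum.mono_neutral_left) (auto simp: chi_0_iff)
    thus ?thesis by simp
  qed
  also have "\<dots> = (\<Sum>c\<in>{1..<int p}. (if chi c = 1 then 3 else 0) * chi (1 - c))"
    unfolding cubes_def sum_distrib_left by (intro sum.mono_neutral_cong_left) auto
  also have "\<dots> = (\<Sum>c\<in>{1..<int p}. (1 + chi c + chi c ^ 2) * chi (1 - c))"
    using not_dvd_residue three_cubes_indicator by (intro sum.cong refl) simp
  also have "\<dots> = (\<Sum>c\<in>{1..<int p}. chi (1 - c)) + (\<Sum>c\<in>{1..<int p}. chi c * chi (1 - c)) + (\<Sum>c\<in>{1..<int p}. chi c ^ 2 * chi (1 - c))"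
    by (simp add: distrib_right sum.distrib)
  also have "(\<Sum>c\<in>{1..<int p}. chi c * chi (1 - c)) = jacobi"
    by (simp add: jacobi_def fsum_split chi_0_iff)
  also have "(\<Sum>c\<in>{1..<int p}. chi (1 - c)) = -1"
  proof -
    have "fsum (\<lambda>c. chi (-1 * c + 1)) = fsum (\<lambda>c. chi c ^ 1)"
      using fsum_affine[OF periodic_chi, of "-1" 1] p_gt_1 by simp
    thus ?thesis using fsum_chi_power[of 1] by (simp add: fsum_nonzero chi_1)
  qed
  also have "(\<Sum>c\<in>{1..<int p}. chi c ^ 2 * chi (1 - c)) = -1"
  proof -
    have "(\<Sum>c\<in>{1..<int p}. chi c ^ 2 * chi (1 - c)) = (\<Sum>c\<in>{1..<int p}. chi (minv c - 1))"
    proof (intro sum.cong refl)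
      fix c assume "c \<in> {1..<int p}"
      hence c: "\<not> int p dvd c" by (rule not_dvd_residue)
      have "[minv c - c * minv c = minv c - 1] (mod int p)" by (rule cong_diff[OF cong_refl minv[OF c]])
      from chi_cong[OF this] have "chi (minv c * (1 - c)) = chi (minv c - 1)" by (simp add: algebra_simps)
      thus "chi c ^ 2 * chi (1 - c) = chi (minv c - 1)" by (simp only: chi_mult chi_minv[OF c])
    qed
    also have "\<dots> = (\<Sum>u\<in>{1..<int p}. chi (u - 1))" by (rule sum_minv)
    also have "\<dots> = fsum (\<lambda>u. chi (1 * u + (-1))) - chi (-1)" by (simp add: fsum_nonzero)
    also have "fsum (\<lambda>u. chi (1 * u + (-1))) = fsum (\<lambda>c. chi c ^ 1)"
      using fsum_affine[OF periodic_chi, of 1 "-1"] p_gt_1 by simp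
    finally show ?thesis using fsum_chi_power[of 1] by (simp add: chi_minus_1)
  qed
  finally show ?thesis by (simp add: algebra_simps)
qed

lemma prod_one_minus_cubes: "[(\<Prod>c\<in>cubes - {1}. 1 - c) = int (card cubes)] (mod int p)"
proof (rule prod_one_minus_nth_roots[OF int_prime])
  show "1 \<in> cubes" using p_gt_1 by (simp add: cubes_def chi_1)
  fix a assume a: "a \<in> cubes"
  obtain k where k: "[a = int g ^ k] (mod int p)"
    using exists_log[OF not_dvd_residue] a by (auto simp: cubes_def)
  have "eis_omega ^ k = 1" using a chi_g_power[OF k] by (simp add: cubes_def)
  hence "k mod 3 = 0"
    using eis_omega_power_mod[of k] eis_omega_neq by (cases "k mod 3 = 1"; cases "k mod 3 = 2") auto
  then obtain l where l: "k = 3 * l" by (auto simp: mod_eq_0_iff_dvd)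
  have "[a ^ card cubes = int g ^ (l * (p - 1))] (mod int p)"
    using cong_pow[OF k, of "card cubes"] unfolding l card_cubes[symmetric]
    by (simp add: power_mult[symmetric] mult_ac)
  moreover have "[int g ^ (l * (p - 1)) = int g ^ 0] (mod int p)"
    unfolding g_power_cong by (simp add: cong_0_iff)
  ultimately show "[a ^ card cubes = 1] (mod int p)" using cong_trans by simp
next
  fix a b assume ab: "a \<in> cubes" "b \<in> cubes" "a \<noteq> b"
  show "\<not> int p dvd (a - b)"
  proof
    assume "int p dvd (a - b)"
    hence "a mod int p = b mod int p" by (simp add: mod_eq_dvd_iff)
    thus False using ab by (simp add: cubes_def)
  qed
qed (simp_all add: finite_cubes)

lemma jacobi_primary: "- jacobi \<in> primary"
proof -
  have "jacobi = 2 + 3 * (\<Sum>c\<in>cubes - {1}. chi (1 - c))" using jacobi_cubes by (simp add: algebra_simps)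
  hence "- jacobi = Eis (1 + 3 * (-1 - ea (\<Sum>c\<in>cubes - {1}. chi (1 - c)))) (3 * (- eb (\<Sum>c\<in>cubes - {1}. chi (1 - c))))"
    by (simp add: eis_eq_iff)
  thus ?thesis using primaryI by metis
qed

text \<open>The product of \<open>1 - c\<close> over the nontrivial cubes \<open>c\<close> is \<open>(p - 1) / 3\<close>, whose character is the
  inverse of that of 3; the sum of the characters of the same elements is \<open>(J - 2) / 3\<close>. The discrete
  logarithm links the product to the second coordinate of the sum modulo 3.\<close>
lemma nine_dvd_jacobi_if_chi_3:
  assumes "chi 3 = 1"
  shows "9 dvd eb jacobi"
proof -
  have nd: "\<not> int p dvd 1 - c" if "c \<in> cubes - {1}" for c
  proof
    assume "int p dvd 1 - c"
    hence "1 mod int p = c mod int p" by (simp add: mod_eq_dvd_iff)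
    thus False using that p_gt_1 by (auto simp: cubes_def)
  qed
  have "chi (int (card cubes)) = 1"
  proof -
    have "3 * int (card cubes) = int p - 1" using card_cubes p_gt_1 by linarith
    hence "[3 * int (card cubes) = -1] (mod int p)" by (simp add: cong_iff_dvd_diff)
    hence "chi 3 * chi (int (card cubes)) = 1" using chi_cong chi_minus_1 by (metis chi_mult)
    thus ?thesis using assms by simp
  qed
  hence "chi (\<Prod>c\<in>cubes - {1}. 1 - c) = 1" using chi_cong[OF prod_one_minus_cubes] by simp
  moreover have "chi (\<Prod>c\<in>A. 1 - c) = (\<Prod>c\<in>A. chi (1 - c))" for A
    by (induction A rule: infinite_finite_induct) (auto simp: chi_1 chi_mult)
  ultimately have "(\<Prod>c\<in>cubes - {1}. chi (1 - c)) = 1" by simp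
  moreover have "[eb (\<Prod>c\<in>cubes - {1}. chi (1 - c)) = (\<Sum>c\<in>cubes - {1}. eb (chi (1 - c)))] (mod 3)"
    using eb_cube_root_prod[of "cubes - {1}" "\<lambda>c. chi (1 - c)"] chi_cases[OF nd] by blast
  ultimately have "3 dvd eb (\<Sum>c\<in>cubes - {1}. chi (1 - c))"
    by (simp add: eb_sum cong_iff_dvd_diff)
  then obtain m where "eb (\<Sum>c\<in>cubes - {1}. chi (1 - c)) = 3 * m" by (auto elim: dvdE)
  moreover have "3 * eb (\<Sum>c\<in>cubes - {1}. chi (1 - c)) = eb jacobi"
    using arg_cong[OF jacobi_cubes, of eb] by simp
  ultimately have "eb jacobi = 9 * m" by simp
  thus ?thesis by (rule dvdI)
qed

end

lemma eis_prime_norm_imp_prime: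
  assumes "Factorial_Ring.prime p" "eis_norm x = int p"
  shows "prime_elem x"
proof (rule eis_irreducible_imp_prime)
  have p: "p > 1" using assms(1) by (rule prime_gt_1_nat)
  show "irreducible x"
    unfolding irreducible_def
  proof (intro conjI allI impI)
    show "\<not> x dvd 1" using assms(2) p by (simp add: eis_dvd_1_iff)
    have "eis_norm x \<noteq> 0" using assms(2) p by linarith
    thus "x \<noteq> 0" by simp
    fix a b assume "x = a * b"
    hence "nat (eis_norm a) * nat (eis_norm b) = p"
      using assms(2) eis_norm_nonneg[of a] by (simp add: eis_norm_mult nat_mult_distrib[symmetric])
    hence "nat (eis_norm a) = 1 \<or> nat (eis_norm b) = 1"
      using assms(1) by (metis dvd_triv_left mult_cancel1 nat_mult_1_right not_prime_0 prime_nat_iff)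
    thus "a dvd 1 \<or> b dvd 1" by (auto simp: eis_dvd_1_iff)
  qed
qed

text \<open>Modulo \<open>p\<close> the numbers 3 and \<open>9 = 3\<^sup>2\<close> are cubes together. The negative of the Jacobi sum \<open>J\<close> is primary
  of norm \<open>p\<close>, hence equal to \<open>x\<close> or its conjugate. If 3 were a cube, 9 would divide the second
  coordinate of \<open>J\<close>, hence that of \<open>x\<close>, which is 6 modulo 9.\<close>
theorem nine_not_cube:
  assumes p: "Factorial_Ring.prime p" and x: "x \<in> residue_class_9 (Eis 4 6)" "eis_norm x = int p"
  shows "[p = 1] (mod 9)" "\<not> (\<exists>y. [y ^ 3 = 9] (mod int p))"
proof -
  obtain s t where st: "ea x - 4 = 9 * s" "eb x - 6 = 9 * t"
    using x(1) by (auto simp: residue_class_9_def elim!: dvdE)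
  hence xe: "x = Eis (4 + 9 * s) (6 + 9 * t)" by (simp add: eis_eq_iff)
  have primary: "x \<in> primary"
    using primaryI[of "1 + 3 * s" "2 + 3 * t"] by (simp add: xe algebra_simps)
  have "int p = 1 + 9 * (3 + 2 * s + 8 * t + 9 * s * s - 9 * s * t + 9 * t * t)"
    unfolding x(2)[symmetric] xe eis_norm_def by (simp add: power2_eq_square algebra_simps)
  hence "[int p = int 1] (mod int 9)" by (simp add: cong_iff_dvd_diff)
  thus p9: "[p = 1] (mod 9)" by (simp only: cong_int_iff)
  hence p3: "p mod 3 = 1" by (simp add: Cong.cong_def) presburger
  have "p > 1" using p by (rule prime_gt_1_nat)
  obtain g where g: "residue_primroot p g" using prime_primitive_root_exists[of p] p \<open>p > 1\<close> by blast
  interpret cubic_character p g using p p3 g by unfold_locales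
  show "\<not> (\<exists>y. [y ^ 3 = 9] (mod int p))"
  proof
    assume "\<exists>y. [y ^ 3 = 9] (mod int p)"
    then obtain y where y: "[y ^ 3 = 9] (mod int p)" by blast
    have n3: "\<not> int p dvd 3"
    proof
      assume "int p dvd 3"
      hence "p dvd 3" using int_dvd_int_iff[of p 3] by simp
      hence "p \<le> 3" by (rule dvd_imp_le) simp
      thus False using p3 \<open>p > 1\<close> by (cases "p = 2"; cases "p = 3") auto
    qed
    have e: "chi 9 = chi 3 ^ 2" using chi_mult[of 3 3] by (simp add: power2_eq_square)
    hence "chi 9 \<noteq> 0" using n3 chi_0_iff[of 3] by simp
    moreover have y3: "chi y ^ 3 = chi 9"
      using chi_cong[OF y] by (simp add: power3_eq_cube chi_mult)
    ultimately have "chi y \<noteq> 0" by auto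
    hence "chi 9 = 1" using chi_cube[of y] y3 chi_0_iff[of y] by simp
    hence "chi 3 ^ 2 = 1" using e by simp
    moreover have "chi 3 ^ 3 = 1" using chi_cube[OF n3] .
    ultimately have "chi 3 = 1" by (simp add: power3_eq_cube power2_eq_square)
    hence nine: "9 dvd eb jacobi" by (rule nine_dvd_jacobi_if_chi_3)
    have px: "prime_elem x" using p x(2) by (rule eis_prime_norm_imp_prime)
    have "(- jacobi) * eis_cnj (- jacobi) = of_int (int p)"
      unfolding eis_mult_cnj using eis_norm_jacobi by (simp add: eis_norm_def)
    also have "of_int (int p) = x * eis_cnj x" unfolding eis_mult_cnj x(2) ..
    finally have "x dvd (- jacobi) * eis_cnj (- jacobi)" by simp
    hence "x dvd - jacobi \<or> x dvd eis_cnj (- jacobi)" using px by (rule prime_elem_dvd_multD[rotated])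
    moreover have "x = z" if z: "x dvd z" "z \<in> primary" "eis_norm z = int p" for z
    proof -
      obtain u where u: "z = x * u" using z(1) by (auto elim: dvdE)
      hence "int p * eis_norm u = int p" using z(3) x(2) by (simp add: eis_norm_mult)
      hence "u dvd 1" using \<open>p > 1\<close> by (simp add: eis_dvd_1_iff)
      moreover have "u \<in> primary" using primary_cofactor[OF primary] z(2) u by simp
      ultimately show ?thesis using primary_unit u by simp
    qed
    moreover have "eis_norm (- jacobi) = int p" using eis_norm_jacobi by (simp add: eis_norm_def)
    ultimately have "x = - jacobi \<or> x = eis_cnj (- jacobi)"
      using jacobi_primary primary_cnj[OF jacobi_primary] eis_norm_cnj[of "- jacobi"] by metis
    hence "9 dvd eb x" using nine by auto
    thus False using st(2) by presburger
  qed
qed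

section \<open>Pure cubic fields\<close>

subsection \<open>The Gauss lemma for monic factors\<close>

lemma map_poly_of_int_mult:
  "map_poly of_int (f * g) = (map_poly of_int f * map_poly of_int g :: 'a :: {comm_ring_1, ring_char_0} poly)"
  by (rule poly_eqI) (simp add: coeff_map_poly coeff_mult)

lemma map_poly_of_rat_mult:
  "map_poly of_rat (f * g) = (map_poly of_rat f * map_poly of_rat g :: 'a :: field_char_0 poly)"
  by (rule poly_eqI) (simp add: coeff_map_poly coeff_mult of_rat_sum of_rat_mult)

lemma map_poly_of_rat_add:
  "map_poly of_rat (f + g) = (map_poly of_rat f + map_poly of_rat g :: 'a :: field_char_0 poly)"
  by (rule poly_eqI) (simp add: coeff_map_poly of_rat_add)

lemma clear_denominators:
  fixes f :: "rat poly"
  obtains m :: int and F :: "int poly" where "m > 0" "smult (of_int m) f = map_poly of_int F"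
proof -
  have "\<exists>m>0. \<exists>F. smult (of_int m) f = map_poly of_int F" for f :: "rat poly"
  proof (induction f)
    case 0
    show ?case by (intro exI[of _ 1] conjI exI[of _ 0]) auto
  next
    case (pCons a f)
    then obtain m F where m: "m > 0" "smult (of_int m) f = map_poly of_int F" by blast
    obtain n d where a: "a = of_int n / of_int d" "d > 0"
      by (metis quotient_of_denom_pos quotient_of_div surj_pair)
    have "smult (of_int (m * d)) (pCons a f) = map_poly of_int (pCons (m * n) (smult d F))"
    proof -
      have "smult (of_int (m * d)) f = smult (of_int d) (map_poly of_int F)"
        unfolding m(2)[symmetric] by (simp add: mult.commute)
      also have "\<dots> = map_poly of_int (smult d F)"
        by (rule poly_eqI) (simp add: coeff_map_poly)
      finally show ?thesis using a by (simp add: map_poly_pCons)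
    qed
    moreover have "m * d > 0" using m a by simp
    ultimately show ?case by blast
  qed
  thus ?thesis using that by blast
qed

lemma content_monic:
  fixes q :: "int poly"
  assumes "lead_coeff q = 1"
  shows "Polynomial.content q = 1"
proof -
  have "Polynomial.content q dvd lead_coeff q" by (rule content_dvd_coeff)
  hence "is_unit (Polynomial.content q)" using assms by simp
  thus ?thesis by (metis is_unit_normalize normalize_content)
qed

text \<open>Clearing denominators, the contents of the two factors must absorb the whole denominators.\<close>
lemma monic_factor_integral:
  fixes f h :: "rat poly" and q :: "int poly"
  assumes "lead_coeff f = 1" "lead_coeff h = 1" "f * h = map_poly of_int q" "lead_coeff q = 1"
  shows "coeff f i \<in> \<int>"
proof -
  obtain m F where m: "m > 0" "smult (of_int m) f = map_poly of_int F" by (rule clear_denominators)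
  obtain n H where n: "n > 0" "smult (of_int n) h = map_poly of_int H" by (rule clear_denominators)
  have "map_poly of_int (F * H) = smult (of_int m) f * smult (of_int n) h"
    by (simp only: map_poly_of_int_mult m n)
  also have "\<dots> = smult (of_int (m * n)) (map_poly of_int q)"
    by (simp add: assms(3) mult.commute)
  also have "\<dots> = map_poly of_int (smult (m * n) q)"
    by (rule poly_eqI) (simp add: coeff_map_poly)
  finally have "coeff (map_poly of_int (F * H) :: rat poly) i = coeff (map_poly of_int (smult (m * n) q)) i" for i
    by simp
  hence "(of_int (coeff (F * H) i) :: rat) = of_int (coeff (smult (m * n) q) i)" for i
    by (simp add: coeff_map_poly del: coeff_smult)
  hence "coeff (F * H) i = coeff (smult (m * n) q) i" for i
    by (simp only: of_int_eq_iff)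
  hence "F * H = smult (m * n) q" by (rule poly_eqI)
  hence "Polynomial.content F * Polynomial.content H = Polynomial.content (smult (m * n) q)" by (metis content_mult)
  hence prod: "Polynomial.content F * Polynomial.content H = m * n"
    using m n by (simp add: content_monic[OF assms(4)] abs_mult)
  have coeffF: "of_int m * coeff f i = of_int (coeff F i)" for i
    using arg_cong[OF m(2), of "\<lambda>p. coeff p i"] by (simp add: coeff_map_poly)
  have coeffH: "of_int n * coeff h i = of_int (coeff H i)" for i
    using arg_cong[OF n(2), of "\<lambda>p. coeff p i"] by (simp add: coeff_map_poly)
  have "coeff F (degree f) = m" using coeffF[of "degree f"] assms(1) by simp
  hence "Polynomial.content F dvd m" by (metis content_dvd_coeff)
  hence F: "Polynomial.content F \<le> m" using m(1) by (rule zdvd_imp_le)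
  have "coeff H (degree h) = n" using coeffH[of "degree h"] assms(2) by simp
  hence "Polynomial.content H dvd n" by (metis content_dvd_coeff)
  hence H: "Polynomial.content H \<le> n" using n(1) by (rule zdvd_imp_le)
  have "Polynomial.content F = m"
  proof (rule ccontr)
    assume "Polynomial.content F \<noteq> m"
    hence "Polynomial.content F < m" using F by simp
    have "Polynomial.content H > 0" using prod m n
      by (metis H mult_pos_pos mult_zero_right normalize_content abs_of_nonneg int_cases2 normalize_int_def abs_ge_zero less_le)
    hence "Polynomial.content F * Polynomial.content H < m * Polynomial.content H" using \<open>Polynomial.content F < m\<close> by simp
    also have "\<dots> \<le> m * n" using H m by simp
    finally show False using prod by simp
  qed
  hence "m dvd coeff F i" by (metis content_dvd_coeff)
  then obtain k where "coeff F i = m * k" by (auto elim: dvdE)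
  hence "of_int m * coeff f i = of_int m * of_int k" using coeffF[of i] by simp
  hence "coeff f i = of_int k" using m(1) by simp
  thus ?thesis by simp
qed

subsection \<open>The norm form and the basis of a pure cubic field\<close>

text \<open>The norm of \<open>a + b t + c t\<^sup>2\<close> for \<open>t\<^sup>3 = p\<close>.\<close>
definition cubic_norm :: "'a :: comm_ring_1 \<Rightarrow> 'a \<Rightarrow> 'a \<Rightarrow> 'a \<Rightarrow> 'a" where
  "cubic_norm p a b c = a^3 + p * b^3 + p^2 * c^3 - 3 * p * a * b * c"

text \<open>Infinite descent: \<open>p\<close> divides \<open>a\<close>, then \<open>b\<close>, then \<open>c\<close>.\<close>
lemma cubic_norm_eq_0_int:
  fixes p :: int
  assumes p: "Factorial_Ring.prime p" and "cubic_norm p a b c = 0"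
  shows "a = 0 \<and> b = 0 \<and> c = 0"
  using assms(2)
proof (induction "nat (\<bar>a\<bar> + \<bar>b\<bar> + \<bar>c\<bar>)" arbitrary: a b c rule: less_induct)
  case less
  have p1: "p > 1" using p prime_gt_1_int by blast
  have cube: "p dvd x" if "p dvd x ^ 3" for x using p that prime_dvd_power by blast
  have "a ^ 3 = p * (- (b^3 + p * c^3 - 3 * a * b * c))"
    using less.prems by (simp add: cubic_norm_def power2_eq_square algebra_simps)
  hence "p dvd a ^ 3" by simp
  then obtain a' where a: "a = p * a'" using cube by (auto elim: dvdE)
  have "p * (p^2 * a'^3 + b^3 + p * c^3 - 3 * p * a' * b * c) = 0"
    using less.prems unfolding a cubic_norm_def by (simp add: power2_eq_square power3_eq_cube algebra_simps)
  hence e: "p^2 * a'^3 + b^3 + p * c^3 - 3 * p * a' * b * c = 0" using p1 by simp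
  hence "b ^ 3 = p * (- (p * a'^3 + c^3 - 3 * a' * b * c))"
    by (simp add: power2_eq_square algebra_simps)
  hence "p dvd b ^ 3" by simp
  then obtain b' where b: "b = p * b'" using cube by (auto elim: dvdE)
  have "p * (p * a'^3 + p^2 * b'^3 + c^3 - 3 * p * a' * b' * c) = 0"
    using e unfolding b by (simp add: power2_eq_square power3_eq_cube algebra_simps)
  hence e: "p * a'^3 + p^2 * b'^3 + c^3 - 3 * p * a' * b' * c = 0" using p1 by simp
  hence "c ^ 3 = p * (- (a'^3 + p * b'^3 - 3 * a' * b' * c))"
    by (simp add: power2_eq_square algebra_simps)
  hence "p dvd c ^ 3" by simp
  then obtain c' where c: "c = p * c'" using cube by (auto elim: dvdE)
  have "p * cubic_norm p a' b' c' = 0"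
    using e unfolding c cubic_norm_def by (simp add: power2_eq_square power3_eq_cube algebra_simps)
  hence N: "cubic_norm p a' b' c' = 0" using p1 by simp
  show ?case
  proof (rule ccontr)
    assume "\<not> ?case"
    hence nz: "\<bar>a'\<bar> + \<bar>b'\<bar> + \<bar>c'\<bar> > 0" unfolding a b c by auto
    hence "1 * (\<bar>a'\<bar> + \<bar>b'\<bar> + \<bar>c'\<bar>) < p * (\<bar>a'\<bar> + \<bar>b'\<bar> + \<bar>c'\<bar>)"
      using p1 by (intro mult_strict_right_mono)
    also have "\<dots> = \<bar>a\<bar> + \<bar>b\<bar> + \<bar>c\<bar>" using p1 unfolding a b c by (simp add: abs_mult algebra_simps)
    finally have "nat (\<bar>a'\<bar> + \<bar>b'\<bar> + \<bar>c'\<bar>) < nat (\<bar>a\<bar> + \<bar>b\<bar> + \<bar>c\<bar>)" using nz by simp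
    from less.hyps[OF this N] show False using nz by simp
  qed
qed

lemma common_denominator:
  fixes a b c :: rat
  obtains d A B C :: int where "d > 0" "a = of_int A / of_int d" "b = of_int B / of_int d" "c = of_int C / of_int d"
proof -
  have q: "\<exists>n d. (x :: rat) = of_int n / of_int d \<and> d > 0" for x
    by (metis quotient_of_denom_pos quotient_of_div surj_pair)
  obtain n1 d1 n2 d2 n3 d3 where e: "a = of_int n1 / of_int d1" "d1 > 0" "b = of_int n2 / of_int d2" "d2 > 0"
    "c = of_int n3 / of_int d3" "d3 > 0" using q[of a] q[of b] q[of c] by blast
  show ?thesis
    by (rule that[of "d1 * d2 * d3" "n1 * d2 * d3" "n2 * d1 * d3" "n3 * d1 * d2"]) (use e in \<open>auto simp: field_simps\<close>)
qed

lemma cubic_norm_eq_0_rat: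
  fixes a b c :: rat
  assumes p: "Factorial_Ring.prime (p :: nat)" and "cubic_norm (of_nat p) a b c = 0"
  shows "a = 0 \<and> b = 0 \<and> c = 0"
proof -
  obtain d A B C where d: "d > 0" and abc: "a = of_int A / of_int d" "b = of_int B / of_int d" "c = of_int C / of_int d"
    by (rule common_denominator)
  have "of_int (cubic_norm (int p) A B C) = (of_int d)^3 * cubic_norm (of_nat p) a b c"
    using d unfolding abc cubic_norm_def by (simp add: field_simps power3_eq_cube power2_eq_square)
  hence "cubic_norm (int p) A B C = 0" using assms(2) by (simp only: mult_zero_right of_int_eq_0_iff)
  moreover have "Factorial_Ring.prime (int p)" using p by simp
  ultimately have "A = 0 \<and> B = 0 \<and> C = 0" by (intro cubic_norm_eq_0_int)
  thus ?thesis by (simp add: abc)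
qed

definition cubic_elem :: "complex \<Rightarrow> rat \<Rightarrow> rat \<Rightarrow> rat \<Rightarrow> complex" where
  "cubic_elem t a b c = of_rat a + of_rat b * t + of_rat c * t^2"

lemma cubic_elem_mult:
  assumes "t ^ 3 = of_nat p"
  shows "cubic_elem t a b c * cubic_elem t u v w =
    cubic_elem t (a * u + of_nat p * (b * w + c * v)) (a * v + b * u + of_nat p * c * w) (a * w + b * v + c * u)"
  unfolding cubic_elem_def of_rat_add of_rat_mult of_rat_of_nat_eq assms[symmetric]
  by (simp add: power2_eq_square power3_eq_cube algebra_simps)

lemma cubic_elem_norm:
  assumes "t ^ 3 = of_nat p"
  shows "cubic_elem t a b c * cubic_elem t (a^2 - of_nat p * b * c) (of_nat p * c^2 - a * b) (b^2 - a * c) =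
    of_rat (cubic_norm (of_nat p) a b c)"
  unfolding cubic_elem_def cubic_norm_def of_rat_add of_rat_mult of_rat_diff of_rat_power of_rat_of_nat_eq
    of_rat_numeral_eq assms[symmetric]
  by (simp add: power2_eq_square power3_eq_cube algebra_simps)

lemma cubic_elem_eq_0:
  assumes "Factorial_Ring.prime p" "t ^ 3 = of_nat p" "cubic_elem t a b c = 0"
  shows "a = 0 \<and> b = 0 \<and> c = 0"
proof -
  have "of_rat (cubic_norm (of_nat p) a b c) = (0 :: complex)"
    unfolding cubic_elem_norm[OF assms(2), symmetric] assms(3) by simp
  hence "cubic_norm (of_nat p) a b c = 0" by simp
  thus ?thesis by (rule cubic_norm_eq_0_rat[OF assms(1)])
qed

lemma cubic_elem_diff:
  "cubic_elem t a b c - cubic_elem t a' b' c' = cubic_elem t (a - a') (b - b') (c - c')"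
  by (simp add: cubic_elem_def of_rat_diff algebra_simps)

lemma cubic_elem_inject:
  assumes "Factorial_Ring.prime p" "t ^ 3 = of_nat p" "cubic_elem t a b c = cubic_elem t a' b' c'"
  shows "a = a' \<and> b = b' \<and> c = c'"
  using cubic_elem_eq_0[OF assms(1,2), of "a - a'" "b - b'" "c - c'"] assms(3)
  by (simp add: cubic_elem_diff[symmetric])

text \<open>The coordinates \<open>u\<close>, \<open>v\<close>, \<open>w\<close> are chosen before the cube root \<open>t\<close>: a relation for one cube root therefore
  carries over to its conjugates.\<close>
lemma poly_cubic_elem:
  "\<exists>u v w. \<forall>t. t ^ 3 = of_nat p \<longrightarrow> poly (map_poly of_rat q) (cubic_elem t a b c) = cubic_elem t u v w"
proof (induction q)
  case 0
  show ?case by (intro exI[of _ 0]) (simp add: cubic_elem_def)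
next
  case (pCons d q)
  then obtain u v w where IH: "\<And>t. t ^ 3 = of_nat p \<Longrightarrow> poly (map_poly of_rat q) (cubic_elem t a b c) = cubic_elem t u v w"
    by blast
  show ?case
  proof (intro exI allI impI)
    fix t :: complex assume t: "t ^ 3 = of_nat p"
    have "poly (map_poly of_rat (pCons d q)) (cubic_elem t a b c) = of_rat d + cubic_elem t a b c * cubic_elem t u v w"
      using IH[OF t] by (simp add: map_poly_pCons)
    also have "\<dots> = cubic_elem t (d + (a * u + of_nat p * (b * w + c * v))) (a * v + b * u + of_nat p * c * w) (a * w + b * v + c * u)"
      unfolding cubic_elem_mult[OF t] by (simp add: cubic_elem_def of_rat_add)
    finally show "poly (map_poly of_rat (pCons d q)) (cubic_elem t a b c) =
      cubic_elem t (d + (a * u + of_nat p * (b * w + c * v))) (a * v + b * u + of_nat p * c * w) (a * w + b * v + c * u)" .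
  qed
qed

definition cubic_char_poly :: "nat \<Rightarrow> rat \<Rightarrow> rat \<Rightarrow> rat \<Rightarrow> rat poly" where
  "cubic_char_poly p a b c = [:- cubic_norm (of_nat p) a b c, 3 * (a^2 - of_nat p * b * c), - 3 * a, 1:]"

lemma cubic_char_poly_root:
  assumes "t ^ 3 = of_nat p"
  shows "poly (map_poly of_rat (cubic_char_poly p a b c)) (cubic_elem t a b c) = 0"
proof -
  have ev: "poly (map_poly of_rat (cubic_char_poly p a b c)) x =
     x ^ 3 - 3 * of_rat a * x ^ 2 + 3 * (of_rat a ^ 2 - of_nat p * of_rat b * of_rat c) * x
       - cubic_norm (of_nat p) (of_rat a) (of_rat b) (of_rat c)" for x :: complex
    unfolding cubic_char_poly_def cubic_norm_def
    by (simp add: map_poly_pCons of_rat_add of_rat_mult of_rat_diff of_rat_power of_rat_minus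
        power2_eq_square power3_eq_cube algebra_simps)
  show ?thesis
    unfolding ev cubic_elem_def cubic_norm_def assms[symmetric]
    by (simp add: power2_eq_square power3_eq_cube algebra_simps)
qed

text \<open>The three conjugates of an irrational element are distinct roots of any rational polynomial that
  kills the element, so its characteristic polynomial divides that polynomial.\<close>
lemma cubic_char_poly_integral:
  assumes p: "Factorial_Ring.prime p" and t: "t ^ 3 = of_nat p"
    and int: "algebraic_int (cubic_elem t a b c)" and irr: "b \<noteq> 0 \<or> c \<noteq> 0"
  shows "coeff (cubic_char_poly p a b c) i \<in> \<int>"
proof -
  \<comment> \<open>The remainder modulo \<open>f\<close> has degree at most 2 and vanishes at the three conjugates, so it is 0.\<close>
  define f where "f = cubic_char_poly p a b c"
  have f: "degree f = 3" "lead_coeff f = 1" by (simp_all add: f_def cubic_char_poly_def)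
  obtain q :: "int poly" where q: "poly (map_poly of_int q) (cubic_elem t a b c) = 0" "lead_coeff q = 1"
    using int unfolding algebraic_int_altdef_ipoly by blast
  define Q where "Q = (map_poly of_int q :: rat poly)"
  have QC: "map_poly of_rat Q = (map_poly of_int q :: complex poly)"
    unfolding Q_def by (rule poly_eqI) (simp add: coeff_map_poly)
  have Q: "lead_coeff Q = 1"
    using q(2) by (simp add: Q_def coeff_map_poly degree_map_poly)
  define T where "T j = zeta3 ^ j * t" for j :: nat
  have T: "T j ^ 3 = of_nat p" for j
  proof -
    have "T j ^ 3 = (zeta3 ^ 3) ^ j * t ^ 3" by (simp add: T_def power_mult_distrib power_mult[symmetric] mult.commute)
    thus ?thesis by (simp add: zeta3_power3 t)
  qed
  have t0: "t \<noteq> 0" using t p by auto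
  define x where "x j = cubic_elem (T j) a b c" for j
  define r where "r = Q mod f"
  have rootQ: "poly (map_poly of_rat Q) (x j) = 0" for j
  proof -
    obtain u v w where uvw: "\<And>s. s ^ 3 = of_nat p \<Longrightarrow> poly (map_poly of_rat Q) (cubic_elem s a b c) = cubic_elem s u v w"
      using poly_cubic_elem by blast
    have "cubic_elem t u v w = 0" using uvw[OF t] q(1) by (simp add: QC)
    hence "u = 0 \<and> v = 0 \<and> w = 0" by (rule cubic_elem_eq_0[OF p t])
    thus ?thesis unfolding x_def uvw[OF T] by (simp add: cubic_elem_def)
  qed
  have "Q = f * (Q div f) + r" by (simp add: r_def)
  hence Qc: "map_poly of_rat Q = (map_poly of_rat f * map_poly of_rat (Q div f) + map_poly of_rat r :: complex poly)"
    by (metis map_poly_of_rat_add map_poly_of_rat_mult)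
  have rootr: "poly (map_poly of_rat r) (x j) = 0" for j
    using rootQ[of j] cubic_char_poly_root[OF T, of a b c j] unfolding Qc x_def f_def by simp
  have distinct: "x i \<noteq> x j" if ij: "T i \<noteq> T j" "T i + T j + T k = 0" for i j k
  proof
    assume "x i = x j"
    hence "(T i - T j) * (of_rat b + of_rat c * (T i + T j)) = 0"
      by (simp add: x_def cubic_elem_def power2_eq_square algebra_simps)
    hence "of_rat b + of_rat c * (T i + T j) = 0" using ij(1) by simp
    moreover have "T i + T j = - T k" using ij(2) by (simp add: eq_neg_iff_add_eq_0)
    ultimately have "cubic_elem (T k) b (- c) 0 = 0" by (simp add: cubic_elem_def of_rat_minus)
    from cubic_elem_eq_0[OF p T this] show False using irr by simp
  qed
  have Tsum: "T 0 + T 1 + T 2 = 0"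
  proof -
    have "T 0 + T 1 + T 2 = (1 + zeta3 + zeta3\<^sup>2) * t" by (simp add: T_def algebra_simps)
    thus ?thesis by (simp add: zeta3_sum)
  qed
  have z2: "zeta3\<^sup>2 \<noteq> 1" "zeta3\<^sup>2 \<noteq> zeta3"
  proof -
    show "zeta3\<^sup>2 \<noteq> zeta3" using zeta3_nz zeta3_neq_1 by (simp add: power2_eq_square)
    show "zeta3\<^sup>2 \<noteq> 1"
    proof
      assume "zeta3\<^sup>2 = 1"
      hence "zeta3 ^ 3 = zeta3" by (simp add: power3_eq_cube power2_eq_square)
      thus False using zeta3_power3 zeta3_neq_1 by simp
    qed
  qed
  have T012: "T 0 \<noteq> T 1" "T 0 \<noteq> T 2" "T 1 \<noteq> T 2"
    using z2 zeta3_neq_1 t0 by (simp_all add: T_def)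
  have Tsum': "T 0 + T 2 + T 1 = 0" "T 1 + T 2 + T 0 = 0" using Tsum by (simp_all only: add_ac)
  have x012: "x 0 \<noteq> x 1" "x 0 \<noteq> x 2" "x 1 \<noteq> x 2"
    by (rule distinct[OF T012(1) Tsum], rule distinct[OF T012(2) Tsum'(1)], rule distinct[OF T012(3) Tsum'(2)])
  have "r = 0"
  proof (rule ccontr)
    assume r: "r \<noteq> 0"
    define R where "R = (map_poly of_rat r :: complex poly)"
    have "f \<noteq> 0" using f(2) by auto
    hence "degree r < 3" using degree_mod_less'[of f Q] f r by (auto simp: r_def)
    moreover have "degree R = degree r" unfolding R_def by (rule degree_map_poly) simp
    moreover have R0: "R \<noteq> 0" using r by (auto simp: R_def poly_eq_iff coeff_map_poly)
    moreover have "card {x 0, x 1, x 2} \<le> card {y. poly R y = 0}"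
      using rootr R0 poly_roots_finite[of R] by (intro card_mono) (auto simp: R_def)
    moreover have "card {x 0, x 1, x 2} = 3" using x012 by simp
    ultimately show False using card_poly_roots_bound[of R] by linarith
  qed
  hence fQ: "f * (Q div f) = map_poly of_int q" using \<open>Q = f * (Q div f) + r\<close> by (simp add: Q_def)
  have "lead_coeff (f * (Q div f)) = 1" using Q fQ by (simp add: Q_def)
  hence "lead_coeff (Q div f) = 1" using f(2) by (simp add: lead_coeff_mult)
  from monic_factor_integral[OF f(2) this fQ q(2)] show ?thesis by (simp add: f_def)
qed

lemma integral_of_quadratic:
  fixes x S P :: rat
  assumes "x^2 - S * x + P = 0" "S \<in> \<int>" "P \<in> \<int>"
  shows "x \<in> \<int>"
proof (rule rational_algebraic_int_is_int)
  show "algebraic_int x"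
  proof (rule algebraic_int.intros[of "[:P, -S, 1:]"])
    show "\<forall>i. coeff [:P, -S, 1:] i \<in> \<int>" using assms(2,3) by (auto simp: coeff_pCons split: nat.splits)
    show "poly [:P, -S, 1:] x = 0" using assms(1) by (simp add: power2_eq_square algebra_simps)
  qed simp
  show "x \<in> \<rat>" using Rats_of_rat[of x, where ?'a = rat] by simp
qed

text \<open>The cube of the denominator of \<open>x\<close> would have to divide a power of \<open>p\<close> below the third.\<close>
lemma integral_of_cube_free_multiple:
  fixes x :: rat
  assumes p: "Factorial_Ring.prime (p :: nat)" and e: "e < 3" and x: "of_nat p ^ e * x ^ 3 \<in> \<int>"
  shows "x \<in> \<int>"
proof -
  obtain r s where rs: "x = of_int r / of_int s" "s > 0" "Rings.coprime r s"
    by (metis quotient_of_coprime quotient_of_denom_pos quotient_of_div surj_pair)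
  obtain k where k: "of_nat p ^ e * x ^ 3 = of_int k" using x by (auto elim: Ints_cases)
  have "of_int (int p ^ e * r ^ 3) = (of_int (k * s ^ 3) :: rat)"
    using k rs(2) unfolding rs(1) by (simp add: field_simps)
  hence eq: "int p ^ e * r ^ 3 = k * s ^ 3" by (simp only: of_int_eq_iff)
  have "Rings.coprime (s ^ 3) (r ^ 3)" using rs(3) by (simp add: coprime_commute)
  moreover have "s ^ 3 dvd int p ^ e * r ^ 3" unfolding eq by simp
  ultimately have sp: "s ^ 3 dvd int p ^ e" by (simp add: coprime_dvd_mult_left_iff)
  have p1: "int p > 1" using p prime_gt_1_nat by simp
  have "\<not> int p dvd s"
  proof
    assume "int p dvd s"
    hence "int p ^ 3 dvd s ^ 3" by (rule dvd_power_same)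
    hence "int p ^ 3 dvd int p ^ e" using sp by (rule dvd_trans)
    hence "int p ^ 3 \<le> int p ^ e" using p1 by (intro zdvd_imp_le) auto
    moreover have "int p ^ e < int p ^ 3" using e p1 by (intro power_strict_increasing) auto
    ultimately show False by simp
  qed
  hence "Rings.coprime (int p) s" using p prime_imp_coprime[of "int p" s] by simp
  hence "Rings.coprime (s ^ 3) (int p ^ e)" by (simp add: coprime_commute)
  hence "is_unit (s ^ 3)" using sp by (metis coprime_absorb_left)
  hence "s = 1" using rs(2) by (metis is_unit_power_iff zdvd1_eq abs_of_pos zero_neq_numeral)
  thus ?thesis by (simp add: rs(1))
qed

text \<open>The necessary half of Dedekind's description of the integers of a pure cubic field of the second
  kind. The coefficients of the characteristic polynomial give \<open>3a\<close> at once; then \<open>p (3b)\<^sup>3\<close> and \<open>p\<^sup>2 (3c)\<^sup>3\<close> have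
  integral sum and product, so they are integral, and so are \<open>3b\<close> and \<open>3c\<close>. The congruences
  hold because the remaining coefficients, with denominators 3 and 27, are integral as well.\<close>
lemma pure_cubic_integers:
  assumes p: "Factorial_Ring.prime p" "[p = 1] (mod 9)" and t: "t ^ 3 = of_nat p"
    and int: "algebraic_int (cubic_elem t a b c)"
  obtains A B C :: int where "a = of_int A / 3" "b = of_int B / 3" "c = of_int C / 3" "3 dvd (A - B)" "3 dvd (B - C)"
proof (cases "b = 0 \<and> c = 0")
  case True
  hence "algebraic_int (of_rat a :: complex)" using int by (simp add: cubic_elem_def)
  hence "(of_rat a :: complex) \<in> \<int>" by (rule rational_algebraic_int_is_int) simp
  then obtain k where "(of_rat a :: complex) = of_int k" by (auto elim: Ints_cases)
  hence "of_rat a = (of_rat (of_int k) :: complex)" by simp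
  hence "a = of_int k" by (simp only: of_rat_eq_iff)
  thus ?thesis using True by (intro that[of "3 * k" 0 0]) auto
next
  case False
  define P where "P = (of_nat p :: rat)"
  define N where "N = cubic_norm P a b c"
  have P0: "P \<noteq> 0" using p by (auto simp: P_def)
  have PI: "P \<in> \<int>" by (simp add: P_def)
  note I = cubic_char_poly_integral[OF p(1) t int, unfolded cubic_char_poly_def P_def[symmetric] N_def[symmetric]]
  have "3 * a \<in> \<int>" using I[of 2] False by (simp add: numeral_2_eq_2 numeral_3_eq_3) 
  then obtain A where A: "3 * a = of_int A" by (auto elim: Ints_cases)
  have "3 * (a^2 - P * b * c) \<in> \<int>" using I[of 1] False by simp
  then obtain U where U: "3 * (a^2 - P * b * c) = of_int U" by (auto elim: Ints_cases)
  have "N \<in> \<int>" using I[of 0] False by simp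
  then obtain M where M: "N = of_int M" by (auto elim: Ints_cases)
  have bc: "9 * P * b * c = of_int (A^2 - 3 * U)"
  proof -
    have "of_int (A^2 - 3 * U) = (3 * a)^2 - 3 * (3 * (a^2 - P * b * c))" unfolding A U by simp
    thus ?thesis by (simp add: power2_eq_square algebra_simps)
  qed
  define x where "x = P * (3 * b)^3"
  define y where "y = P^2 * (3 * c)^3"
  have sum: "x + y = of_int (27 * M - A^3 + 3 * A * (A^2 - 3 * U))"
  proof -
    have "x + y = 27 * N - (3 * a)^3 + 3 * (3 * a) * (9 * P * b * c)"
      by (simp add: x_def y_def N_def cubic_norm_def power3_eq_cube algebra_simps)
    thus ?thesis unfolding A bc M by simp
  qed
  have prod: "x * y = of_int ((A^2 - 3 * U)^3)"
  proof -
    have "x * y = (9 * P * b * c)^3" by (simp add: x_def y_def power3_eq_cube power2_eq_square algebra_simps)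
    thus ?thesis unfolding bc by simp
  qed
  have "x^2 - (x + y) * x + x * y = 0" by (simp add: power2_eq_square algebra_simps)
  from integral_of_quadratic[OF this] have "x \<in> \<int>" unfolding sum prod by (simp only: Ints_of_int)
  hence "3 * b \<in> \<int>" using integral_of_cube_free_multiple[OF p(1), of 1 "3 * b"] by (simp add: x_def P_def)
  then obtain B where B: "3 * b = of_int B" by (auto elim: Ints_cases)
  have "y^2 - (x + y) * y + x * y = 0" by (simp add: power2_eq_square algebra_simps)
  from integral_of_quadratic[OF this] have "y \<in> \<int>" unfolding sum prod by (simp only: Ints_of_int)
  hence "3 * c \<in> \<int>" using integral_of_cube_free_multiple[OF p(1), of 2 "3 * c"] by (simp add: y_def P_def)
  then obtain C where C: "3 * c = of_int C" by (auto elim: Ints_cases)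
  have "of_int (int p * B * C) = (of_int (A^2 - 3 * U) :: rat)"
  proof -
    have "(of_int (int p * B * C) :: rat) = P * (3 * b) * (3 * c)" unfolding B C by (simp add: P_def)
    also have "\<dots> = 9 * P * b * c" by simp
    finally show ?thesis by (simp only: bc)
  qed
  hence e1: "int p * B * C = A^2 - 3 * U" by (simp only: of_int_eq_iff)
  have "of_int (A^3 + int p * B^3 + int p^2 * C^3 - 3 * int p * A * B * C) = (of_int (27 * M) :: rat)"
  proof -
    have "(of_int (A^3 + int p * B^3 + int p^2 * C^3 - 3 * int p * A * B * C) :: rat) =
       (3 * a)^3 + P * (3 * b)^3 + P^2 * (3 * c)^3 - 3 * P * (3 * a) * (3 * b) * (3 * c)"
      unfolding A B C by (simp add: P_def)
    also have "\<dots> = 27 * N" by (simp add: N_def cubic_norm_def power3_eq_cube algebra_simps)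
    finally show ?thesis by (simp add: M)
  qed
  hence e2: "A^3 + int p * B^3 + int p^2 * C^3 - 3 * int p * A * B * C = 27 * M" by (simp only: of_int_eq_iff)
  obtain k where k: "int p = 1 + 9 * k"
  proof -
    have "[int p = int 1] (mod int 9)" using p(2) by (simp only: cong_int_iff)
    hence "9 dvd int p - 1" by (simp add: cong_iff_dvd_diff)
    then obtain k where "int p - 1 = 9 * k" by (rule dvdE)
    thus ?thesis by (intro that[of k]) simp
  qed
  have "A^2 - B * C = 3 * (U + 3 * k * B * C)" using e1 unfolding k by (simp add: algebra_simps)
  hence d1: "3 dvd (A^2 - B * C)" by simp
  have "A^3 + B^3 + C^3 = 3 * (9 * M - 3 * k * B^3 - 6 * k * C^3 - 27 * k^2 * C^3 + int p * A * B * C)"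
    using e2 unfolding k by (simp add: power2_eq_square algebra_simps)
  hence d2: "3 dvd (A^3 + B^3 + C^3)" by simp
  have "3 dvd (A - B) \<and> 3 dvd (B - C)"
  proof -
    have m: "A mod 3 \<in> {0,1,2}" "B mod 3 \<in> {0,1,2}" "C mod 3 \<in> {0,1,2}" by auto
    have "[(A mod 3)^2 - (B mod 3) * (C mod 3) = A^2 - B * C] (mod 3)"
      by (intro cong_diff cong_pow cong_mult) (simp_all add: Cong.cong_def)
    hence c1: "((A mod 3)^2 - (B mod 3) * (C mod 3)) mod 3 = 0"
      unfolding Cong.cong_def dvd_imp_mod_0[OF d1] .
    have "[(A mod 3)^3 + (B mod 3)^3 + (C mod 3)^3 = A^3 + B^3 + C^3] (mod 3)"
      by (intro cong_add cong_pow) (simp_all add: Cong.cong_def)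
    hence c2: "((A mod 3)^3 + (B mod 3)^3 + (C mod 3)^3) mod 3 = 0"
      unfolding Cong.cong_def dvd_imp_mod_0[OF d2] .
    have fin: "\<forall>r\<in>{0,1,2::int}. \<forall>s\<in>{0,1,2}. \<forall>u\<in>{0,1,2}.
        (r^2 - s * u) mod 3 = 0 \<longrightarrow> (r^3 + s^3 + u^3) mod 3 = 0 \<longrightarrow> r = s \<and> s = u" by simp
    have "A mod 3 = B mod 3 \<and> B mod 3 = C mod 3" by (rule fin[rule_format, OF m c1 c2])
    thus ?thesis by (simp add: mod_eq_dvd_iff)
  qed
  thus ?thesis using A B C by (intro that[of A B C]) auto
qed

subsection \<open>The field generated by a cube root\<close>

lemma complex_ring_field: "Ring.field complex_ring"
  by (rule field_from_type_algebra)

lemma complex_ring_simps [simp]: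
  "carrier complex_ring = UNIV" "\<one>\<^bsub>complex_ring\<^esub> = 1" "\<zero>\<^bsub>complex_ring\<^esub> = 0"
  "x \<oplus>\<^bsub>complex_ring\<^esub> y = x + y" "x \<otimes>\<^bsub>complex_ring\<^esub> y = x * y"
  by (simp_all add: ring_of_type_algebra_def)

lemma complex_ring_uminus [simp]: "\<ominus>\<^bsub>complex_ring\<^esub> x = - x"
proof -
  interpret C: Ring.field complex_ring by (rule complex_ring_field)
  show ?thesis by (rule C.minus_equality) auto
qed

lemma complex_ring_inverse [simp]: "x \<noteq> 0 \<Longrightarrow> inv\<^bsub>complex_ring\<^esub> x = inverse x"
proof -
  interpret C: Ring.field complex_ring by (rule complex_ring_field)
  assume "x \<noteq> 0"
  thus ?thesis by (intro C.inv_char) auto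
qed

lemma cubic_elem_inverse:
  assumes p: "Factorial_Ring.prime p" and t: "t ^ 3 = of_nat p" and nz: "cubic_elem t a b c \<noteq> 0"
  shows "\<exists>u v w. inverse (cubic_elem t a b c) = cubic_elem t u v w"
proof -
  define n where "n = cubic_norm (of_nat p) a b c"
  have n0: "n \<noteq> 0"
  proof
    assume "n = 0"
    hence "a = 0 \<and> b = 0 \<and> c = 0" unfolding n_def by (rule cubic_norm_eq_0_rat[OF p])
    thus False using nz by (simp add: cubic_elem_def)
  qed
  define u v w where "u = a^2 - of_nat p * b * c" and "v = of_nat p * c^2 - a * b" and "w = b^2 - a * c"
  have "cubic_elem t a b c * cubic_elem t u v w = of_rat n"
    unfolding u_def v_def w_def n_def by (rule cubic_elem_norm[OF t])
  hence "inverse (cubic_elem t a b c) = cubic_elem t u v w / of_rat n"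
    using n0 nz by (simp add: field_simps)
  also have "\<dots> = cubic_elem t (u / n) (v / n) (w / n)"
    by (simp add: cubic_elem_def of_rat_divide add_divide_distrib)
  finally show ?thesis by blast
qed

lemma generate_field_cube_root:
  assumes p: "Factorial_Ring.prime p" and t: "t ^ 3 = of_nat p"
  shows "generate_field complex_ring {t} = {x. \<exists>a b c. x = cubic_elem t a b c}" (is "?F = ?K")
proof
  show "?F \<subseteq> ?K"
  proof
    fix x assume "x \<in> ?F"
    thus "x \<in> ?K"
    proof (induction rule: generate_field.induct)
      case one
      have "\<one>\<^bsub>complex_ring\<^esub> = cubic_elem t 1 0 0" by (simp add: cubic_elem_def)
      thus ?case by blast
    next
      case (incl h)
      hence "h = cubic_elem t 0 1 0" by (simp add: cubic_elem_def)
      thus ?case by blast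
    next
      case (a_inv h)
      then obtain a b c where "h = cubic_elem t a b c" by blast
      hence "\<ominus>\<^bsub>complex_ring\<^esub> h = cubic_elem t (-a) (-b) (-c)" by (simp add: cubic_elem_def of_rat_minus)
      thus ?case by blast
    next
      case (m_inv h)
      then obtain a b c where h: "h = cubic_elem t a b c" by blast
      have "h \<noteq> 0" using m_inv by simp
      thus ?case using cubic_elem_inverse[OF p t, of a b c] by (simp add: h)
    next
      case (eng_add h1 h2)
      then obtain a b c a' b' c' where "h1 = cubic_elem t a b c" "h2 = cubic_elem t a' b' c'" by blast
      hence "h1 \<oplus>\<^bsub>complex_ring\<^esub> h2 = cubic_elem t (a + a') (b + b') (c + c')"
        by (simp add: cubic_elem_def of_rat_add algebra_simps)
      thus ?case by blast
    next
      case (eng_mult h1 h2)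
      then obtain a b c a' b' c' where "h1 = cubic_elem t a b c" "h2 = cubic_elem t a' b' c'" by blast
      hence "h1 \<otimes>\<^bsub>complex_ring\<^esub> h2 = cubic_elem t (a * a' + of_nat p * (b * c' + c * b'))
          (a * b' + b * a' + of_nat p * c * c') (a * c' + b * b' + c * a')"
        by (simp add: cubic_elem_mult[OF t])
      thus ?case by blast
    qed
  qed
  interpret C: Ring.field complex_ring by (rule complex_ring_field)
  note cl = generate_field.eng_add[where R = complex_ring and H = "{t}", simplified]
    generate_field.eng_mult[where R = complex_ring and H = "{t}", simplified]
    generate_field.a_inv[where R = complex_ring and H = "{t}", simplified]
  have one: "1 \<in> ?F" using generate_field.one[of complex_ring "{t}"] by simp
  have tF: "t \<in> ?F" by (rule generate_field.incl) simp
  have zero: "0 \<in> ?F" using C.zero_in_generate[of "{t}"] by simp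
  have nat: "of_nat n \<in> ?F" for n
    by (induction n) (use zero one cl(1) in auto)
  have int: "of_int n \<in> ?F" for n
    by (cases n) (use nat cl(3) in \<open>auto simp del: of_nat_Suc\<close>)
  have rat: "of_rat q \<in> ?F" for q
  proof -
    obtain n d where q: "q = of_int n / of_int d" "d > 0"
      by (metis quotient_of_denom_pos quotient_of_div surj_pair)
    have "inv\<^bsub>complex_ring\<^esub> (of_int d) \<in> ?F"
      by (rule generate_field.m_inv) (use q int in auto)
    hence "inverse (of_int d) \<in> ?F" using q by simp
    hence "of_int n * inverse (of_int d) \<in> ?F" by (rule cl(2)[OF int])
    thus ?thesis by (simp add: q of_rat_divide field_simps)
  qed
  show "?K \<subseteq> ?F"
    unfolding cubic_elem_def power2_eq_square by (auto intro!: cl(1) cl(2) rat tF)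
qed

text \<open>The dimension is built up by adjoining \<open>1\<close>, \<open>t\<close> and \<open>t\<^sup>2\<close> to the zero space; uniqueness of coordinates
  shows that each lies outside the span of its predecessors.\<close>
lemma cubic_field_generate_field:
  assumes p: "Factorial_Ring.prime p" and t: "t ^ 3 = of_nat p"
  shows "cubic_field (generate_field complex_ring {t})"
proof -
  interpret C: Ring.field complex_ring by (rule complex_ring_field)
  define E where "E m = {x. \<exists>a b c. x = cubic_elem t a b c \<and> (m < 1 \<longrightarrow> a = 0) \<and> (m < 2 \<longrightarrow> b = 0) \<and> (m < 3 \<longrightarrow> c = 0)}" for m :: nat
  have ratE: "k \<in> \<rat> \<longleftrightarrow> (\<exists>q. k = of_rat q)" for k :: complex by (auto elim: Rats_cases)
  have ext: "x \<in> C.line_extension \<rat> v F \<longleftrightarrow> (\<exists>q. \<exists>y\<in>F. x = of_rat q * v + y)" for x v F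
    unfolding C.line_extension_mem_iff complex_ring_simps Bex_def ratE by auto
  have step: "of_rat q * 1 + cubic_elem t 0 0 0 = cubic_elem t q 0 0"
    "of_rat q * t + cubic_elem t a 0 0 = cubic_elem t a q 0"
    "of_rat q * t^2 + cubic_elem t a b 0 = cubic_elem t a b q" for a b q
    by (simp_all add: cubic_elem_def)
  have Es: "x \<in> E 0 \<longleftrightarrow> x = cubic_elem t 0 0 0" "x \<in> E 1 \<longleftrightarrow> (\<exists>a. x = cubic_elem t a 0 0)"
    "x \<in> E 2 \<longleftrightarrow> (\<exists>a b. x = cubic_elem t a b 0)" "x \<in> E 3 \<longleftrightarrow> (\<exists>a b c. x = cubic_elem t a b c)" for x
    by (auto simp: E_def)
  have E0: "E 0 = {\<zero>\<^bsub>complex_ring\<^esub>}" by (auto simp: Es cubic_elem_def)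
  have E1: "C.line_extension \<rat> 1 (E 0) = E 1"
    by (rule Set.set_eqI) (simp only: ext Es Bex_def, metis step(1))
  have E2: "C.line_extension \<rat> t (E 1) = E 2"
    by (rule Set.set_eqI) (simp only: ext Es Bex_def, metis step(2))
  have E3: "C.line_extension \<rat> (t^2) (E 2) = E 3"
    by (rule Set.set_eqI) (simp only: ext Es Bex_def, metis step(3))
  have n0: "1 \<notin> E 0" by (auto simp: E_def cubic_elem_def)
  have n1: "t \<notin> E 1"
  proof
    assume "t \<in> E 1"
    then obtain a where "cubic_elem t 0 1 0 = cubic_elem t a 0 0" by (auto simp: E_def cubic_elem_def)
    from cubic_elem_inject[OF p t this] show False by simp
  qed
  have n2: "t^2 \<notin> E 2"
  proof
    assume "t^2 \<in> E 2"
    then obtain a b where "cubic_elem t 0 0 1 = cubic_elem t a b 0" by (auto simp: E_def cubic_elem_def)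
    from cubic_elem_inject[OF p t this] show False by simp
  qed
  have "C.dimension 0 \<rat> (E 0)" unfolding E0 by (rule C.zero_dim)
  from C.Suc_dim[OF _ n0 this] have "C.dimension (Suc 0) \<rat> (E 1)" unfolding E1 by simp
  from C.Suc_dim[OF _ n1 this] have "C.dimension (Suc (Suc 0)) \<rat> (E 2)" unfolding E2 by simp
  from C.Suc_dim[OF _ n2 this] have "C.dimension 3 \<rat> (E 3)" unfolding E3 by (simp add: numeral_3_eq_3)
  moreover have "E 3 = generate_field complex_ring {t}"
    unfolding generate_field_cube_root[OF p t] by (auto simp: E_def)
  ultimately have dim: "C.dimension 3 \<rat> (generate_field complex_ring {t})" by simp
  moreover have "subfield (generate_field complex_ring {t}) complex_ring"
    by (rule C.generate_field_is_subfield) simp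
  ultimately show ?thesis unfolding cubic_field_def number_field_def C.finite_dimension_def by blast
qed

subsection \<open>The index form\<close>

text \<open>The powers of an element beyond the square reduce by its characteristic equation.\<close>
lemma generate_ring_cubic_integer:
  fixes \<alpha> :: complex
  assumes eq: "\<alpha> ^ 3 = of_int T * \<alpha> ^ 2 - of_int U * \<alpha> + of_int N" and x: "x \<in> generate_ring complex_ring {\<alpha>}"
  shows "\<exists>u v w. x = of_int u + of_int v * \<alpha> + of_int w * \<alpha> ^ 2"
  using x
proof (induction rule: generate_ring.induct)
  case one
  show ?case by (rule exI[of _ 1], rule exI[of _ 0], rule exI[of _ 0]) simp
next
  case (incl h)
  hence h: "h = \<alpha>" by simp
  show ?case unfolding h by (rule exI[of _ 0], rule exI[of _ 1], rule exI[of _ 0]) simp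
next
  case (a_inv h)
  then obtain u v w where "h = of_int u + of_int v * \<alpha> + of_int w * \<alpha> ^ 2" by blast
  thus ?case by (intro exI[of _ "-u"] exI[of _ "-v"] exI[of _ "-w"]) simp
next
  case (eng_add h1 h2)
  then obtain u v w u' v' w' where "h1 = of_int u + of_int v * \<alpha> + of_int w * \<alpha> ^ 2"
    "h2 = of_int u' + of_int v' * \<alpha> + of_int w' * \<alpha> ^ 2" by blast
  thus ?case by (intro exI[of _ "u + u'"] exI[of _ "v + v'"] exI[of _ "w + w'"]) (simp add: algebra_simps)
next
  case (eng_mult h1 h2)
  then obtain u v w u' v' w' where h: "h1 = of_int u + of_int v * \<alpha> + of_int w * \<alpha> ^ 2"
    "h2 = of_int u' + of_int v' * \<alpha> + of_int w' * \<alpha> ^ 2" by blast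
  have e4: "\<alpha> ^ 4 = of_int (T^2 - U) * \<alpha> ^ 2 + of_int (N - T * U) * \<alpha> + of_int (T * N)"
  proof -
    have "\<alpha> ^ 4 = \<alpha> * \<alpha> ^ 3" by (simp add: power_numeral_reduce)
    also have "\<dots> = of_int T * \<alpha> ^ 3 - of_int U * \<alpha> ^ 2 + of_int N * \<alpha>"
      by (subst eq) (simp add: power2_eq_square power3_eq_cube algebra_simps)
    also have "\<dots> = of_int (T^2 - U) * \<alpha> ^ 2 + of_int (N - T * U) * \<alpha> + of_int (T * N)"
      by (subst eq) (simp add: power2_eq_square algebra_simps)
    finally show ?thesis .
  qed
  have "h1 * h2 = of_int (u * u') + of_int (u * v' + v * u') * \<alpha> + of_int (u * w' + v * v' + w * u') * \<alpha> ^ 2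
     + of_int (v * w' + w * v') * \<alpha> ^ 3 + of_int (w * w') * \<alpha> ^ 4"
    unfolding h by (simp add: power2_eq_square power3_eq_cube power4_eq_xxxx algebra_simps)
  also have "\<dots> = of_int (u * u' + (v * w' + w * v') * N + w * w' * (T * N))
      + of_int (u * v' + v * u' - (v * w' + w * v') * U + w * w' * (N - T * U)) * \<alpha>
      + of_int (u * w' + v * v' + w * u' + (v * w' + w * v') * T + w * w' * (T^2 - U)) * \<alpha> ^ 2"
    unfolding eq e4 by (simp add: algebra_simps)
  finally show ?case unfolding complex_ring_simps by blast
qed

lemma cubic_elem_char_equation:
  assumes t: "t ^ 3 = of_nat p"
  shows "cubic_elem t a b c ^ 3 = of_rat (3 * a) * cubic_elem t a b c ^ 2
    - of_rat (3 * (a^2 - of_nat p * b * c)) * cubic_elem t a b c + of_rat (cubic_norm (of_nat p) a b c)"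
  unfolding cubic_elem_def cubic_norm_def of_rat_add of_rat_mult of_rat_diff of_rat_power of_rat_of_nat_eq
    of_rat_numeral_eq t[symmetric]
  by (simp add: power2_eq_square power3_eq_cube algebra_simps)

text \<open>The integers \<open>t\<close> and \<open>(1 + t + t\<^sup>2) / 3\<close> would have integral coordinates \<open>(u, v, w)\<close> and \<open>(u', v', w')\<close> with
  respect to \<open>1\<close>, \<open>\<alpha>\<close>, \<open>\<alpha>\<^sup>2\<close>. Comparing the coefficients of \<open>t\<close> and \<open>t\<^sup>2\<close> and taking determinants gives
  \<open>(v w' - w v') (b\<^sup>3 - p c\<^sup>3) = 1/3\<close>. With \<open>b = B/3\<close> and \<open>c = C/3\<close> this says that \<open>B\<^sup>3 - p C\<^sup>3\<close> divides 9, whereas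
  \<open>B \<equiv> C\<close> modulo 3 and \<open>p \<equiv> 1\<close> modulo 9 make it a multiple of 9. So it is \<open>9\<close> or \<open>-9\<close>, and the equation
  \<open>p x\<^sup>3 + y\<^sup>3 = 9\<close> is solved by \<open>(-C, B)\<close> or \<open>(C, -B)\<close>.\<close>
lemma not_monogenic_pure_cubic:
  assumes p: "p \<in> insoluble_primes" and t: "t ^ 3 = of_nat p"
  shows "\<not> monogenic (generate_field complex_ring {t})"
proof
  assume "monogenic (generate_field complex_ring {t})"
  then obtain \<alpha> where \<alpha>: "\<alpha> \<in> ring_of_integers (generate_field complex_ring {t})"
    and gen: "ring_of_integers (generate_field complex_ring {t}) = generate_ring complex_ring {\<alpha>}"
    unfolding monogenic_def by blast
  have pp: "Factorial_Ring.prime p" "[p = 1] (mod 9)" and insol: "\<And>x y. int p * x ^ 3 + y ^ 3 \<noteq> 9"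
    using p by (auto simp: insoluble_primes_def)
  note K = generate_field_cube_root[OF pp(1) t]
  obtain a b c where abc: "\<alpha> = cubic_elem t a b c" and int: "algebraic_int (cubic_elem t a b c)"
    using \<alpha> by (auto simp: ring_of_integers_def K)
  obtain A B C where ABC: "a = of_int A / 3" "b = of_int B / 3" "c = of_int C / 3" "3 dvd (A - B)" "3 dvd (B - C)"
    by (rule pure_cubic_integers[OF pp t int])
  define P where "P = (of_nat p :: rat)"
  have PI: "P \<in> \<int>" by (simp add: P_def)
  have coeffs: "3 * a \<in> \<int> \<and> 3 * (a^2 - P * b * c) \<in> \<int> \<and> cubic_norm P a b c \<in> \<int>"
  proof (cases "b = 0 \<and> c = 0")
    case True
    hence "3 dvd A" using ABC by auto
    hence "a \<in> \<int>" unfolding ABC(1) by (auto elim!: dvdE)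
    thus ?thesis using True by (auto simp: cubic_norm_def intro!: Ints_mult Ints_power)
  next
    case False
    hence nz: "b \<noteq> 0 \<or> c \<noteq> 0" by blast
    note I = cubic_char_poly_integral[OF pp(1) t int nz, unfolded cubic_char_poly_def P_def[symmetric]]
    show ?thesis using I[of 2] I[of 1] I[of 0] by (simp add: numeral_2_eq_2 numeral_3_eq_3)
  qed
  obtain T where T: "3 * a = of_int T" using coeffs by (auto elim: Ints_cases)
  obtain U where U: "3 * (a^2 - P * b * c) = of_int U" using coeffs by (auto elim: Ints_cases)
  obtain N where N: "cubic_norm P a b c = of_int N" using coeffs by (auto elim: Ints_cases)
  have eq: "\<alpha> ^ 3 = of_int T * \<alpha> ^ 2 - of_int U * \<alpha> + of_int N"
    using cubic_elem_char_equation[OF t, of a b c, folded P_def abc, unfolded T U N] by simp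
  have sq: "\<alpha> ^ 2 = cubic_elem t (a^2 + 2 * P * b * c) (2 * a * b + P * c^2) (b^2 + 2 * a * c)"
  proof -
    have "\<alpha> ^ 2 = cubic_elem t a b c * cubic_elem t a b c" by (simp add: abc power2_eq_square)
    also have "\<dots> = cubic_elem t (a^2 + 2 * P * b * c) (2 * a * b + P * c^2) (b^2 + 2 * a * c)"
      unfolding cubic_elem_mult[OF t] P_def
      by (rule arg_cong2[where f = "\<lambda>f x. f x", OF arg_cong2[where f = "\<lambda>x y. cubic_elem t x y"]])
         (simp_all add: power2_eq_square algebra_simps)
    finally show ?thesis .
  qed
  have coords: "\<exists>v w :: int. y = of_int v * b + of_int w * (2 * a * b + P * c^2) \<and> z = of_int v * c + of_int w * (b^2 + 2 * a * c)"
    if "cubic_elem t x y z \<in> ring_of_integers (generate_field complex_ring {t})" for x y z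
  proof -
    have "cubic_elem t x y z \<in> generate_ring complex_ring {\<alpha>}" using that gen by simp
    from generate_ring_cubic_integer[OF eq this] obtain u v w where
      "cubic_elem t x y z = of_int u + of_int v * \<alpha> + of_int w * \<alpha> ^ 2" by blast
    also have "\<dots> = cubic_elem t (of_int u + of_int v * a + of_int w * (a^2 + 2 * P * b * c))
       (of_int v * b + of_int w * (2 * a * b + P * c^2)) (of_int v * c + of_int w * (b^2 + 2 * a * c))"
      unfolding sq unfolding abc cubic_elem_def by (simp add: of_rat_add of_rat_mult algebra_simps)
    finally have "cubic_elem t x y z = \<dots>" .
    from cubic_elem_inject[OF pp(1) t this] show ?thesis by blast
  qed
  obtain k where k: "int p = 1 + 9 * k"
  proof -
    have "[int p = int 1] (mod int 9)" using pp(2) by (simp only: cong_int_iff)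
    hence "9 dvd int p - 1" by (simp add: cong_iff_dvd_diff)
    then obtain k where "int p - 1 = 9 * k" by (rule dvdE)
    thus ?thesis by (intro that[of k]) simp
  qed
  have Pk: "t ^ 3 = 1 + 9 * of_int k"
  proof -
    have "t ^ 3 = of_int (int p)" using t by simp
    thus ?thesis unfolding k by simp
  qed
  have "algebraic_int (cubic_elem t 0 1 0)"
  proof (rule algebraic_int.intros[of "[: - (t^3), 0, 0, 1 :]"])
    show "\<forall>i. coeff [: - (t^3), 0, 0, 1 :] i \<in> \<int>" unfolding t by (auto simp: coeff_pCons split: nat.splits)
    show "poly [: - (t^3), 0, 0, 1 :] (cubic_elem t 0 1 0) = 0" by (simp add: cubic_elem_def power3_eq_cube)
  qed simp
  hence "cubic_elem t 0 1 0 \<in> ring_of_integers (generate_field complex_ring {t})"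
    unfolding ring_of_integers_def K by blast
  from coords[OF this] obtain v w :: int where vw: "1 = of_int v * b + of_int w * (2 * a * b + P * c^2)"
    "0 = of_int v * c + of_int w * (b^2 + 2 * a * c)" by blast
  have "algebraic_int (cubic_elem t (1/3) (1/3) (1/3))"
  proof (rule algebraic_int.intros[of "[: - 3 * of_int (k^2), - 3 * of_int k, -1, 1 :]"])
    show "\<forall>i. coeff [: - 3 * of_int (k^2), - 3 * of_int k, -1, 1 :] i \<in> \<int>"
      by (auto simp: coeff_pCons split: nat.splits)
    \<comment> \<open>The polynomial is \<open>X\<^sup>3 - X\<^sup>2 + (1 - p)/3 X - (p - 1)\<^sup>2/27\<close> for \<open>p = 1 + 9k\<close>.\<close>
    have kt: "of_int k = (t^3 - 1) / 9" using Pk by simp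
    show "poly [: - 3 * of_int (k^2), - 3 * of_int k, -1, 1 :] (cubic_elem t (1/3) (1/3) (1/3)) = 0"
      unfolding of_int_power kt
      by (simp add: cubic_elem_def of_rat_divide field_simps power2_eq_square power3_eq_cube)
  qed simp
  hence "cubic_elem t (1/3) (1/3) (1/3) \<in> ring_of_integers (generate_field complex_ring {t})"
    unfolding ring_of_integers_def K by blast
  from coords[OF this] obtain v' w' :: int where vw': "1 / 3 = of_int v' * b + of_int w' * (2 * a * b + P * c^2)"
    "1 / 3 = of_int v' * c + of_int w' * (b^2 + 2 * a * c)" by blast
  define D where "D = v * w' - w * v'"
  have "of_int D * (b^3 - P * c^3) = (of_int v * b + of_int w * (2 * a * b + P * c^2)) * (of_int v' * c + of_int w' * (b^2 + 2 * a * c))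
      - (of_int v * c + of_int w * (b^2 + 2 * a * c)) * (of_int v' * b + of_int w' * (2 * a * b + P * c^2))"
    by (simp add: D_def power2_eq_square power3_eq_cube algebra_simps)
  also have "\<dots> = 1 / 3" unfolding vw[symmetric] vw'[symmetric] by simp
  finally have "of_int D * (b^3 - P * c^3) = 1 / 3" .
  hence "of_int (D * (B^3 - int p * C^3)) = (of_int 9 :: rat)"
    unfolding ABC P_def by (simp add: field_simps)
  hence D9: "D * (B^3 - int p * C^3) = 9" by (simp only: of_int_eq_iff)
  obtain m where m: "B = C + 3 * m"
  proof -
    obtain m where "B - C = 3 * m" using ABC(5) by (rule dvdE)
    thus ?thesis by (intro that[of m]) simp
  qed
  \<comment> \<open>The quotient of \<open>(C + 3m)\<^sup>3 - (1 + 9k) C\<^sup>3\<close> by 9.\<close>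
  define e where "e = m * C^2 + 3 * m^2 * C + 3 * m^3 - k * C^3"
  have e: "B^3 - int p * C^3 = 9 * e"
    unfolding m k e_def by (simp add: power2_eq_square power3_eq_cube algebra_simps)
  have "D * e = 1" using D9 unfolding e by simp
  hence "e = 1 \<or> e = -1" by (auto simp: zmult_eq_1_iff)
  thus False
  proof
    assume "e = 1"
    hence "int p * (-C)^3 + B^3 = 9" using e by simp
    thus False using insol by blast
  next
    assume "e = -1"
    hence "int p * C^3 + (-B)^3 = 9" using e by simp
    thus False using insol by blast
  qed
qed

theorem pure_cubic_field_nonmonogenic:
  assumes "p \<in> insoluble_primes"
  shows "cubic_field (pure_cubic_field p) \<and> \<not> monogenic (pure_cubic_field p)"
proof -
  have t: "complex_of_real (root 3 (real p)) ^ 3 = of_nat p"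
    unfolding of_real_power[symmetric] by (simp add: real_root_pow_pos2)
  have p: "Factorial_Ring.prime p" using assms by (simp add: insoluble_primes_def)
  show ?thesis
    unfolding pure_cubic_field_def
    using cubic_field_generate_field[OF p t] not_monogenic_pure_cubic[OF assms t] by blast
qed

section \<open>Chebyshev's bound\<close>

lemma card_multiples: "card {m\<in>{1..n}. d dvd m} = n div d" if "d > 0" for d n :: nat
proof -
  have "{m\<in>{1..n}. d dvd m} = (*) d ` {1..n div d}"
  proof (intro equalityI subsetI)
    fix m assume m: "m \<in> {m\<in>{1..n}. d dvd m}"
    then obtain e where e: "m = d * e" by (auto elim: dvdE)
    hence "e \<le> n div d" using m that by (simp add: less_eq_div_iff_mult_less_eq mult.commute)
    moreover have "e \<ge> 1" using m e by (cases e) auto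
    ultimately show "m \<in> (*) d ` {1..n div d}" unfolding e by (intro imageI) simp
  next
    fix m assume "m \<in> (*) d ` {1..n div d}"
    then obtain e where e0: "m = d * e" "e \<in> {1..n div d}" by (rule imageE)
    hence e: "m = d * e" "1 \<le> e" "e \<le> n div d" by auto
    hence "d * e \<le> n" using that by (simp add: less_eq_div_iff_mult_less_eq mult.commute)
    thus "m \<in> {m\<in>{1..n}. d dvd m}" using e that by auto
  qed
  thus ?thesis using that by (simp add: card_image inj_on_def)
qed

text \<open>A common range of summation for all \<open>n \<le> M\<close> lets the formulas for \<open>n\<close> and \<open>2n\<close> be subtracted termwise.\<close>
lemma ln_fact_mangoldt:
  assumes "n \<le> M"
  shows "ln (fact n :: real) = (\<Sum>d=1..M. mangoldt d * real (n div d))"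
proof -
  have "ln (fact n :: real) = ln (\<Prod>m=1..n. real m)" by (simp add: fact_prod)
  also have "\<dots> = (\<Sum>m=1..n. ln (real m))" by (rule ln_prod) auto
  also have "\<dots> = (\<Sum>m=1..n. \<Sum>d=1..M. if d dvd m then mangoldt d else 0)"
  proof (rule sum.cong[OF refl])
    fix m assume m: "m \<in> {1..n}"
    hence "ln (real m) = (\<Sum>d | d dvd m. mangoldt d)" using mangoldt_sum[of m, where ?'a = real] by simp
    also have "{d. d dvd m} = {d\<in>{1..M}. d dvd m}"
    proof (intro equalityI subsetI)
      fix d assume "d \<in> {d. d dvd m}"
      thus "d \<in> {d\<in>{1..M}. d dvd m}" using m assms dvd_imp_le[of d m] by (cases "d = 0") auto
    qed auto
    also have "(\<Sum>d\<in>{d\<in>{1..M}. d dvd m}. mangoldt d) = (\<Sum>d=1..M. if d dvd m then mangoldt d else (0::real))"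
      by (rule sum.inter_filter) simp
    finally show "ln (real m) = \<dots>" .
  qed
  also have "\<dots> = (\<Sum>d=1..M. \<Sum>m=1..n. if d dvd m then mangoldt d else 0)" by (rule sum.swap)
  also have "\<dots> = (\<Sum>d=1..M. mangoldt d * real (n div d))"
  proof (rule sum.cong[OF refl])
    fix d assume "d \<in> {1..M}"
    thus "(\<Sum>m=1..n. if d dvd m then mangoldt d else 0) = mangoldt d * real (n div d)"
      using card_multiples[of d n] by (simp add: sum.inter_filter[symmetric])
  qed
  finally show ?thesis .
qed

text \<open>Each prime power in the interval from \<open>n\<close> to \<open>2n\<close> contributes to the logarithm of the central binomial
  coefficient, which is at most \<open>2n ln 2\<close>.\<close>
lemma mangoldt_sum_doubling: "(\<Sum>d\<in>{n<..2*n}. mangoldt d :: real) \<le> 2 * real n * ln 2"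
proof -
  have "(\<Sum>d\<in>{n<..2*n}. mangoldt d :: real) = (\<Sum>d\<in>{n<..2*n}. mangoldt d * (real (2*n div d) - 2 * real (n div d)))"
  proof (rule sum.cong[OF refl])
    fix d assume d: "d \<in> {n<..2*n}"
    hence "2 * n div d = 1" by (intro div_nat_eqI) auto
    thus "mangoldt d = mangoldt d * (real (2*n div d) - 2 * real (n div d))" using d by simp
  qed
  also have "\<dots> \<le> (\<Sum>d=1..2*n. mangoldt d * (real (2*n div d) - 2 * real (n div d)))"
  proof (rule sum_mono2)
    fix d assume "d \<in> {1..2*n} - {n<..2*n}"
    have "d * (2 * (n div d)) \<le> 2 * n" using div_times_less_eq_dividend[of n d] by (simp add: mult.commute)
    hence "d > 0 \<Longrightarrow> 2 * (n div d) \<le> 2 * n div d" by (simp add: less_eq_div_iff_mult_less_eq mult.commute)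
    hence "real (2*n div d) - 2 * real (n div d) \<ge> 0" by (cases "d = 0") (simp_all add: of_nat_mono[of "2 * (n div d)" "2 * n div d", where ?'a = real, simplified])
    thus "0 \<le> mangoldt d * (real (2*n div d) - 2 * real (n div d))" by (intro mult_nonneg_nonneg mangoldt_nonneg)
  qed auto
  also have "\<dots> = ln (fact (2*n)) - 2 * ln (fact n)"
    unfolding ln_fact_mangoldt[OF order_refl, of "2*n"] ln_fact_mangoldt[of n "2*n", simplified]
    by (simp add: algebra_simps sum_subtractf sum_distrib_left)
  also have "\<dots> = ln (real (2 * n choose n))"
  proof -
    have "real (2 * n choose n) = fact (2*n) / (fact n * fact n)"
      using binomial_fact[of n "2*n", where ?'a = real] by (simp add: mult_2)
    thus ?thesis by (simp add: ln_div ln_mult)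
  qed
  also have "\<dots> \<le> ln (2 ^ (2*n))"
  proof (subst ln_le_cancel_iff)
    show "real (2 * n choose n) \<le> 2 ^ (2*n)" using of_nat_mono[OF binomial_le_pow2[of "2*n" n], where ?'a = real] by simp
  qed auto
  also have "\<dots> = 2 * real n * ln 2" by (simp add: ln_realpow)
  finally show ?thesis .
qed

lemma chebyshev: "(\<Sum>d=1..N. mangoldt d :: real) \<le> 4 * real N"
proof (induction N rule: less_induct)
  case (less N)
  show ?case
  proof (cases "N = 0")
    case False
    define m where "m = N div 2"
    have m: "m < N" "N = 2 * m \<or> N = 2 * m + 1" using False by (auto simp: m_def)
    have "(\<Sum>d=1..2*m. mangoldt d :: real) = (\<Sum>d=1..m. mangoldt d) + (\<Sum>d\<in>{m<..2*m}. mangoldt d)"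
      by (subst sum.union_disjoint[symmetric]) (auto intro!: sum.cong)
    also have "\<dots> \<le> 4 * real m + 2 * real m * ln 2" using less.IH[OF m(1)] mangoldt_sum_doubling[of m] by linarith
    also have "\<dots> \<le> 6 * real m" using ln_2_less_1 mult_left_mono[of "ln 2" 1 "2 * real m"] by simp
    finally have 1: "(\<Sum>d=1..2*m. mangoldt d :: real) \<le> 6 * real m" .
    from m(2) show ?thesis
    proof
      assume N: "N = 2 * m + 1"
      have "mangoldt N \<le> ln (real N)" using mangoldt_le[of N] False by simp
      also have "\<dots> \<le> real N - 1" using False by (intro ln_le_minus_one) auto
      finally have "mangoldt N \<le> 2 * real m" using N by simp
      moreover have "(\<Sum>d=1..N. mangoldt d :: real) = (\<Sum>d=1..2*m. mangoldt d) + mangoldt N" by (simp add: N)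
      ultimately show ?thesis using 1 N by simp
    qed (use 1 in simp)
  qed simp
qed

text \<open>The prime powers that are not primes contribute little: \<open>n = p\<^sup>k \<le> N\<close> with \<open>k \<ge> 2\<close>
  has \<open>p \<le> \<surd>N\<close> and \<open>k \<le> log\<^sub>2 N\<close>.\<close>
lemma mangoldt_composite_sum:
  assumes N: "N \<ge> 1"
  shows "(\<Sum>n | n \<in> {1..N} \<and> \<not> Factorial_Ring.prime n. mangoldt n) \<le> sqrt (real N) * log 2 (real N) * ln (real N)"
proof -
  define E where "E = {n\<in>{1..N}. \<not> Factorial_Ring.prime n \<and> primepow n}"
  define B where "B = {1..nat \<lfloor>sqrt (real N)\<rfloor>} \<times> {1..nat \<lfloor>log 2 (real N)\<rfloor>}"
  have log0: "log 2 (real N) \<ge> 0" using N by simp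
  have "E \<subseteq> (\<lambda>(p, k). p ^ k) ` B"
  proof
    fix n assume n: "n \<in> E"
    then obtain p k where pk: "Factorial_Ring.prime p" "k > 0" "n = p ^ k" by (auto simp: E_def primepow_def)
    have "k \<noteq> 1" using n pk by (auto simp: E_def)
    hence k2: "k \<ge> 2" using pk(2) by simp
    have p2: "p \<ge> 2" using pk(1) by (rule prime_ge_2_nat)
    have nN: "p ^ k \<le> N" using n pk(3) by (simp add: E_def)
    have "p ^ 2 \<le> p ^ k" using k2 p2 by (intro power_increasing) auto
    hence "p ^ 2 \<le> N" using nN by simp
    hence "real p ^ 2 \<le> real N" by (metis of_nat_le_iff of_nat_power)
    hence "real p \<le> sqrt (real N)" by (rule real_le_rsqrt)
    hence 1: "p \<le> nat \<lfloor>sqrt (real N)\<rfloor>" by (simp add: le_nat_floor)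
    have "2 ^ k \<le> p ^ k" using p2 by (rule power_mono) simp
    hence "2 ^ k \<le> N" using nN by simp
    hence "(2::real) ^ k \<le> real N" by (metis of_nat_le_iff of_nat_power of_nat_numeral)
    hence "real k \<le> log 2 (real N)" using N by (simp add: le_log_iff powr_realpow)
    hence 2: "k \<le> nat \<lfloor>log 2 (real N)\<rfloor>" by (rule le_nat_floor)
    show "n \<in> (\<lambda>(p, k). p ^ k) ` B"
      using 1 2 pk(2,3) p2 by (intro image_eqI[of _ _ "(p,k)"]) (auto simp: B_def)
  qed
  hence "card E \<le> card B" by (rule surj_card_le[rotated]) (simp add: B_def)
  also have "card B = nat \<lfloor>sqrt (real N)\<rfloor> * nat \<lfloor>log 2 (real N)\<rfloor>" by (simp add: B_def)
  finally have "real (card E) \<le> real (nat \<lfloor>sqrt (real N)\<rfloor> * nat \<lfloor>log 2 (real N)\<rfloor>)" by (rule of_nat_mono)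
  also have "\<dots> = real (nat \<lfloor>sqrt (real N)\<rfloor>) * real (nat \<lfloor>log 2 (real N)\<rfloor>)" by (rule of_nat_mult)
  also have "\<dots> \<le> sqrt (real N) * log 2 (real N)" using log0 by (intro mult_mono of_nat_floor) auto
  finally have card: "real (card E) \<le> sqrt (real N) * log 2 (real N)" .
  have "(\<Sum>n | n \<in> {1..N} \<and> \<not> Factorial_Ring.prime n. mangoldt n) = (\<Sum>n\<in>E. mangoldt n :: real)"
    by (rule sum.mono_neutral_right) (auto simp: E_def mangoldt_def)
  also have "\<dots> \<le> (\<Sum>n\<in>E. ln (real N))"
  proof (rule sum_mono)
    fix n assume "n \<in> E"
    hence n: "n > 0" "n \<le> N" by (auto simp: E_def)
    have "mangoldt n \<le> ln (real n)" using mangoldt_le[OF n(1)] .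
    also have "\<dots> \<le> ln (real N)" using n by simp
    finally show "mangoldt n \<le> ln (real N)" .
  qed
  also have "\<dots> = real (card E) * ln (real N)" by simp
  also have "\<dots> \<le> sqrt (real N) * log 2 (real N) * ln (real N)" using card N by (intro mult_right_mono) auto
  finally show ?thesis .
qed

section \<open>Primary primes over a rational prime\<close>

lemma eis_mangoldt_nonzeroE:
  assumes "eis_mangoldt x \<noteq> 0"
  obtains \<pi> k where "\<pi> \<in> primary_primes" "k > 0" "x = \<pi> ^ k"
  using assms that unfolding eis_mangoldt_def by (meson)

lemma eis_cnj_power: "eis_cnj (x ^ k) = eis_cnj x ^ k"
proof (induction k)
  case 0
  show ?case by (simp add: eis_eq_iff)
next
  case (Suc k)
  thus ?case by (simp add: eis_cnj_mult)
qed

lemma eis_cnj_dvd: "x dvd y \<Longrightarrow> eis_cnj x dvd eis_cnj y"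
  by (auto elim!: dvdE simp: eis_cnj_mult)

lemma primary_primes_cnj:
  assumes "\<pi> \<in> primary_primes"
  shows "eis_cnj \<pi> \<in> primary_primes"
proof -
  have p: "prime_elem \<pi>" "\<pi> \<in> primary" using assms by (auto simp: primary_primes_def)
  have "prime_elem (eis_cnj \<pi>)"
  proof (rule prime_elemI)
    show "eis_cnj \<pi> \<noteq> 0" using primary_not_0[OF primary_cnj[OF p(2)]] .
    show "\<not> eis_cnj \<pi> dvd 1"
    proof
      assume "eis_cnj \<pi> dvd 1"
      hence "eis_cnj \<pi> = 1" by (rule primary_unit[OF primary_cnj[OF p(2)]])
      hence "eis_norm \<pi> = 1" by (metis eis_norm_cnj eis_norm_power power_0)
      thus False using eis_norm_primary_prime_gt_1[OF assms] by simp
    qed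
    fix a b assume "eis_cnj \<pi> dvd a * b"
    hence "\<pi> dvd eis_cnj a * eis_cnj b" using eis_cnj_dvd[of "eis_cnj \<pi>" "a * b"] by (simp add: eis_cnj_mult)
    hence "\<pi> dvd eis_cnj a \<or> \<pi> dvd eis_cnj b" by (rule prime_elem_dvd_multD[OF p(1)])
    thus "eis_cnj \<pi> dvd a \<or> eis_cnj \<pi> dvd b"
      using eis_cnj_dvd[of \<pi> "eis_cnj a"] eis_cnj_dvd[of \<pi> "eis_cnj b"] by auto
  qed
  thus ?thesis using primary_cnj[OF p(2)] by (simp add: primary_primes_def)
qed

text \<open>A prime element divides its norm, hence one of the rational prime factors \<open>p\<close> of the norm; its norm
  then divides the norm \<open>p\<^sup>2\<close> of \<open>p\<close>.\<close>
lemma primary_prime_rational_prime: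
  assumes "\<pi> \<in> primary_primes"
  obtains p m where "Factorial_Ring.prime p" "\<pi> dvd of_nat p" "eis_norm \<pi> = int (p ^ m)" "0 < m" "m \<le> 2"
proof -
  have pr: "prime_elem \<pi>" using assms by (simp add: primary_primes_def)
  define n where "n = nat (eis_norm \<pi>)"
  have n: "eis_norm \<pi> = int n" "n > 1" using eis_norm_primary_prime_gt_1[OF assms] by (auto simp: n_def)
  have ex: "\<exists>p. Factorial_Ring.prime p \<and> \<pi> dvd of_nat p" if "\<pi> dvd of_nat m" "m > 0" for m :: nat
    using that
  proof (induction m rule: less_induct)
    case (less m)
    have "m \<noteq> 1" using less.prems prime_elem_not_unit[OF pr] by auto
    then obtain p where p: "Factorial_Ring.prime p" "p dvd m" using prime_factor_nat by blast
    then obtain l where l: "m = p * l" by (auto elim: dvdE)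
    have lm: "l < m" "l > 0" using l p(1) less.prems(2) prime_gt_1_nat[OF p(1)] by auto
    have "\<pi> dvd of_nat p * of_nat l" using less.prems by (simp add: l)
    hence "\<pi> dvd of_nat p \<or> \<pi> dvd of_nat l" by (rule prime_elem_dvd_multD[OF pr])
    thus ?case using p(1) less.IH[OF lm(1) _ lm(2)] by blast
  qed
  have "\<pi> dvd \<pi> * eis_cnj \<pi>" by simp
  hence "\<pi> dvd of_nat n" by (simp add: eis_mult_cnj n(1))
  with n(2) obtain p where p: "Factorial_Ring.prime p" "\<pi> dvd of_nat p" using ex[of n] by auto
  have "eis_norm \<pi> dvd eis_norm (of_nat p)" using p(2) by (rule eis_norm_dvd)
  also have "eis_norm (of_nat p) = int (p ^ 2)" by (simp add: eis_norm_def power2_eq_square)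
  finally have "n dvd p ^ 2" unfolding n(1) by (simp only: of_nat_dvd_iff)
  then obtain m where m: "m \<le> 2" "n = p ^ m" using divides_primepow_nat[OF p(1)] by blast
  moreover have "m \<noteq> 0" using m n(2) by (cases m) auto
  ultimately show ?thesis using p n(1) by (intro that[of p m]) auto
qed

text \<open>Above a rational prime there are at most two primary primes, and these are conjugate.\<close>
lemma eis_mangoldt_support:
  assumes x: "x \<in> primary_of_norm n" "eis_mangoldt x \<noteq> 0"
  shows "{y \<in> primary_of_norm n. eis_mangoldt y \<noteq> 0} \<subseteq> {x, eis_cnj x}" "eis_mangoldt x \<le> 2 * mangoldt n"
    "eis_mangoldt x \<le> ln (real n)"
proof -
  obtain \<pi> k where pk: "\<pi> \<in> primary_primes" "k > 0" "x = \<pi> ^ k" using x(2) by (rule eis_mangoldt_nonzeroE)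
  obtain p m where pm: "Factorial_Ring.prime p" "\<pi> dvd of_nat p" "eis_norm \<pi> = int (p ^ m)" "0 < m" "m \<le> 2"
    using pk(1) by (rule primary_prime_rational_prime)
  have N: "int n = eis_norm \<pi> ^ k" using x(1) by (simp add: primary_of_norm_def pk eis_norm_power)
  also have "\<dots> = int (p ^ (m * k))" by (simp add: pm(3) power_mult)
  finally have n: "n = p ^ (m * k)" by (simp only: of_nat_eq_iff)
  have p1: "p > 1" using pm(1) by (rule prime_gt_1_nat)
  have mang: "mangoldt n = ln (real p)" unfolding n using pm(1,4) pk(2) by (subst mangoldt_primepow) auto
  have L: "eis_mangoldt x = real m * ln (real p)"
    unfolding pk(3) eis_mangoldt_power[OF pk(1,2)] pm(3) using p1 by (simp add: ln_realpow)
  have lp: "ln (real p) \<ge> 0" using p1 by simp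
  show "eis_mangoldt x \<le> 2 * mangoldt n"
    unfolding L mang using pm(5) lp by (intro mult_right_mono) auto
  have "ln (real n) = real (m * k) * ln (real p)" unfolding n using p1 by (simp add: ln_realpow)
  moreover have "real m \<le> real (m * k)" by (rule of_nat_mono) (use pk(2) in simp)
  ultimately show "eis_mangoldt x \<le> ln (real n)" unfolding L using lp by (simp only: mult_right_mono)
  show "{y \<in> primary_of_norm n. eis_mangoldt y \<noteq> 0} \<subseteq> {x, eis_cnj x}"
  proof
    fix y assume "y \<in> {y \<in> primary_of_norm n. eis_mangoldt y \<noteq> 0}"
    hence y: "y \<in> primary_of_norm n" "eis_mangoldt y \<noteq> 0" by auto
    obtain \<sigma> l where sl: "\<sigma> \<in> primary_primes" "l > 0" "y = \<sigma> ^ l" using y(2) by (rule eis_mangoldt_nonzeroE)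
    obtain q r where qr: "Factorial_Ring.prime q" "\<sigma> dvd of_nat q" "eis_norm \<sigma> = int (q ^ r)" "0 < r" "r \<le> 2"
      using sl(1) by (rule primary_prime_rational_prime)
    have "int n = eis_norm \<sigma> ^ l" using y(1) by (simp add: primary_of_norm_def sl eis_norm_power)
    also have "\<dots> = int (q ^ (r * l))" by (simp add: qr(3) power_mult)
    finally have n': "n = q ^ (r * l)" by (simp only: of_nat_eq_iff)
    have "q dvd n" unfolding n' using qr(4) sl(2) by (intro dvd_power) auto
    hence "q dvd p" unfolding n using prime_dvd_power[OF qr(1)] by blast
    hence qp: "q = p" using qr(1) pm(1) by (metis primes_dvd_imp_eq)
    have s: "prime_elem \<sigma>" using sl(1) by (simp add: primary_primes_def)
    have "\<sigma> dvd of_nat p" using qr(2) qp by simp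
    also have "(of_nat p :: eis) dvd of_nat p ^ m" using pm(4) by (intro dvd_power) auto
    also have "of_nat p ^ m = \<pi> * eis_cnj \<pi>" by (simp add: eis_mult_cnj pm(3))
    finally have "\<sigma> dvd \<pi> \<or> \<sigma> dvd eis_cnj \<pi>" by (rule prime_elem_dvd_multD[OF s])
    hence "\<sigma> = \<pi> \<or> \<sigma> = eis_cnj \<pi>"
      using primary_prime_unique[OF sl(1) pk(1), of 1] primary_prime_unique[OF sl(1) primary_primes_cnj[OF pk(1)], of 1] by auto
    moreover from this have "eis_norm \<sigma> = eis_norm \<pi>" by auto
    hence "q ^ r = p ^ m" unfolding qr(3) pm(3) by (simp only: of_nat_eq_iff)
    hence "r = m" unfolding qp using p1 by (simp add: power_inject_exp)
    hence "l = k" using n n' qp p1 pm(4) by (simp add: power_inject_exp)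
    ultimately show "y \<in> {x, eis_cnj x}" unfolding sl(3) pk(3) eis_cnj_power by auto
  qed
qed

section \<open>Mean values of von Mangoldt functions\<close>

text \<open>At most two conjugate terms, each at most \<open>2 \<Lambda>(n)\<close>; this carries Chebyshev's bound over to the
  Eisenstein integers.\<close>
lemma eis_mangoldt_class_sum:
  "(\<Sum>x\<in>primary_of_norm n. eis_mangoldt x) \<le> 4 * mangoldt n"
proof (cases "\<exists>x\<in>primary_of_norm n. eis_mangoldt x \<noteq> 0")
  case True
  then obtain x where x: "x \<in> primary_of_norm n" "eis_mangoldt x \<noteq> 0" by blast
  have "(\<Sum>x\<in>primary_of_norm n. eis_mangoldt x) = (\<Sum>y | y \<in> primary_of_norm n \<and> eis_mangoldt y \<noteq> 0. eis_mangoldt y)"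
    by (rule sum.mono_neutral_right) auto
  also have "\<dots> \<le> (\<Sum>y | y \<in> primary_of_norm n \<and> eis_mangoldt y \<noteq> 0. 2 * mangoldt n)"
    by (rule sum_mono) (use eis_mangoldt_support(2) in auto)
  also have "\<dots> = real (card {y \<in> primary_of_norm n. eis_mangoldt y \<noteq> 0}) * (2 * mangoldt n)" by simp
  also have "\<dots> \<le> real 2 * (2 * mangoldt n)"
  proof (rule mult_right_mono[OF of_nat_mono])
    have "card {y \<in> primary_of_norm n. eis_mangoldt y \<noteq> 0} \<le> card {x, eis_cnj x}"
      by (rule card_mono[OF _ eis_mangoldt_support(1)[OF x]]) simp
    also have "\<dots> \<le> 2" by (simp add: card_insert_if)
    finally show "card {y \<in> primary_of_norm n. eis_mangoldt y \<noteq> 0} \<le> 2" .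
  qed (simp add: mangoldt_nonneg)
  finally show ?thesis by simp
next
  case False
  hence "(\<Sum>x\<in>primary_of_norm n. eis_mangoldt x) = 0" by (intro sum.neutral) auto
  thus ?thesis by (simp add: mangoldt_nonneg)
qed

lemma linear_growth_mangoldt:
  assumes "\<And>n. norm (f n) \<le> 4 * mangoldt n"
  shows "linear_growth f"
  unfolding linear_growth_def
proof (intro exI allI)
  fix N
  have "(\<Sum>n=1..N. norm (f n)) \<le> (\<Sum>n=1..N. 4 * mangoldt n)" by (rule sum_mono) (rule assms)
  also have "\<dots> = 4 * (\<Sum>n=1..N. mangoldt n)" by (simp add: sum_distrib_left)
  also have "\<dots> \<le> 16 * real N" using chebyshev[of N] by simp
  finally show "(\<Sum>n=1..N. norm (f n)) \<le> 16 * real N" .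
qed

abbreviation char_mangoldt :: "int \<Rightarrow> int \<Rightarrow> nat \<Rightarrow> complex" where
  "char_mangoldt j k \<equiv> norm_sum (\<lambda>x. cubic_char j k x * of_real (eis_mangoldt x))"

lemma cubic_char_log_derivative:
  obtains C :: real where "C > 0" "\<And>j k. log_derivative_pair (norm_sum (cubic_char j k)) (char_mangoldt j k)
     (if 3 dvd j \<and> 3 dvd k then of_real C else 0)"
proof -
  obtain C K :: real where C: "C > 0" and K: "\<And>j k n. norm ((\<Sum>m=1..n. norm_sum (cubic_char j k) m)
     - (if 3 dvd j \<and> 3 dvd k then of_real C else 0) * of_nat n) \<le> K * sqrt (real n)"
    using cubic_char_mean_value by blast
  have one: "norm_sum (cubic_char 0 0) m = of_real (real (card (primary_of_norm m)))" for m
    by (simp add: norm_sum_def cubic_char_0)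
  have card: "(\<Sum>m=1..n. real (card (primary_of_norm m))) \<le> (C + \<bar>K\<bar>) * real n" for n
  proof -
    have "(\<Sum>m=1..n. norm_sum (cubic_char 0 0) m) - of_real C * of_nat n =
      of_real ((\<Sum>m=1..n. real (card (primary_of_norm m))) - C * real n)" unfolding one by simp
    hence "\<bar>(\<Sum>m=1..n. real (card (primary_of_norm m))) - C * real n\<bar> \<le> K * sqrt (real n)"
      using K[of 0 0 n] by (simp only: dvd_0_right simp_thms if_True norm_of_real)
    hence "(\<Sum>m=1..n. real (card (primary_of_norm m))) \<le> C * real n + K * sqrt (real n)" by linarith
    also have "K * sqrt (real n) \<le> \<bar>K\<bar> * real n"
    proof (intro mult_mono)
      show "sqrt (real n) \<le> real n"
        by (cases "n = 0") (auto intro!: real_le_lsqrt simp: power2_eq_square)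
    qed auto
    finally show ?thesis by (simp add: algebra_simps)
  qed
  have bound: "norm (norm_sum (cubic_char j k) m) \<le> real (card (primary_of_norm m))" for j k m
    unfolding norm_sum_def by (rule order_trans[OF norm_sum]) (simp add: norm_cubic_char)
  have "log_derivative_pair (norm_sum (cubic_char j k)) (char_mangoldt j k)
     (if 3 dvd j \<and> 3 dvd k then of_real C else 0)" for j k
    unfolding log_derivative_pair_def
  proof (intro conjI)
    show "linear_growth (norm_sum (cubic_char j k))"
      unfolding linear_growth_def
      by (intro exI[of _ "C + \<bar>K\<bar>"] allI order_trans[OF sum_mono[OF bound] card])
    show "linear_growth (char_mangoldt j k)"
    proof (rule linear_growth_mangoldt)
      fix n
      have "norm (char_mangoldt j k n) \<le> (\<Sum>x\<in>primary_of_norm n. norm (cubic_char j k x * of_real (eis_mangoldt x)))"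
        unfolding norm_sum_def by (rule norm_sum)
      also have "\<dots> = (\<Sum>x\<in>primary_of_norm n. eis_mangoldt x)"
        by (simp add: norm_mult norm_cubic_char eis_mangoldt_nonneg)
      also have "\<dots> \<le> 4 * mangoldt n" by (rule eis_mangoldt_class_sum)
      finally show "norm (char_mangoldt j k n) \<le> 4 * mangoldt n" .
    qed
    have "primary_of_norm 1 = {1}"
    proof (intro equalityI subsetI)
      fix x assume "x \<in> primary_of_norm 1"
      hence x: "x \<in> primary" "eis_norm x = 1" by (auto simp: primary_of_norm_def)
      have "x * eis_cnj x = 1" by (simp add: eis_mult_cnj x(2))
      hence "x dvd 1" by (metis dvd_triv_left)
      thus "x \<in> {1}" using primary_unit[OF x(1)] by simp
    next
      fix x :: eis assume "x \<in> {1}"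
      thus "x \<in> primary_of_norm 1" using primary_1 eis_norm_power[of 1 0] by (simp add: primary_of_norm_def)
    qed
    thus "norm_sum (cubic_char j k) 1 = 1" by (simp add: norm_sum_def cubic_char_def)
    show "\<exists>K. \<forall>n. norm ((\<Sum>m=1..n. norm_sum (cubic_char j k) m) - (if 3 dvd j \<and> 3 dvd k then of_real C else 0) * of_nat n) \<le> K * sqrt (real n)"
      using K by blast
    show "\<forall>n>0. (\<Sum>d | d dvd n. char_mangoldt j k d * norm_sum (cubic_char j k) (n div d)) = norm_sum (cubic_char j k) n * of_real (ln (real n))"
      by (intro allI impI norm_sum_convolution cubic_char_mult)
  qed
  with C show ?thesis by (rule that)
qed

text \<open>With \<open>w = exp(i\<phi>)\<close> the value is \<open>2(1 + cos \<phi>)\<^sup>2\<close>.\<close>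
lemma three_four_one:
  fixes w :: complex
  assumes "norm w = 1"
  shows "Re (3 + 4 * w + w\<^sup>2) \<ge> 0"
proof -
  have "(Re w)\<^sup>2 + (Im w)\<^sup>2 = 1" using assms by (simp add: cmod_def)
  hence "Re (3 + 4 * w + w\<^sup>2) = 2 * (1 + Re w)\<^sup>2" by (simp add: power2_eq_square algebra_simps)
  thus ?thesis by simp
qed

lemma char_mangoldt_pole: "simple_pole_at_1 (char_mangoldt j k) (if 3 dvd j \<and> 3 dvd k then 1 else 0)"
proof -
  obtain C :: real where C: "C > 0" and P: "\<And>j k. log_derivative_pair (norm_sum (cubic_char j k)) (char_mangoldt j k)
     (if 3 dvd j \<and> 3 dvd k then of_real C else 0)" using cubic_char_log_derivative by blast
  have triv: "cubic_char j k x = 1" if "3 dvd j" "3 dvd k" for j k x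
  proof -
    have "3 dvd (j * ((ea x - 1) div 3) + k * (eb x div 3)) - 0" using that by simp
    from zeta3_powi_cong[OF this] show ?thesis by (simp add: cubic_char_def)
  qed
  have pos: "Re (3 * char_mangoldt 0 0 n + 4 * char_mangoldt j k n * z + char_mangoldt (2 * j) (2 * k) n * z\<^sup>2) \<ge> 0"
    if z: "norm z = 1" for n z
  proof -
    have "3 * char_mangoldt 0 0 n + 4 * char_mangoldt j k n * z + char_mangoldt (2 * j) (2 * k) n * z\<^sup>2 =
      (\<Sum>x\<in>primary_of_norm n. of_real (eis_mangoldt x) * (3 + 4 * (cubic_char j k x * z) + (cubic_char j k x * z)\<^sup>2))"
      unfolding norm_sum_def cubic_char_square
      by (simp add: cubic_char_0 sum.distrib sum_distrib_left sum_distrib_right power_mult_distrib algebra_simps)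
    also have "Re \<dots> = (\<Sum>x\<in>primary_of_norm n. eis_mangoldt x * Re (3 + 4 * (cubic_char j k x * z) + (cubic_char j k x * z)\<^sup>2))"
      by (simp only: Re_sum Re_complex_of_real Im_complex_of_real times_complex.sel) simp
    also have "\<dots> \<ge> 0"
      by (intro sum_nonneg mult_nonneg_nonneg eis_mangoldt_nonneg three_four_one) (simp add: norm_mult norm_cubic_char z)
    finally show ?thesis .
  qed
  have "simple_pole_at_1 (char_mangoldt j k) (if (if 3 dvd j \<and> 3 dvd k then of_real C else 0) = (0::complex) then 0 else 1)"
  proof (rule log_derivative_simple_pole[OF P[of 0 0] P[of j k] P[of "2 * j" "2 * k"]])
    show "(if 3 dvd (0::int) \<and> 3 dvd (0::int) then complex_of_real C else 0) \<noteq> 0" using C by simp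
    have d: "3 dvd 2 * i \<longleftrightarrow> 3 dvd i" for i :: int by presburger
    show "(if 3 dvd j \<and> 3 dvd k then complex_of_real C else 0) = 0 \<and> (if 3 dvd 2 * j \<and> 3 dvd 2 * k then complex_of_real C else 0) = 0 \<or>
        norm_sum (cubic_char j k) = norm_sum (cubic_char 0 0) \<and>
        (if 3 dvd j \<and> 3 dvd k then complex_of_real C else 0) = (if 3 dvd (0::int) \<and> 3 dvd (0::int) then complex_of_real C else 0)"
    proof (cases "3 dvd j \<and> 3 dvd k")
      case True
      hence "cubic_char j k = cubic_char 0 0" using triv by (intro ext) (simp add: cubic_char_0)
      thus ?thesis using True by simp
    next
      case False
      thus ?thesis unfolding d by (simp only: if_False simp_thms)
    qed
  qed (rule pos)
  thus ?thesis using C by (auto split: if_splits)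
qed

lemma simple_pole_at_1_add:
  assumes "simple_pole_at_1 f c" "simple_pole_at_1 g d"
  shows "simple_pole_at_1 (\<lambda>n. w * f n + g n) (w * c + d)"
proof -
  obtain h1 where f: "linear_growth f" "h1 analytic_on {s. Re s \<ge> 1}"
    "\<And>s. Re s > 1 \<Longrightarrow> dirichlet_series f s = c / (s - 1) + h1 s"
    using assms(1) by (auto simp: simple_pole_at_1_def)
  obtain h2 where g: "linear_growth g" "h2 analytic_on {s. Re s \<ge> 1}"
    "\<And>s. Re s > 1 \<Longrightarrow> dirichlet_series g s = d / (s - 1) + h2 s"
    using assms(2) by (auto simp: simple_pole_at_1_def)
  obtain K1 K2 where K: "\<And>N. (\<Sum>n=1..N. norm (f n)) \<le> K1 * real N" "\<And>N. (\<Sum>n=1..N. norm (g n)) \<le> K2 * real N"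
    using f(1) g(1) by (auto simp: linear_growth_def)
  have lin: "linear_growth (\<lambda>n. w * f n + g n)"
    unfolding linear_growth_def
  proof (intro exI allI)
    fix N
    have "(\<Sum>n=1..N. norm (w * f n + g n)) \<le> (\<Sum>n=1..N. norm w * norm (f n) + norm (g n))"
      by (intro sum_mono order_trans[OF norm_triangle_ineq]) (simp add: norm_mult)
    also have "\<dots> = norm w * (\<Sum>n=1..N. norm (f n)) + (\<Sum>n=1..N. norm (g n))"
      by (simp add: sum.distrib sum_distrib_left)
    also have "\<dots> \<le> norm w * (K1 * real N) + K2 * real N"
      by (intro add_mono mult_left_mono K) auto
    finally show "(\<Sum>n=1..N. norm (w * f n + g n)) \<le> (norm w * K1 + K2) * real N" by (simp add: algebra_simps)
  qed
  have "dirichlet_series (\<lambda>n. w * f n + g n) s = (w * c + d) / (s - 1) + (w * h1 s + h2 s)" if s: "Re s > 1" for s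
  proof -
    have "(\<lambda>n. w * (f n * of_nat n powr (-s)) + g n * of_nat n powr (-s)) sums (w * dirichlet_series f s + dirichlet_series g s)"
      by (intro sums_add sums_mult dirichlet_series_sums f(1) g(1) s)
    hence "(\<lambda>n. (w * f n + g n) * of_nat n powr (-s)) sums (w * dirichlet_series f s + dirichlet_series g s)"
      by (simp add: algebra_simps)
    hence "dirichlet_series (\<lambda>n. w * f n + g n) s = w * dirichlet_series f s + dirichlet_series g s"
      using dirichlet_series_sums[OF lin s] by (metis sums_unique2)
    thus ?thesis using f(3)[OF s] g(3)[OF s] by (simp add: algebra_simps add_divide_distrib)
  qed
  moreover have "(\<lambda>s. w * h1 s + h2 s) analytic_on {s. Re s \<ge> 1}"
    by (intro analytic_on_add analytic_on_mult analytic_on_const f(2) g(2))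
  ultimately show ?thesis unfolding simple_pole_at_1_def using lin by blast
qed

lemma simple_pole_at_1_sum:
  assumes "finite I" "\<And>i. i \<in> I \<Longrightarrow> simple_pole_at_1 (f i) (c i)"
  shows "simple_pole_at_1 (\<lambda>n. \<Sum>i\<in>I. w i * f i n) (\<Sum>i\<in>I. w i * c i)"
  using assms
proof (induction I rule: finite_induct)
  case empty
  have "linear_growth (\<lambda>_. 0)" by (auto simp: linear_growth_def intro!: exI[of _ 0])
  moreover have "dirichlet_series (\<lambda>_. 0) s = 0" for s by (simp add: dirichlet_series_def)
  ultimately show ?case
    unfolding simple_pole_at_1_def by (auto intro!: exI[of _ "\<lambda>_. 0"])
next
  case (insert i I)
  have "simple_pole_at_1 (\<lambda>n. w i * f i n + (\<Sum>i\<in>I. w i * f i n)) (w i * c i + (\<Sum>i\<in>I. w i * c i))"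
    by (rule simple_pole_at_1_add) (use insert in auto)
  thus ?case using insert.hyps by simp
qed

text \<open>Primes in this class have a second coordinate divisible by 3 and not by 9, which keeps 3
  from being a cube modulo their norm if that is a prime.\<close>
abbreviation "noncube_class \<equiv> residue_class_9 (Eis 4 6)"

definition class_mangoldt :: "nat \<Rightarrow> real" where
  "class_mangoldt n = (\<Sum>x\<in>primary_of_norm n \<inter> noncube_class. eis_mangoldt x)"

text \<open>Orthogonality of the characters of the group of primary classes modulo 9. The class of \<open>4 + 6\<omega>\<close> has
  the parameters \<open>(u, v) = (1, 2)\<close>, whence the exponents \<open>-(j + 2k)\<close>.\<close>
lemma class_mangoldt_expansion:
  "of_real (class_mangoldt n) =
     (\<Sum>(j,k)\<in>{0,1,2}\<times>{0,1,2}. (zeta3 powi (- (j + 2 * k)) / 9) * char_mangoldt j k n)"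
proof -
  have orth: "(\<Sum>(j,k)\<in>{0,1,2}\<times>{0,1,2}. (zeta3 powi (- (j + 2 * k)) / 9) * cubic_char j k x) = (if x \<in> noncube_class then 1 else 0)"
    if x: "x \<in> primary" for x
  proof -
    obtain u v where uv: "x = Eis (1 + 3 * u) (3 * v)" using x by (rule primaryE)
    have e: "(zeta3 powi (- (j + 2 * k)) / 9) * cubic_char j k x = zeta3 powi ((u - 1) * j) * zeta3 powi ((v - 2) * k) / 9" for j k
    proof -
      have "zeta3 powi (- (j + 2 * k)) * cubic_char j k x = zeta3 powi (- (j + 2 * k) + (j * u + k * v))"
        unfolding uv cubic_char_params by (rule power_int_add[symmetric]) (simp add: zeta3_nz)
      also have "- (j + 2 * k) + (j * u + k * v) = (u - 1) * j + (v - 2) * k" by (simp add: algebra_simps)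
      also have "zeta3 powi \<dots> = zeta3 powi ((u - 1) * j) * zeta3 powi ((v - 2) * k)"
        by (rule power_int_add) (simp add: zeta3_nz)
      finally show ?thesis by simp
    qed
    have "(\<Sum>(j,k)\<in>{0,1,2}\<times>{0,1,2}. (zeta3 powi (- (j + 2 * k)) / 9) * cubic_char j k x) =
       (\<Sum>j\<in>{0,1,2}. zeta3 powi ((u - 1) * j)) * (\<Sum>k\<in>{0,1,2}. zeta3 powi ((v - 2) * k)) / 9"
      unfolding e sum_product sum.cartesian_product sum_divide_distrib by (simp only: case_prod_unfold)
    also have "\<dots> = (if 3 dvd (u - 1) then 3 else 0) * (if 3 dvd (v - 2) then 3 else 0) / 9"
      unfolding zeta3_powi_sum ..
    also have "\<dots> = (if 3 dvd (u - 1) \<and> 3 dvd (v - 2) then 1 else 0)" by simp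
    also have "3 dvd (u - 1) \<and> 3 dvd (v - 2) \<longleftrightarrow> x \<in> noncube_class"
    proof -
      have "9 dvd (1 + 3 * u - 4) \<longleftrightarrow> 3 dvd (u - 1)" "9 dvd (3 * v - 6) \<longleftrightarrow> 3 dvd (v - 2)" by presburger+
      thus ?thesis by (simp add: uv residue_class_9_def)
    qed
    finally show ?thesis .
  qed
  have "of_real (class_mangoldt n) = (\<Sum>x\<in>primary_of_norm n. of_real (eis_mangoldt x) * (if x \<in> noncube_class then 1 else 0 :: complex))"
    unfolding class_mangoldt_def of_real_sum
    by (subst sum.inter_restrict) (auto intro!: sum.cong)
  also have "\<dots> = (\<Sum>x\<in>primary_of_norm n. of_real (eis_mangoldt x) *
      (\<Sum>(j,k)\<in>{0,1,2}\<times>{0,1,2}. (zeta3 powi (- (j + 2 * k)) / 9) * cubic_char j k x))"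
    by (rule sum.cong[OF refl]) (simp only: orth primary_of_norm_def mem_Collect_eq)
  also have "\<dots> = (\<Sum>(j,k)\<in>{0,1,2}\<times>{0,1,2}. (zeta3 powi (- (j + 2 * k)) / 9) * char_mangoldt j k n)"
    unfolding norm_sum_def sum_distrib_left case_prod_unfold
    by (subst sum.swap) (simp only: mult_ac)
  finally show ?thesis .
qed

text \<open>Of the nine characters only the trivial one has a pole, and its weight is \<open>1/9\<close>.\<close>
lemma class_mangoldt_mean_value: "(\<lambda>N. (\<Sum>n=1..N. class_mangoldt n) / real N) \<longlonglongrightarrow> 1 / 9"
proof (rule mean_value_of_simple_pole)
  show "class_mangoldt n \<ge> 0" for n
    unfolding class_mangoldt_def by (intro sum_nonneg eis_mangoldt_nonneg)
  let ?w = "\<lambda>(j, k). zeta3 powi (- (j + 2 * k)) / 9"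
  let ?c = "\<lambda>(j::int, k::int). if 3 dvd j \<and> 3 dvd k then 1 else 0 :: complex"
  have "simple_pole_at_1 (\<lambda>n. \<Sum>i\<in>{0,1,2}\<times>{0,1,2}. ?w i * (case i of (j, k) \<Rightarrow> char_mangoldt j k) n) (\<Sum>i\<in>{0,1,2}\<times>{0,1,2}. ?w i * ?c i)"
    by (rule simple_pole_at_1_sum) (auto simp: char_mangoldt_pole simp del: One_nat_def split: prod.split intro: char_mangoldt_pole)
  also have "(\<lambda>n. \<Sum>i\<in>{0,1,2}\<times>{0,1,2}. ?w i * (case i of (j, k) \<Rightarrow> char_mangoldt j k) n) = (\<lambda>n. of_real (class_mangoldt n))"
    unfolding class_mangoldt_expansion by (simp only: case_prod_unfold)
  also have "(\<Sum>i\<in>{0,1,2}\<times>{0,1,2}. ?w i * ?c i) = 1 / 9"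
    by (simp add: sum.cartesian_product[symmetric])
  finally show "simple_pole_at_1 (\<lambda>n. of_real (class_mangoldt n)) (of_real (1 / 9))" by simp
qed

text \<open>The prime number theorem: all three functions of \<open>log_derivative_simple_pole\<close> are taken to be \<open>\<zeta>\<close>.\<close>
lemma mangoldt_mean_value: "(\<lambda>N. (\<Sum>n=1..N. mangoldt n) / real N) \<longlonglongrightarrow> 1"
proof (rule mean_value_of_simple_pole)
  have P: "log_derivative_pair (\<lambda>_. 1) (\<lambda>n. of_real (mangoldt n)) 1"
    unfolding log_derivative_pair_def
  proof (intro conjI)
    show "linear_growth (\<lambda>n. of_real (mangoldt n))"
      by (rule linear_growth_mangoldt) (simp add: mangoldt_nonneg)
    show "\<exists>K. \<forall>n. norm ((\<Sum>k=1..n. 1) - 1 * complex_of_nat n) \<le> K * sqrt (real n)"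
      by (intro exI[of _ 0]) simp
    show "\<forall>n>0. (\<Sum>d | d dvd n. complex_of_real (mangoldt d) * 1) = 1 * of_real (ln (real n))"
      by (auto simp: mangoldt_sum)
  qed (simp_all add: linear_growth_one)
  have "simple_pole_at_1 (\<lambda>n. of_real (mangoldt n)) (if (1::complex) = 0 then 0 else 1)"
  proof (rule log_derivative_simple_pole[OF P P P])
    fix n :: nat and z :: complex assume z: "norm z = 1"
    have "3 * complex_of_real (mangoldt n) + 4 * complex_of_real (mangoldt n) * z + complex_of_real (mangoldt n) * z\<^sup>2 = of_real (mangoldt n) * (3 + 4 * z + z\<^sup>2)"
      by (simp only: distrib_left mult_ac)
    also have "Re \<dots> = mangoldt n * Re (3 + 4 * z + z\<^sup>2)"
      by (simp only: Re_complex_of_real Im_complex_of_real times_complex.sel)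
    also have "\<dots> \<ge> 0" by (intro mult_nonneg_nonneg mangoldt_nonneg three_four_one z)
    finally show "Re (3 * complex_of_real (mangoldt n) + 4 * complex_of_real (mangoldt n) * z + complex_of_real (mangoldt n) * z\<^sup>2) \<ge> 0" .
  qed auto
  thus "simple_pole_at_1 (\<lambda>n. of_real (mangoldt n)) (of_real 1)" by simp
qed (simp add: mangoldt_nonneg)

section \<open>The density of the insoluble primes\<close>

lemma class_mangoldt_le: "class_mangoldt n \<le> 4 * mangoldt n"
proof -
  have "class_mangoldt n \<le> (\<Sum>x\<in>primary_of_norm n. eis_mangoldt x)"
    unfolding class_mangoldt_def by (rule sum_mono2) (auto simp: eis_mangoldt_nonneg)
  also have "\<dots> \<le> 4 * mangoldt n" by (rule eis_mangoldt_class_sum)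
  finally show ?thesis .
qed

text \<open>Conjugation moves the class of \<open>4 + 6\<omega>\<close> to that of \<open>7 + 3\<omega>\<close>, so at most one of two conjugate primes counts.\<close>
lemma class_mangoldt_prime:
  assumes p: "Factorial_Ring.prime p"
  shows "class_mangoldt p \<le> (if p \<in> insoluble_primes then ln (real p) else 0)"
proof -
  define T where "T = {x \<in> primary_of_norm p \<inter> noncube_class. eis_mangoldt x \<noteq> 0}"
  have T: "class_mangoldt p = (\<Sum>x\<in>T. eis_mangoldt x)"
    unfolding class_mangoldt_def T_def by (rule sum.mono_neutral_right) auto
  have lnp: "ln (real p) \<ge> 0" using prime_gt_1_nat[OF p] by simp
  show ?thesis
  proof (cases "T = {}")
    case True
    thus ?thesis using T lnp by simp
  next
    case False
    then obtain x where x: "x \<in> T" by blast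
    hence x': "x \<in> primary_of_norm p" "eis_mangoldt x \<noteq> 0" "x \<in> noncube_class" "eis_norm x = int p"
      by (auto simp: T_def primary_of_norm_def)
    have "eis_cnj x \<notin> noncube_class"
    proof
      assume "eis_cnj x \<in> noncube_class"
      hence "9 dvd - eb x - 6" by (simp add: residue_class_9_def)
      moreover have "9 dvd eb x - 6" using x'(3) by (simp add: residue_class_9_def)
      ultimately show False by presburger
    qed
    hence "T = {x}" using x eis_mangoldt_support(1)[OF x'(1,2)] by (auto simp: T_def)
    hence le: "class_mangoldt p \<le> ln (real p)" using T eis_mangoldt_support(3)[OF x'(1,2)] by simp
    have "\<not> (\<exists>x y. int p * x ^ 3 + y ^ 3 = 9)"
    proof
      assume "\<exists>x y. int p * x ^ 3 + y ^ 3 = 9"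
      then obtain u v where "int p * u ^ 3 + v ^ 3 = 9" by blast
      hence "v ^ 3 - 9 = int p * (- (u ^ 3))" by simp
      hence "int p dvd v ^ 3 - 9" by simp
      hence "[v ^ 3 = 9] (mod int p)" by (simp add: cong_iff_dvd_diff)
      thus False using nine_not_cube(2)[OF p x'(3,4)] by blast
    qed
    hence "p \<in> insoluble_primes" using p nine_not_cube(1)[OF p x'(3,4)] by (simp add: insoluble_primes_def)
    thus ?thesis using le by simp
  qed
qed

text \<open>Prime norms contribute at most \<open>ln N\<close> for each insoluble prime; the norms that are not prime, among
  them those of the primes that stay prime in the Eisenstein integers, fall under \<open>mangoldt_composite_sum\<close>.\<close>
lemma insoluble_primes_lower_bound:
  assumes N: "N \<ge> 1"
  shows "(\<Sum>n=1..N. class_mangoldt n) - 4 * (sqrt (real N) * log 2 (real N) * ln (real N))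
    \<le> real (card {p\<in>insoluble_primes. p \<le> N}) * ln (real N)"
proof -
  let ?S = "{p\<in>insoluble_primes. p \<le> N}"
  have split: "{1..N} = {n \<in> {1..N}. Factorial_Ring.prime n} \<union> {n \<in> {1..N}. \<not> Factorial_Ring.prime n}" by auto
  have "(\<Sum>n=1..N. class_mangoldt n) = (\<Sum>n | n \<in> {1..N} \<and> Factorial_Ring.prime n. class_mangoldt n)
      + (\<Sum>n | n \<in> {1..N} \<and> \<not> Factorial_Ring.prime n. class_mangoldt n)"
    by (subst split, rule sum.union_disjoint) auto
  also have "(\<Sum>n | n \<in> {1..N} \<and> \<not> Factorial_Ring.prime n. class_mangoldt n) \<le>
      (\<Sum>n | n \<in> {1..N} \<and> \<not> Factorial_Ring.prime n. 4 * mangoldt n)"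
    by (rule sum_mono) (rule class_mangoldt_le)
  also have "\<dots> \<le> 4 * (sqrt (real N) * log 2 (real N) * ln (real N))"
    unfolding sum_distrib_left[symmetric] using mangoldt_composite_sum[OF N] by simp
  also have "(\<Sum>n | n \<in> {1..N} \<and> Factorial_Ring.prime n. class_mangoldt n) \<le>
      (\<Sum>n | n \<in> {1..N} \<and> Factorial_Ring.prime n. if n \<in> ?S then ln (real n) else 0)"
    by (rule sum_mono) (use class_mangoldt_prime in auto)
  also have "\<dots> = (\<Sum>n\<in>?S. ln (real n))"
  proof -
    have "{n \<in> {n. n \<in> {1..N} \<and> Factorial_Ring.prime n}. n \<in> ?S} = ?S"
      by (auto simp: insoluble_primes_def dest: prime_gt_0_nat)
    moreover have "(\<Sum>n | n \<in> {1..N} \<and> Factorial_Ring.prime n. if n \<in> ?S then ln (real n) else 0) =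
      (\<Sum>n\<in>{n \<in> {n. n \<in> {1..N} \<and> Factorial_Ring.prime n}. n \<in> ?S}. ln (real n))"
      by (rule sum.inter_filter[symmetric]) simp
    ultimately show ?thesis by simp
  qed
  also have "\<dots> \<le> (\<Sum>n\<in>?S. ln (real N))"
    by (rule sum_mono) (auto simp: insoluble_primes_def dest: prime_gt_0_nat)
  also have "\<dots> = real (card ?S) * ln (real N)" by simp
  finally show ?thesis by simp
qed

text \<open>All but \<open>N\<^sup>1\<^sup>-\<^sup>\<delta>\<close> of the primes up to \<open>N\<close> have logarithm at least \<open>(1 - \<delta>) ln N\<close>.\<close>
lemma prime_count_upper_bound:
  assumes N: "N \<ge> 2" and \<delta>: "0 < \<delta>" "\<delta> < 1"
  shows "real (card {p. Factorial_Ring.prime p \<and> p \<le> N}) \<le>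
    real N powr (1 - \<delta>) + (\<Sum>n=1..N. mangoldt n) / ((1 - \<delta>) * ln (real N))"
proof -
  define Y where "Y = real N powr (1 - \<delta>)"
  define B where "B = {p. Factorial_Ring.prime p \<and> p \<le> N \<and> Y < real p}"
  have lnN: "ln (real N) > 0" using N by simp
  have Y: "Y > 0" "ln Y = (1 - \<delta>) * ln (real N)" using N by (simp_all add: Y_def ln_powr)
  have "{p. Factorial_Ring.prime p \<and> p \<le> N} \<subseteq> {1..nat \<lfloor>Y\<rfloor>} \<union> B"
  proof
    fix p assume "p \<in> {p. Factorial_Ring.prime p \<and> p \<le> N}"
    hence p: "Factorial_Ring.prime p" "p \<le> N" by auto
    show "p \<in> {1..nat \<lfloor>Y\<rfloor>} \<union> B"
      using p prime_gt_0_nat[OF p(1)] by (cases "real p \<le> Y") (auto simp: B_def le_nat_floor)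
  qed
  moreover have finB: "finite B" by (rule finite_subset[of _ "{..N}"]) (auto simp: B_def)
  ultimately have "card {p. Factorial_Ring.prime p \<and> p \<le> N} \<le> card ({1..nat \<lfloor>Y\<rfloor>} \<union> B)"
    by (intro card_mono) auto
  also have "\<dots> \<le> card {1..nat \<lfloor>Y\<rfloor>} + card B" by (rule card_Un_le)
  finally have "real (card {p. Factorial_Ring.prime p \<and> p \<le> N}) \<le> real (nat \<lfloor>Y\<rfloor>) + real (card B)"
    by (simp flip: of_nat_add)
  also have "real (nat \<lfloor>Y\<rfloor>) \<le> Y" using Y(1) by (intro of_nat_floor) simp
  also have "real (card B) \<le> (\<Sum>n=1..N. mangoldt n) / ((1 - \<delta>) * ln (real N))"
  proof -
    have "real (card B) * ((1 - \<delta>) * ln (real N)) = (\<Sum>p\<in>B. ln Y)" by (simp add: Y(2))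
    also have "\<dots> \<le> (\<Sum>p\<in>B. mangoldt p)"
    proof (rule sum_mono)
      fix p assume p: "p \<in> B"
      hence "ln Y \<le> ln (real p)" using Y(1) by (simp add: B_def)
      thus "ln Y \<le> mangoldt p" using p by (simp add: B_def)
    qed
    also have "\<dots> \<le> (\<Sum>n=1..N. mangoldt n)"
      by (rule sum_mono2) (auto simp: B_def mangoldt_nonneg dest: prime_gt_0_nat)
    finally show ?thesis using lnN \<delta> by (simp add: field_simps)
  qed
  finally show ?thesis by (simp add: Y_def)
qed

text \<open>The quotient of the two preceding bounds, scaled by \<open>ln N / N\<close> so that every term has a limit.\<close>
lemma insoluble_primes_ratio_bound:
  fixes x :: real
  assumes x: "x \<ge> 3" and \<delta>: "0 < \<delta>" "\<delta> < 1"
  defines "N \<equiv> nat \<lfloor>x\<rfloor>"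
  shows "((\<Sum>n=1..N. class_mangoldt n) / real N - 4 * (sqrt (real N) * log 2 (real N) * ln (real N) / real N)) /
      (real N powr (- \<delta>) * ln (real N) + (\<Sum>n=1..N. mangoldt n) / real N / (1 - \<delta>))
    \<le> real (card {p \<in> insoluble_primes. real p \<le> x}) / real (prime_count x)"
proof -
  have N: "N \<ge> 3" using x by (simp add: N_def le_nat_floor)
  have lnN: "ln (real N) > 0" using N by simp
  have floor: "real p \<le> x \<longleftrightarrow> p \<le> N" for p :: nat
    using x by (simp add: N_def le_nat_iff le_floor_iff)
  define c where "c = real (card {p \<in> insoluble_primes. p \<le> N})"
  define A where "A = (\<Sum>n=1..N. class_mangoldt n)"
  define P where "P = (\<Sum>n=1..N. mangoldt n :: real)"
  define E where "E = sqrt (real N) * log 2 (real N) * ln (real N)"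
  define U where "U = real N powr (1 - \<delta>) + P / ((1 - \<delta>) * ln (real N))"
  have c: "A - 4 * E \<le> c * ln (real N)"
    unfolding A_def E_def c_def using N by (intro insoluble_primes_lower_bound) simp
  have "finite {p. Factorial_Ring.prime p \<and> p \<le> N}" by (rule finite_subset[of _ "{..N}"]) auto
  moreover have sub: "{p. Factorial_Ring.prime p \<and> real p < x} \<subseteq> {p. Factorial_Ring.prime p \<and> p \<le> N}"
  proof
    fix p assume p: "p \<in> {p. Factorial_Ring.prime p \<and> real p < x}"
    hence "real p \<le> x" by simp
    hence "p \<le> N" unfolding floor .
    thus "p \<in> {p. Factorial_Ring.prime p \<and> p \<le> N}" using p by simp
  qed
  ultimately have "prime_count x \<le> card {p. Factorial_Ring.prime p \<and> p \<le> N}"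
    unfolding prime_count_def by (rule card_mono)
  hence "real (prime_count x) \<le> real (card {p. Factorial_Ring.prime p \<and> p \<le> N})" by simp
  also have "\<dots> \<le> U" unfolding U_def P_def using N \<delta> by (intro prime_count_upper_bound) auto
  finally have pU: "real (prime_count x) \<le> U" .
  have "2 \<in> {p. Factorial_Ring.prime p \<and> real p < x}" using x by simp
  moreover have "finite {p. Factorial_Ring.prime p \<and> real p < x}"
    by (rule finite_subset[OF sub]) (rule finite_subset[of _ "{..N}"], auto)
  ultimately have p0: "real (prime_count x) > 0" unfolding prime_count_def
    by (metis card_gt_0_iff empty_iff of_nat_0_less_iff)
  have U0: "U > 0" using p0 pU by linarith
  have "(A / real N - 4 * (E / real N)) / (real N powr (- \<delta>) * ln (real N) + P / real N / (1 - \<delta>))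
      = ((A - 4 * E) / ln (real N)) / U"
  proof -
    have "real N powr (1 - \<delta>) = real N * real N powr (- \<delta>)"
      using powr_add[of "real N" 1 "- \<delta>"] N by simp
    hence "U * ln (real N) = real N * (real N powr (- \<delta>) * ln (real N)) + P / (1 - \<delta>)"
      unfolding U_def using lnN by (simp add: distrib_right)
    hence D: "real N powr (- \<delta>) * ln (real N) + P / real N / (1 - \<delta>) = (U * ln (real N)) / real N"
      using N by (simp add: add_divide_distrib mult.commute)
    show ?thesis unfolding D using N by (simp add: diff_divide_distrib[symmetric] mult.commute)
  qed
  also have "\<dots> \<le> c / U"
    using c lnN U0 by (intro divide_right_mono) (simp_all add: field_simps)
  also have "\<dots> \<le> c / real (prime_count x)"
    using pU p0 U0 by (intro divide_left_mono) (simp_all add: c_def)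
  finally show ?thesis unfolding A_def P_def E_def c_def floor .
qed

theorem insoluble_primes_density:
  "Liminf at_top (\<lambda>x :: real. ereal (real (card {p \<in> insoluble_primes. real p \<le> x}) / real (prime_count x))) \<ge> ereal (1 / 9)"
proof (subst le_Liminf_iff, intro allI impI)
  fix y assume "y < ereal (1 / 9)"
  then obtain z where z: "y < ereal z" "z < 1 / 9" using ereal_dense2[of y "ereal (1/9)"] by auto
  \<comment> \<open>The limit of the lower bound is \<open>(1 - \<delta>) / 9\<close>, which this choice keeps above \<open>z\<close>.\<close>
  define \<delta> where "\<delta> = min (1/2) ((1 - 9 * z) / 2)"
  have \<delta>: "0 < \<delta>" "\<delta> < 1" "z < (1 - \<delta>) / 9" using z(2) by (auto simp: \<delta>_def min_def field_simps)
  define g where "g N = ((\<Sum>n=1..N. class_mangoldt n) / real N - 4 * (sqrt (real N) * log 2 (real N) * ln (real N) / real N)) /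
      (real N powr (- \<delta>) * ln (real N) + (\<Sum>n=1..N. mangoldt n) / real N / (1 - \<delta>))" for N
  have l1: "(\<lambda>N. sqrt (real N) * log 2 (real N) * ln (real N) / real N) \<longlonglongrightarrow> 0" by real_asymp
  have l2: "(\<lambda>N. real N powr (- \<delta>) * ln (real N)) \<longlonglongrightarrow> 0" using \<delta>(1) by real_asymp
  have "g \<longlonglongrightarrow> (1 / 9 - 4 * 0) / (0 + 1 / (1 - \<delta>))"
    unfolding g_def using \<delta>
    by (intro tendsto_intros l1 l2 class_mangoldt_mean_value mangoldt_mean_value) auto
  hence "g \<longlonglongrightarrow> (1 - \<delta>) / 9" by simp
  hence "\<forall>\<^sub>F N in sequentially. g N > z" using \<delta>(3) by (rule order_tendstoD)
  moreover have "filterlim (\<lambda>x :: real. nat \<lfloor>x\<rfloor>) sequentially at_top"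
    by (rule filterlim_compose[OF filterlim_nat_sequentially filterlim_floor_sequentially])
  ultimately have "\<forall>\<^sub>F x in at_top. g (nat \<lfloor>x :: real\<rfloor>) > z" by (rule eventually_compose_filterlim)
  moreover have "\<forall>\<^sub>F x in at_top. (x :: real) \<ge> 3" by (rule eventually_ge_at_top)
  ultimately show "\<forall>\<^sub>F x :: real in at_top. y < ereal (real (card {p \<in> insoluble_primes. real p \<le> x}) / real (prime_count x))"
  proof eventually_elim
    case (elim x)
    have "z < real (card {p \<in> insoluble_primes. real p \<le> x}) / real (prime_count x)"
      using insoluble_primes_ratio_bound[OF elim(2) \<delta>(1,2)] elim(1) unfolding g_def by linarith
    thus ?case using z(1) by (simp add: less_trans)
  qed
qed

theorem theorem2:
  shows "Liminf at_top
           (\<lambda>x :: real. ereal (real (card {p \<in> insoluble_primes. real p \<le> x}) / real (prime_count x)))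
             \<ge> ereal (1 / 9)
         \<and> (\<forall>p\<in>insoluble_primes. cubic_field (pure_cubic_field p) \<and> \<not> monogenic (pure_cubic_field p))"
  using insoluble_primes_density pure_cubic_field_nonmonogenic by blast

end
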